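(* Let $N\ge 1$, $q>1$, $T\in(0,\infty)$, and let $h:[0,\infty)\to[0,\infty)$ be continuous and nondecreasing with $h(t)>0$ for $t>0$. Suppose that $h(t)=\exp(-\omega(t)/t)$ for $t>0$, where $\omega:[0,\infty)\to[0,\infty)$ is continuous, nondecreasing and satisfies $$\int_0^1\frac{\sqrt{\omega(s)}}{s}\,ds<\infty .$$ Assume moreover that for every $k>0$ and every $R\in(0,\infty]$, $$\int_0^T\int_{B_R}h(t)\,(kE(x,t))^q\,dx\,dt<\infty ,$$ so that for every $k>0$ the fundamental solution $u_k$ of $$\partial_t u-\Delta u+h(t)u^q=0\ \text{ in } Q^T,\qquad u(\cdot,0)=k\delta_0,$$ exists. Then $u_\infty:=\lim_{k\to\infty}u_k$ has single-point initial blow-up at $(0,0)$.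
   Context: $Q^T=\mathbb{R}^N\times(0,T)$; $B_R=\{x\in\mathbb{R}^N:|x|<R\}$ (with $B_\infty=\mathbb{R}^N$); $\delta_0$ is the Dirac mass at $0\in\mathbb{R}^N$; $E(x,t)=(4\pi t)^{-N/2}e^{-|x|^2/4t}$ is the heat kernel, so that $kE$ is the fundamental solution of $\partial_t v-\Delta v=0$ with $v(\cdot,0)=k\delta_0$. The fundamental solution $u_k$ is the unique nonnegative function $u\in L^1_{loc}(\overline{Q^T})$ with $h u^q\in L^1_{loc}(\overline{Q^T})$ such that $$\iint_{Q^T}\left(-u\,\partial_t\varphi-u\,\Delta\varphi+h(t)u^q\varphi\right)dx\,dt=k\,\varphi(0,0)$$ for all $\varphi\in C^{2,1}_0(\mathbb{R}^N\times[0,T))$ (compactly supported test functions, $C^2$ in $x$ and $C^1$ in $t$). The map $k\mapsto u_k$ is increasing and $u_k(x,t)\le \left((q-1)\int_0^t h(s)\,ds\right)^{-1/(q-1)}$, so $u_\infty=\lim_{k\to\infty}u_k$ is a well-defined pointwise limit and is a solution of the equation in $Q^T$. Single-point initial blow-up at $(0,0)$ means: $u_\infty$ is a solution of the equation in $Q^T$ which is singular at $(0,0)$ and such that $\lim_{t\to0}u_\infty(x,t)=0$ for all $x\neq0$. *)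

theory Defs
  imports "HOL-Analysis.Analysis"
begin

definition QT :: "real \<Rightarrow> ((real^'n) \<times> real) set" where
  "QT T = UNIV \<times> {0<..<T}"

text \<open>The radius is extended real, so that \<open>B \<infinity>\<close> is the whole space.\<close>

definition B :: "ereal \<Rightarrow> (real^'n) set" where
  "B R = {x. ereal (norm x) < R}"

definition heat_kernel :: "real^'n \<Rightarrow> real \<Rightarrow> real" where
  "heat_kernel x t =
     (4 * pi * t) powr (- real CARD('n) / 2) * exp (- (norm x)\<^sup>2 / (4 * t))"

definition L1_loc :: "((real^'n) \<times> real) set \<Rightarrow> ((real^'n) \<times> real \<Rightarrow> real) \<Rightarrow> bool" where
  "L1_loc S f \<longleftrightarrow> (\<forall>K. compact K \<and> K \<subseteq> S \<longrightarrow> f absolutely_integrable_on K)"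

text \<open>
  The time derivative is taken within a time interval \<open>I\<close>; it is one-sided at an endpoint that
  belongs to \<open>I\<close>.
\<close>

definition dt :: "real set \<Rightarrow> ((real^'n) \<times> real \<Rightarrow> real) \<Rightarrow> (real^'n) \<times> real \<Rightarrow> real" where
  "dt I \<phi> = (\<lambda>(x, t). vector_derivative (\<lambda>s. \<phi> (x, s)) (at t within I))"

definition dx :: "'n \<Rightarrow> ((real^'n) \<times> real \<Rightarrow> real) \<Rightarrow> (real^'n) \<times> real \<Rightarrow> real" where
  "dx i \<phi> = (\<lambda>(x, t). deriv (\<lambda>s. \<phi> (x + s *\<^sub>R axis i 1, t)) 0)"

definition laplacian :: "((real^'n) \<times> real \<Rightarrow> real) \<Rightarrow> (real^'n) \<times> real \<Rightarrow> real" where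
  "laplacian \<phi> z = (\<Sum>i\<in>UNIV. dx i (dx i \<phi>) z)"

definition dx_exists :: "'n \<Rightarrow> real set \<Rightarrow> ((real^'n) \<times> real \<Rightarrow> real) \<Rightarrow> bool" where
  "dx_exists i I \<phi> \<longleftrightarrow>
     (\<forall>x. \<forall>t\<in>I. (\<lambda>s. \<phi> (x + s *\<^sub>R axis i 1, t)) field_differentiable (at 0))"

definition C21 :: "real set \<Rightarrow> ((real^'n) \<times> real \<Rightarrow> real) \<Rightarrow> bool" where
  "C21 I \<phi> \<longleftrightarrow>
     continuous_on (UNIV \<times> I) \<phi> \<and>
     (\<forall>x. \<forall>t\<in>I. (\<lambda>s. \<phi> (x, s)) differentiable (at t within I)) \<and>
     continuous_on (UNIV \<times> I) (dt I \<phi>) \<and>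
     (\<forall>i. dx_exists i I \<phi> \<and> continuous_on (UNIV \<times> I) (dx i \<phi>)) \<and>
     (\<forall>i j. dx_exists j I (dx i \<phi>) \<and> continuous_on (UNIV \<times> I) (dx j (dx i \<phi>)))"

text \<open>
  Test functions on \<open>UNIV \<times> I\<close>. For \<open>I = {0..<T}\<close> they need not vanish at time \<open>0\<close>; for
  \<open>I = {0<..<T}\<close> they are compactly supported in \<open>QT T\<close>. Values outside \<open>UNIV \<times> I\<close> play no role.
\<close>

definition C21_0 :: "real set \<Rightarrow> ((real^'n) \<times> real \<Rightarrow> real) set" where
  "C21_0 I = {\<phi>. C21 I \<phi> \<and>
     (\<exists>K. compact K \<and> K \<subseteq> UNIV \<times> I \<and> (\<forall>z \<in> UNIV \<times> I - K. \<phi> z = 0))}"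

definition weak_form ::
  "(real \<Rightarrow> real) \<Rightarrow> real \<Rightarrow> real \<Rightarrow> real set \<Rightarrow>
   ((real^'n) \<times> real \<Rightarrow> real) \<Rightarrow> ((real^'n) \<times> real \<Rightarrow> real) \<Rightarrow> real" where
  "weak_form h q T I u \<phi> =
     (LINT z : QT T | lebesgue.
        - u z * dt I \<phi> z - u z * laplacian \<phi> z + h (snd z) * u z powr q * \<phi> z)"

text \<open>
  The integral identities determine a solution only up to null sets. As initial blow-up concerns
  pointwise values, a solution is always identified with its continuous representative in \<open>QT T\<close>,
  which exists by interior parabolic regularity.
\<close>

definition fundamental_solution ::
  "(real \<Rightarrow> real) \<Rightarrow> real \<Rightarrow> real \<Rightarrow> real \<Rightarrow> ((real^'n) \<times> real \<Rightarrow> real) \<Rightarrow> bool" where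
  "fundamental_solution h q T k u \<longleftrightarrow>
     continuous_on (QT T) u \<and>
     (\<forall>z\<in>QT T. 0 \<le> u z) \<and>
     L1_loc (closure (QT T)) u \<and>
     L1_loc (closure (QT T)) (\<lambda>z. h (snd z) * u z powr q) \<and>
     (\<forall>\<phi>\<in>C21_0 {0..<T}. weak_form h q T {0..<T} u \<phi> = k * \<phi> (0, 0))"

definition solution_in_QT ::
  "(real \<Rightarrow> real) \<Rightarrow> real \<Rightarrow> real \<Rightarrow> ((real^'n) \<times> real \<Rightarrow> real) \<Rightarrow> bool" where
  "solution_in_QT h q T u \<longleftrightarrow>
     continuous_on (QT T) u \<and>
     (\<forall>z\<in>QT T. 0 \<le> u z) \<and>
     L1_loc (QT T) u \<and>
     L1_loc (QT T) (\<lambda>z. h (snd z) * u z powr q) \<and>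
     (\<forall>\<phi>\<in>C21_0 {0<..<T}. weak_form h q T {0<..<T} u \<phi> = 0)"

definition singular_at_origin :: "real \<Rightarrow> ((real^'n) \<times> real \<Rightarrow> real) \<Rightarrow> bool" where
  "singular_at_origin T u \<longleftrightarrow> (\<forall>r>0. \<not> bounded (u ` (QT T \<inter> ball (0, 0) r)))"

definition single_point_initial_blow_up ::
  "(real \<Rightarrow> real) \<Rightarrow> real \<Rightarrow> real \<Rightarrow> ((real^'n) \<times> real \<Rightarrow> real) \<Rightarrow> bool" where
  "single_point_initial_blow_up h q T u \<longleftrightarrow>
     solution_in_QT h q T u \<and>
     singular_at_origin T u \<and>
     (\<forall>x. x \<noteq> 0 \<longrightarrow> ((\<lambda>t. u (x, t)) \<longlongrightarrow> 0) (at_right 0))"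

end

theory Submission
  imports Defs
begin

text \<open>
  The differences \<open>u\<^sub>k - u\<^sub>l\<close> are subcaloric where they are positive, and every solution obeys the
  Keller--Osserman bound \<open>u \<le> exp (O(\<omega>(t)) / t + \<dots>)\<close>, which does not depend on \<open>x\<close> or \<open>k\<close>. A region in
  which a subcaloric function is as large as this bound can only invade a region in which it
  vanishes initially behind a front of speed of order \<open>\<surd>\<omega>(t) / t\<close>: the exponentials
  \<open>exp (t B\<^sup>2 - B p)\<close>, with \<open>p\<close> the distance to the front and \<open>B\<close> of order \<open>\<surd>\<omega>(t) / t\<close>, are
  supersolutions of the heat equation. The Dini condition says precisely that the front covers only a
  finite distance, which tends to \<open>0\<close> with \<open>t\<close>.

  A front coming from infinity thus never arrives. Together with Kato's inequality across \<open>t = 0\<close>,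
  which makes the positive part of \<open>u\<^sub>k - u\<^sub>l\<close> vanish initially for \<open>k \<le> l\<close>, this shows that \<open>u\<^sub>k\<close>
  increases with \<open>k\<close>, although no growth condition at infinity is imposed. A front starting at the
  origin does not reach \<open>x \<noteq> 0\<close> for small times, so \<open>u\<^sub>k(x, t)\<close> tends to \<open>0\<close> as \<open>t \<rightarrow> 0\<close>, uniformly in
  \<open>k\<close>.
\<close>

section \<open>Convolution and integration by parts\<close>

text \<open>No regularity theory is used: a solution is only a continuous function satisfying an
  integral identity. Comparison with explicit barriers is still possible, because all that it needs
  is an inequality at a point where a smooth function touches from above.

  Two demands fix the order of \<open>B\<close>. Absorption alone bounds solutions by about exp
  (O(\<omega>/t)), so exp (t B^2) dominates this once \<open>B\<close> is a large multiple of sqrt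
  \<omega> / t; and for exp (t B^2 - B p) to remain a supersolution as \<open>B\<close> decreases,
  \<open>p\<close> has to shrink at a rate proportional to \<open>B\<close>. The distance covered is
  then a multiple of the integral of \<open>B\<close>.

  The obstacle is time 0, where solutions are merely integrable while comparison needs uniformly
  small initial values. These come from a mean value inequality on cylinders reaching below time 0,
  where everything is extended by 0: the average over a cylinder becomes an integral over a thin
  slab, small by dominated convergence. This requires functions that are subcaloric across time 0,
  Dirac source included, which is what Kato's inequality has to deliver for differences.\<close>

definition cc :: "('a::euclidean_space \<Rightarrow> real) \<Rightarrow> bool" where
  "cc k \<longleftrightarrow> continuous_on UNIV k \<and> (\<exists>R. \<forall>z. k z \<noteq> 0 \<longrightarrow> norm z \<le> R)"

text \<open>Borel rather than Lebesgue measurability keeps the integrals over \<open>lborel\<close>,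
  where Fubini is at hand; the Lebesgue integrals in the definitions are converted where they are
  met.\<close>

definition loc_int :: "('a::euclidean_space \<Rightarrow> real) \<Rightarrow> bool" where
  "loc_int w \<longleftrightarrow> w \<in> borel_measurable borel \<and>
     (\<forall>R. integrable lborel (\<lambda>z. indicator (cball 0 R) z * w z))"

definition conv :: "('a::euclidean_space \<Rightarrow> real) \<Rightarrow> ('a \<Rightarrow> real) \<Rightarrow> 'a \<Rightarrow> real" where
  "conv w k z = (\<integral>y. w y * k (z - y) \<partial>lborel)"

text \<open>Time and space derivatives are the cases \<open>e = (0, 1)\<close> and
  \<open>e = (axis i 1, 0)\<close> on the product space, so each calculus rule is proved once for
  both.\<close>

definition dir_deriv :: "'a::euclidean_space \<Rightarrow> ('a \<Rightarrow> real) \<Rightarrow> ('a \<Rightarrow> real) \<Rightarrow> bool" where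
  "dir_deriv e k k' \<longleftrightarrow> (\<forall>z. ((\<lambda>s. k (z + s *\<^sub>R e)) has_real_derivative k' z) (at 0))"

lemma cc_continuous: "cc k \<Longrightarrow> continuous_on UNIV k"
  by (simp add: cc_def)

lemma cc_isCont: "cc k \<Longrightarrow> isCont k z"
  by (simp add: cc_def continuous_on_eq_continuous_at)

lemma cc_measurable: "cc k \<Longrightarrow> k \<in> borel_measurable borel"
  by (simp add: cc_def borel_measurable_continuous_onI)

lemma cc_supportE:
  assumes "cc k" obtains R where "R > 0" "\<And>z. norm z > R \<Longrightarrow> k z = 0"
proof -
  obtain R where "\<forall>z. k z \<noteq> 0 \<longrightarrow> norm z \<le> R" using assms by (auto simp: cc_def)
  then show ?thesis by (intro that[of "max R 1"]) (auto simp: not_le[symmetric])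
qed

lemma cc_boundedE:
  assumes "cc k" obtains M where "M > 0" "\<And>z. \<bar>k z\<bar> \<le> M"
proof -
  obtain R where R: "R > 0" "\<And>z. norm z > R \<Longrightarrow> k z = 0" using cc_supportE[OF assms] by blast
  have "bounded (k ` cball 0 R)"
    by (intro compact_imp_bounded compact_continuous_image)
       (use assms in \<open>auto simp: cc_def intro: continuous_on_subset\<close>)
  then obtain M where M: "M > 0" "\<And>z. z \<in> cball 0 R \<Longrightarrow> \<bar>k z\<bar> \<le> M"
    by (auto simp: bounded_pos)
  show ?thesis
  proof (rule that[OF M(1)])
    fix z show "\<bar>k z\<bar> \<le> M" using M R(2)[of z] by (cases "norm z \<le> R") auto
  qed
qed

lemma loc_int_measurable: "loc_int w \<Longrightarrow> w \<in> borel_measurable borel"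
  by (simp add: loc_int_def)

lemma loc_int_mult:
  assumes w: "loc_int w" and k: "k \<in> borel_measurable borel" and M: "\<And>z. \<bar>k z\<bar> \<le> M"
    and R: "\<And>z. norm z > R \<Longrightarrow> k z = 0"
  shows "integrable lborel (\<lambda>z. w z * k z)"
proof (rule Bochner_Integration.integrable_bound)
  show "integrable lborel (\<lambda>z. M * (indicator (cball 0 R) z * w z))"
    using w by (auto simp: loc_int_def)
  show "(\<lambda>z. w z * k z) \<in> borel_measurable lborel" using w k by (auto simp: loc_int_def)
  have "M \<ge> 0" using M[of 0] by linarith
  then show "AE z in lborel. norm (w z * k z) \<le> norm (M * (indicator (cball 0 R) z * w z))"
    using M R by (intro AE_I2) (auto simp: indicator_def abs_mult mult.commute intro: mult_right_mono)
qed

lemma loc_int_mult_cc: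
  assumes "loc_int w" "cc k" shows "integrable lborel (\<lambda>z. w z * k z)"
  by (rule cc_supportE[OF assms(2)], rule cc_boundedE[OF assms(2)], rule loc_int_mult)
     (use assms cc_measurable in auto)

lemma loc_int_abs: "loc_int w \<Longrightarrow> loc_int (\<lambda>z. \<bar>w z\<bar>)"
proof -
  assume w: "loc_int w"
  have "integrable lborel (\<lambda>z. norm (indicator (cball 0 R) z * w z))" for R
    using w by (intro integrable_norm) (auto simp: loc_int_def)
  moreover have "norm (indicator (cball 0 R) z * w z) = indicator (cball 0 R) z * \<bar>w z\<bar>" for R z
    by (auto simp: abs_mult indicator_def)
  ultimately show ?thesis using w by (auto simp: loc_int_def)
qed

lemma loc_int_diff: "loc_int v \<Longrightarrow> loc_int w \<Longrightarrow> loc_int (\<lambda>z. v z - w z)"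
  unfolding loc_int_def by (auto simp: right_diff_distrib)

lemma loc_int_bound:
  assumes "loc_int w" "v \<in> borel_measurable borel" "\<And>z. \<bar>v z\<bar> \<le> \<bar>w z\<bar>"
  shows "loc_int v"
  unfolding loc_int_def
proof (intro conjI allI)
  fix R
  show "integrable lborel (\<lambda>z. indicator (cball 0 R) z * v z)"
    by (rule Bochner_Integration.integrable_bound[of _ "\<lambda>z. indicator (cball 0 R) z * w z"])
       (use assms in \<open>auto simp: loc_int_def abs_mult indicator_def\<close>)
qed (use assms in auto)

lemma loc_int_continuous: "continuous_on UNIV w \<Longrightarrow> loc_int w"
  unfolding loc_int_def
  using borel_integrable_compact[OF compact_cball, of _ _ w]
  by (auto intro: borel_measurable_continuous_onI continuous_on_subset)

text \<open>Kernels bounded by \<open>M\<close> and supported in one ball are dominated by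
  \<open>M\<close> times the absolute value of \<open>w\<close> on that ball. Both continuity and
  differentiability of a convolution reduce to this, with translates and with difference quotients
  of the kernel.\<close>

lemma conv_limit:
  fixes w :: "'a::euclidean_space \<Rightarrow> real"
  assumes w: "loc_int w"
    and m: "\<And>n. k n \<in> borel_measurable borel"
    and M: "\<And>n z. \<bar>k n z\<bar> \<le> M" and R: "\<And>n z. norm z > R \<Longrightarrow> k n z = 0"
    and lim: "\<And>z. (\<lambda>n. k n z) \<longlonglongrightarrow> l z"
  shows "(\<lambda>n. \<integral>y. w y * k n y \<partial>lborel) \<longlonglongrightarrow> (\<integral>y. w y * l y \<partial>lborel)"
proof (rule integral_dominated_convergence[where w="\<lambda>y. M * \<bar>w y\<bar> * indicator (cball 0 R) y"])
  have lm: "l \<in> borel_measurable borel"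
    by (rule borel_measurable_LIMSEQ_real[of _ k]) (use lim m in auto)
  show "(\<lambda>y. w y * l y) \<in> borel_measurable lborel"
    using w lm by (auto simp: loc_int_def)
  show "(\<lambda>y. w y * k i y) \<in> borel_measurable lborel" for i
    using w m by (auto simp: loc_int_def)
  have "integrable lborel (\<lambda>y. M * (indicator (cball 0 R) y * \<bar>w y\<bar>))"
    using loc_int_abs[OF w] by (auto simp: loc_int_def)
  then show "integrable lborel (\<lambda>y. M * \<bar>w y\<bar> * indicator (cball 0 R) y)"
    by (simp add: ac_simps)
  show "AE x in lborel. (\<lambda>i. w x * k i x) \<longlonglongrightarrow> w x * l x"
    by (intro AE_I2 tendsto_intros lim)
  show "AE x in lborel. norm (w x * k i x) \<le> M * \<bar>w x\<bar> * indicator (cball 0 R) x" for i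
    using M R by (intro AE_I2)
      (auto simp: indicator_def abs_mult mult.commute[of M] intro: mult_left_mono)
qed

lemma cc_shift:
  assumes "cc k" shows "cc (\<lambda>y. k (z - y))"
proof -
  obtain R where R: "R > 0" "\<And>z. norm z > R \<Longrightarrow> k z = 0" using cc_supportE[OF assms] by blast
  have "norm y \<le> R + norm z" if "k (z - y) \<noteq> 0" for y
  proof -
    have "norm (z - y) \<le> R" using R(2)[of "z - y"] that by force
    then show ?thesis using norm_triangle_sub[of y z] by (simp add: norm_minus_commute)
  qed
  then show ?thesis using assms unfolding cc_def
    by (auto intro!: continuous_on_compose2[of UNIV k] continuous_intros)
qed

lemma conv_continuous:
  assumes w: "loc_int w" and k: "cc k" shows "isCont (conv w k) z"
  unfolding isCont_def tendsto_at_iff_sequentially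
proof safe
  fix X :: "nat \<Rightarrow> 'a" assume X: "X \<longlonglongrightarrow> z"
  obtain R where R: "R > 0" "\<And>z. norm z > R \<Longrightarrow> k z = 0" using cc_supportE[OF k] by blast
  obtain M where M: "M > 0" "\<And>z. \<bar>k z\<bar> \<le> M" using cc_boundedE[OF k] by blast
  obtain L where L: "\<And>n. norm (X n) \<le> L"
    using convergent_imp_bounded[OF X] by (auto simp: bounded_iff)
  have "(\<lambda>n. \<integral>y. w y * k (X n - y) \<partial>lborel) \<longlonglongrightarrow> (\<integral>y. w y * k (z - y) \<partial>lborel)"
  proof (rule conv_limit[OF w, where M=M and R="R + L"])
    show "k (X n - y) = 0" if "norm y > R + L" for n y
    proof -
      have "norm y \<le> norm (X n - y) + norm (X n)"
        by (metis norm_minus_commute norm_triangle_sub add.commute)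
      then show ?thesis using L[of n] that by (intro R(2)) linarith
    qed
    show "(\<lambda>n. k (X n - y)) \<longlonglongrightarrow> k (z - y)" for y
      by (rule isCont_tendsto_compose[OF cc_isCont[OF k]]) (intro tendsto_intros X)
    show "(\<lambda>y. k (X n - y)) \<in> borel_measurable borel" for n
      by (rule cc_measurable[OF cc_shift[OF k]])
  qed (rule M)
  then show "(conv w k \<circ> X) \<longlonglongrightarrow> conv w k z" by (simp add: conv_def o_def)
qed

lemma dir_derivD:
  assumes "dir_deriv e k k'"
  shows "((\<lambda>s. k (z + s *\<^sub>R e)) has_real_derivative k' (z + s *\<^sub>R e)) (at s)"
proof -
  have "((\<lambda>r. k (z + s *\<^sub>R e + r *\<^sub>R e)) has_real_derivative k' (z + s *\<^sub>R e)) (at 0)"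
    using assms by (auto simp: dir_deriv_def)
  then have "((\<lambda>r. k (z + (r + s) *\<^sub>R e)) has_real_derivative k' (z + s *\<^sub>R e)) (at 0)"
    by (simp add: algebra_simps)
  then show ?thesis
    using DERIV_shift[of "\<lambda>s. k (z + s *\<^sub>R e)" _ 0 s] by simp
qed

text \<open>The mean value inequality along the line supplies the domination under which a
  convolution may be differentiated.\<close>

lemma dir_deriv_quotient_bound:
  assumes d: "dir_deriv e k k'" and M: "\<And>z. \<bar>k' z\<bar> \<le> M" and s: "s \<noteq> 0"
  shows "\<bar>(k (z + s *\<^sub>R e) - k z) / s\<bar> \<le> M"
proof -
  have "norm (k (z + s *\<^sub>R e) - k (z + 0 *\<^sub>R e)) \<le> M * norm (s - 0)"
    by (rule field_differentiable_bound[where S=UNIV and f="\<lambda>s. k (z + s *\<^sub>R e)"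
          and f'="\<lambda>s. k' (z + s *\<^sub>R e)"])
       (use M dir_derivD[OF d] in auto)
  then show ?thesis using s by (simp add: divide_le_eq abs_divide)
qed

lemma conv_dir_deriv:
  assumes w: "loc_int w" and k: "cc k" and k': "cc k'" and d: "dir_deriv e k k'"
  shows "dir_deriv e (conv w k) (conv w k')"
  unfolding dir_deriv_def has_field_derivative_iff tendsto_at_iff_sequentially
proof (intro allI impI)
  fix z and X :: "nat \<Rightarrow> real"
  assume X0: "\<forall>i. X i \<in> UNIV - {0}" and X: "X \<longlonglongrightarrow> 0"
  have nz: "X n \<noteq> 0" for n using X0 by auto
  obtain R where R: "R > 0" "\<And>z. norm z > R \<Longrightarrow> k z = 0" using cc_supportE[OF k] by blast
  obtain M where M: "M > 0" "\<And>z. \<bar>k' z\<bar> \<le> M" using cc_boundedE[OF k'] by blast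
  obtain L where L: "\<And>n. norm (X n) \<le> L"
    using convergent_imp_bounded[OF X] by (auto simp: bounded_iff)
  have L0: "L \<ge> 0" using L[of 0] by (meson norm_ge_zero order_trans)
  define K where "K n y = (k (z - y + X n *\<^sub>R e) - k (z - y)) / X n" for n y
  have "(\<lambda>n. \<integral>y. w y * K n y \<partial>lborel) \<longlonglongrightarrow> (\<integral>y. w y * k' (z - y) \<partial>lborel)"
  proof (rule conv_limit[OF w, where M=M and R="R + norm z + L * norm e"])
    show "K n y = 0" if "norm y > R + norm z + L * norm e" for n y
    proof -
      have a: "norm (X n *\<^sub>R e) \<le> L * norm e" using L[of n] by (simp add: mult_right_mono)
      have "norm y \<le> norm (z - y) + norm z"
        by (metis norm_minus_commute norm_triangle_sub add.commute)
      moreover have "norm (z - y) \<le> norm (z - y + X n *\<^sub>R e) + norm (X n *\<^sub>R e)"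
        by (metis add_diff_cancel_right' norm_triangle_ineq4)
      moreover have "L * norm e \<ge> 0" using L0 by simp
      ultimately show ?thesis using a that by (simp add: K_def R(2))
    qed
    show "\<bar>K n y\<bar> \<le> M" for n y
      unfolding K_def by (rule dir_deriv_quotient_bound[OF d M(2) nz])
    show "(\<lambda>n. K n y) \<longlonglongrightarrow> k' (z - y)" for y
    proof -
      have "((\<lambda>s. (k (z - y + s *\<^sub>R e) - k (z - y)) / s) \<longlongrightarrow> k' (z - y)) (at 0)"
        using d[unfolded dir_deriv_def, rule_format, of "z - y"]
        by (simp add: has_field_derivative_iff)
      then show ?thesis
        unfolding tendsto_at_iff_sequentially K_def using X X0 by (auto simp: o_def)
    qed
    have "(\<lambda>y. k (z - y)) \<in> borel_measurable borel" "(\<lambda>y. k ((z + X n *\<^sub>R e) - y)) \<in> borel_measurable borel" for n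
      by (rule cc_measurable[OF cc_shift[OF k]])+
    then show "K n \<in> borel_measurable borel" for n
      unfolding K_def by (simp add: algebra_simps)
  qed
  moreover have "(\<integral>y. w y * K n y \<partial>lborel) = (conv w k (z + X n *\<^sub>R e) - conv w k z) / X n" for n
  proof -
    have "conv w k (z + X n *\<^sub>R e) - conv w k z =
        (\<integral>y. w y * k (z + X n *\<^sub>R e - y) - w y * k (z - y) \<partial>lborel)"
      unfolding conv_def
      by (subst Bochner_Integration.integral_diff) (auto intro!: loc_int_mult_cc[OF w] cc_shift k)
    then show ?thesis
      unfolding K_def by (simp flip: integral_divide_zero add: right_diff_distrib algebra_simps)
  qed
  ultimately show "((\<lambda>h. (conv w k (z + h *\<^sub>R e) - conv w k (z + 0 *\<^sub>R e)) / (h - 0)) \<circ> X)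
      \<longlonglongrightarrow> conv w k' z"
    by (simp add: o_def conv_def)
qed

lemma integral_lborel_shift:
  fixes f :: "'a::euclidean_space \<Rightarrow> real"
  assumes "f \<in> borel_measurable borel"
  shows "(\<integral>y. f (c + y) \<partial>lborel) = (\<integral>y. f y \<partial>lborel)"
proof -
  have "(\<integral>y. f y \<partial>distr lborel borel ((+) c)) = (\<integral>y. f (c + y) \<partial>lborel)"
    by (rule integral_distr) (use assms in auto)
  then show ?thesis by (simp add: lborel_distr_plus)
qed

lemma integral_lborel_uminus:
  fixes f :: "'a::euclidean_space \<Rightarrow> real"
  assumes [measurable]: "f \<in> borel_measurable borel"
  shows "(\<integral>y. f (- y) \<partial>lborel) = (\<integral>y. f y \<partial>lborel)"
proof -
  have eq: "(lborel :: 'a measure) = distr lborel borel uminus"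
    using lborel_affine[of "-1" "0::'a"] by (simp add: density_1)
  show ?thesis
    by (subst (2) eq) (subst integral_distr, auto)
qed

lemma integral_lborel_reflect:
  fixes f :: "'a::euclidean_space \<Rightarrow> real"
  assumes [measurable]: "f \<in> borel_measurable borel"
  shows "(\<integral>y. f (z - y) \<partial>lborel) = (\<integral>y. f y \<partial>lborel)"
  using integral_lborel_uminus[of "\<lambda>y. f (z + y)"] integral_lborel_shift[of f z]
  by simp

text \<open>Convolving with the constant \<open>1\<close> turns \<open>k\<close> into the constant
  function whose value is its integral. Differentiating that constant under the integral sign gives
  the integral of \<open>k'\<close>. This is the source of all integration by parts below, without
  iterated integrals.\<close>

lemma integral_dir_deriv_eq_0:
  assumes k: "cc k" and k': "cc k'" and d: "dir_deriv e k k'"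
  shows "(\<integral>y. k' y \<partial>lborel) = 0"
proof -
  have c: "conv (\<lambda>_. 1) f z = (\<integral>y. f y \<partial>lborel)" if "cc f" for f :: "'a \<Rightarrow> real" and z
    unfolding conv_def using integral_lborel_reflect[of f z] that cc_measurable by auto
  have "dir_deriv e (conv (\<lambda>_. 1) k) (conv (\<lambda>_. 1) k')"
    by (intro conv_dir_deriv k k' d loc_int_continuous continuous_intros)
  then have "((\<lambda>s. \<integral>y. k y \<partial>lborel) has_real_derivative (\<integral>y. k' y \<partial>lborel)) (at 0)"
    by (simp add: dir_deriv_def c k k')
  then show ?thesis using DERIV_unique DERIV_const by blast
qed

section \<open>Test functions and mollifiers\<close>

text \<open>A test function on the whole space-time together with its derivatives; carrying the derivatives
  explicitly avoids \<open>deriv\<close> and one-sided derivatives until the definitions of a solution are met.\<close>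

definition jet :: "((real^'n) \<times> real \<Rightarrow> real) \<Rightarrow> ((real^'n) \<times> real \<Rightarrow> real) \<Rightarrow>
    ('n \<Rightarrow> (real^'n) \<times> real \<Rightarrow> real) \<Rightarrow> ('n \<Rightarrow> 'n \<Rightarrow> (real^'n) \<times> real \<Rightarrow> real) \<Rightarrow> bool" where
  "jet \<phi> \<phi>t \<phi>x \<phi>xx \<longleftrightarrow> cc \<phi> \<and> cc \<phi>t \<and> (\<forall>i. cc (\<phi>x i)) \<and> (\<forall>i j. cc (\<phi>xx i j)) \<and>
     dir_deriv (0, 1) \<phi> \<phi>t \<and> (\<forall>i. dir_deriv (axis i 1, 0) \<phi> (\<phi>x i)) \<and>
     (\<forall>i j. dir_deriv (axis j 1, 0) (\<phi>x i) (\<phi>xx i j))"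

text \<open>The weak form of \<open>\<partial>\<^sub>t w - \<Delta> w + g = c \<delta>\<close> on all of space-time before \<open>T\<close>, with \<open>\<delta>\<close> the Dirac
  mass at the space-time origin: extending a solution by \<open>0\<close> to negative times turns its initial
  datum into this source.\<close>

definition weak_eq :: "real \<Rightarrow> ((real^'n) \<times> real \<Rightarrow> real) \<Rightarrow> ((real^'n) \<times> real \<Rightarrow> real) \<Rightarrow> real \<Rightarrow> bool" where
  "weak_eq T w g c \<longleftrightarrow> (\<forall>\<phi> \<phi>t \<phi>x \<phi>xx a. jet \<phi> \<phi>t \<phi>x \<phi>xx \<longrightarrow> a < T \<longrightarrow> (\<forall>z. snd z > a \<longrightarrow> \<phi> z = 0) \<longrightarrow>
     (\<integral>y. w y * (- \<phi>t y - (\<Sum>i\<in>UNIV. \<phi>xx i i y)) \<partial>lborel) = - (\<integral>y. g y * \<phi> y \<partial>lborel) + c * \<phi> 0)"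

lemma dir_deriv_eq_0:
  assumes d: "dir_deriv e k k'" and S: "open S" "z \<in> S" and 0: "\<And>y. y \<in> S \<Longrightarrow> k y = 0"
  shows "k' z = 0"
proof -
  have "((\<lambda>s. k (z + s *\<^sub>R e)) has_real_derivative k' z) (at 0)"
    using d by (auto simp: dir_deriv_def)
  moreover have "((\<lambda>s. k (z + s *\<^sub>R e)) has_real_derivative 0) (at 0)"
  proof (rule DERIV_cong_ev[THEN iffD2, OF refl _ refl])
    show "((\<lambda>s. 0) has_real_derivative 0) (at 0)" by simp
    have "((\<lambda>s. z + s *\<^sub>R e) \<longlongrightarrow> z + 0 *\<^sub>R e) (nhds (0::real))"
      by (intro tendsto_intros filterlim_ident)
    then have "eventually (\<lambda>s. z + s *\<^sub>R e \<in> S) (nhds 0)"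
      using S by (intro topological_tendstoD) auto
    then show "eventually (\<lambda>s. k (z + s *\<^sub>R e) = 0) (nhds 0)"
      by eventually_elim (rule 0)
  qed
  ultimately show ?thesis by (rule DERIV_unique)
qed

lemma dir_deriv_reflect:
  assumes "dir_deriv e k k'" shows "dir_deriv e (\<lambda>y. k (z - y)) (\<lambda>y. - k' (z - y))"
  unfolding dir_deriv_def
proof
  fix y
  have "((\<lambda>s. k (z - y + s *\<^sub>R e)) has_real_derivative k' (z - y)) (at (- 0))"
    using assms by (auto simp: dir_deriv_def)
  then have "((\<lambda>s. k (z - y + (- s) *\<^sub>R e)) has_real_derivative - k' (z - y)) (at 0)"
    by (subst (asm) DERIV_mirror) simp
  then show "((\<lambda>s. k (z - (y + s *\<^sub>R e))) has_real_derivative - k' (z - y)) (at 0)"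
    by (simp add: algebra_simps)
qed

lemma dir_deriv_uminus: "dir_deriv e k k' \<Longrightarrow> dir_deriv e (\<lambda>y. - k y) (\<lambda>y. - k' y)"
  unfolding dir_deriv_def by (auto intro: derivative_intros)

lemma cc_uminus: "cc k \<Longrightarrow> cc (\<lambda>y. - k y)"
  unfolding cc_def by (auto intro: continuous_intros)

lemma cc_diff:
  assumes "cc k" "cc l" shows "cc (\<lambda>y. k y - l y)"
proof -
  obtain R where R: "\<And>z. norm z > R \<Longrightarrow> k z = 0" using cc_supportE[OF assms(1)] by blast
  obtain R' where R': "\<And>z. norm z > R' \<Longrightarrow> l z = 0" using cc_supportE[OF assms(2)] by blast
  show ?thesis unfolding cc_def
  proof (intro conjI exI[of _ "max R R'"] allI impI)
    show "continuous_on UNIV (\<lambda>y. k y - l y)"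
      using assms by (intro continuous_intros cc_continuous)
    fix z assume "k z - l z \<noteq> 0"
    then have "k z \<noteq> 0 \<or> l z \<noteq> 0" by auto
    then show "norm z \<le> max R R'" using R[of z] R'[of z] by linarith
  qed
qed

lemma cc_sum: "finite I \<Longrightarrow> (\<And>i. i \<in> I \<Longrightarrow> cc (k i)) \<Longrightarrow> cc (\<lambda>y. \<Sum>i\<in>I. k i y)"
proof (induction I rule: finite_induct)
  case empty then show ?case by (simp add: cc_def)
next
  case (insert i I)
  then have "cc (\<lambda>y. k i y - (- (\<Sum>i\<in>I. k i y)))" by (intro cc_diff cc_uminus) auto
  with insert show ?case by simp
qed

lemma cc_dir_deriv:
  assumes "cc k" "dir_deriv e k k'" "continuous_on UNIV k'" shows "cc k'"
proof -
  obtain R where R: "R > 0" "\<And>z. norm z > R \<Longrightarrow> k z = 0" using cc_supportE[OF assms(1)] by blast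
  have "k' z = 0" if "norm z > R" for z
    by (rule dir_deriv_eq_0[OF assms(2), of "{z. norm z > R}"])
       (use R that in \<open>auto intro!: open_Collect_less continuous_intros\<close>)
  then have "\<forall>z. k' z \<noteq> 0 \<longrightarrow> norm z \<le> R" by (meson not_le)
  then show ?thesis using assms(3) unfolding cc_def by blast
qed

lemma jetI:
  assumes "cc \<phi>" "continuous_on UNIV \<phi>t" "\<And>i. continuous_on UNIV (\<phi>x i)"
    "\<And>i j. continuous_on UNIV (\<phi>xx i j)" "dir_deriv (0, 1) \<phi> \<phi>t"
    "\<And>i. dir_deriv (axis i 1, 0) \<phi> (\<phi>x i)" "\<And>i j. dir_deriv (axis j 1, 0) (\<phi>x i) (\<phi>xx i j)"
  shows "jet \<phi> \<phi>t \<phi>x \<phi>xx"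
proof -
  have x: "cc (\<phi>x i)" for i by (rule cc_dir_deriv[OF assms(1,6,3)])
  moreover have "cc (\<phi>xx i j)" for i j by (rule cc_dir_deriv[OF x assms(7,4)])
  moreover have "cc \<phi>t" by (rule cc_dir_deriv[OF assms(1,5,2)])
  ultimately show ?thesis unfolding jet_def using assms by simp
qed

lemma jet_heat_cc: "jet \<phi> \<phi>t \<phi>x \<phi>xx \<Longrightarrow> cc (\<lambda>y. - \<phi>t y - (\<Sum>i\<in>UNIV. \<phi>xx i i y))"
  unfolding jet_def by (intro cc_diff cc_uminus cc_sum) auto

lemma jet_eq_0:
  assumes j: "jet \<phi> \<phi>t \<phi>x \<phi>xx" and S: "open S" "z \<in> S" and 0: "\<And>y. y \<in> S \<Longrightarrow> \<phi> y = 0"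
  shows "\<phi>t z = 0" "\<phi>x i z = 0" "\<phi>xx i j z = 0"
proof -
  have x: "\<phi>x i y = 0" if "y \<in> S" for y
    by (rule dir_deriv_eq_0[where k=\<phi> and S=S and e="(axis i 1, 0)"])
       (use j S 0 that in \<open>auto simp: jet_def\<close>)
  show "\<phi>x i z = 0" by (rule x) (rule S)
  show "\<phi>t z = 0"
    by (rule dir_deriv_eq_0[where k=\<phi> and S=S and e="(0,1)"]) (use j S 0 in \<open>auto simp: jet_def\<close>)
  show "\<phi>xx i j z = 0"
    by (rule dir_deriv_eq_0[where k="\<phi>x i" and S=S and e="(axis j 1, 0)"])
       (use j S x in \<open>auto simp: jet_def\<close>)
qed

text \<open>Testing a weak equation with a mollifier in the argument \<open>z - y\<close> evaluates
  the mollified equation at \<open>z\<close>. The reflection changes the sign of first derivatives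
  and leaves second derivatives alone.\<close>

lemma jet_reflect:
  assumes "jet \<phi> \<phi>t \<phi>x \<phi>xx"
  shows "jet (\<lambda>y. \<phi> (z - y)) (\<lambda>y. - \<phi>t (z - y)) (\<lambda>i y. - \<phi>x i (z - y)) (\<lambda>i j y. \<phi>xx i j (z - y))"
proof -
  have "dir_deriv (axis j 1, 0) (\<lambda>y. - \<phi>x i (z - y)) (\<lambda>y. \<phi>xx i j (z - y))" for i j
    using dir_deriv_uminus[OF dir_deriv_reflect[of "(axis j 1, 0)" "\<phi>x i" "\<phi>xx i j" z]] assms
    by (auto simp: jet_def)
  then show ?thesis
    using assms unfolding jet_def
    by (auto intro!: cc_shift cc_uminus dir_deriv_reflect)
qed

section \<open>Functions that are radial in space\<close>

lemma norm_add_axis: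
  fixes x :: "real^'n"
  shows "(norm (x + s *\<^sub>R axis j 1))\<^sup>2 = (norm x)\<^sup>2 + 2 * s * (x $ j) + s\<^sup>2"
  unfolding power2_norm_eq_inner
  by (simp add: inner_add_left inner_add_right inner_axis inner_commute[of "axis _ _"] power2_eq_square algebra_simps)

lemma norm_Pair_sq: "(norm (x, t))\<^sup>2 = (norm x)\<^sup>2 + (norm t)\<^sup>2"
  by (simp add: norm_Pair)

text \<open>Barriers become infinite at the edge of their domain, so their derivatives exist only on
  an open set.\<close>

definition dir_deriv_on :: "'a::euclidean_space set \<Rightarrow> 'a \<Rightarrow> ('a \<Rightarrow> real) \<Rightarrow> ('a \<Rightarrow> real) \<Rightarrow> bool" where
  "dir_deriv_on U e k k' \<longleftrightarrow> (\<forall>z\<in>U. ((\<lambda>s. k (z + s *\<^sub>R e)) has_real_derivative k' z) (at (0::real)))"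

lemma dir_deriv_on_UNIV: "dir_deriv_on UNIV e k k' \<longleftrightarrow> dir_deriv e k k'"
  by (simp add: dir_deriv_on_def dir_deriv_def)

text \<open>Radial functions are written through the squared distance, which is a quadratic
  polynomial along each coordinate line; the centre then needs no separate treatment.\<close>

lemma radial_dir_deriv_on_x:
  fixes x0 :: "real^'n" and F F' :: "real \<Rightarrow> real \<Rightarrow> real"
  assumes "\<And>z. z \<in> U \<Longrightarrow> ((\<lambda>p. F p (snd z)) has_real_derivative F' ((norm (fst z - x0))\<^sup>2) (snd z)) (at ((norm (fst z - x0))\<^sup>2))"
  shows "dir_deriv_on U (axis j 1, 0) (\<lambda>z. F ((norm (fst z - x0))\<^sup>2) (snd z))
           (\<lambda>z. 2 * (fst z - x0) $ j * F' ((norm (fst z - x0))\<^sup>2) (snd z))"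
  unfolding dir_deriv_on_def
proof
  fix z assume z: "z \<in> U"
  let ?x = "fst z - x0"
  have 1: "((\<lambda>s. (norm ?x)\<^sup>2 + 2 * s * (?x $ j) + s\<^sup>2) has_real_derivative 2 * ?x $ j) (at 0)"
    by (auto intro!: derivative_eq_intros)
  have "((\<lambda>s. F ((norm ?x)\<^sup>2 + 2 * s * (?x $ j) + s\<^sup>2) (snd z)) has_real_derivative
      F' ((norm ?x)\<^sup>2) (snd z) * (2 * ?x $ j)) (at 0)"
    by (rule DERIV_chain2[OF _ 1]) (use assms[OF z] in simp)
  moreover have "fst (z + s *\<^sub>R (axis j 1, 0)) - x0 = ?x + s *\<^sub>R axis j 1"
    "snd (z + s *\<^sub>R (axis j 1, 0)) = snd z" for s :: real by auto
  ultimately show "((\<lambda>s. F ((norm (fst (z + s *\<^sub>R (axis j 1, 0)) - x0))\<^sup>2) (snd (z + s *\<^sub>R (axis j 1, 0))))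
     has_real_derivative 2 * ?x $ j * F' ((norm ?x)\<^sup>2) (snd z)) (at 0)"
    by (simp only: norm_add_axis) (simp add: mult.commute)
qed

lemma radial_dir_deriv_on_xx:
  fixes x0 :: "real^'n" and F' F'' :: "real \<Rightarrow> real \<Rightarrow> real"
  assumes "\<And>z. z \<in> U \<Longrightarrow> ((\<lambda>p. F' p (snd z)) has_real_derivative F'' ((norm (fst z - x0))\<^sup>2) (snd z)) (at ((norm (fst z - x0))\<^sup>2))"
  shows "dir_deriv_on U (axis j 1, 0) (\<lambda>z. 2 * (fst z - x0) $ i * F' ((norm (fst z - x0))\<^sup>2) (snd z))
           (\<lambda>z. 4 * (fst z - x0) $ i * (fst z - x0) $ j * F'' ((norm (fst z - x0))\<^sup>2) (snd z)
              + (if i = j then 2 * F' ((norm (fst z - x0))\<^sup>2) (snd z) else 0))"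
  unfolding dir_deriv_on_def
proof
  fix z assume z: "z \<in> U"
  have 1: "((\<lambda>s. F' ((norm (fst (z + s *\<^sub>R (axis j 1, 0)) - x0))\<^sup>2) (snd (z + s *\<^sub>R (axis j 1, 0))))
     has_real_derivative 2 * (fst z - x0) $ j * F'' ((norm (fst z - x0))\<^sup>2) (snd z)) (at 0)"
    using radial_dir_deriv_on_x[OF assms, of U j] z by (auto simp: dir_deriv_on_def)
  have "((\<lambda>s. 2 * ((fst z - x0) $ i + s * (if i = j then 1 else 0))) has_real_derivative (if i = j then 2 else 0)) (at 0)"
    by (auto intro!: derivative_eq_intros)
  then have 2: "((\<lambda>s. 2 * (fst (z + s *\<^sub>R (axis j 1, 0)) - x0) $ i) has_real_derivative (if i = j then 2 else 0)) (at 0)"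
    by (simp add: axis_def algebra_simps eq_commute)
  show "((\<lambda>s. 2 * (fst (z + s *\<^sub>R (axis j 1, 0)) - x0) $ i *
          F' ((norm (fst (z + s *\<^sub>R (axis j 1, 0)) - x0))\<^sup>2) (snd (z + s *\<^sub>R (axis j 1, 0))))
     has_real_derivative 4 * (fst z - x0) $ i * (fst z - x0) $ j * F'' ((norm (fst z - x0))\<^sup>2) (snd z)
              + (if i = j then 2 * F' ((norm (fst z - x0))\<^sup>2) (snd z) else 0)) (at 0)"
    by (rule DERIV_cong[OF DERIV_mult[OF 2 1]]) (simp add: algebra_simps)
qed

lemma radial_dir_deriv_on_t:
  fixes x0 :: "real^'n" and F F' :: "real \<Rightarrow> real \<Rightarrow> real"
  assumes "\<And>z. z \<in> U \<Longrightarrow> ((\<lambda>s. F ((norm (fst z - x0))\<^sup>2) s) has_real_derivative F' ((norm (fst z - x0))\<^sup>2) (snd z)) (at (snd z))"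
  shows "dir_deriv_on U (0, 1) (\<lambda>z. F ((norm (fst z - x0))\<^sup>2) (snd z))
           (\<lambda>z. F' ((norm (fst z - x0))\<^sup>2) (snd z))"
  unfolding dir_deriv_on_def
proof
  fix z assume z: "z \<in> U"
  have "((\<lambda>s. F ((norm (fst z - x0))\<^sup>2) (snd z + s)) has_real_derivative
      F' ((norm (fst z - x0))\<^sup>2) (snd z) * 1) (at 0)"
    by (rule DERIV_chain2[where f="\<lambda>s. F ((norm (fst z - x0))\<^sup>2) s"])
       (use assms[OF z] in \<open>auto intro!: derivative_eq_intros\<close>)
  then show "((\<lambda>s. F ((norm (fst (z + s *\<^sub>R (0, 1)) - x0))\<^sup>2) (snd (z + s *\<^sub>R (0, 1))))
      has_real_derivative F' ((norm (fst z - x0))\<^sup>2) (snd z)) (at 0)"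
    by simp
qed

lemmas radial_dir_deriv_x = radial_dir_deriv_on_x[of UNIV, unfolded dir_deriv_on_UNIV]
lemmas radial_dir_deriv_xx = radial_dir_deriv_on_xx[of UNIV, unfolded dir_deriv_on_UNIV]
lemmas radial_dir_deriv_t = radial_dir_deriv_on_t[of UNIV, unfolded dir_deriv_on_UNIV]

lemma continuous_on_radial:
  fixes x0 :: "real^'n" and F :: "real \<Rightarrow> real \<Rightarrow> real"
  assumes "continuous_on UNIV (\<lambda>(p, s). F p s)"
  shows "continuous_on UNIV (\<lambda>z. F ((norm (fst z - x0))\<^sup>2) (snd z))"
proof -
  have "continuous_on UNIV (\<lambda>z::(real^'n) \<times> real. ((norm (fst z - x0))\<^sup>2, snd z))"
    by (intro continuous_intros)
  from continuous_on_compose2[OF assms this] show ?thesis by simp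
qed

lemma jet_radial:
  fixes x0 :: "real^'n"
  assumes c: "continuous_on UNIV (\<lambda>(p, s). F p s)" "continuous_on UNIV (\<lambda>(p, s). Fs p s)"
    "continuous_on UNIV (\<lambda>(p, s). Fp p s)" "continuous_on UNIV (\<lambda>(p, s). Fpp p s)"
    and d: "\<And>p s. ((\<lambda>s. F p s) has_real_derivative Fs p s) (at s)"
    "\<And>p s. ((\<lambda>p. F p s) has_real_derivative Fp p s) (at p)"
    "\<And>p s. ((\<lambda>p. Fp p s) has_real_derivative Fpp p s) (at p)"
    and supp: "\<And>z. norm z > R \<Longrightarrow> F ((norm (fst z - x0))\<^sup>2) (snd z) = 0"
  shows "jet (\<lambda>z. F ((norm (fst z - x0))\<^sup>2) (snd z))
     (\<lambda>z. Fs ((norm (fst z - x0))\<^sup>2) (snd z))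
     (\<lambda>i z. 2 * (fst z - x0) $ i * Fp ((norm (fst z - x0))\<^sup>2) (snd z))
     (\<lambda>i j z. 4 * (fst z - x0) $ i * (fst z - x0) $ j * Fpp ((norm (fst z - x0))\<^sup>2) (snd z)
              + (if i = j then 2 * Fp ((norm (fst z - x0))\<^sup>2) (snd z) else 0))"
proof (rule jetI)
  show "cc (\<lambda>z. F ((norm (fst z - x0))\<^sup>2) (snd z))"
    unfolding cc_def
  proof (intro conjI exI[of _ R] allI impI)
    show "norm z \<le> R" if "F ((norm (fst z - x0))\<^sup>2) (snd z) \<noteq> 0" for z
      using supp[of z] that by (meson not_le)
  qed (rule continuous_on_radial[OF c(1)])
  show "continuous_on UNIV (\<lambda>z. 4 * (fst z - x0) $ i * (fst z - x0) $ j * Fpp ((norm (fst z - x0))\<^sup>2) (snd z)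
              + (if i = j then 2 * Fp ((norm (fst z - x0))\<^sup>2) (snd z) else 0))" for i j
    by (cases "i = j") (auto intro!: continuous_intros continuous_on_radial[OF c(3)] continuous_on_radial[OF c(4)])
qed (intro continuous_intros continuous_on_radial c radial_dir_deriv_t radial_dir_deriv_x radial_dir_deriv_xx d)+

text \<open>The odd \<open>if i = i\<close> is the diagonal of the Hessian in
  \<open>jet_radial\<close>; keeping it lets this identity rewrite the sums produced there.\<close>

lemma radial_laplacian:
  fixes x :: "real^'n"
  shows "(\<Sum>i\<in>UNIV. 4 * x $ i * x $ i * a + (if i = i then 2 * b else 0)) = 4 * (norm x)\<^sup>2 * a + 2 * real CARD('n) * b"
proof -
  have "(norm x)\<^sup>2 = (\<Sum>i\<in>UNIV. x $ i * x $ i)"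
    by (simp add: power2_norm_eq_inner inner_vec_def)
  then show ?thesis by (simp add: sum.distrib sum_distrib_left sum_distrib_right mult.assoc)
qed

section \<open>Polynomial bumps and mollifiers\<close>

lemma DERIV_max_0_power:
  "((\<lambda>v::real. (max 0 v) ^ Suc (Suc n)) has_real_derivative real (Suc (Suc n)) * (max 0 v) ^ Suc n) (at v)"
proof -
  consider "v > 0" | "v < 0" | "v = 0" by linarith
  then show ?thesis
  proof cases
    case 1
    have "((\<lambda>v::real. v ^ Suc (Suc n)) has_real_derivative real (Suc (Suc n)) * v ^ Suc n) (at v)"
      using DERIV_pow[of "Suc (Suc n)" v] by simp
    moreover have "eventually (\<lambda>v. v ^ Suc (Suc n) = (max 0 v) ^ Suc (Suc n)) (nhds v)"
      using 1 by (intro eventually_nhds_in_open[of "{0<..}" v, THEN eventually_mono]) auto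
    ultimately have "((\<lambda>v::real. (max 0 v) ^ Suc (Suc n)) has_real_derivative real (Suc (Suc n)) * v ^ Suc n) (at v)"
      by (rule DERIV_cong_ev[THEN iffD1, OF refl _ refl, rotated])
    then show ?thesis using 1 by (simp add: max_def)
  next
    case 2
    have "((\<lambda>v::real. 0) has_real_derivative 0) (at v)" by simp
    moreover have "eventually (\<lambda>v. 0 = (max 0 v) ^ Suc (Suc n)) (nhds v)"
      using 2 by (intro eventually_nhds_in_open[of "{..<0}" v, THEN eventually_mono]) auto
    ultimately have "((\<lambda>v::real. (max 0 v) ^ Suc (Suc n)) has_real_derivative 0) (at v)"
      by (rule DERIV_cong_ev[THEN iffD1, OF refl _ refl, rotated])
    then show ?thesis using 2 by simp
  next
    case 3
    have "((\<lambda>h::real. (max 0 h) ^ Suc (Suc n) / h) \<longlongrightarrow> 0) (at 0)"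
    proof (rule Lim_null_comparison)
      have "norm ((max 0 h) ^ Suc (Suc n) / h) \<le> \<bar>h\<bar> ^ Suc n" for h :: real
        using zero_le_power[of "\<bar>h\<bar>" "Suc n"] by (cases "h \<ge> 0") (simp_all add: max_def)
      then show "eventually (\<lambda>h. norm ((max 0 h) ^ Suc (Suc n) / h) \<le> \<bar>h\<bar> ^ Suc n) (at (0::real))"
        by (intro always_eventually allI)
      show "((\<lambda>h. \<bar>h\<bar> ^ Suc n) \<longlongrightarrow> 0) (at (0::real))"
        by (intro tendsto_eq_intros | simp)+
    qed
    then show ?thesis using 3 by (simp add: has_field_derivative_iff)
  qed
qed

lemma exists_mollifier:
  assumes "\<epsilon> > 0"
  obtains \<eta> \<eta>t \<eta>x \<eta>xx where "jet (\<eta> :: (real^'n) \<times> real \<Rightarrow> real) \<eta>t \<eta>x \<eta>xx" "\<And>z. \<eta> z \<ge> 0"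
    "\<And>z. norm z \<ge> \<epsilon> \<Longrightarrow> \<eta> z = 0" "(\<integral>z. \<eta> z \<partial>lborel) = 1"
proof -
  \<comment> \<open>The cube is the lowest power of the positive part with a continuous second
    derivative. The factor \<open>c\<close> stays free so that one computation covers both the raw
    bump (\<open>c = 1\<close>) and the normalised one (\<open>c = 1 / I\<close>).\<close>
  define F where "F c p s = c * (max 0 (\<epsilon>\<^sup>2 - p - s\<^sup>2)) ^ 3" for c p s :: real
  define Fs where "Fs c p s = c * (3 * (max 0 (\<epsilon>\<^sup>2 - p - s\<^sup>2))\<^sup>2 * (- 2 * s))" for c p s :: real
  define Fp where "Fp c p s = c * (3 * (max 0 (\<epsilon>\<^sup>2 - p - s\<^sup>2))\<^sup>2 * (- 1))" for c p s :: real
  define Fpp where "Fpp c p s = c * (- 3 * (2 * (max 0 (\<epsilon>\<^sup>2 - p - s\<^sup>2)) * (- 1)))" for c p s :: real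
  let ?f = "\<lambda>F z. F ((norm (fst z - (0::real^'n)))\<^sup>2) (snd z)"
  have F: "?f (F c) z = c * (max 0 (\<epsilon>\<^sup>2 - (norm z)\<^sup>2)) ^ 3" for c and z :: "(real^'n) \<times> real"
    by (cases z) (simp add: F_def norm_Pair_sq diff_diff_eq)
  have 0: "?f (F c) z = 0" if "norm z \<ge> \<epsilon>" for c and z :: "(real^'n) \<times> real"
  proof -
    have "\<epsilon>\<^sup>2 \<le> (norm z)\<^sup>2" using that assms by (intro power_mono) auto
    then show ?thesis unfolding F by simp
  qed
  have D3: "((\<lambda>v::real. (max 0 v) ^ 3) has_real_derivative 3 * (max 0 v)\<^sup>2) (at v)" for v
    using DERIV_max_0_power[of 1 v] by (simp add: numeral_eq_Suc)
  have D2: "((\<lambda>v::real. (max 0 v)\<^sup>2) has_real_derivative 2 * (max 0 v)) (at v)" for v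
    using DERIV_max_0_power[of 0 v] by (simp add: numeral_eq_Suc)
  have jet: "jet (?f (F c)) (?f (Fs c)) (\<lambda>i z. 2 * (fst z - 0) $ i * ?f (Fp c) z)
     (\<lambda>i j z. 4 * (fst z - (0::real^'n)) $ i * (fst z - 0) $ j * ?f (Fpp c) z
              + (if i = j then 2 * ?f (Fp c) z else 0))" for c
  proof (rule jet_radial)
    show "((\<lambda>s. F c p s) has_real_derivative Fs c p s) (at s)" for p s
      unfolding F_def Fs_def
      by (rule DERIV_cmult DERIV_chain2[OF D3])+ (auto intro!: derivative_eq_intros)
    show "((\<lambda>p. F c p s) has_real_derivative Fp c p s) (at p)" for p s
      unfolding F_def Fp_def
      by (rule DERIV_cmult DERIV_chain2[OF D3])+ (auto intro!: derivative_eq_intros)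
    have "((\<lambda>p. c * (-3 * (max 0 (\<epsilon>\<^sup>2 - p - s\<^sup>2))\<^sup>2)) has_real_derivative Fpp c p s) (at p)" for p s
      unfolding Fpp_def
      by (rule DERIV_cmult DERIV_chain2[OF D2])+ (auto intro!: derivative_eq_intros)
    then show "((\<lambda>p. Fp c p s) has_real_derivative Fpp c p s) (at p)" for p s
      unfolding Fp_def by simp
    show "?f (F c) z = 0" if "norm z > \<epsilon>" for z :: "(real^'n) \<times> real" using 0[of z] that by simp
  qed (auto simp: F_def Fs_def Fp_def Fpp_def split_beta intro!: continuous_intros)
  define I where "I = (\<integral>z. ?f (F 1) z \<partial>(lborel :: ((real^'n) \<times> real) measure))"
  have cc1: "cc (?f (F 1))" using jet[of 1] by (simp add: jet_def)
  have int: "integrable lborel (?f (F 1))"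
    using loc_int_mult_cc[OF loc_int_continuous cc1, of "\<lambda>_. 1"] by auto
  have nn: "?f (F 1) z \<ge> 0" for z :: "(real^'n) \<times> real" unfolding F by simp
  \<comment> \<open>A vanishing integral would make the nonnegative bump zero almost everywhere, but
    its zero set is exactly the complement of a ball of positive measure.\<close>
  have "I \<noteq> 0"
  proof
    assume "I = 0"
    then have "AE z in lborel. ?f (F 1) z = 0"
      using integral_nonneg_eq_0_iff_AE[OF int] nn by (simp add: I_def)
    moreover have "(?f (F 1) z = 0) = (z \<notin> ball 0 \<epsilon>)" for z :: "(real^'n) \<times> real"
    proof -
      have "(norm z)\<^sup>2 < \<epsilon>\<^sup>2" if "norm z < \<epsilon>" using that by (intro power_strict_mono) auto
      moreover have "\<epsilon>\<^sup>2 \<le> (norm z)\<^sup>2" if "norm z \<ge> \<epsilon>" using that assms by (intro power_mono) auto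
      ultimately show ?thesis unfolding F
        by (cases "norm z < \<epsilon>") (auto simp: not_less max_def split: if_splits)
    qed
    ultimately have "AE z in lborel. z \<notin> ball (0::(real^'n) \<times> real) \<epsilon>" by simp
    then have "emeasure lborel (ball (0::(real^'n) \<times> real) \<epsilon>) = 0"
      by (subst (asm) AE_iff_measurable[OF _ refl]) (auto simp: ball_def)
    then show False
      using assms unit_ball_vol_pos[of "real DIM((real^'n) \<times> real)"] by (simp add: emeasure_ball)
  qed
  moreover have "I \<ge> 0" unfolding I_def by (intro integral_nonneg_AE AE_I2 nn)
  ultimately have I: "I > 0" by simp
  show ?thesis
  proof (rule that[OF jet[of "1 / I"]])
    show "?f (F (1 / I)) z \<ge> 0" for z :: "(real^'n) \<times> real" unfolding F using I by simp
    show "?f (F (1 / I)) z = 0" if "norm z \<ge> \<epsilon>" for z :: "(real^'n) \<times> real" using 0 that .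
    have "(\<integral>z. ?f (F (1 / I)) z \<partial>(lborel :: ((real^'n) \<times> real) measure)) = (\<integral>z. ?f (F 1) z / I \<partial>lborel)"
      unfolding F by simp
    also have "\<dots> = 1" using I by (simp add: I_def)
    finally show "(\<integral>z. ?f (F (1 / I)) z \<partial>(lborel :: ((real^'n) \<times> real) measure)) = 1" .
  qed
qed

text \<open>A mollification at \<open>z\<close> is a weighted average over the \<epsilon>-ball
  around \<open>z\<close>, so it inherits any closeness to a constant that holds on that
  ball.\<close>

lemma conv_near:
  assumes w: "loc_int w" and \<eta>: "cc \<eta>" "\<And>z. \<eta> z \<ge> 0" "\<And>z. norm z \<ge> \<epsilon> \<Longrightarrow> \<eta> z = 0" "(\<integral>z. \<eta> z \<partial>lborel) = 1"
    and near: "\<And>y. dist y z < \<epsilon> \<Longrightarrow> \<bar>w y - c\<bar> \<le> \<kappa>"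
  shows "\<bar>conv w \<eta> z - c\<bar> \<le> \<kappa>"
proof -
  have i: "integrable lborel (\<lambda>y. \<eta> (z - y))"
    using loc_int_mult_cc[OF loc_int_continuous cc_shift[OF \<eta>(1)], of "\<lambda>_. 1"] by auto
  have one: "(\<integral>y. \<eta> (z - y) \<partial>lborel) = 1"
    using integral_lborel_reflect[OF cc_measurable[OF \<eta>(1)]] \<eta>(4) by simp
  have "conv w \<eta> z - c = (\<integral>y. w y * \<eta> (z - y) - c * \<eta> (z - y) \<partial>lborel)"
    unfolding conv_def
    by (subst Bochner_Integration.integral_diff[OF loc_int_mult_cc[OF w cc_shift[OF \<eta>(1)]] integrable_mult_right[OF i]])
       (simp add: one)
  moreover have "norm (\<integral>y. w y * \<eta> (z - y) - c * \<eta> (z - y) \<partial>lborel) \<le> (\<integral>y. \<kappa> * \<eta> (z - y) \<partial>lborel)"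
  proof (rule Bochner_Integration.integral_norm_bound_integral)
    show "integrable lborel (\<lambda>y. w y * \<eta> (z - y) - c * \<eta> (z - y))"
      by (intro Bochner_Integration.integrable_diff loc_int_mult_cc[OF w] integrable_mult_right[OF i] cc_shift \<eta>(1))
    show "norm (w y * \<eta> (z - y) - c * \<eta> (z - y)) \<le> \<kappa> * \<eta> (z - y)" for y
    proof (cases "norm (z - y) < \<epsilon>")
      case True
      then have "\<bar>w y - c\<bar> \<le> \<kappa>" by (intro near) (simp add: dist_norm norm_minus_commute)
      then show ?thesis using \<eta>(2)[of "z - y"]
        by (simp flip: left_diff_distrib add: abs_mult mult_right_mono)
    next
      case False then show ?thesis by (simp add: \<eta>(3))
    qed
  qed (use i in auto)
  ultimately show ?thesis by (simp add: one)
qed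

text \<open>The reflected mollifier is a legitimate test function as long as its support ends before
  \<open>T\<close>. The equation then holds pointwise for smooth functions, with the Dirac source
  smeared into \<open>c * \<eta> z\<close>.\<close>

lemma conv_weak_eq:
  assumes eq: "weak_eq T w g c" and w: "loc_int w" and j: "jet \<eta> \<eta>t \<eta>x \<eta>xx"
    and \<eta>: "\<And>z. norm z \<ge> \<epsilon> \<Longrightarrow> \<eta> z = 0" and z: "snd z + \<epsilon> < T"
  shows "conv w \<eta>t z - (\<Sum>i\<in>UNIV. conv w (\<eta>xx i i) z) = - conv g \<eta> z + c * \<eta> z"
proof -
  have "\<eta> (z - y) = 0" if "snd y > snd z + \<epsilon>" for y
  proof (rule \<eta>)
    have "\<epsilon> \<le> norm (snd (z - y))" using that by simp
    also have "\<dots> \<le> norm (z - y)" by (metis norm_snd_le prod.collapse)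
    finally show "\<epsilon> \<le> norm (z - y)" .
  qed
  then have "(\<integral>y. w y * (- (- \<eta>t (z - y)) - (\<Sum>i\<in>UNIV. \<eta>xx i i (z - y))) \<partial>lborel)
      = - (\<integral>y. g y * \<eta> (z - y) \<partial>lborel) + c * \<eta> (z - 0)"
    using eq[unfolded weak_eq_def, rule_format, OF jet_reflect[OF j] z] by simp
  moreover have "(\<integral>y. w y * (- (- \<eta>t (z - y)) - (\<Sum>i\<in>UNIV. \<eta>xx i i (z - y))) \<partial>lborel)
      = conv w \<eta>t z - (\<Sum>i\<in>UNIV. conv w (\<eta>xx i i) z)"
    unfolding conv_def right_diff_distrib sum_distrib_left
    using j w by (subst Bochner_Integration.integral_diff)
      (auto simp: jet_def intro!: Bochner_Integration.integral_sum loc_int_mult_cc cc_shift cc_sum Bochner_Integration.integrable_sum)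
  ultimately show ?thesis by (simp add: conv_def)
qed

section \<open>Weak solutions are viscosity solutions\<close>

lemma dir_deriv_on_add:
  "dir_deriv_on U e k k' \<Longrightarrow> dir_deriv_on U e l l' \<Longrightarrow> dir_deriv_on U e (\<lambda>z. k z + l z) (\<lambda>z. k' z + l' z)"
  unfolding dir_deriv_on_def by (auto intro: derivative_intros)

lemma dir_deriv_on_diff:
  "dir_deriv_on U e k k' \<Longrightarrow> dir_deriv_on U e l l' \<Longrightarrow> dir_deriv_on U e (\<lambda>z. k z - l z) (\<lambda>z. k' z - l' z)"
  unfolding dir_deriv_on_def by (auto intro: derivative_intros)

lemma dir_deriv_on_mono: "dir_deriv e k k' \<Longrightarrow> dir_deriv_on U e k k'"
  unfolding dir_deriv_on_def dir_deriv_def by auto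

lemma dir_deriv_onD:
  assumes "dir_deriv_on U e k k'" "z + s *\<^sub>R e \<in> U"
  shows "((\<lambda>s. k (z + s *\<^sub>R e)) has_real_derivative k' (z + s *\<^sub>R e)) (at s)"
proof -
  have "((\<lambda>r. k (z + s *\<^sub>R e + r *\<^sub>R e)) has_real_derivative k' (z + s *\<^sub>R e)) (at 0)"
    using assms by (auto simp: dir_deriv_on_def)
  then have "((\<lambda>r. k (z + (r + s) *\<^sub>R e)) has_real_derivative k' (z + s *\<^sub>R e)) (at 0)"
    by (simp add: algebra_simps)
  then show ?thesis
    using DERIV_shift[of "\<lambda>s. k (z + s *\<^sub>R e)" _ 0 s] by simp
qed

lemma second_derivative_local_max:
  fixes f f' :: "real \<Rightarrow> real"
  assumes d: "d > 0" and f: "\<And>s. \<bar>s\<bar> < d \<Longrightarrow> (f has_real_derivative f' s) (at s)"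
    and f': "(f' has_real_derivative D) (at 0)" and max: "\<And>s. \<bar>s\<bar> < d \<Longrightarrow> f s \<le> f 0"
  shows "D \<le> 0"
proof (rule ccontr)
  assume "\<not> D \<le> 0"
  then have D: "D > 0" by simp
  have f0: "f' 0 = 0"
    by (rule DERIV_local_max[OF f d]) (use d max in auto)
  obtain e where e: "e > 0" "\<And>h. h > 0 \<Longrightarrow> h < e \<Longrightarrow> f' 0 < f' (0 + h)"
    using DERIV_pos_inc_right[OF f' D] by auto
  define s where "s = min d e / 2"
  have s: "s > 0" "s < d" "s < e" using d e by (auto simp: s_def)
  obtain y where y: "y > 0" "y < s" "f s - f 0 = (s - 0) * f' y"
    using MVT2[of 0 s f f'] f s by force
  then have "f' y > 0" using e(2)[of y] f0 s by auto
  then have "f s > f 0" using y s by (smt (verit) mult_pos_pos)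
  then show False using max[of s] s by auto
qed

lemma line_in_open:
  assumes "open U" "(z::'a::euclidean_space) \<in> U"
  obtains d where "d > 0" "\<And>s. \<bar>s\<bar> < d \<Longrightarrow> z + s *\<^sub>R e \<in> U"
proof -
  obtain r where r: "r > 0" "ball z r \<subseteq> U" using assms openE by blast
  show ?thesis
  proof (rule that[of "r / (norm e + 1)"])
    show "r / (norm e + 1) > 0" using r by (simp add: add_nonneg_pos)
    fix s assume s: "\<bar>s\<bar> < r / (norm e + 1)"
    then have "\<bar>s\<bar> * (norm e + 1) < r" by (simp add: less_divide_eq add_nonneg_pos)
    then have "\<bar>s\<bar> * norm e < r" by (simp add: distrib_left)
    then show "z + s *\<^sub>R e \<in> U" using r by (auto simp: dist_norm)
  qed
qed

lemma dir_deriv_local_max: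
  fixes z :: "'a::euclidean_space"
  assumes "open U" "z \<in> U" "dir_deriv_on U e f f'" "\<And>y. y \<in> U \<Longrightarrow> f y \<le> f z"
  shows "f' z = 0"
proof -
  obtain d where d: "d > 0" "\<And>s. \<bar>s\<bar> < d \<Longrightarrow> z + s *\<^sub>R e \<in> U" using line_in_open[OF assms(1,2)] by blast
  have "((\<lambda>s. f (z + s *\<^sub>R e)) has_real_derivative f' z) (at 0)"
    using assms by (auto simp: dir_deriv_on_def)
  then show ?thesis
    by (rule DERIV_local_max[OF _ d(1)]) (use d assms(4) in auto)
qed

lemma dir_deriv2_local_max:
  fixes z :: "'a::euclidean_space"
  assumes "open U" "z \<in> U" "dir_deriv_on U e f f'" "dir_deriv_on U e f' f''" "\<And>y. y \<in> U \<Longrightarrow> f y \<le> f z"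
  shows "f'' z \<le> 0"
proof -
  obtain d where d: "d > 0" "\<And>s. \<bar>s\<bar> < d \<Longrightarrow> z + s *\<^sub>R e \<in> U" using line_in_open[OF assms(1,2)] by blast
  show ?thesis
  proof (rule second_derivative_local_max[OF d(1)])
    show "((\<lambda>s. f (z + s *\<^sub>R e)) has_real_derivative f' (z + s *\<^sub>R e)) (at s)" if "\<bar>s\<bar> < d" for s
      by (rule dir_deriv_onD[OF assms(3) d(2)[OF that]])
    show "((\<lambda>s. f' (z + s *\<^sub>R e)) has_real_derivative f'' z) (at 0)"
      using assms by (auto simp: dir_deriv_on_def)
    show "f (z + s *\<^sub>R e) \<le> f (z + 0 *\<^sub>R e)" if "\<bar>s\<bar> < d" for s
      using assms(5) d(2)[OF that] by simp
  qed
qed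

text \<open>A continuous distributional subsolution is a viscosity subsolution: the mollified function
  touches the perturbed test function from below at a nearby point, where the classical maximum
  principle applies.\<close>

lemma weak_eq_touch:
  fixes w g \<psi> :: "(real^'n) \<times> real \<Rightarrow> real"
  assumes eq: "weak_eq T w g c" and w: "loc_int w" and g: "loc_int g"
    and U: "open U" "z0 \<in> U" "U \<subseteq> QT T" and cont: "continuous_on U w" "continuous_on U g" "continuous_on U \<psi>"
    and t: "dir_deriv_on U (0, 1) \<psi> \<psi>t"
    and x: "\<And>i. dir_deriv_on U (axis i 1, 0) \<psi> (\<psi>x i)"
    and xx: "\<And>i. dir_deriv_on U (axis i 1, 0) (\<psi>x i) (\<psi>xx i)"
    and cont': "continuous_on U \<psi>t" "\<And>i. continuous_on U (\<psi>xx i)"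
    and max: "\<And>z. z \<in> U \<Longrightarrow> w z - \<psi> z \<le> w z0 - \<psi> z0"
  shows "\<psi>t z0 - (\<Sum>i\<in>UNIV. \<psi>xx i z0) \<le> - g z0"
proof (rule ccontr)
  assume neg: "\<not> \<psi>t z0 - (\<Sum>i\<in>UNIV. \<psi>xx i z0) \<le> - g z0"
  \<comment> \<open>A third of the gap: one part is lost when the heat operator of the test function
    moves away from \<open>z0\<close>, one when \<open>g\<close> is mollified, and the last remains
    as the contradiction.\<close>
  define \<kappa> where "\<kappa> = (\<psi>t z0 - (\<Sum>i\<in>UNIV. \<psi>xx i z0) + g z0) / 3"
  have \<kappa>: "\<kappa> > 0" using neg by (simp add: \<kappa>_def)
  define x0 t0 where "x0 = fst z0" and "t0 = snd z0"
  let ?P = "\<lambda>z. (norm (fst z - x0))\<^sup>2"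
  \<comment> \<open>Quartic in space and quadratic in time, \<theta> makes the maximum strict while
    its contribution to the heat operator vanishes at \<open>z0\<close>.\<close>
  define \<theta> where "\<theta> z = (?P z)\<^sup>2 + (snd z - t0)\<^sup>2" for z
  define \<theta>t where "\<theta>t z = 2 * (snd z - t0)" for z :: "(real^'n) \<times> real"
  define \<theta>x where "\<theta>x i z = 2 * (fst z - x0) $ i * (2 * ?P z)" for i and z :: "(real^'n) \<times> real"
  define \<theta>xx where "\<theta>xx i z = 4 * (fst z - x0) $ i * (fst z - x0) $ i * 2 + (if i = i then 2 * (2 * ?P z) else 0)"
    for i and z :: "(real^'n) \<times> real"
  have \<theta>0: "\<theta> z0 = 0" "\<theta>t z0 = 0" "\<theta>xx i z0 = 0" for i
    by (auto simp: \<theta>_def \<theta>t_def \<theta>xx_def x0_def t0_def)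
  have \<theta>t: "dir_deriv (0, 1) \<theta> \<theta>t"
    unfolding \<theta>_def[abs_def] \<theta>t_def[abs_def]
    by (rule radial_dir_deriv_t[where F="\<lambda>p s. p\<^sup>2 + (s - t0)\<^sup>2" and F'="\<lambda>p s. 2 * (s - t0)"])
       (auto intro!: derivative_eq_intros)
  have \<theta>x: "dir_deriv (axis i 1, 0) \<theta> (\<theta>x i)" for i
    unfolding \<theta>_def[abs_def] \<theta>x_def[abs_def]
    by (rule radial_dir_deriv_x[where F="\<lambda>p s. p\<^sup>2 + (s - t0)\<^sup>2" and F'="\<lambda>p s. 2 * p"])
       (auto intro!: derivative_eq_intros)
  have \<theta>xx: "dir_deriv (axis i 1, 0) (\<theta>x i) (\<theta>xx i)" for i
    unfolding \<theta>x_def[abs_def] \<theta>xx_def[abs_def]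
    by (rule radial_dir_deriv_xx[where F'="\<lambda>p s. 2 * p" and F''="\<lambda>p s. 2"])
       (auto intro!: derivative_eq_intros)
  have cont\<theta>: "continuous_on A \<theta>" "continuous_on A \<theta>t" "continuous_on A (\<theta>xx i)" for A i
    unfolding \<theta>_def[abs_def] \<theta>t_def[abs_def] \<theta>xx_def[abs_def] by (auto intro!: continuous_intros)
  define G where "G z = (\<psi>t z + \<theta>t z) - (\<Sum>i\<in>UNIV. \<psi>xx i z + \<theta>xx i z)" for z
  have contG: "continuous_on U G" unfolding G_def[abs_def]
    by (intro continuous_intros cont' cont\<theta>)
  have "3 * \<kappa> = \<psi>t z0 - (\<Sum>i\<in>UNIV. \<psi>xx i z0) + g z0" by (simp add: \<kappa>_def)
  then have G0: "G z0 = - g z0 + 3 * \<kappa>" unfolding G_def \<theta>0 by simp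
  have "open {z\<in>U. G z > - g z0 + 2 * \<kappa> \<and> \<bar>g z - g z0\<bar> < \<kappa>}"
  proof -
    have "open (U \<inter> (\<lambda>z. G z) -` {- g z0 + 2 * \<kappa><..})" "open (U \<inter> (\<lambda>z. \<bar>g z - g z0\<bar>) -` {..<\<kappa>})"
      using U contG cont(2) by (auto intro!: continuous_open_preimage continuous_intros)
    then have "open ((U \<inter> (\<lambda>z. G z) -` {- g z0 + 2 * \<kappa><..}) \<inter> (U \<inter> (\<lambda>z. \<bar>g z - g z0\<bar>) -` {..<\<kappa>}))"
      by (rule open_Int)
    then show ?thesis by (rule back_subst[where P="open"]) auto
  qed
  from open_contains_cball_eq[OF this, rule_format, of z0] obtain m' where m': "m' > 0" "cball z0 m' \<subseteq> {z\<in>U. G z > - g z0 + 2 * \<kappa> \<and> \<bar>g z - g z0\<bar> < \<kappa>}"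
    using U(2) G0 \<kappa> by force
  define m where "m = m' / 2"
  have m: "m > 0" "m' = 2 * m" using m' by (auto simp: m_def)
  \<comment> \<open>A lower bound for \<theta> at distance at least \<open>m\<close>: there one of
    the squared space and time distances is at least m^2 / 2.\<close>
  define \<mu> where "\<mu> = min ((m\<^sup>2 / 2)\<^sup>2) (m\<^sup>2 / 2)"
  have \<mu>: "\<mu> > 0" using m by (simp add: \<mu>_def)
  have \<theta>\<mu>: "\<theta> z \<ge> \<mu>" if "dist z z0 \<ge> m" for z
  proof -
    have "m\<^sup>2 \<le> (dist z z0)\<^sup>2" using that m by (intro power_mono) auto
    also have "\<dots> = ?P z + (snd z - t0)\<^sup>2"
      by (cases z, cases z0) (simp add: dist_norm norm_Pair_sq x0_def t0_def)
    finally have "?P z \<ge> m\<^sup>2 / 2 \<or> (snd z - t0)\<^sup>2 \<ge> m\<^sup>2 / 2" by linarith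
    then show ?thesis
    proof
      assume "?P z \<ge> m\<^sup>2 / 2"
      then have "(?P z)\<^sup>2 \<ge> (m\<^sup>2 / 2)\<^sup>2" by (intro power_mono) auto
      then show ?thesis unfolding \<theta>_def \<mu>_def by (smt (verit) zero_le_power2)
    qed (auto simp: \<theta>_def \<mu>_def intro!: min.coboundedI2 add_increasing)
  qed
  have sub: "cball z0 m' \<subseteq> U" using m' by auto
  have "uniformly_continuous_on (cball z0 m') w"
    by (intro compact_uniformly_continuous continuous_on_subset[OF cont(1) sub]) auto
  then obtain \<delta> where \<delta>: "\<delta> > 0" "\<And>y z. y \<in> cball z0 m' \<Longrightarrow> z \<in> cball z0 m' \<Longrightarrow> dist y z < \<delta> \<Longrightarrow> \<bar>w y - w z\<bar> < \<mu> / 3"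
    unfolding uniformly_continuous_on_def using \<mu>
    by (metis dist_real_def zero_less_divide_iff zero_less_numeral dist_commute)
  define \<epsilon> where "\<epsilon> = min \<delta> m / 2"
  have \<epsilon>: "\<epsilon> > 0" "\<epsilon> < \<delta>" "\<epsilon> < m" using \<delta> m by (auto simp: \<epsilon>_def)
  have near: "y \<in> cball z0 m'" if "dist z z0 \<le> m" "dist y z \<le> \<epsilon>" for y z
    using dist_triangle[of y z0 z] that \<epsilon> m by (auto simp: dist_commute)
  have T: "snd z + \<epsilon> < T" "snd z > \<epsilon>" if "dist z z0 \<le> m" for z
  proof -
    have "z + (0, \<epsilon>) \<in> QT T" "z - (0, \<epsilon>) \<in> QT T"
      using near[OF that, of "z + (0, \<epsilon>)"] near[OF that, of "z - (0, \<epsilon>)"] sub U \<epsilon> by (auto simp: dist_norm norm_Pair)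
    then show "snd z + \<epsilon> < T" "snd z > \<epsilon>" by (auto simp: QT_def mem_Times_iff)
  qed
  obtain \<eta> \<eta>t \<eta>x \<eta>xx where j: "jet (\<eta> :: (real^'n) \<times> real \<Rightarrow> real) \<eta>t \<eta>x \<eta>xx"
    and \<eta>: "\<And>z. \<eta> z \<ge> 0" "\<And>z. norm z \<ge> \<epsilon> \<Longrightarrow> \<eta> z = 0" "(\<integral>z. \<eta> z \<partial>lborel) = 1"
    using exists_mollifier[OF \<epsilon>(1)] by metis
  have cc: "cc \<eta>" "cc \<eta>t" "\<And>i. cc (\<eta>x i)" "\<And>i j. cc (\<eta>xx i j)" using j by (auto simp: jet_def)
  have F1: "\<bar>conv w \<eta> z - w z\<bar> \<le> \<mu> / 3" if "dist z z0 \<le> m" for z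
  proof (rule conv_near[OF w cc(1) \<eta>])
    fix y assume "dist y z < \<epsilon>"
    then show "\<bar>w y - w z\<bar> \<le> \<mu> / 3"
      using near[OF that, of y] near[OF that, of z] \<epsilon> by (intro less_imp_le \<delta>(2)) auto
  qed
  define H where "H z = conv w \<eta> z - (\<psi> z + \<theta> z)" for z
  have subm: "cball z0 m \<subseteq> U" using sub m by (auto simp: subset_iff)
  have "continuous_on (cball z0 m) H" unfolding H_def[abs_def]
    by (intro continuous_intros cont\<theta> continuous_on_subset[OF cont(3) subm])
       (auto intro!: continuous_at_imp_continuous_on conv_continuous w cc)
  then obtain z1 where z1: "z1 \<in> cball z0 m" "\<And>z. z \<in> cball z0 m \<Longrightarrow> H z \<le> H z1"
    using continuous_attains_sup[of "cball z0 m" H] m by auto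
  \<comment> \<open>On the boundary of the ball the penalty \<mu> outweighs the two mollification
    errors of \<mu>/3, at \<open>z1\<close> and at \<open>z0\<close>, so the maximum is
    interior.\<close>
  have z1b: "z1 \<in> ball z0 m"
  proof (rule ccontr)
    assume "z1 \<notin> ball z0 m"
    then have "\<theta> z1 \<ge> \<mu>" by (intro \<theta>\<mu>) (auto simp: dist_commute)
    moreover have "w z1 - \<psi> z1 \<le> w z0 - \<psi> z0" using z1 subm by (intro max) auto
    moreover have "\<bar>conv w \<eta> z1 - w z1\<bar> \<le> \<mu> / 3" "\<bar>conv w \<eta> z0 - w z0\<bar> \<le> \<mu> / 3"
      using F1[of z1] F1[of z0] z1 m by (simp_all add: dist_commute)
    moreover have "H z0 \<le> H z1" using z1 m by auto
    ultimately show False using \<mu> unfolding H_def \<theta>0 by linarith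
  qed
  let ?B = "ball z0 m"
  have BU: "?B \<subseteq> U" using subm by auto
  have restr: "dir_deriv_on ?B e k k'" if "dir_deriv_on U e k k'" for e k k'
    using that BU by (auto simp: dir_deriv_on_def)
  have max1: "\<And>y. y \<in> ?B \<Longrightarrow> H y \<le> H z1" using z1 by auto
  have dw: "dir_deriv (0,1) (conv w \<eta>) (conv w \<eta>t)" "dir_deriv (axis i 1,0) (conv w \<eta>) (conv w (\<eta>x i))"
    "dir_deriv (axis i 1,0) (conv w (\<eta>x i)) (conv w (\<eta>xx i i))" for i
    using j by (auto simp: jet_def intro!: conv_dir_deriv w cc)
  have "conv w \<eta>t z1 - (\<psi>t z1 + \<theta>t z1) = 0"
    by (rule dir_deriv_local_max[OF open_ball z1b, where e="(0,1)" and f=H, OF _ max1])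
       (unfold H_def[abs_def], intro dir_deriv_on_diff dir_deriv_on_add restr[OF t]
          dir_deriv_on_mono[OF dw(1)] dir_deriv_on_mono[OF \<theta>t])
  moreover have "conv w (\<eta>xx i i) z1 - (\<psi>xx i z1 + \<theta>xx i z1) \<le> 0" for i
    by (rule dir_deriv2_local_max[OF open_ball z1b, where e="(axis i 1,0)" and f=H
          and f'="\<lambda>z. conv w (\<eta>x i) z - (\<psi>x i z + \<theta>x i z)", OF _ _ max1])
       (unfold H_def[abs_def], (intro dir_deriv_on_diff dir_deriv_on_add restr[OF x] restr[OF xx]
          dir_deriv_on_mono[OF dw(2)] dir_deriv_on_mono[OF dw(3)] dir_deriv_on_mono[OF \<theta>x] dir_deriv_on_mono[OF \<theta>xx])+)
  then have "(\<Sum>i\<in>UNIV. conv w (\<eta>xx i i) z1) \<le> (\<Sum>i\<in>UNIV. \<psi>xx i z1 + \<theta>xx i z1)"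
    by (intro sum_mono) simp
  ultimately have "conv w \<eta>t z1 - (\<Sum>i\<in>UNIV. conv w (\<eta>xx i i) z1) \<ge> G z1"
    unfolding G_def by simp
  moreover have "z1 \<in> cball z0 m'" using z1 m by auto
  then have "G z1 > - g z0 + 2 * \<kappa>" using subsetD[OF m'(2)] by auto
  moreover have z1m: "dist z1 z0 \<le> m" using z1 by (simp add: dist_commute)
  moreover have "conv w \<eta>t z1 - (\<Sum>i\<in>UNIV. conv w (\<eta>xx i i) z1) = - conv g \<eta> z1 + c * \<eta> z1"
    by (rule conv_weak_eq[OF eq w j \<eta>(2) T(1)[OF z1m]])
  \<comment> \<open>All times in the ball exceed \<epsilon>, so the mollifier centred at
    \<open>z1\<close> does not see the source at the origin.\<close>
  moreover have "\<eta> z1 = 0"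
  proof (rule \<eta>(2))
    have "\<epsilon> \<le> norm (snd z1)" using T(2)[OF z1m] by simp
    also have "\<dots> \<le> norm z1" by (metis norm_snd_le prod.collapse)
    finally show "\<epsilon> \<le> norm z1" .
  qed
  moreover have "\<bar>conv g \<eta> z1 - g z0\<bar> \<le> \<kappa>"
  proof (rule conv_near[OF g cc(1) \<eta>])
    fix y assume "dist y z1 < \<epsilon>"
    then have "y \<in> cball z0 m'" using near[OF z1m, of y] by auto
    from subsetD[OF m'(2) this] show "\<bar>g y - g z0\<bar> \<le> \<kappa>" by auto
  qed
  ultimately show False using \<kappa> by simp
qed

section \<open>The mean value inequality for subcaloric functions\<close>

text \<open>A polynomial C^2 switch from 1 on \<open>v \<le> 0\<close> to 0 on
  \<open>v \<ge> 1\<close>. The inner cube flattens it at 0 and the outer cube at 1.\<close>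

definition cut :: "real \<Rightarrow> real" where
  "cut v = (max 0 (1 - (max 0 v) ^ 3)) ^ 3"

definition cut' :: "real \<Rightarrow> real" where
  "cut' v = - 9 * (max 0 (1 - (max 0 v) ^ 3))\<^sup>2 * (max 0 v)\<^sup>2"

definition cut'' :: "real \<Rightarrow> real" where
  "cut'' v = 54 * max 0 (1 - (max 0 v) ^ 3) * (max 0 v) ^ 4
     - 18 * (max 0 (1 - (max 0 v) ^ 3))\<^sup>2 * max 0 v"

lemma DERIV_max_0_cube: "((\<lambda>v::real. (max 0 v) ^ 3) has_real_derivative 3 * (max 0 v)\<^sup>2) (at v)"
  using DERIV_max_0_power[of 1 v] by (simp add: numeral_eq_Suc)

lemma DERIV_max_0_square: "((\<lambda>v::real. (max 0 v)\<^sup>2) has_real_derivative 2 * (max 0 v)) (at v)"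
  using DERIV_max_0_power[of 0 v] by (simp add: numeral_eq_Suc)

lemma DERIV_cut: "(cut has_real_derivative cut' v) (at v)"
  unfolding cut_def[abs_def] cut'_def
  by (rule DERIV_cong, rule DERIV_chain2[OF DERIV_max_0_cube], rule DERIV_diff[OF DERIV_const DERIV_max_0_cube])
     simp

lemma DERIV_cut': "(cut' has_real_derivative cut'' v) (at v)"
proof -
  have 1: "((\<lambda>v. (max 0 (1 - (max 0 v) ^ 3))\<^sup>2) has_real_derivative
      2 * max 0 (1 - (max 0 v) ^ 3) * (- (3 * (max 0 v)\<^sup>2))) (at v)"
    by (rule DERIV_chain2[OF DERIV_max_0_square], rule DERIV_cong, rule DERIV_diff[OF DERIV_const DERIV_max_0_cube])
       simp
  have "((\<lambda>v. - 9 * (max 0 (1 - (max 0 v) ^ 3))\<^sup>2 * (max 0 v)\<^sup>2) has_real_derivative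
     (- 9 * (2 * max 0 (1 - (max 0 v) ^ 3) * (- (3 * (max 0 v)\<^sup>2)))) * (max 0 v)\<^sup>2
       + 2 * (max 0 v) * (- 9 * (max 0 (1 - (max 0 v) ^ 3))\<^sup>2)) (at v)"
    by (rule DERIV_mult[OF DERIV_cmult[OF 1] DERIV_max_0_square])
  then show ?thesis
    unfolding cut'_def[abs_def] cut''_def
    by (rule DERIV_cong) (simp add: algebra_simps power2_eq_square power4_eq_xxxx)
qed

lemma continuous_on_cut [continuous_intros]:
  "continuous_on A f \<Longrightarrow> continuous_on A (\<lambda>x. cut (f x))"
  "continuous_on A f \<Longrightarrow> continuous_on A (\<lambda>x. cut' (f x))"
  "continuous_on A f \<Longrightarrow> continuous_on A (\<lambda>x. cut'' (f x))"
  unfolding cut_def cut'_def cut''_def by (auto intro!: continuous_intros)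

lemma cut_le_0: "v \<le> 0 \<Longrightarrow> cut v = 1" "v \<le> 0 \<Longrightarrow> cut' v = 0" "v \<le> 0 \<Longrightarrow> cut'' v = 0"
  by (simp_all add: cut_def cut'_def cut''_def)

lemma cut_ge_1: "v \<ge> 1 \<Longrightarrow> cut v = 0" "v \<ge> 1 \<Longrightarrow> cut' v = 0" "v \<ge> 1 \<Longrightarrow> cut'' v = 0"
  by (simp_all add: cut_def cut'_def cut''_def)

lemma cut_bounds: "0 \<le> cut v" "cut v \<le> 1" "cut' v \<le> 0" "\<bar>cut' v\<bar> \<le> 9" "\<bar>cut'' v\<bar> \<le> 72"
proof -
  have *: "0 \<le> max 0 v ^ k \<and> max 0 v ^ k \<le> 1" if "v < 1" for k
    using that by (auto intro!: power_le_one)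
  define a b where "a = max 0 (1 - (max 0 v) ^ 3)" and "b = max 0 v"
  show "0 \<le> cut v" "cut v \<le> 1" "cut' v \<le> 0"
    by (auto simp: cut_def cut'_def intro!: power_le_one)
  have c: "cut' v = - 9 * (a\<^sup>2 * b\<^sup>2)" "cut'' v = 54 * (a * b ^ 4) - 18 * (a\<^sup>2 * b)"
    by (simp_all add: cut'_def cut''_def a_def b_def)
  show "\<bar>cut' v\<bar> \<le> 9" "\<bar>cut'' v\<bar> \<le> 72"
  proof (atomize(full), cases "v < 1")
    case True
    have a: "0 \<le> a" "a \<le> 1" and b: "0 \<le> b" "b \<le> 1" using True by (auto simp: a_def b_def)
    then have "0 \<le> a\<^sup>2 * b\<^sup>2" "a\<^sup>2 * b\<^sup>2 \<le> 1" "0 \<le> a * b ^ 4" "a * b ^ 4 \<le> 1" "0 \<le> a\<^sup>2 * b" "a\<^sup>2 * b \<le> 1"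
      by (auto intro!: mult_le_one power_le_one)
    then show "\<bar>cut' v\<bar> \<le> 9 \<and> \<bar>cut'' v\<bar> \<le> 72" unfolding c by (simp only: abs_le_iff) linarith
  qed (simp add: cut_ge_1)
qed

text \<open>The time derivative of the switch is the weight that averages the function near the pole
  in the mean value inequality; this keeps that weight away from zero on the middle half.\<close>

lemma cut'_middle: "1 / 4 \<le> v \<Longrightarrow> v \<le> 3 / 4 \<Longrightarrow> cut' v \<le> - 1 / 10"
proof -
  assume v: "1 / 4 \<le> v" "v \<le> 3 / 4"
  have "v ^ 3 \<le> (3 / 4) ^ 3" using v by (intro power_mono) auto
  then have "37 / 64 \<le> 1 - v ^ 3" by (simp add: power3_eq_cube)
  also have "\<dots> \<le> max 0 (1 - (max 0 v) ^ 3)" using v by (simp add: max_def)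
  finally have "37 / 64 \<le> max 0 (1 - (max 0 v) ^ 3)" .
  then have 1: "(37 / 64)\<^sup>2 \<le> (max 0 (1 - (max 0 v) ^ 3))\<^sup>2" by (rule power_mono) simp
  have 2: "(1 / 4)\<^sup>2 \<le> (max 0 v)\<^sup>2" using v by (intro power_mono) auto
  have "(37 / 64)\<^sup>2 * (1 / 4)\<^sup>2 \<le> (max 0 (1 - (max 0 v) ^ 3))\<^sup>2 * (max 0 v)\<^sup>2"
    by (rule mult_mono[OF 1 2]) simp_all
  then show ?thesis by (simp add: cut'_def power2_eq_square)
qed

text \<open>The right-hand side is the maximum of \<tau>^(-b) exp (-a/\<tau>), attained at \<tau> =
  a/b; it follows from ln y \<le> y - 1 with y = a/(\<tau> b). Away from its pole the heat kernel is
  thus bounded uniformly in time.\<close>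

lemma exp_ln_bound:
  fixes a b \<tau> :: real
  assumes "a > 0" "b > 0" "\<tau> > 0"
  shows "exp (- b * ln \<tau> - a / \<tau>) \<le> exp (b * (ln (b / a) - 1))"
proof -
  have "ln (a / (\<tau> * b)) \<le> a / (\<tau> * b) - 1" using assms by (intro ln_le_minus_one) auto
  moreover have "ln (a / (\<tau> * b)) = - ln \<tau> - ln (b / a)"
    using assms by (simp add: ln_div ln_mult)
  ultimately have "- ln \<tau> \<le> a / (\<tau> * b) + (ln (b / a) - 1)" by linarith
  then have "b * (- ln \<tau>) \<le> b * (a / (\<tau> * b) + (ln (b / a) - 1))" using assms by (intro mult_left_mono) auto
  also have "\<dots> = a / \<tau> + b * (ln (b / a) - 1)" using assms by (simp add: distrib_left)
  finally show ?thesis by simp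
qed

text \<open>The heat kernel has its pole at time \<open>t0 + \<delta>\<close>, but the test function
  is already 0 after \<open>t0\<close>, so two overlapping open half-spaces cover
  everything.\<close>

lemma continuous_on_halves:
  fixes F :: "real \<Rightarrow> real \<Rightarrow> real"
  assumes "\<delta> > 0" "continuous_on {z. snd z < t0 + \<delta>} (\<lambda>(p, s). F p s)" "\<And>p s. s > t0 \<Longrightarrow> F p s = 0"
  shows "continuous_on UNIV (\<lambda>(p, s). F p s)"
proof -
  have "continuous_on {z. snd z > t0} (\<lambda>(p, s). F p s)"
    by (rule continuous_on_eq[of _ "\<lambda>_. 0"]) (auto simp: assms(3))
  then have "continuous_on ({z. snd z < t0 + \<delta>} \<union> {z. snd z > t0}) (\<lambda>(p, s). F p s)"
    using assms by (intro continuous_on_open_Un open_Collect_less continuous_intros)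
  moreover have "{z. snd z < t0 + \<delta>} \<union> {z. snd z > t0} = (UNIV :: (real \<times> real) set)" using assms(1) by auto
  ultimately show ?thesis by simp
qed

text \<open>Subsolutions of the heat equation in the sense of distributions. \<open>Q\<close> may
  reach below time 0, and it may or may not contain the origin; this decides whether the Dirac
  source is felt.\<close>

definition subcal :: "((real^'n) \<times> real \<Rightarrow> real) \<Rightarrow> ((real^'n) \<times> real) set \<Rightarrow> bool" where
  "subcal W Q \<longleftrightarrow> (\<forall>\<phi> \<phi>t \<phi>x \<phi>xx. jet \<phi> \<phi>t \<phi>x \<phi>xx \<longrightarrow> (\<forall>z. \<phi> z \<ge> 0) \<longrightarrow> (\<forall>z. z \<notin> Q \<longrightarrow> \<phi> z = 0) \<longrightarrow>
     (\<integral>y. W y * (- \<phi>t y - (\<Sum>i\<in>UNIV. \<phi>xx i i y)) \<partial>lborel) \<le> 0)"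

text \<open>The test function is a truncated backward heat kernel with pole slightly after \<open>t0\<close>, switched
  off in time just before \<open>t0\<close>. The switching produces the (positive) average of \<open>W\<close> near the point;
  all other terms live where the cut-offs vary, away from the pole.\<close>

lemma subcaloric_mean_value:
  fixes r :: real
  assumes r: "r > 0"
  obtains C where "C \<ge> 0"
    "\<And>(W :: (real^'n) \<times> real \<Rightarrow> real) x0 t0.
      loc_int W \<Longrightarrow> \<forall>z. W z \<ge> 0 \<Longrightarrow> isCont W (x0, t0) \<Longrightarrow>
      subcal W (cball x0 (2 * r) \<times> {t0 - 2 * r\<^sup>2..t0}) \<Longrightarrow>
      W (x0, t0) \<le> C * (\<integral>y. W y * indicator (cball x0 (2 * r) \<times> {t0 - 2 * r\<^sup>2..t0}) y \<partial>lborel)"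
proof -
  define N where "N = real CARD('n)"
  have N: "N > 0" by (simp add: N_def)
  \<comment> \<open>\<open>D0\<close> and \<open>D1\<close> bound the kernel \<open>E\<close> and
    \<open>E / \<tau>\<close> where the squared distance exceeds r^2: they are the values from
    \<open>exp_ln_bound\<close> for a = r^2/4 and the exponents N/2 and N/2 + 1.\<close>
  define D0 where "D0 = exp (N / 2 * (ln (N / 2 / (r\<^sup>2 / 4)) - 1))"
  define D1 where "D1 = exp ((N / 2 + 1) * (ln ((N / 2 + 1) / (r\<^sup>2 / 4)) - 1))"
  define C2 where "C2 = 9 / r\<^sup>2 * exp (- (N / 2) * ln (r\<^sup>2))
      + (16 * r\<^sup>2 * (72 / (3 * r\<^sup>2)\<^sup>2) * D0 + 8 * r\<^sup>2 * (9 / (3 * r\<^sup>2)) * D1 + 2 * N * (9 / (3 * r\<^sup>2)) * D0)"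
  \<comment> \<open>A lower bound for the mass that the switched-off kernel puts on the small
    cylinder \<open>S\<close>. It is free of \<delta>, which is what lets \<delta> tend to
    0.\<close>
  define c0 where "c0 = 1 / 20 * unit_ball_vol N * exp (- (N / 2) * ln 2 - 1 / 4)"
  have c0: "c0 > 0" using N by (simp add: c0_def)
  have C2: "C2 \<ge> 0" using N r by (simp add: C2_def D0_def D1_def)
  show ?thesis
  proof (rule that[of "C2 / c0"])
    show "C2 / c0 \<ge> 0" using C2 c0 by simp
    fix W :: "(real^'n) \<times> real \<Rightarrow> real" and x0 :: "real^'n" and t0 :: real
    assume W: "loc_int W" and W0': "\<forall>z. W z \<ge> 0" and Wc: "isCont W (x0, t0)"
      and sb: "subcal W (cball x0 (2 * r) \<times> {t0 - 2 * r\<^sup>2..t0})"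
    have W0: "\<And>z. W z \<ge> 0" using W0' by blast
    have sub: "\<And>\<phi> \<phi>t \<phi>x \<phi>xx. jet \<phi> \<phi>t \<phi>x \<phi>xx \<Longrightarrow> (\<And>z. \<phi> z \<ge> 0) \<Longrightarrow>
         (\<And>z. z \<notin> cball x0 (2 * r) \<times> {t0 - 2 * r\<^sup>2..t0} \<Longrightarrow> \<phi> z = 0) \<Longrightarrow>
         (\<integral>y. W y * (- \<phi>t y - (\<Sum>i\<in>UNIV. \<phi>xx i i y)) \<partial>lborel) \<le> 0"
      using sb unfolding subcal_def by blast
    define Q where "Q = cball x0 (2 * r) \<times> {t0 - 2 * r\<^sup>2..t0}"
    define I where "I = (\<integral>y. W y * indicator Q y \<partial>lborel)"
    \<comment> \<open>\<open>m\<close> stands for the infimum of \<open>W\<close> on a small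
      cylinder just below the point. Since both constants are independent of \<delta>, continuity of
      \<open>W\<close> turns \<open>m\<close> into its value at the point.\<close>
    have key: "m * c0 \<le> C2 * I"
      if \<delta>: "\<delta> > 0" "\<delta> \<le> r\<^sup>2" and m: "m \<ge> 0" "\<And>z. z \<in> cball x0 (sqrt \<delta>) \<times> {t0 - 3/4 * \<delta>..t0 - 1/4 * \<delta>} \<Longrightarrow> m \<le> W z"
      for m \<delta>
    proof -
      define S where "S = cball x0 (sqrt \<delta>) \<times> {t0 - 3/4 * \<delta>..t0 - 1/4 * \<delta>}"
      \<comment> \<open>\<open>X\<close> switches off in time over the last \<delta> before
        \<open>t0\<close>, \<open>Th\<close> switches on between t0 - 2r^2 and t0 - r^2, and
        \<open>Z\<close> cuts off the squared distance between r^2 and 4r^2. The pole at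
        \<open>t0 + \<delta>\<close> stays at time distance at least \<delta> from the
        support.\<close>
      define X where "X s = cut ((s - (t0 - \<delta>)) / \<delta>)" for s
      define X' where "X' s = cut' ((s - (t0 - \<delta>)) / \<delta>) / \<delta>" for s
      define Th where "Th s = cut ((t0 - r\<^sup>2 - s) / r\<^sup>2)" for s
      define Th' where "Th' s = - cut' ((t0 - r\<^sup>2 - s) / r\<^sup>2) / r\<^sup>2" for s
      define Z where "Z p = cut ((p - r\<^sup>2) / (3 * r\<^sup>2))" for p
      define Z' where "Z' p = cut' ((p - r\<^sup>2) / (3 * r\<^sup>2)) / (3 * r\<^sup>2)" for p
      define Z'' where "Z'' p = cut'' ((p - r\<^sup>2) / (3 * r\<^sup>2)) / (3 * r\<^sup>2)\<^sup>2" for p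
      define \<tau> where "\<tau> s = t0 + \<delta> - s" for s
      \<comment> \<open>The backward heat kernel without its factor of 4 pi; the power of \<tau> is
        kept in the exponent to match \<open>exp_ln_bound\<close>.\<close>
      define E where "E p s = exp (- (N / 2) * ln (\<tau> s) - p / (4 * \<tau> s))" for p s
      define Es where "Es p s = E p s * (N / (2 * \<tau> s) - p / (4 * (\<tau> s)\<^sup>2))" for p s
      define F where "F p s = X s * Th s * (Z p * E p s)" for p s
      define Fs where "Fs p s = (X' s * Th s + X s * Th' s) * (Z p * E p s) + X s * Th s * (Z p * Es p s)" for p s
      define Fp where "Fp p s = X s * Th s * (Z' p * E p s + Z p * (E p s * (- 1 / (4 * \<tau> s))))" for p s
      define Fpp where "Fpp p s = X s * Th s * (Z'' p * E p s + 2 * Z' p * (E p s * (- 1 / (4 * \<tau> s)))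
          + Z p * (E p s * (- 1 / (4 * \<tau> s)) * (- 1 / (4 * \<tau> s))))" for p s
      have X0: "X s = 0" "X' s = 0" if "s \<ge> t0" for s
        using that \<delta> by (auto simp: X_def X'_def intro!: cut_ge_1)
      have Th0: "Th s = 0" "Th' s = 0" if "s \<le> t0 - 2 * r\<^sup>2" for s
        using that r by (auto simp: Th_def Th'_def field_simps intro!: cut_ge_1)
      have Th1: "Th s = 1" "Th' s = 0" if "s \<ge> t0 - r\<^sup>2" for s
        using that r by (auto simp: Th_def Th'_def divide_le_0_iff intro!: cut_le_0)
      have Z0: "Z p = 0" "Z' p = 0" "Z'' p = 0" if "p \<ge> 4 * r\<^sup>2" for p
        using that r by (auto simp: Z_def Z'_def Z''_def field_simps intro!: cut_ge_1)
      have Z1: "Z p = 1" "Z' p = 0" "Z'' p = 0" if "p \<le> r\<^sup>2" for p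
        using that r by (auto simp: Z_def Z'_def Z''_def divide_le_0_iff intro!: cut_le_0)
      have bX: "0 \<le> X s" "X s \<le> 1" "X' s \<le> 0" for s
        using \<delta> by (auto simp: X_def X'_def cut_bounds divide_le_0_iff)
      have bTh: "0 \<le> Th s" "Th s \<le> 1" "\<bar>Th' s\<bar> \<le> 9 / r\<^sup>2" for s
      proof -
        show "0 \<le> Th s" "Th s \<le> 1" by (auto simp: Th_def cut_bounds)
        have "\<bar>Th' s\<bar> = \<bar>cut' ((t0 - r\<^sup>2 - s) / r\<^sup>2)\<bar> / r\<^sup>2" by (simp add: Th'_def abs_divide)
        then show "\<bar>Th' s\<bar> \<le> 9 / r\<^sup>2" by (simp only:) (intro divide_right_mono cut_bounds, simp)
      qed
      have bZ: "0 \<le> Z p" "Z p \<le> 1" "\<bar>Z' p\<bar> \<le> 9 / (3 * r\<^sup>2)" "\<bar>Z'' p\<bar> \<le> 72 / (3 * r\<^sup>2)\<^sup>2" for p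
      proof -
        show "0 \<le> Z p" "Z p \<le> 1" by (auto simp: Z_def cut_bounds)
        have "\<bar>Z' p\<bar> = \<bar>cut' ((p - r\<^sup>2) / (3 * r\<^sup>2))\<bar> / (3 * r\<^sup>2)" by (simp add: Z'_def abs_divide)
        then show "\<bar>Z' p\<bar> \<le> 9 / (3 * r\<^sup>2)" by (simp only:) (intro divide_right_mono cut_bounds, simp)
        have "\<bar>Z'' p\<bar> = \<bar>cut'' ((p - r\<^sup>2) / (3 * r\<^sup>2))\<bar> / (3 * r\<^sup>2)\<^sup>2" by (simp add: Z''_def abs_divide)
        then show "\<bar>Z'' p\<bar> \<le> 72 / (3 * r\<^sup>2)\<^sup>2" by (simp only:) (intro divide_right_mono cut_bounds, simp)
      qed
      have dX: "(X has_real_derivative X' s) (at s)" for s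
        unfolding X_def[abs_def] X'_def
        by (rule DERIV_cong[OF DERIV_chain2[OF DERIV_cut]]) (use \<delta> in \<open>auto intro!: derivative_eq_intros\<close>)
      have dTh: "(Th has_real_derivative Th' s) (at s)" for s
      proof -
        have "((\<lambda>s. t0 - r\<^sup>2 - s) has_real_derivative - 1) (at s)" by (auto intro!: derivative_eq_intros)
        from DERIV_chain2[OF DERIV_cut DERIV_cdivide[OF this, of "r\<^sup>2"]] show ?thesis
          unfolding Th_def[abs_def] Th'_def by simp
      qed
      have dZ: "(Z has_real_derivative Z' p) (at p)" for p
      proof -
        have "((\<lambda>p. p - r\<^sup>2) has_real_derivative 1) (at p)" by (auto intro!: derivative_eq_intros)
        from DERIV_chain2[OF DERIV_cut DERIV_cdivide[OF this, of "3 * r\<^sup>2"]] show ?thesis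
          unfolding Z_def[abs_def] Z'_def by simp
      qed
      have dZ': "(Z' has_real_derivative Z'' p) (at p)" for p
      proof -
        have "((\<lambda>p. cut' ((p - r\<^sup>2) / (3 * r\<^sup>2))) has_real_derivative cut'' ((p - r\<^sup>2) / (3 * r\<^sup>2)) * (1 / (3 * r\<^sup>2))) (at p)"
          by (rule DERIV_chain2[OF DERIV_cut'], rule DERIV_cdivide) (auto intro!: derivative_eq_intros)
        from DERIV_cdivide[OF this, of "3 * r\<^sup>2"] show ?thesis
          unfolding Z'_def[abs_def] Z''_def by (simp add: power2_eq_square)
      qed
      have dEs: "((\<lambda>s. E p s) has_real_derivative Es p s) (at s)" if "s < t0 + \<delta>" for p s
      proof -
        have t: "\<tau> s > 0" using that by (simp add: \<tau>_def)
        have 1: "((\<lambda>t. - (N / 2) * ln t - p / (4 * t)) has_real_derivative (- (N / (2 * t)) + p / (4 * t\<^sup>2))) (at t)"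
          if "t > 0" for t
          using that by (auto intro!: derivative_eq_intros simp: field_simps power2_eq_square)
        have 2: "(\<tau> has_real_derivative - 1) (at s)" unfolding \<tau>_def[abs_def] by (auto intro!: derivative_eq_intros)
        from DERIV_chain2[OF DERIV_exp DERIV_chain2[OF 1[OF t] 2]] show ?thesis
          unfolding E_def[abs_def] Es_def by (rule DERIV_cong) (simp add: algebra_simps)
      qed
      have dEp: "((\<lambda>p. E p s) has_real_derivative E p s * (- 1 / (4 * \<tau> s))) (at p)" for p s
        unfolding E_def[abs_def]
        by (rule DERIV_cong[OF DERIV_chain2[OF DERIV_exp DERIV_diff[OF DERIV_const DERIV_cdivide[OF DERIV_ident]]]]) simp
      have jet: "jet (\<lambda>z. F ((norm (fst z - x0))\<^sup>2) (snd z)) (\<lambda>z. Fs ((norm (fst z - x0))\<^sup>2) (snd z))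
         (\<lambda>i z. 2 * (fst z - x0) $ i * Fp ((norm (fst z - x0))\<^sup>2) (snd z))
         (\<lambda>i j z. 4 * (fst z - x0) $ i * (fst z - x0) $ j * Fpp ((norm (fst z - x0))\<^sup>2) (snd z)
              + (if i = j then 2 * Fp ((norm (fst z - x0))\<^sup>2) (snd z) else 0))"
      proof (rule jet_radial)
        have cE: "continuous_on {z. snd z < t0 + \<delta>} (\<lambda>z. E (fst z) (snd z))"
          "continuous_on {z. snd z < t0 + \<delta>} (\<lambda>z. Es (fst z) (snd z))"
          unfolding E_def Es_def \<tau>_def by (auto intro!: continuous_intros)
        have cX: "continuous_on A (\<lambda>z. X (snd z))" "continuous_on A (\<lambda>z. X' (snd z))" "continuous_on A (\<lambda>z. Th (snd z))"
          "continuous_on A (\<lambda>z. Th' (snd z))" "continuous_on A (\<lambda>z. Z (fst z))" "continuous_on A (\<lambda>z. Z' (fst z))"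
          "continuous_on A (\<lambda>z. Z'' (fst z))" for A :: "(real \<times> real) set"
          unfolding X_def X'_def Th_def Th'_def Z_def Z'_def Z''_def using r \<delta> by (auto intro!: continuous_intros)
        have cT: "continuous_on {z. snd z < t0 + \<delta>} (\<lambda>z::real\<times>real. \<tau> (snd z))"
          unfolding \<tau>_def by (auto intro!: continuous_intros)
        have T0: "\<tau> s \<noteq> 0" if "s < t0 + \<delta>" for s using that by (auto simp: \<tau>_def)
        show "continuous_on UNIV (\<lambda>(p, s). F p s)" "continuous_on UNIV (\<lambda>(p, s). Fs p s)"
          "continuous_on UNIV (\<lambda>(p, s). Fp p s)" "continuous_on UNIV (\<lambda>(p, s). Fpp p s)"
          by (rule continuous_on_halves[OF \<delta>(1), of t0],
              force simp: F_def Fs_def Fp_def Fpp_def split_beta T0 intro!: continuous_intros cE cX cT,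
              simp add: F_def Fs_def Fp_def Fpp_def X0)+
        show "((\<lambda>s. F p s) has_real_derivative Fs p s) (at s)" for p s
        proof (cases "s < t0 + \<delta>")
          case True
          show ?thesis unfolding F_def Fs_def
            by (rule DERIV_cong[OF DERIV_mult[OF DERIV_mult[OF dX dTh] DERIV_cmult[OF dEs[OF True]]]])
               (simp add: algebra_simps)
        next
          case False
          have "((\<lambda>s. F p s) has_real_derivative 0) (at s)"
          proof (rule DERIV_cong_ev[THEN iffD1, OF refl _ refl, rotated])
            show "((\<lambda>s. 0) has_real_derivative 0) (at s)" by simp
            show "eventually (\<lambda>s. 0 = F p s) (nhds s)"
              using False \<delta> by (intro eventually_nhds_in_open[of "{t0<..}" s, THEN eventually_mono]) (auto simp: F_def X0)
          qed
          then show ?thesis using False \<delta> by (simp add: Fs_def X0)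
        qed
        show "((\<lambda>p. F p s) has_real_derivative Fp p s) (at p)" for p s
          unfolding F_def Fp_def
          by (rule DERIV_cmult, rule DERIV_cong[OF DERIV_mult[OF dZ dEp]]) (simp add: algebra_simps)
        show "((\<lambda>p. Fp p s) has_real_derivative Fpp p s) (at p)" for p s
          unfolding Fp_def Fpp_def
          by (rule DERIV_cmult, rule DERIV_cong[OF DERIV_add[OF DERIV_mult[OF dZ' dEp] DERIV_mult[OF dZ DERIV_cmult_right[OF dEp]]]])
             (simp add: algebra_simps)
        show "F ((norm (fst z - x0))\<^sup>2) (snd z) = 0"
          if z: "norm z > norm x0 + 2 * r + \<bar>t0\<bar> + 2 * r\<^sup>2" for z :: "(real^'n) \<times> real"
        proof -
          have "norm z \<le> norm (fst z) + \<bar>snd z\<bar>" by (metis norm_Pair_le prod.collapse real_norm_def)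
          moreover have "norm (fst z) \<le> norm (fst z - x0) + norm x0" by (metis add.commute norm_triangle_sub)
          ultimately have "norm (fst z - x0) \<ge> 2 * r \<or> \<bar>snd z\<bar> > \<bar>t0\<bar> + 2 * r\<^sup>2" using z by linarith
          then show ?thesis
          proof
            assume "norm (fst z - x0) \<ge> 2 * r"
            then have "(norm (fst z - x0))\<^sup>2 \<ge> (2 * r)\<^sup>2" using r by (intro power_mono) auto
            then show ?thesis by (simp add: F_def Z0)
          next
            assume "\<bar>snd z\<bar> > \<bar>t0\<bar> + 2 * r\<^sup>2"
            moreover have "r\<^sup>2 \<ge> 0" by simp
            ultimately have "snd z \<ge> t0 \<or> snd z \<le> t0 - 2 * r\<^sup>2" by linarith
            then show ?thesis by (auto simp: F_def X0 Th0)
          qed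
        qed
      qed
      define L where "L p s = - Fs p s - (4 * p * Fpp p s + 2 * N * Fp p s)" for p s
      \<comment> \<open>\<open>E\<close> solves the backward heat equation, so every term in which
        no cut-off is differentiated cancels.\<close>
      have L_eq: "L p s = - X' s * Th s * Z p * E p s - X s * Th' s * Z p * E p s
         - X s * Th s * E p s * (4 * p * Z'' p - 2 * p * Z' p / \<tau> s + 2 * N * Z' p)" if "s < t0 + \<delta>" for p s
      proof -
        have alg: "- ((x' * h + x * h') * (z * e) + x * h * (z * (e * (N / (2 * t) - p / (4 * t\<^sup>2)))))
            - (4 * p * (x * h * (z'' * e + 2 * z' * (e * (- 1 / (4 * t))) + z * (e * (- 1 / (4 * t)) * (- 1 / (4 * t)))))
            + 2 * N * (x * h * (z' * e + z * (e * (- 1 / (4 * t))))))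
          = - x' * h * z * e - x * h' * z * e - x * h * e * (4 * p * z'' - 2 * p * z' / t + 2 * N * z')"
          if "t \<noteq> 0" for x x' h h' z z' z'' e t :: real
          using that by (simp add: field_simps power2_eq_square)
        show ?thesis unfolding L_def Fs_def Fp_def Fpp_def Es_def
          by (rule alg) (use that in \<open>simp add: \<tau>_def\<close>)
      qed
      have Q_iff: "z \<in> Q \<longleftrightarrow> (norm (fst z - x0))\<^sup>2 \<le> 4 * r\<^sup>2 \<and> t0 - 2 * r\<^sup>2 \<le> snd z \<and> snd z \<le> t0" for z
      proof -
        have "norm (fst z - x0) \<le> 2 * r \<longleftrightarrow> (norm (fst z - x0))\<^sup>2 \<le> (2 * r)\<^sup>2"
          using r by (intro power_mono_iff[symmetric]) auto
        then show ?thesis by (cases z) (auto simp: Q_def dist_norm norm_minus_commute)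
      qed
      have S_iff: "z \<in> S \<longleftrightarrow> (norm (fst z - x0))\<^sup>2 \<le> \<delta> \<and> t0 - 3/4 * \<delta> \<le> snd z \<and> snd z \<le> t0 - 1/4 * \<delta>" for z
      proof -
        have "norm (fst z - x0) \<le> sqrt \<delta> \<longleftrightarrow> (norm (fst z - x0))\<^sup>2 \<le> (sqrt \<delta>)\<^sup>2"
          using \<delta> by (intro power_mono_iff[symmetric]) auto
        then show ?thesis using \<delta> by (cases z) (auto simp: S_def dist_norm norm_minus_commute)
      qed
      define e where "e = 1 / (10 * \<delta>) * exp (- (N / 2) * ln (2 * \<delta>) - 1 / 4)"
      have e: "e > 0" using \<delta> by (simp add: e_def)
      have err: "\<bar>X s * Th' s * Z p * E p s + X s * Th s * E p s * (4 * p * Z'' p - 2 * p * Z' p / \<tau> s + 2 * N * Z' p)\<bar> \<le> C2"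
        if "s < t0 + \<delta>" "p \<ge> 0" for p s
      proof -
        have \<tau>: "\<tau> s > 0" using that by (simp add: \<tau>_def)
        have E0: "E p s \<ge> 0" by (simp add: E_def)
        \<comment> \<open>\<open>Th'\<close> lives before time t0 - r^2, where the distance in time
          to the pole is at least r^2.\<close>
        have 1: "\<bar>X s * Th' s * Z p * E p s\<bar> \<le> 9 / r\<^sup>2 * exp (- (N / 2) * ln (r\<^sup>2))"
        proof (cases "s \<ge> t0 - r\<^sup>2")
          case False
          then have "r\<^sup>2 \<le> \<tau> s" using \<delta> by (simp add: \<tau>_def)
          then have "ln (r\<^sup>2) \<le> ln (\<tau> s)" using r \<tau> by (subst ln_le_cancel_iff) auto
          then have "N / 2 * ln (r\<^sup>2) \<le> N / 2 * ln (\<tau> s)" using N by (intro mult_left_mono) auto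
          moreover have "p / (4 * \<tau> s) \<ge> 0" using \<tau> that by simp
          ultimately have "E p s \<le> exp (- (N / 2) * ln (r\<^sup>2))" by (simp add: E_def)
          then have "\<bar>X s\<bar> * \<bar>Th' s\<bar> * \<bar>Z p\<bar> * \<bar>E p s\<bar> \<le> 1 * (9 / r\<^sup>2) * 1 * exp (- (N / 2) * ln (r\<^sup>2))"
            using bX[of s] bTh[of s] bZ[of p] E0 r by (intro mult_mono) auto
          then show ?thesis by (simp add: abs_mult)
        qed (use r in \<open>simp add: Th1\<close>)
        \<comment> \<open>The derivatives of \<open>Z\<close> live on the shell between r^2 and
          4r^2, where the Gaussian factor beats the powers of \<tau>.\<close>
        have 2: "\<bar>X s * Th s * E p s * (4 * p * Z'' p - 2 * p * Z' p / \<tau> s + 2 * N * Z' p)\<bar>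
            \<le> 16 * r\<^sup>2 * (72 / (3 * r\<^sup>2)\<^sup>2) * D0 + 8 * r\<^sup>2 * (9 / (3 * r\<^sup>2)) * D1 + 2 * N * (9 / (3 * r\<^sup>2)) * D0"
        proof (cases "r\<^sup>2 < p \<and> p < 4 * r\<^sup>2")
          case True
          have "r\<^sup>2 / 4 / \<tau> s \<le> p / 4 / \<tau> s" using True \<tau> by (intro divide_right_mono) auto
          then have "E p s \<le> exp (- (N / 2) * ln (\<tau> s) - r\<^sup>2 / 4 / \<tau> s)" by (simp add: E_def)
          also have "\<dots> \<le> D0" unfolding D0_def using exp_ln_bound[of "r\<^sup>2 / 4" "N / 2" "\<tau> s"] r N \<tau> by simp
          finally have e0: "E p s \<le> D0" .
          have "E p s / \<tau> s = exp (- (N / 2) * ln (\<tau> s) - p / (4 * \<tau> s) - ln (\<tau> s))"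
            using \<tau> by (simp add: E_def exp_diff)
          also have "\<dots> \<le> exp (- (N / 2 + 1) * ln (\<tau> s) - r\<^sup>2 / 4 / \<tau> s)"
            using \<open>r\<^sup>2 / 4 / \<tau> s \<le> p / 4 / \<tau> s\<close> by (simp add: algebra_simps)
          also have "\<dots> \<le> D1" unfolding D1_def using exp_ln_bound[of "r\<^sup>2 / 4" "N / 2 + 1" "\<tau> s"] r N \<tau> by simp
          finally have e1: "E p s / \<tau> s \<le> D1" .
          have e1': "E p s / \<tau> s \<ge> 0" using E0 \<tau> by simp
          have p4: "\<bar>4 * p\<bar> \<le> 16 * r\<^sup>2" "\<bar>2 * p\<bar> \<le> 8 * r\<^sup>2" using True that(2) by auto
          have E1: "\<bar>E p s\<bar> \<le> D0" "\<bar>E p s / \<tau> s\<bar> \<le> D1"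
            using E0 e0 e1 e1' by (simp_all only: abs_of_nonneg)
          have a: "\<bar>4 * p * Z'' p * E p s\<bar> \<le> 16 * r\<^sup>2 * (72 / (3 * r\<^sup>2)\<^sup>2) * D0"
            unfolding abs_mult[of "4 * p * Z'' p"] abs_mult[of "4 * p"]
            by (rule mult_mono[OF mult_mono[OF p4(1) bZ(4)] E1(1)]) auto
          have b: "\<bar>2 * p * Z' p * (E p s / \<tau> s)\<bar> \<le> 8 * r\<^sup>2 * (9 / (3 * r\<^sup>2)) * D1"
            unfolding abs_mult[of "2 * p * Z' p"] abs_mult[of "2 * p"]
            by (rule mult_mono[OF mult_mono[OF p4(2) bZ(3)] E1(2)]) auto
          have c: "\<bar>2 * N * Z' p * E p s\<bar> \<le> 2 * N * (9 / (3 * r\<^sup>2)) * D0"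
            unfolding abs_mult using bZ[of p] E0 e0 r N by (intro mult_mono) auto
          have "\<bar>X s * Th s * E p s * (4 * p * Z'' p - 2 * p * Z' p / \<tau> s + 2 * N * Z' p)\<bar>
            = \<bar>X s * Th s\<bar> * \<bar>4 * p * Z'' p * E p s - 2 * p * Z' p * (E p s / \<tau> s) + 2 * N * Z' p * E p s\<bar>"
            by (simp flip: abs_mult) (simp add: algebra_simps)
          also have "\<dots> \<le> 1 * \<bar>4 * p * Z'' p * E p s - 2 * p * Z' p * (E p s / \<tau> s) + 2 * N * Z' p * E p s\<bar>"
            using bX[of s] bTh[of s] by (intro mult_right_mono) (auto simp: abs_mult intro: mult_le_one)
          also have "\<dots> \<le> 16 * r\<^sup>2 * (72 / (3 * r\<^sup>2)\<^sup>2) * D0 + 8 * r\<^sup>2 * (9 / (3 * r\<^sup>2)) * D1 + 2 * N * (9 / (3 * r\<^sup>2)) * D0"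
          proof -
            have "1 * \<bar>A - B + C\<bar> \<le> A' + B' + C'" if "\<bar>A\<bar> \<le> A'" "\<bar>B\<bar> \<le> B'" "\<bar>C\<bar> \<le> C'" for A B C A' B' C' :: real
              using that by (auto simp: abs_le_iff)
            from this[OF a b c] show ?thesis .
          qed
          finally show ?thesis .
        next
          case False
          then have "Z' p = 0" "Z'' p = 0" using Z0 Z1 by (auto simp: not_less)
          then show ?thesis using N by (simp add: D0_def D1_def)
        qed
        show ?thesis using 1 2 unfolding C2_def by linarith
      qed
      have pos: "- X' s * Th s * Z p * E p s \<ge> 0" for p s
        using bX[of s] bTh[of s] bZ[of p] by (simp add: E_def mult_nonpos_nonneg)
      have low: "- X' s * Th s * Z p * E p s \<ge> e"
        if "t0 - 3/4 * \<delta> \<le> s" "s \<le> t0 - 1/4 * \<delta>" "0 \<le> p" "p \<le> \<delta>" for p s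
      proof -
        have "1 / 4 \<le> (s - (t0 - \<delta>)) / \<delta>" "(s - (t0 - \<delta>)) / \<delta> \<le> 3 / 4"
          using that \<delta> by (auto simp: field_simps)
        from cut'_middle[OF this] have X: "- X' s \<ge> 1 / 10 / \<delta>"
          unfolding X'_def using \<delta> by (simp add: field_simps)
        have \<tau>: "5 / 4 * \<delta> \<le> \<tau> s" "\<tau> s \<le> 2 * \<delta>" using that \<delta> by (auto simp: \<tau>_def)
        have "p / (4 * \<tau> s) \<le> 1 / 4" using \<tau> that \<delta> by (simp add: divide_le_eq)
        moreover have "N / 2 * ln (\<tau> s) \<le> N / 2 * ln (2 * \<delta>)"
          using \<tau> \<delta> N by (intro mult_left_mono) (auto simp: ln_le_cancel_iff)
        ultimately have E: "E p s \<ge> exp (- (N / 2) * ln (2 * \<delta>) - 1 / 4)" by (simp add: E_def)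
        have "Th s = 1" using that \<delta> by (intro Th1) linarith
        moreover have "Z p = 1" using that \<delta> by (intro Z1) linarith
        moreover have "1 / 10 / \<delta> * exp (- (N / 2) * ln (2 * \<delta>) - 1 / 4) \<le> - X' s * E p s"
          using X E \<delta> bX by (intro mult_mono) auto
        ultimately show ?thesis unfolding e_def by simp
      qed
      have LQ: "L ((norm (fst z - x0))\<^sup>2) (snd z) \<ge> e * indicator S z - C2 * indicator Q z" for z
      proof (cases "z \<in> Q")
        case True
        let ?p = "(norm (fst z - x0))\<^sup>2" and ?s = "snd z"
        have s: "?s < t0 + \<delta>" using True \<delta> by (simp add: Q_iff)
        have "L ?p ?s \<ge> - X' ?s * Th ?s * Z ?p * E ?p ?s - C2"
          unfolding L_eq[OF s] using err[OF s, of ?p] by (simp add: abs_le_iff)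
        moreover have "- X' ?s * Th ?s * Z ?p * E ?p ?s \<ge> e * indicator S z"
          using low[of ?s ?p] pos[of ?s ?p] by (auto simp: indicator_def S_iff)
        ultimately show ?thesis using True by simp
      next
        case False
        have "r\<^sup>2 \<ge> 0" by simp
        then have "z \<notin> S" using False \<delta> unfolding S_iff Q_iff by linarith
        moreover have "L ((norm (fst z - x0))\<^sup>2) (snd z) = 0"
          using False unfolding Q_iff de_Morgan_conj
          by (elim disjE) (simp_all add: L_def Fs_def Fp_def Fpp_def X0 Th0 Z0)
        ultimately show ?thesis using False by simp
      qed
      have meas: "measure lborel S = unit_ball_vol N * sqrt \<delta> ^ CARD('n) * (\<delta> / 2)"
      proof -
        have "emeasure lborel S = emeasure (lborel \<Otimes>\<^sub>M lborel) S" by (simp add: lborel_prod)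
        also have "\<dots> = emeasure lborel (cball x0 (sqrt \<delta>)) * emeasure lborel {t0 - 3/4 * \<delta>..t0 - 1/4 * \<delta>}"
          unfolding S_def by (rule lborel.emeasure_pair_measure_Times) auto
        also have "\<dots> = ennreal (unit_ball_vol N * sqrt \<delta> ^ CARD('n)) * ennreal (\<delta> / 2)"
          using \<delta> by (simp add: emeasure_cball N_def)
        finally show ?thesis
          using \<delta> N by (simp add: measure_def enn2real_mult)
      qed
      have Qm: "Q \<in> sets borel" "S \<in> sets borel"
        unfolding Q_def S_def by (intro borel_closed closed_Times; simp)+
      have Qb: "norm z \<le> norm x0 + 2 * r + \<bar>t0\<bar> + 2 * r\<^sup>2" if "z \<in> Q" for z
      proof -
        have "norm z \<le> norm (fst z) + \<bar>snd z\<bar>" by (metis norm_Pair_le prod.collapse real_norm_def)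
        moreover have "norm (fst z) \<le> norm (fst z - x0) + norm x0" by (metis add.commute norm_triangle_sub)
        moreover have "norm (fst z - x0) \<le> 2 * r" "t0 - 2 * r\<^sup>2 \<le> snd z" "snd z \<le> t0"
          using that by (auto simp: Q_def dist_norm norm_minus_commute)
        ultimately show ?thesis using zero_le_power2[of r] by linarith
      qed
      have SQ: "z \<in> Q" if "z \<in> S" for z
        using that \<delta> zero_le_power2[of r] unfolding S_iff Q_iff by linarith
      have iQ: "integrable lborel (\<lambda>y. W y * indicator Q y)"
        by (rule loc_int_mult[OF W, where M=1 and R="norm x0 + 2 * r + \<bar>t0\<bar> + 2 * r\<^sup>2"])
           (use Qm Qb in \<open>force simp: indicator_def\<close>)+
      have iS: "integrable lborel (\<lambda>y. W y * indicator S y)"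
        by (rule loc_int_mult[OF W, where M=1 and R="norm x0 + 2 * r + \<bar>t0\<bar> + 2 * r\<^sup>2"])
           (use Qm Qb SQ in \<open>force simp: indicator_def\<close>)+
      have fS: "emeasure lborel S < \<infinity>"
        by (rule le_less_trans[OF emeasure_mono emeasure_lborel_cball_finite[of 0 "norm x0 + 2 * r + \<bar>t0\<bar> + 2 * r\<^sup>2"]])
           (use Qb SQ in auto)
      let ?L = "\<lambda>y. L ((norm (fst y - x0))\<^sup>2) (snd y)"
      have Leq: "L ((norm (fst y - x0))\<^sup>2) (snd y) = - Fs ((norm (fst y - x0))\<^sup>2) (snd y) - (\<Sum>i\<in>UNIV.
          4 * (fst y - x0) $ i * (fst y - x0) $ i * Fpp ((norm (fst y - x0))\<^sup>2) (snd y)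
              + (if i = i then 2 * Fp ((norm (fst y - x0))\<^sup>2) (snd y) else 0))" for y
        unfolding L_def radial_laplacian N_def ..
      have iL: "integrable lborel (\<lambda>y. W y * ?L y)"
        unfolding Leq by (intro loc_int_mult_cc[OF W] jet_heat_cc[OF jet])
      have "e * (m * measure lborel S) \<le> e * (\<integral>y. W y * indicator S y \<partial>lborel)"
      proof -
        have "m * measure lborel S = (\<integral>y. m * indicator S y \<partial>lborel)" using Qm fS by simp
        also have "\<dots> \<le> (\<integral>y. W y * indicator S y \<partial>lborel)"
        proof (rule integral_mono)
          show "m * indicator S y \<le> W y * indicator S y" for y
            using m(2)[of y] by (auto simp: indicator_def S_def)
          show "integrable lborel (\<lambda>y. m * indicat_real S y)"
            using Qm fS by (intro integrable_mult_right integrable_real_indicator) auto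
        qed (rule iS)
        finally show ?thesis using e by (intro mult_left_mono) auto
      qed
      also have "\<dots> - C2 * I = (\<integral>y. e * (W y * indicator S y) - C2 * (W y * indicator Q y) \<partial>lborel)"
        unfolding I_def using iQ iS by simp
      also have "\<dots> \<le> (\<integral>y. W y * ?L y \<partial>lborel)"
      proof (rule integral_mono)
        show "integrable lborel (\<lambda>y. e * (W y * indicator S y) - C2 * (W y * indicator Q y))"
          using iQ iS by auto
        show "e * (W y * indicator S y) - C2 * (W y * indicator Q y) \<le> W y * ?L y" for y
          using mult_left_mono[OF LQ[of y] W0[of y]] by (simp add: algebra_simps)
      qed (rule iL)
      also have "\<dots> \<le> 0"
        unfolding Leq
      proof (rule sub[OF jet])
        show "F ((norm (fst z - x0))\<^sup>2) (snd z) \<ge> 0" for z :: "(real^'n) \<times> real"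
          using bX bTh bZ by (auto simp: F_def E_def)
        show "F ((norm (fst z - x0))\<^sup>2) (snd z) = 0"
          if "z \<notin> cball x0 (2 * r) \<times> {t0 - 2 * r\<^sup>2..t0}" for z :: "(real^'n) \<times> real"
          using that unfolding Q_def[symmetric] Q_iff de_Morgan_conj
          by (elim disjE) (simp_all add: F_def X0 Th0 Z0)
      qed
      finally have "m * (e * measure lborel S) \<le> C2 * I" by (simp add: ac_simps)
      \<comment> \<open>The powers of \<delta> cancel: the switch contributes \<delta>^(-1) and the
        kernel \<delta>^(-N/2), against a cylinder of volume proportional to \<delta>^(N/2 +
        1).\<close>
      moreover have "e * measure lborel S = c0"
      proof -
        have "sqrt \<delta> = exp (ln \<delta> / 2)" using \<delta> by (simp add: ln_sqrt[symmetric])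
        then have "sqrt \<delta> ^ CARD('n) = exp (N / 2 * ln \<delta>)"
          by (simp add: N_def exp_of_nat_mult[symmetric])
        moreover have "exp (- (N / 2) * ln (2 * \<delta>) - 1 / 4) = exp (- (N / 2) * ln 2 - 1 / 4) * exp (- (N / 2 * ln \<delta>))"
          using \<delta> by (simp add: ln_mult exp_add[symmetric] algebra_simps)
        ultimately show ?thesis
          unfolding e_def meas c0_def using \<delta> by (simp add: exp_minus field_simps)
      qed
      ultimately show ?thesis by simp
    qed
    have I0: "I \<ge> 0" unfolding I_def by (intro integral_nonneg_AE AE_I2) (simp add: W0)
    have "W (x0, t0) \<le> C2 / c0 * I + \<eta>" if \<eta>: "\<eta> > 0" for \<eta>
    proof (cases "W (x0, t0) - \<eta> \<ge> 0")
      case True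
      obtain d where d: "d > 0" "\<And>y. dist y (x0, t0) < d \<Longrightarrow> dist (W y) (W (x0, t0)) < \<eta>"
        using Wc \<eta> unfolding continuous_at_eps_delta by blast
      \<comment> \<open>The bound (d/4)^2 gives sqrt \<delta> \<le> d/4 in space, and \<delta> \<le>
        1 gives \<delta> \<le> sqrt \<delta> in time, so the small cylinder lies in the ball of
        radius \<open>d\<close>.\<close>
      define \<delta> where "\<delta> = min (min (r\<^sup>2) 1) ((d / 4)\<^sup>2)"
      have \<delta>: "\<delta> > 0" "\<delta> \<le> r\<^sup>2" "\<delta> \<le> 1" using r d by (auto simp: \<delta>_def)
      have "sqrt \<delta> \<le> sqrt ((d / 4)\<^sup>2)" unfolding \<delta>_def by (intro real_sqrt_le_mono) auto
      then have sd: "sqrt \<delta> \<le> d / 4" using d by simp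
      have "\<delta> = sqrt \<delta> * sqrt \<delta>" using \<delta> by simp
      also have "\<dots> \<le> sqrt \<delta> * 1" using \<delta> by (intro mult_left_mono) auto
      finally have sd': "\<delta> \<le> sqrt \<delta>" by simp
      have "(W (x0, t0) - \<eta>) * c0 \<le> C2 * I"
      proof (rule key[OF \<delta>(1,2) True])
        fix z assume "z \<in> cball x0 (sqrt \<delta>) \<times> {t0 - 3/4 * \<delta>..t0 - 1/4 * \<delta>}"
        then have z: "norm (fst z - x0) \<le> sqrt \<delta>" "\<bar>snd z - t0\<bar> \<le> \<delta>"
          using \<delta> by (auto simp: dist_norm norm_minus_commute)
        have "dist z (x0, t0) \<le> norm (fst z - x0) + \<bar>snd z - t0\<bar>"
          unfolding dist_norm by (metis fst_conv fst_diff norm_Pair_le prod.collapse real_norm_def snd_conv snd_diff)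
        then have "dist z (x0, t0) < d" using z sd sd' d by linarith
        from d(2)[OF this] show "W (x0, t0) - \<eta> \<le> W z" by (simp add: dist_real_def)
      qed
      then show ?thesis using c0 by (simp add: field_simps)
    next
      case False
      have "C2 / c0 * I \<ge> 0" using C2 c0 I0 by simp
      then show ?thesis using False by linarith
    qed
    then have "W (x0, t0) \<le> C2 / c0 * I" by (rule field_le_epsilon)
    then show "W (x0, t0) \<le> C2 / c0 * (\<integral>y. W y * indicator (cball x0 (2 * r) \<times> {t0 - 2 * r\<^sup>2..t0}) y \<partial>lborel)"
      unfolding I_def Q_def .
  qed
qed

section \<open>Kato's inequality across the initial time\<close>

text \<open>A convex \<open>C\<^sup>2\<close> substitute for the positive part, with bounded derivative and vanishing exactly on
  the nonpositive numbers. With it Kato's inequality needs no limit in the convex function.\<close>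

definition soft_pos :: "real \<Rightarrow> real" where "soft_pos s = max 0 s - arctan (max 0 s)"
definition soft_pos' :: "real \<Rightarrow> real" where "soft_pos' s = (max 0 s)\<^sup>2 / (1 + (max 0 s)\<^sup>2)"
definition soft_pos'' :: "real \<Rightarrow> real" where "soft_pos'' s = 2 * max 0 s / (1 + (max 0 s)\<^sup>2)\<^sup>2"

lemma DERIV_pj: "(soft_pos has_real_derivative soft_pos' s) (at s)"
proof -
  have F: "((\<lambda>s. s - arctan s) has_real_derivative s\<^sup>2 / (1 + s\<^sup>2)) (at s)" for s :: real
    by (rule DERIV_cong, rule DERIV_diff[OF DERIV_ident DERIV_arctan])
       (simp add: field_simps add_pos_nonneg less_imp_neq[symmetric] sum_power2_eq_zero_iff add_nonneg_eq_0_iff)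
  consider "s > 0" | "s < 0" | "s = 0" by linarith
  then show ?thesis
  proof cases
    case 1
    have "eventually (\<lambda>v. v - arctan v = soft_pos v) (nhds s)"
      using 1 by (intro eventually_nhds_in_open[of "{0<..}" s, THEN eventually_mono]) (auto simp: soft_pos_def)
    from DERIV_cong_ev[THEN iffD1, OF refl this refl F] show ?thesis using 1 by (simp add: soft_pos'_def)
  next
    case 2
    have "eventually (\<lambda>v. 0 = soft_pos v) (nhds s)"
      using 2 by (intro eventually_nhds_in_open[of "{..<0}" s, THEN eventually_mono]) (auto simp: soft_pos_def)
    from DERIV_cong_ev[THEN iffD1, OF refl this refl DERIV_const] show ?thesis using 2 by (simp add: soft_pos'_def)
  next
    case 3
    have "((\<lambda>h. soft_pos h / h) \<longlongrightarrow> 0) (at 0)"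
    proof (rule Lim_null_comparison)
      show "eventually (\<lambda>h. norm (soft_pos h / h) \<le> \<bar>(h - arctan h) / h\<bar>) (at 0)"
      proof (intro always_eventually allI)
        show "norm (soft_pos h / h) \<le> \<bar>(h - arctan h) / h\<bar>" for h
        proof (cases "h \<le> 0")
          case True
          then have "norm (soft_pos h / h) = 0" by (simp add: soft_pos_def)
          then show ?thesis by (simp only: abs_ge_zero)
        qed (simp add: soft_pos_def)
      qed
      have "((\<lambda>h. (h - arctan h) / h) \<longlongrightarrow> 0) (at 0)"
        using F[of 0] by (simp add: has_field_derivative_iff)
      then show "((\<lambda>h. \<bar>(h - arctan h) / h\<bar>) \<longlongrightarrow> 0) (at 0)" by (rule tendsto_rabs_zero)
    qed
    then show ?thesis using 3 by (simp add: has_field_derivative_iff soft_pos'_def soft_pos_def)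
  qed
qed

lemma one_plus_sq_nz: "1 + (x::real)\<^sup>2 \<noteq> 0"
  by (metis add_eq_0_iff not_one_le_zero zero_le_power2 neg_0_le_iff_le le_minus_one_simps(3))

lemma DERIV_pj': "(soft_pos' has_real_derivative soft_pos'' s) (at s)"
  unfolding soft_pos'_def[abs_def] soft_pos''_def
  by (rule DERIV_cong, rule DERIV_divide[OF DERIV_max_0_square DERIV_add[OF DERIV_const DERIV_max_0_square] one_plus_sq_nz])
     (simp add: power2_eq_square algebra_simps)

lemma soft_pos_bounds: "0 \<le> soft_pos' s" "soft_pos' s \<le> 1" "0 \<le> soft_pos'' s" "soft_pos'' s \<le> 1"
proof -
  let ?m = "max 0 s"
  show "0 \<le> soft_pos' s" "0 \<le> soft_pos'' s" by (auto simp: soft_pos'_def soft_pos''_def)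
  show "soft_pos' s \<le> 1" by (simp add: soft_pos'_def divide_le_eq add_pos_nonneg)
  have "2 * ?m \<le> 1 + ?m\<^sup>2" using sum_squares_bound[of 1 ?m] by simp
  also have "\<dots> \<le> (1 + ?m\<^sup>2)\<^sup>2" by (rule self_le_power) auto
  finally show "soft_pos'' s \<le> 1" by (simp add: soft_pos''_def divide_le_eq add_pos_nonneg)
qed

lemma soft_pos_lipschitz: "\<bar>soft_pos a - soft_pos b\<bar> \<le> \<bar>a - b\<bar>"
  using field_differentiable_bound[of UNIV soft_pos soft_pos' 1 a b] DERIV_pj soft_pos_bounds by auto

lemma soft_pos'_lipschitz: "\<bar>soft_pos' a - soft_pos' b\<bar> \<le> \<bar>a - b\<bar>"
  using field_differentiable_bound[of UNIV soft_pos' soft_pos'' 1 a b] DERIV_pj' soft_pos_bounds by auto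

lemma soft_pos_le_0: "s \<le> 0 \<Longrightarrow> soft_pos s = 0" "s \<le> 0 \<Longrightarrow> soft_pos' s = 0"
  by (simp_all add: soft_pos_def soft_pos'_def)

lemma soft_pos_mono: "a \<le> b \<Longrightarrow> soft_pos a \<le> soft_pos b"
  by (rule DERIV_nonneg_imp_nondecreasing[of a b soft_pos]) (use DERIV_pj soft_pos_bounds in auto)

lemma soft_pos_pos: "s > 0 \<Longrightarrow> soft_pos s > 0"
proof -
  assume "s > 0"
  then obtain z where "z > 0" "z < s" "soft_pos s - soft_pos 0 = (s - 0) * soft_pos' z"
    using MVT2[of 0 s soft_pos soft_pos'] DERIV_pj by auto
  moreover have "soft_pos' z > 0" using \<open>z > 0\<close> by (simp add: soft_pos'_def add_pos_pos)
  ultimately show ?thesis by (simp add: soft_pos_def)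
qed

lemma soft_pos_nonneg: "soft_pos s \<ge> 0"
  using soft_pos_mono[of 0 "max 0 s"] by (simp add: soft_pos_def)

lemma soft_pos_le_abs: "\<bar>soft_pos s\<bar> \<le> \<bar>s\<bar>"
  using soft_pos_lipschitz[of s 0] by (simp add: soft_pos_le_0)

lemma isCont_pj: "isCont soft_pos s" "isCont soft_pos' s" "isCont soft_pos'' s"
  using DERIV_pj DERIV_pj' by (auto intro: DERIV_isCont simp: soft_pos''_def[abs_def] one_plus_sq_nz intro!: continuous_intros)

section \<open>Integration by parts against test functions\<close>

lemma dir_deriv_mult:
  "dir_deriv e k k' \<Longrightarrow> dir_deriv e l l' \<Longrightarrow> dir_deriv e (\<lambda>z. k z * l z) (\<lambda>z. k' z * l z + k z * l' z)"
  unfolding dir_deriv_def by (auto intro!: derivative_eq_intros)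

lemma dir_deriv_chain:
  assumes "\<And>s. (f has_real_derivative f' s) (at s)" "dir_deriv e k k'"
  shows "dir_deriv e (\<lambda>z. f (k z)) (\<lambda>z. f' (k z) * k' z)"
  unfolding dir_deriv_def
proof
  fix z
  have "((\<lambda>s. f (k (z + s *\<^sub>R e))) has_real_derivative f' (k (z + 0 *\<^sub>R e)) * k' z) (at 0)"
    by (rule DERIV_chain2[OF assms(1)]) (use assms(2) in \<open>simp add: dir_deriv_def\<close>)
  then show "((\<lambda>s. f (k (z + s *\<^sub>R e))) has_real_derivative f' (k z) * k' z) (at 0)" by simp
qed

lemma cc_mult: "cc k \<Longrightarrow> continuous_on UNIV f \<Longrightarrow> cc (\<lambda>z. f z * k z)"
  unfolding cc_def by (intro conjI continuous_on_mult) auto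

lemma cc_integrable: "cc k \<Longrightarrow> integrable lborel k"
  using loc_int_mult_cc[OF loc_int_continuous, of "\<lambda>_. 1" k] by auto

text \<open>The product has compact support because \<open>k\<close> has, so the integral of its
  derivative is zero; no decay of \<open>v\<close> is involved.\<close>

lemma dir_deriv_parts1:
  assumes v: "continuous_on UNIV v" "continuous_on UNIV v'" "dir_deriv e v v'"
    and k: "cc k" "cc k'" "dir_deriv e k k'"
  shows "(\<integral>z. v z * k' z \<partial>lborel) = - (\<integral>z. v' z * k z \<partial>lborel)"
proof -
  have c: "cc (\<lambda>z. v z * k z)" "cc (\<lambda>z. v' z * k z)" "cc (\<lambda>z. v z * k' z)" using v k by (auto intro: cc_mult)
  have "cc (\<lambda>z. v' z * k z - - (v z * k' z))" by (intro cc_diff cc_uminus c)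
  then have "cc (\<lambda>z. v' z * k z + v z * k' z)" by simp
  from integral_dir_deriv_eq_0[OF c(1) this dir_deriv_mult[OF v(3) k(3)]]
  show ?thesis using c by (simp add: cc_integrable)
qed

lemma heat_parts:
  fixes v :: "(real^'n) \<times> real \<Rightarrow> real"
  assumes c: "continuous_on UNIV v" "continuous_on UNIV vt" "\<And>i. continuous_on UNIV (vx i)" "\<And>i. continuous_on UNIV (vxx i)"
    and d: "dir_deriv (0,1) v vt" "\<And>i. dir_deriv (axis i 1, 0) v (vx i)" "\<And>i. dir_deriv (axis i 1, 0) (vx i) (vxx i)"
    and j: "jet \<phi> \<phi>t \<phi>x \<phi>xx"
  shows "(\<integral>z. v z * (- \<phi>t z - (\<Sum>i\<in>UNIV. \<phi>xx i i z)) \<partial>lborel) = (\<integral>z. (vt z - (\<Sum>i\<in>UNIV. vxx i z)) * \<phi> z \<partial>lborel)"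
proof -
  have jj: "cc \<phi>" "cc \<phi>t" "\<And>i. cc (\<phi>x i)" "\<And>i j. cc (\<phi>xx i j)" "dir_deriv (0, 1) \<phi> \<phi>t"
    "\<And>i. dir_deriv (axis i 1, 0) \<phi> (\<phi>x i)" "\<And>i. dir_deriv (axis i 1, 0) (\<phi>x i) (\<phi>xx i i)"
    using j by (auto simp: jet_def)
  have t: "(\<integral>z. v z * \<phi>t z \<partial>lborel) = - (\<integral>z. vt z * \<phi> z \<partial>lborel)"
    by (rule dir_deriv_parts1[OF c(1,2) d(1) jj(1,2,5)])
  have x: "(\<integral>z. v z * \<phi>xx i i z \<partial>lborel) = (\<integral>z. vxx i z * \<phi> z \<partial>lborel)" for i
  proof -
    have "(\<integral>z. v z * \<phi>xx i i z \<partial>lborel) = - (\<integral>z. vx i z * \<phi>x i z \<partial>lborel)"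
      by (rule dir_deriv_parts1[where e="(axis i 1, 0)"]) (intro c d jj)+
    moreover have "(\<integral>z. vx i z * \<phi>x i z \<partial>lborel) = - (\<integral>z. vxx i z * \<phi> z \<partial>lborel)"
      by (rule dir_deriv_parts1[where e="(axis i 1, 0)"]) (intro c d jj)+
    ultimately show ?thesis by simp
  qed
  have "(\<integral>z. v z * (- \<phi>t z - (\<Sum>i\<in>UNIV. \<phi>xx i i z)) \<partial>lborel)
    = - (\<integral>z. v z * \<phi>t z \<partial>lborel) - (\<Sum>i\<in>UNIV. (\<integral>z. v z * \<phi>xx i i z \<partial>lborel))"
    using c jj by (simp add: right_diff_distrib sum_distrib_left cc_integrable cc_mult
        Bochner_Integration.integrable_sum Bochner_Integration.integral_sum)
  also have "\<dots> = (\<integral>z. (vt z - (\<Sum>i\<in>UNIV. vxx i z)) * \<phi> z \<partial>lborel)"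
    unfolding t x using c jj by (simp add: left_diff_distrib sum_distrib_right cc_integrable cc_mult
        Bochner_Integration.integrable_sum Bochner_Integration.integral_sum)
  finally show ?thesis .
qed

text \<open>For the smooth mollified function this is the chain rule. The term with
  \<open>soft_pos''\<close> and the squared gradient drops out by convexity, and the smeared source
  drops out because \<open>c \<le> 0\<close>.\<close>

lemma kato_mollified:
  fixes w g :: "(real^'n) \<times> real \<Rightarrow> real"
  assumes eq: "weak_eq T w g c" and c: "c \<le> 0" and w: "loc_int w" and g: "loc_int g"
    and j: "jet \<phi> \<phi>t \<phi>x \<phi>xx" and \<phi>0: "\<And>z. \<phi> z \<ge> 0" and \<phi>a: "\<And>z. snd z > a \<Longrightarrow> \<phi> z = 0" and a: "a + \<epsilon> < T"
    and e: "jet \<eta> \<eta>t \<eta>x \<eta>xx" and \<eta>: "\<And>z. \<eta> z \<ge> 0" "\<And>z. norm z \<ge> \<epsilon> \<Longrightarrow> \<eta> z = 0"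
  shows "(\<integral>z. soft_pos (conv w \<eta> z) * (- \<phi>t z - (\<Sum>i\<in>UNIV. \<phi>xx i i z)) \<partial>lborel)
    \<le> - (\<integral>z. soft_pos' (conv w \<eta> z) * conv g \<eta> z * \<phi> z \<partial>lborel)"
proof -
  have cc: "cc \<eta>" "cc \<eta>t" "\<And>i. cc (\<eta>x i)" "\<And>i j. cc (\<eta>xx i j)" using e by (auto simp: jet_def)
  have dw: "dir_deriv (0,1) (conv w \<eta>) (conv w \<eta>t)" "dir_deriv (axis i 1,0) (conv w \<eta>) (conv w (\<eta>x i))"
    "dir_deriv (axis i 1,0) (conv w (\<eta>x i)) (conv w (\<eta>xx i i))" for i
    using e by (auto simp: jet_def intro!: conv_dir_deriv w cc)
  have cw: "continuous_on UNIV (conv w k)" "continuous_on UNIV (conv g k)" if "cc k" for k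
    using that by (auto intro!: continuous_at_imp_continuous_on conv_continuous w g)
  have cpj: "continuous_on UNIV (\<lambda>z. soft_pos (conv w \<eta> z))" "continuous_on UNIV (\<lambda>z. soft_pos' (conv w \<eta> z))"
    "continuous_on UNIV (\<lambda>z. soft_pos'' (conv w \<eta> z))"
  proof -
    have "continuous_on UNIV soft_pos" "continuous_on UNIV soft_pos'" "continuous_on UNIV soft_pos''"
      by (simp_all add: continuous_at_imp_continuous_on isCont_pj)
    then show "continuous_on UNIV (\<lambda>z. soft_pos (conv w \<eta> z))" "continuous_on UNIV (\<lambda>z. soft_pos' (conv w \<eta> z))"
      "continuous_on UNIV (\<lambda>z. soft_pos'' (conv w \<eta> z))"
      using continuous_on_compose2[OF _ cw(1)[OF cc(1)] subset_UNIV] by blast+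
  qed
  have "(\<integral>z. soft_pos (conv w \<eta> z) * (- \<phi>t z - (\<Sum>i\<in>UNIV. \<phi>xx i i z)) \<partial>lborel)
    = (\<integral>z. (soft_pos' (conv w \<eta> z) * conv w \<eta>t z - (\<Sum>i\<in>UNIV. (soft_pos'' (conv w \<eta> z) * conv w (\<eta>x i) z) * conv w (\<eta>x i) z
         + soft_pos' (conv w \<eta> z) * conv w (\<eta>xx i i) z)) * \<phi> z \<partial>lborel)"
    by (rule heat_parts[OF _ _ _ _ _ _ _ j, where vx="\<lambda>i z. soft_pos' (conv w \<eta> z) * conv w (\<eta>x i) z"])
       (intro continuous_intros cw cc cpj dir_deriv_chain DERIV_pj DERIV_pj' dw dir_deriv_mult)+
  also have "\<dots> \<le> (\<integral>z. - (soft_pos' (conv w \<eta> z) * conv g \<eta> z * \<phi> z) \<partial>lborel)"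
  proof (rule integral_mono)
    show "integrable lborel (\<lambda>z. (soft_pos' (conv w \<eta> z) * conv w \<eta>t z - (\<Sum>i\<in>UNIV. (soft_pos'' (conv w \<eta> z) * conv w (\<eta>x i) z) * conv w (\<eta>x i) z
         + soft_pos' (conv w \<eta> z) * conv w (\<eta>xx i i) z)) * \<phi> z)"
      by (intro cc_integrable cc_mult continuous_intros cw cc cpj) (use j in \<open>simp add: jet_def\<close>)
    show "integrable lborel (\<lambda>z. - (soft_pos' (conv w \<eta> z) * conv g \<eta> z * \<phi> z))"
      by (intro cc_integrable cc_uminus cc_mult continuous_intros cw cc cpj) (use j in \<open>simp add: jet_def\<close>)
    fix z
    show "(soft_pos' (conv w \<eta> z) * conv w \<eta>t z - (\<Sum>i\<in>UNIV. (soft_pos'' (conv w \<eta> z) * conv w (\<eta>x i) z) * conv w (\<eta>x i) z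
         + soft_pos' (conv w \<eta> z) * conv w (\<eta>xx i i) z)) * \<phi> z \<le> - (soft_pos' (conv w \<eta> z) * conv g \<eta> z * \<phi> z)"
    proof (cases "snd z > a")
      case False
      let ?w = "conv w \<eta> z"
      have "(\<Sum>i\<in>UNIV. (soft_pos'' ?w * conv w (\<eta>x i) z) * conv w (\<eta>x i) z + soft_pos' ?w * conv w (\<eta>xx i i) z)
          \<ge> (\<Sum>i\<in>UNIV. soft_pos' ?w * conv w (\<eta>xx i i) z)"
        using soft_pos_bounds(3)[of ?w] by (intro sum_mono) (simp add: mult.assoc)
      then have "soft_pos' ?w * conv w \<eta>t z - (\<Sum>i\<in>UNIV. (soft_pos'' ?w * conv w (\<eta>x i) z) * conv w (\<eta>x i) z + soft_pos' ?w * conv w (\<eta>xx i i) z)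
        \<le> soft_pos' ?w * (conv w \<eta>t z - (\<Sum>i\<in>UNIV. conv w (\<eta>xx i i) z))"
        by (simp add: right_diff_distrib sum_distrib_left)
      also have "conv w \<eta>t z - (\<Sum>i\<in>UNIV. conv w (\<eta>xx i i) z) = - conv g \<eta> z + c * \<eta> z"
        by (rule conv_weak_eq[OF eq w e \<eta>(2)]) (use False a in auto)
      also have "soft_pos' ?w * (- conv g \<eta> z + c * \<eta> z) \<le> soft_pos' ?w * (- conv g \<eta> z)"
        using soft_pos_bounds(1)[of ?w] c \<eta>(1)[of z] by (intro mult_left_mono) (auto simp: mult_nonpos_nonneg)
      finally show ?thesis using \<phi>0[of z] by (auto dest: mult_right_mono[of _ _ "\<phi> z"])
    qed (simp add: \<phi>a)
  qed
  finally show ?thesis by simp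
qed

text \<open>The crude bound that replaces continuity of translations in \<open>L1\<close>; no rate is needed because it
  is applied to the part of \<open>h\<close> that lives in a thin time slab.\<close>

lemma conv_L1_bound:
  fixes h :: "'a::euclidean_space \<Rightarrow> real"
  assumes h: "loc_int h" and \<eta>: "cc \<eta>" "\<And>z. \<eta> z \<ge> 0" "\<And>z. norm z \<ge> \<epsilon> \<Longrightarrow> \<eta> z = 0" "(\<integral>z. \<eta> z \<partial>lborel) = 1"
    and \<psi>: "cc \<psi>" "\<And>z. \<bar>\<psi> z\<bar> \<le> M" "\<And>z. norm z > R \<Longrightarrow> \<psi> z = 0" and \<epsilon>: "\<epsilon> \<le> 1"
  shows "(\<integral>z. \<bar>conv h \<eta> z\<bar> * \<bar>\<psi> z\<bar> \<partial>lborel) \<le> M * (\<integral>z. indicator (cball 0 (R + 1)) z * \<bar>h z\<bar> \<partial>lborel)"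
proof -
  have M: "M \<ge> 0" using \<psi>(2)[of 0] by (meson abs_ge_zero order_trans)
  have hm [measurable]: "h \<in> borel_measurable borel" and [measurable]: "\<eta> \<in> borel_measurable borel" "\<psi> \<in> borel_measurable borel"
    using h cc_measurable \<eta> \<psi> by (auto simp: loc_int_def)
  have ih: "integrable lborel (\<lambda>y. \<bar>h y\<bar> * \<eta> (z - y))" for z
    by (intro loc_int_mult_cc loc_int_abs h cc_shift \<eta>)
  have one: "(\<integral>\<^sup>+ z. ennreal (\<eta> (z - y)) \<partial>lborel) = 1" for y
  proof -
    have "integrable lborel (\<lambda>z. \<eta> (- (y - z)))"
      using cc_integrable[OF cc_shift[of "\<lambda>z. \<eta> (0 - z)", of y]] cc_shift[OF \<eta>(1), of 0] by simp
    moreover have "(\<integral>z. \<eta> (- (y - z)) \<partial>lborel) = 1"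
      using integral_lborel_reflect[of "\<lambda>z. \<eta> (- z)" y] integral_lborel_uminus[of \<eta>] \<eta>(4) by simp
    ultimately show ?thesis using \<eta>(2) by (simp add: nn_integral_eq_integral)
  qed
  have "(\<integral>\<^sup>+ z. ennreal (\<bar>conv h \<eta> z\<bar> * \<bar>\<psi> z\<bar>) \<partial>lborel)
      \<le> (\<integral>\<^sup>+ z. (\<integral>\<^sup>+ y. ennreal (\<bar>h y\<bar> * \<eta> (z - y) * \<bar>\<psi> z\<bar>) \<partial>lborel) \<partial>lborel)"
  proof (rule nn_integral_mono)
    fix z
    have "\<bar>conv h \<eta> z\<bar> \<le> (\<integral>y. \<bar>h y\<bar> * \<eta> (z - y) \<partial>lborel)"
      unfolding conv_def using integral_abs_bound[of lborel "\<lambda>y. h y * \<eta> (z - y)"] \<eta>(2) by (simp add: abs_mult)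
    then have "ennreal (\<bar>conv h \<eta> z\<bar> * \<bar>\<psi> z\<bar>) \<le> ennreal (\<integral>y. \<bar>h y\<bar> * \<eta> (z - y) * \<bar>\<psi> z\<bar> \<partial>lborel)"
      using ih by (intro ennreal_leI) (simp add: mult_right_mono)
    also have "\<dots> = (\<integral>\<^sup>+ y. ennreal (\<bar>h y\<bar> * \<eta> (z - y) * \<bar>\<psi> z\<bar>) \<partial>lborel)"
      using ih \<eta>(2) by (intro nn_integral_eq_integral[symmetric]) auto
    finally show "ennreal (\<bar>conv h \<eta> z\<bar> * \<bar>\<psi> z\<bar>) \<le> (\<integral>\<^sup>+ y. ennreal (\<bar>h y\<bar> * \<eta> (z - y) * \<bar>\<psi> z\<bar>) \<partial>lborel)" .
  qed
  also have "\<dots> = (\<integral>\<^sup>+ y. (\<integral>\<^sup>+ z. ennreal (\<bar>h y\<bar> * \<eta> (z - y) * \<bar>\<psi> z\<bar>) \<partial>lborel) \<partial>lborel)"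
    by (rule lborel_pair.Fubini') measurable
  also have "\<dots> \<le> (\<integral>\<^sup>+ y. ennreal (M * (indicator (cball 0 (R + 1)) y * \<bar>h y\<bar>)) \<partial>lborel)"
  proof (rule nn_integral_mono)
    fix y
    have "(\<integral>\<^sup>+ z. ennreal (\<bar>h y\<bar> * \<eta> (z - y) * \<bar>\<psi> z\<bar>) \<partial>lborel)
      \<le> (\<integral>\<^sup>+ z. ennreal (M * (indicator (cball 0 (R + 1)) y * \<bar>h y\<bar>)) * ennreal (\<eta> (z - y)) \<partial>lborel)"
    proof (rule nn_integral_mono)
      fix z
      have "\<bar>h y\<bar> * \<eta> (z - y) * \<bar>\<psi> z\<bar> \<le> M * (indicator (cball 0 (R + 1)) y * \<bar>h y\<bar>) * \<eta> (z - y)"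
      proof (cases "\<eta> (z - y) = 0 \<or> \<psi> z = 0")
        case False
        then have "norm (z - y) < \<epsilon>" "norm z \<le> R" using \<eta>(3)[of "z - y"] \<psi>(3)[of z] by force+
        then have "norm y \<le> R + 1" using norm_triangle_sub[of y z] \<epsilon> by (simp add: norm_minus_commute)
        moreover have "\<bar>h y\<bar> * \<eta> (z - y) * \<bar>\<psi> z\<bar> \<le> \<bar>h y\<bar> * \<eta> (z - y) * M"
          using \<psi>(2) \<eta>(2) by (intro mult_left_mono) auto
        ultimately show ?thesis by (simp add: ac_simps)
      qed (use M \<eta>(2) in auto)
      then show "ennreal (\<bar>h y\<bar> * \<eta> (z - y) * \<bar>\<psi> z\<bar>) \<le> ennreal (M * (indicator (cball 0 (R + 1)) y * \<bar>h y\<bar>)) * ennreal (\<eta> (z - y))"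
        using \<eta>(2) M by (subst ennreal_mult[symmetric]) (auto intro: ennreal_leI)
    qed
    also have "\<dots> = ennreal (M * (indicator (cball 0 (R + 1)) y * \<bar>h y\<bar>))"
      by (subst nn_integral_cmult) (auto simp: one)
    finally show "(\<integral>\<^sup>+ z. ennreal (\<bar>h y\<bar> * \<eta> (z - y) * \<bar>\<psi> z\<bar>) \<partial>lborel) \<le> ennreal (M * (indicator (cball 0 (R + 1)) y * \<bar>h y\<bar>))" .
  qed
  also have "\<dots> = ennreal (\<integral>y. M * (indicator (cball 0 (R + 1)) y * \<bar>h y\<bar>) \<partial>lborel)"
    using loc_int_abs[OF h] M by (intro nn_integral_eq_integral) (auto simp: loc_int_def)
  finally have *: "(\<integral>\<^sup>+ z. ennreal (\<bar>conv h \<eta> z\<bar> * \<bar>\<psi> z\<bar>) \<partial>lborel) \<le> ennreal (M * (\<integral>y. indicator (cball 0 (R + 1)) y * \<bar>h y\<bar> \<partial>lborel))"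
    by simp
  have "0 \<le> M * (\<integral>y. indicator (cball 0 (R + 1)) y * \<bar>h y\<bar> \<partial>lborel)"
    using M by (intro mult_nonneg_nonneg integral_nonneg_AE) auto
  moreover have "integrable lborel (\<lambda>z. \<bar>conv h \<eta> z\<bar> * \<bar>\<psi> z\<bar>)"
  proof -
    have "continuous_on UNIV (conv h \<eta>)" by (intro continuous_at_imp_continuous_on ballI conv_continuous h \<eta>)
    then have "cc (\<lambda>z. conv h \<eta> z * \<psi> z)" by (intro cc_mult \<psi>)
    then show ?thesis using integrable_abs[OF cc_integrable] by (simp add: abs_mult[symmetric])
  qed
  ultimately show ?thesis
    using * by (subst (asm) nn_integral_eq_integral) (auto simp: ennreal_le_iff)
qed

section \<open>L1 approximation up to the initial time\<close>

lemma conv_add: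
  assumes "loc_int v" "loc_int w" "cc k"
  shows "conv (\<lambda>z. v z + w z) k z = conv v k z + conv w k z"
  unfolding conv_def distrib_right
  by (rule Bochner_Integration.integral_add) (intro loc_int_mult_cc assms cc_shift)+

text \<open>Bundled so that an estimate can be uniform over all mollifiers of small radius: in
  \<open>kato\<close> one and the same mollifier has to serve three estimates.\<close>

definition mollifier :: "real \<Rightarrow> ('a::euclidean_space \<Rightarrow> real) \<Rightarrow> bool" where
  "mollifier \<epsilon> \<eta> \<longleftrightarrow> cc \<eta> \<and> (\<forall>z. \<eta> z \<ge> 0) \<and> (\<forall>z. norm z \<ge> \<epsilon> \<longrightarrow> \<eta> z = 0) \<and> (\<integral>z. \<eta> z \<partial>lborel) = 1"

text \<open>A function continuous in the open cylinder may be singular at time 0, but the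
  singularity is integrable. A cut-off in time isolates it in a slab so thin that its L1 norm is
  small; what remains vanishes near time 0 and is therefore continuous for all times below
  \<open>T\<close>.\<close>

lemma time_split:
  fixes f :: "(real^'n) \<times> real \<Rightarrow> real"
  assumes f: "loc_int f" "continuous_on (QT T) f" "\<And>z. z \<notin> QT T \<Longrightarrow> f z = 0" and \<kappa>: "\<kappa> > 0"
  obtains f1 f2 where "\<And>z. f z = f1 z + f2 z" "loc_int f1" "loc_int f2" "\<And>z. \<bar>f1 z\<bar> \<le> \<bar>f z\<bar>" "\<And>z. \<bar>f2 z\<bar> \<le> \<bar>f z\<bar>"
    "(\<integral>z. indicator (cball 0 R) z * \<bar>f1 z\<bar> \<partial>lborel) < \<kappa>" "continuous_on {z. snd z < T} f2"
proof -
  define \<delta> where "\<delta> n = 1 / real (Suc n)" for n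
  have \<delta>: "\<delta> n > 0" for n by (simp add: \<delta>_def)
  have \<delta>0: "\<delta> \<longlonglongrightarrow> 0" unfolding \<delta>_def by (rule LIMSEQ_Suc[OF lim_1_over_n])
  define ct where "ct n z = cut ((snd z - \<delta> n) / \<delta> n)" for n and z :: "(real^'n) \<times> real"
  have ctb: "0 \<le> ct n z" "ct n z \<le> 1" for n z by (auto simp: ct_def cut_bounds)
  have ctc: "continuous_on A (ct n)" for A n
    unfolding ct_def using \<delta>[of n] by (auto intro!: continuous_intros)
  have ctm: "ct n \<in> borel_measurable borel" for n by (intro borel_measurable_continuous_onI ctc)
  have fm: "f \<in> borel_measurable borel" using f by (simp add: loc_int_def)
  have "(\<lambda>n. \<integral>z. \<bar>f z\<bar> * (indicator (cball 0 R) z * ct n z) \<partial>lborel) \<longlonglongrightarrow> (\<integral>z. 0 \<partial>(lborel :: ((real^'n) \<times> real) measure))"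
  proof (rule integral_dominated_convergence[where w="\<lambda>z. indicator (cball 0 R) z * \<bar>f z\<bar>"])
    show "integrable lborel (\<lambda>z. indicator (cball 0 R) z * \<bar>f z\<bar>)" using loc_int_abs[OF f(1)] by (simp add: loc_int_def)
    show "AE z in lborel. norm (\<bar>f z\<bar> * (indicator (cball 0 R) z * ct n z)) \<le> indicator (cball 0 R) z * \<bar>f z\<bar>" for n
    proof (intro AE_I2)
      fix z
      have "\<bar>f z\<bar> * ct n z \<le> \<bar>f z\<bar> * 1" using ctb[of n z] by (intro mult_left_mono) auto
      then show "norm (\<bar>f z\<bar> * (indicator (cball 0 R) z * ct n z)) \<le> indicator (cball 0 R) z * \<bar>f z\<bar>"
        using ctb[of n z] by (cases "z \<in> cball 0 R") (simp_all add: abs_mult)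
    qed
    show "AE z in lborel. (\<lambda>n. \<bar>f z\<bar> * (indicator (cball 0 R) z * ct n z)) \<longlonglongrightarrow> 0"
    proof (intro AE_I2)
      fix z show "(\<lambda>n. \<bar>f z\<bar> * (indicator (cball 0 R) z * ct n z)) \<longlonglongrightarrow> 0"
      proof (cases "snd z > 0")
        case True
        have "eventually (\<lambda>n. \<delta> n < snd z / 2) sequentially"
          using order_tendstoD(2)[OF \<delta>0, of "snd z / 2"] True by simp
        then have "eventually (\<lambda>n. \<bar>f z\<bar> * (indicator (cball 0 R) z * ct n z) = 0) sequentially"
        proof eventually_elim
          case (elim n)
          then have "ct n z = 0" unfolding ct_def using \<delta>[of n] by (intro cut_ge_1) (simp add: field_simps)
          then show ?case by simp
        qed
        then show ?thesis by (rule tendsto_eventually)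
      next
        case False
        then have "f z = 0" by (intro f(3)) (auto simp: QT_def)
        then show ?thesis by simp
      qed
    qed
    show "(\<lambda>z. \<bar>f z\<bar> * (indicator (cball 0 R) z * ct n z)) \<in> borel_measurable lborel" for n
      unfolding measurable_lborel2
      by (intro borel_measurable_times borel_measurable_abs borel_measurable_indicator fm ctm) simp
  qed simp
  then have "eventually (\<lambda>n. (\<integral>z. \<bar>f z\<bar> * (indicator (cball 0 R) z * ct n z) \<partial>lborel) < \<kappa>) sequentially"
    using \<kappa> by (auto dest: order_tendstoD(2))
  then obtain n where n: "(\<integral>z. \<bar>f z\<bar> * (indicator (cball 0 R) z * ct n z) \<partial>lborel) < \<kappa>"
    by (auto dest: eventually_happens)
  show ?thesis
  proof (rule that[of "\<lambda>z. ct n z * f z" "\<lambda>z. (1 - ct n z) * f z"])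
    show b: "\<bar>ct n z * f z\<bar> \<le> \<bar>f z\<bar>" "\<bar>(1 - ct n z) * f z\<bar> \<le> \<bar>f z\<bar>" for z
      using ctb[of n z] unfolding abs_mult by (intro mult_left_le_one_le; simp)+
    show "loc_int (\<lambda>z. ct n z * f z)" "loc_int (\<lambda>z. (1 - ct n z) * f z)"
      by (rule loc_int_bound[OF f(1) _ b(1)], intro borel_measurable_times ctm fm)
         (rule loc_int_bound[OF f(1) _ b(2)], intro borel_measurable_times borel_measurable_diff borel_measurable_const ctm fm)
    show "f z = ct n z * f z + (1 - ct n z) * f z" for z by (simp add: left_diff_distrib)
    have "(\<integral>z. indicator (cball 0 R) z * \<bar>ct n z * f z\<bar> \<partial>lborel) = (\<integral>z. \<bar>f z\<bar> * (indicator (cball 0 R) z * ct n z) \<partial>lborel)"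
    proof (intro Bochner_Integration.integral_cong refl)
      show "indicator (cball 0 R) z * \<bar>ct n z * f z\<bar> = \<bar>f z\<bar> * (indicator (cball 0 R) z * ct n z)" for z
        using ctb[of n z] by (cases "z \<in> cball 0 R") (simp_all add: abs_mult)
    qed
    then show "(\<integral>z. indicator (cball 0 R) z * \<bar>ct n z * f z\<bar> \<partial>lborel) < \<kappa>" using n by linarith
    have "continuous_on (QT T \<union> {z. snd z < \<delta> n \<and> snd z < T}) (\<lambda>z. (1 - ct n z) * f z)"
    proof (rule continuous_on_open_Un)
      show "open (QT T)" unfolding QT_def by (intro open_Times) auto
      show "open {z::(real^'n) \<times> real. snd z < \<delta> n \<and> snd z < T}"
        by (intro open_Collect_conj open_Collect_less continuous_intros)
      show "continuous_on (QT T) (\<lambda>z. (1 - ct n z) * f z)" by (intro continuous_intros ctc f)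
      have "1 - ct n z = 0" if "snd z < \<delta> n" for z
        unfolding ct_def using that \<delta>[of n] by (simp add: cut_le_0 divide_le_0_iff)
      then show "continuous_on {z. snd z < \<delta> n \<and> snd z < T} (\<lambda>z. (1 - ct n z) * f z)"
        by (subst continuous_on_cong[where g="\<lambda>_. 0", OF refl]) auto
    qed
    moreover have "QT T \<union> {z. snd z < \<delta> n \<and> snd z < T} = {z::(real^'n) \<times> real. snd z < T}"
      using \<delta>[of n] by (auto simp: QT_def)
    ultimately show "continuous_on {z. snd z < T} (\<lambda>z. (1 - ct n z) * f z)" by simp
  qed
qed


text \<open>The slab part enters twice, mollified and not, each time by its small L1 norm. The
  remainder is uniformly continuous on a compact set slightly larger than the support of \<psi>, so
  its mollification is uniformly close.\<close>

lemma conv_L1_close: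
  fixes f :: "(real^'n) \<times> real \<Rightarrow> real"
  assumes f: "loc_int f" "continuous_on (QT T) f" "\<And>z. z \<notin> QT T \<Longrightarrow> f z = 0"
    and \<psi>: "cc \<psi>" "\<And>z. snd z > a \<Longrightarrow> \<psi> z = 0" and a: "a < T" and \<kappa>: "\<kappa> > 0"
  obtains e where "e > 0"
    "\<And>\<epsilon> (\<eta> :: (real^'n) \<times> real \<Rightarrow> real). \<epsilon> \<le> e \<Longrightarrow> mollifier \<epsilon> \<eta> \<Longrightarrow> (\<integral>z. \<bar>conv f \<eta> z - f z\<bar> * \<bar>\<psi> z\<bar> \<partial>lborel) \<le> \<kappa>"
proof -
  obtain R where R: "R > 0" "\<And>z. norm z > R \<Longrightarrow> \<psi> z = 0" using cc_supportE[OF \<psi>(1)] by blast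
  obtain M where M: "M > 0" "\<And>z. \<bar>\<psi> z\<bar> \<le> M" using cc_boundedE[OF \<psi>(1)] by blast
  have ipsi: "integrable lborel (\<lambda>z. \<bar>\<psi> z\<bar>)" by (intro integrable_abs cc_integrable \<psi>)
  define I where "I = (\<integral>z. \<bar>\<psi> z\<bar> \<partial>lborel)"
  have I: "I \<ge> 0" unfolding I_def by (intro integral_nonneg_AE) auto
  have \<psi>m: "\<psi> \<in> borel_measurable borel" by (rule cc_measurable[OF \<psi>(1)])
  have k4: "\<kappa> / (4 * M) > 0" using \<kappa> M by simp
  obtain f1 f2 where fs: "\<And>z. f z = f1 z + f2 z" "loc_int f1" "loc_int f2" "\<And>z. \<bar>f1 z\<bar> \<le> \<bar>f z\<bar>"
    "(\<integral>z. indicator (cball 0 (R + 1)) z * \<bar>f1 z\<bar> \<partial>lborel) < \<kappa> / (4 * M)" "continuous_on {z. snd z < T} f2"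
    by (rule time_split[OF f k4, of "R + 1"], assumption, rule that; assumption)
  \<comment> \<open>Room above the support of \<psi>: points within \<open>e\<close> of it still lie
    before \<open>T\<close>, where \<open>f2\<close> is continuous.\<close>
  define a' where "a' = (a + T) / 2"
  have a': "a < a'" "a' < T" using a by (auto simp: a'_def)
  define K where "K = cball 0 (R + 1) \<inter> {z::(real^'n) \<times> real. snd z \<le> a'}"
  have "closed {z::(real^'n) \<times> real. snd z \<le> a'}" by (intro closed_Collect_le continuous_intros)
  then have "compact K" unfolding K_def by (intro compact_Int_closed) auto
  moreover have "continuous_on K f2" by (rule continuous_on_subset[OF fs(6)]) (use a' in \<open>auto simp: K_def\<close>)
  ultimately have "uniformly_continuous_on K f2" by (intro compact_uniformly_continuous)
  moreover have k2: "\<kappa> / (2 * (I + 1)) > 0" using \<kappa> I by simp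
  ultimately obtain d where d: "d > 0" "\<And>y z. y \<in> K \<Longrightarrow> z \<in> K \<Longrightarrow> dist y z < d \<Longrightarrow> dist (f2 y) (f2 z) < \<kappa> / (2 * (I + 1))"
    unfolding uniformly_continuous_on_def by metis
  define e where "e = min (min d 1) (a' - a)"
  have e: "e > 0" "e \<le> d" "e \<le> 1" "e \<le> a' - a" using d a' by (auto simp: e_def)
  show ?thesis
  proof (rule that[OF e(1)])
    fix \<epsilon> and \<eta> :: "(real^'n) \<times> real \<Rightarrow> real" assume \<epsilon>: "\<epsilon> \<le> e" and m: "mollifier \<epsilon> \<eta>"
    have \<eta>: "cc \<eta>" "\<And>z. \<eta> z \<ge> 0" "\<And>z. norm z \<ge> \<epsilon> \<Longrightarrow> \<eta> z = 0" "(\<integral>z. \<eta> z \<partial>lborel) = 1"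
      using m by (auto simp: mollifier_def)
    have split: "conv f \<eta> z = conv f1 \<eta> z + conv f2 \<eta> z" for z
      using conv_add[OF fs(2,3) \<eta>(1), of z] unfolding fs(1)[symmetric] .
    have close: "\<bar>conv f2 \<eta> z - f2 z\<bar> \<le> \<kappa> / (2 * (I + 1))" if "\<psi> z \<noteq> 0" for z
    proof (rule conv_near[OF fs(3) \<eta>])
      fix y assume y: "dist y z < \<epsilon>"
      have z: "norm z \<le> R" "snd z \<le> a" using R(2)[of z] \<psi>(2)[of z] that by force+
      have "\<bar>snd y - snd z\<bar> \<le> dist y z" using dist_snd_le[of y z] by (simp add: dist_real_def)
      moreover have "norm y \<le> norm z + dist y z" unfolding dist_norm by (rule norm_triangle_sub)
      ultimately have "y \<in> K" "z \<in> K" using z y e \<epsilon> a' by (auto simp: K_def)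
      then show "\<bar>f2 y - f2 z\<bar> \<le> \<kappa> / (2 * (I + 1))"
        using d(2)[of y z] y e \<epsilon> by (simp add: dist_real_def)
    qed
    have i1: "integrable lborel (\<lambda>z. \<bar>conv h \<eta> z\<bar> * \<bar>\<psi> z\<bar>)" if "loc_int h" for h
    proof -
      have "continuous_on UNIV (conv h \<eta>)" by (intro continuous_at_imp_continuous_on ballI conv_continuous that \<eta>)
      then have "cc (\<lambda>z. conv h \<eta> z * \<psi> z)" by (intro cc_mult \<psi>)
      then show ?thesis using integrable_abs[OF cc_integrable] by (simp add: abs_mult[symmetric])
    qed
    have i2: "integrable lborel (\<lambda>z. \<bar>h z\<bar> * \<bar>\<psi> z\<bar>)" if "loc_int h" for h
      using integrable_abs[OF loc_int_mult_cc[OF that \<psi>(1)]] by (simp add: abs_mult)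
    have "(\<integral>z. \<bar>conv f \<eta> z - f z\<bar> * \<bar>\<psi> z\<bar> \<partial>lborel)
      \<le> (\<integral>z. \<bar>conv f1 \<eta> z\<bar> * \<bar>\<psi> z\<bar> + \<bar>f1 z\<bar> * \<bar>\<psi> z\<bar> + \<kappa> / (2 * (I + 1)) * \<bar>\<psi> z\<bar> \<partial>lborel)"
    proof (rule Bochner_Integration.integral_mono')
      show "integrable lborel (\<lambda>z. \<bar>conv f1 \<eta> z\<bar> * \<bar>\<psi> z\<bar> + \<bar>f1 z\<bar> * \<bar>\<psi> z\<bar> + \<kappa> / (2 * (I + 1)) * \<bar>\<psi> z\<bar>)"
        by (intro Bochner_Integration.integrable_add i1 i2 fs integrable_mult_right ipsi)
      fix z
      show "\<bar>conv f \<eta> z - f z\<bar> * \<bar>\<psi> z\<bar> \<le> \<bar>conv f1 \<eta> z\<bar> * \<bar>\<psi> z\<bar> + \<bar>f1 z\<bar> * \<bar>\<psi> z\<bar> + \<kappa> / (2 * (I + 1)) * \<bar>\<psi> z\<bar>"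
      proof (cases "\<psi> z = 0")
        case False
        have "\<bar>conv f \<eta> z - f z\<bar> \<le> \<bar>conv f1 \<eta> z\<bar> + \<bar>f1 z\<bar> + \<kappa> / (2 * (I + 1))"
          using close[OF False] unfolding split fs(1)[of z] by linarith
        from mult_right_mono[OF this, of "\<bar>\<psi> z\<bar>"] show ?thesis by (simp add: distrib_right)
      qed simp
    qed (use I \<kappa> in \<open>auto intro!: add_nonneg_nonneg mult_nonneg_nonneg divide_nonneg_pos\<close>)
    also have "\<dots> = (\<integral>z. \<bar>conv f1 \<eta> z\<bar> * \<bar>\<psi> z\<bar> \<partial>lborel) + (\<integral>z. \<bar>f1 z\<bar> * \<bar>\<psi> z\<bar> \<partial>lborel) + \<kappa> / (2 * (I + 1)) * I"
      unfolding I_def using i1[OF fs(2)] i2[OF fs(2)] ipsi by simp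
    finally have le: "(\<integral>z. \<bar>conv f \<eta> z - f z\<bar> * \<bar>\<psi> z\<bar> \<partial>lborel) \<le> (\<integral>z. \<bar>conv f1 \<eta> z\<bar> * \<bar>\<psi> z\<bar> \<partial>lborel) + (\<integral>z. \<bar>f1 z\<bar> * \<bar>\<psi> z\<bar> \<partial>lborel) + \<kappa> / (2 * (I + 1)) * I" .
    have le1: "(\<integral>z. \<bar>conv f1 \<eta> z\<bar> * \<bar>\<psi> z\<bar> \<partial>lborel) \<le> M * (\<integral>z. indicator (cball 0 (R + 1)) z * \<bar>f1 z\<bar> \<partial>lborel)"
      by (rule conv_L1_bound[OF fs(2) \<eta> \<psi>(1) M(2) R(2)]) (use e \<epsilon> in auto)
    have "(\<integral>z. \<bar>f1 z\<bar> * \<bar>\<psi> z\<bar> \<partial>lborel) \<le> (\<integral>z. M * (indicator (cball 0 (R + 1)) z * \<bar>f1 z\<bar>) \<partial>lborel)"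
    proof (rule Bochner_Integration.integral_mono')
      show "integrable lborel (\<lambda>z. M * (indicator (cball 0 (R + 1)) z * \<bar>f1 z\<bar>))"
        using loc_int_abs[OF fs(2)] by (auto simp: loc_int_def)
      show "\<bar>f1 z\<bar> * \<bar>\<psi> z\<bar> \<le> M * (indicator (cball 0 (R + 1)) z * \<bar>f1 z\<bar>)" for z
      proof (cases "norm z > R")
        case False
        then show ?thesis using mult_left_mono[OF M(2)[of z], of "\<bar>f1 z\<bar>"] by (simp add: mult.commute)
      qed (use M in \<open>simp add: R(2)\<close>)
    qed (use M in auto)
    also have "\<dots> = M * (\<integral>z. indicator (cball 0 (R + 1)) z * \<bar>f1 z\<bar> \<partial>lborel)" by simp
    finally have le2: "(\<integral>z. \<bar>f1 z\<bar> * \<bar>\<psi> z\<bar> \<partial>lborel) \<le> M * (\<integral>z. indicator (cball 0 (R + 1)) z * \<bar>f1 z\<bar> \<partial>lborel)" .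
    have "M * (\<integral>z. indicator (cball 0 (R + 1)) z * \<bar>f1 z\<bar> \<partial>lborel) \<le> M * (\<kappa> / (4 * M))"
      using fs(5) M by (intro mult_left_mono) auto
    then have le3: "M * (\<integral>z. indicator (cball 0 (R + 1)) z * \<bar>f1 z\<bar> \<partial>lborel) \<le> \<kappa> / 4" using M by simp
    have "\<kappa> / (2 * (I + 1)) * I \<le> \<kappa> / 2"
      using \<kappa> I by (simp add: field_simps)
    with le le1 le2 le3 show "(\<integral>z. \<bar>conv f \<eta> z - f z\<bar> * \<bar>\<psi> z\<bar> \<partial>lborel) \<le> \<kappa>" by linarith
  qed
qed


text \<open>After mollification the sign condition may fail, namely where \<open>g\<close> is
  negative, so that w \<le> 0, while the mollified \<open>w\<close> is positive. There
  \<open>soft_pos'\<close> of the mollified \<open>w\<close> is at most the mollification error,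
  since it is Lipschitz and vanishes at \<open>w z\<close>. The error is small in L1 against the
  bounded part of \<open>g\<close>, and the rest of \<open>g\<close> is small in L1 itself. The
  support of \<phi> may cross time 0; the source has the favourable sign.\<close>

lemma kato:
  fixes w g :: "(real^'n) \<times> real \<Rightarrow> real"
  assumes eq: "weak_eq T w g c" and c: "c \<le> 0"
    and w: "loc_int w" "continuous_on (QT T) w" "\<And>z. z \<notin> QT T \<Longrightarrow> w z = 0"
    and g: "loc_int g" "continuous_on (QT T) g" "\<And>z. z \<notin> QT T \<Longrightarrow> g z = 0"
    and sign: "\<And>z. w z > 0 \<Longrightarrow> g z \<ge> 0"
    and j: "jet \<phi> \<phi>t \<phi>x \<phi>xx" and \<phi>0: "\<And>z. \<phi> z \<ge> 0" and \<phi>a: "\<And>z. snd z > a \<Longrightarrow> \<phi> z = 0" and a: "a < T"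
  shows "(\<integral>z. soft_pos (w z) * (- \<phi>t z - (\<Sum>i\<in>UNIV. \<phi>xx i i z)) \<partial>lborel) \<le> 0"
proof (rule field_le_epsilon)
  fix \<kappa> :: real assume \<kappa>: "\<kappa> > 0"
  have \<phi>: "cc \<phi>" using j by (simp add: jet_def)
  define \<psi> where "\<psi> z = - \<phi>t z - (\<Sum>i\<in>UNIV. \<phi>xx i i z)" for z
  have \<psi>: "cc \<psi>" unfolding \<psi>_def[abs_def] by (rule jet_heat_cc[OF j])
  have op: "open {z::(real^'n) \<times> real. snd z > a}" by (intro open_Collect_less continuous_intros)
  have \<psi>a: "\<psi> z = 0" if "snd z > a" for z
    unfolding \<psi>_def using jet_eq_0[OF j op, of z] that \<phi>a by simp
  obtain R where R: "R > 0" "\<And>z. norm z > R \<Longrightarrow> \<phi> z = 0" using cc_supportE[OF \<phi>] by blast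
  obtain M where M: "M > 0" "\<And>z. \<bar>\<phi> z\<bar> \<le> M" using cc_boundedE[OF \<phi>] by blast
  \<comment> \<open>The error budget is \<kappa>/4 for replacing \<open>w\<close> and \<kappa>/4 for
    replacing \<open>g\<close> by mollifications, \<kappa>/8 for the slab part of \<open>g\<close>
    and \<kappa>/4 for the region of wrong sign.\<close>
  have k8: "\<kappa> / (8 * M) > 0" using \<kappa> M by simp
  obtain g1 g2 where gs: "\<And>z. g z = g1 z + g2 z" "loc_int g1" "loc_int g2" "\<And>z. \<bar>g1 z\<bar> \<le> \<bar>g z\<bar>" "\<And>z. \<bar>g2 z\<bar> \<le> \<bar>g z\<bar>"
    "(\<integral>z. indicator (cball 0 R) z * \<bar>g1 z\<bar> \<partial>lborel) < \<kappa> / (8 * M)" "continuous_on {z. snd z < T} g2"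
    by (rule time_split[OF g k8, of R], assumption, rule that; assumption)
  \<comment> \<open>Only \<open>g2\<close> has such a bound; \<open>g\<close> itself may blow up at
    time 0.\<close>
  obtain L where L: "L > 0" "\<And>z. norm z \<le> R \<Longrightarrow> snd z \<le> a \<Longrightarrow> \<bar>g2 z\<bar> \<le> L"
  proof -
    have "closed {z::(real^'n) \<times> real. snd z \<le> a}" by (intro closed_Collect_le continuous_intros)
    then have "compact (cball 0 R \<inter> {z::(real^'n) \<times> real. snd z \<le> a})" by (intro compact_Int_closed) auto
    moreover have "continuous_on (cball 0 R \<inter> {z. snd z \<le> a}) g2"
      by (rule continuous_on_subset[OF gs(7)]) (use a in auto)
    ultimately have "bounded (g2 ` (cball 0 R \<inter> {z. snd z \<le> a}))"
      by (intro compact_imp_bounded compact_continuous_image)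
    then obtain L where "L > 0" "\<forall>y\<in>g2 ` (cball 0 R \<inter> {z. snd z \<le> a}). norm y \<le> L" unfolding bounded_pos by blast
    then show ?thesis by (intro that[of L]) auto
  qed
  have k4: "\<kappa> / 4 > 0" and kL: "\<kappa> / (4 * L) > 0" using \<kappa> L by auto
  obtain e1 where e1: "e1 > 0" "\<And>\<epsilon> \<eta>. \<epsilon> \<le> e1 \<Longrightarrow> mollifier \<epsilon> \<eta> \<Longrightarrow> (\<integral>z. \<bar>conv w \<eta> z - w z\<bar> * \<bar>\<psi> z\<bar> \<partial>lborel) \<le> \<kappa> / 4"
    by (rule conv_L1_close[OF w \<psi> \<psi>a a k4]) (assumption | rule that)+
  obtain e2 where e2: "e2 > 0" "\<And>\<epsilon> \<eta>. \<epsilon> \<le> e2 \<Longrightarrow> mollifier \<epsilon> \<eta> \<Longrightarrow> (\<integral>z. \<bar>conv g \<eta> z - g z\<bar> * \<bar>\<phi> z\<bar> \<partial>lborel) \<le> \<kappa> / 4"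
    by (rule conv_L1_close[OF g \<phi> \<phi>a a k4]) (assumption | rule that)+
  obtain e3 where e3: "e3 > 0" "\<And>\<epsilon> \<eta>. \<epsilon> \<le> e3 \<Longrightarrow> mollifier \<epsilon> \<eta> \<Longrightarrow> (\<integral>z. \<bar>conv w \<eta> z - w z\<bar> * \<bar>\<phi> z\<bar> \<partial>lborel) \<le> \<kappa> / (4 * L)"
    by (rule conv_L1_close[OF w \<phi> \<phi>a a kL]) (assumption | rule that)+
  define \<epsilon> where "\<epsilon> = min (min e1 e2) (min e3 ((T - a) / 2))"
  have \<epsilon>: "\<epsilon> > 0" "\<epsilon> \<le> e1" "\<epsilon> \<le> e2" "\<epsilon> \<le> e3" "a + \<epsilon> < T" using e1 e2 e3 a by (auto simp: \<epsilon>_def min_def field_simps)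
  obtain \<eta> \<eta>t \<eta>x \<eta>xx where je: "jet (\<eta> :: (real^'n) \<times> real \<Rightarrow> real) \<eta>t \<eta>x \<eta>xx"
    and \<eta>: "\<And>z. \<eta> z \<ge> 0" "\<And>z. norm z \<ge> \<epsilon> \<Longrightarrow> \<eta> z = 0" "(\<integral>z. \<eta> z \<partial>lborel) = 1"
    using exists_mollifier[OF \<epsilon>(1)] by metis
  have cce: "cc \<eta>" using je by (simp add: jet_def)
  have m: "mollifier \<epsilon> \<eta>" using \<eta> cce by (simp add: mollifier_def)
  have cw: "continuous_on UNIV (conv w \<eta>)" "continuous_on UNIV (conv g \<eta>)"
    by (auto intro!: continuous_at_imp_continuous_on conv_continuous w g cce)
  have cpj: "continuous_on UNIV (\<lambda>z. soft_pos (conv w \<eta> z))" "continuous_on UNIV (\<lambda>z. soft_pos' (conv w \<eta> z))"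
  proof -
    have "continuous_on UNIV soft_pos" "continuous_on UNIV soft_pos'"
      by (simp_all add: continuous_at_imp_continuous_on isCont_pj)
    then show "continuous_on UNIV (\<lambda>z. soft_pos (conv w \<eta> z))" "continuous_on UNIV (\<lambda>z. soft_pos' (conv w \<eta> z))"
      using continuous_on_compose2[OF _ cw(1) subset_UNIV] by blast+
  qed
  have lw: "loc_int (conv w \<eta>)" "loc_int (conv g \<eta>)" using cw by (auto intro: loc_int_continuous)
  have pjm: "soft_pos \<in> borel_measurable borel" "soft_pos' \<in> borel_measurable borel"
    by (auto intro!: borel_measurable_continuous_onI continuous_at_imp_continuous_on isCont_pj)
  have lpj: "loc_int (\<lambda>z. soft_pos (w z))"
    by (rule loc_int_bound[OF w(1)]) (use w pjm in \<open>auto simp: loc_int_def soft_pos_le_abs\<close>)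
  have iabs: "integrable lborel (\<lambda>z. \<bar>f z - h z\<bar> * \<bar>k z\<bar>)" if "loc_int f" "loc_int h" "cc k" for f h k :: "(real^'n) \<times> real \<Rightarrow> real"
    using integrable_abs[OF loc_int_mult_cc[OF loc_int_diff[OF that(1,2)] that(3)]] by (simp add: abs_mult)
  have A: "(\<integral>z. soft_pos (w z) * \<psi> z \<partial>lborel) - (\<integral>z. soft_pos (conv w \<eta> z) * \<psi> z \<partial>lborel) \<le> \<kappa> / 4"
  proof -
    have i: "integrable lborel (\<lambda>z. soft_pos (w z) * \<psi> z)" "integrable lborel (\<lambda>z. soft_pos (conv w \<eta> z) * \<psi> z)"
      by (intro loc_int_mult_cc lpj \<psi> loc_int_continuous cpj)+
    have "(\<integral>z. soft_pos (w z) * \<psi> z \<partial>lborel) - (\<integral>z. soft_pos (conv w \<eta> z) * \<psi> z \<partial>lborel)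
      = (\<integral>z. soft_pos (w z) * \<psi> z - soft_pos (conv w \<eta> z) * \<psi> z \<partial>lborel)" using i by simp
    also have "\<dots> \<le> (\<integral>z. \<bar>conv w \<eta> z - w z\<bar> * \<bar>\<psi> z\<bar> \<partial>lborel)"
    proof (rule integral_mono)
      show "soft_pos (w z) * \<psi> z - soft_pos (conv w \<eta> z) * \<psi> z \<le> \<bar>conv w \<eta> z - w z\<bar> * \<bar>\<psi> z\<bar>" for z
      proof -
        have "soft_pos (w z) * \<psi> z - soft_pos (conv w \<eta> z) * \<psi> z \<le> \<bar>(soft_pos (w z) - soft_pos (conv w \<eta> z)) * \<psi> z\<bar>"
          by (simp add: left_diff_distrib)
        also have "\<dots> \<le> \<bar>conv w \<eta> z - w z\<bar> * \<bar>\<psi> z\<bar>"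
          using soft_pos_lipschitz[of "w z" "conv w \<eta> z"] by (simp add: abs_mult abs_minus_commute mult_right_mono)
        finally show ?thesis .
      qed
    qed (use i iabs[OF lw(1) w(1) \<psi>] in auto)
    also have "\<dots> \<le> \<kappa> / 4" by (rule e1(2)[OF \<epsilon>(2) m])
    finally show ?thesis .
  qed
  have Bd: "(\<integral>z. soft_pos (conv w \<eta> z) * \<psi> z \<partial>lborel) \<le> - (\<integral>z. soft_pos' (conv w \<eta> z) * conv g \<eta> z * \<phi> z \<partial>lborel)"
    unfolding \<psi>_def by (rule kato_mollified[OF eq c w(1) g(1) j \<phi>0 \<phi>a \<epsilon>(5) je \<eta>(1,2)])
  have "- (\<integral>z. soft_pos' (conv w \<eta> z) * conv g \<eta> z * \<phi> z \<partial>lborel)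
    \<le> (\<integral>z. \<bar>conv g \<eta> z - g z\<bar> * \<bar>\<phi> z\<bar> + M * (indicator (cball 0 R) z * \<bar>g1 z\<bar>)
         + L * (\<bar>conv w \<eta> z - w z\<bar> * \<bar>\<phi> z\<bar>) \<partial>lborel)"
    unfolding Bochner_Integration.integral_minus[symmetric]
  proof (rule integral_mono)
    show "integrable lborel (\<lambda>z. - (soft_pos' (conv w \<eta> z) * conv g \<eta> z * \<phi> z))"
      by (intro cc_integrable cc_uminus cc_mult continuous_intros cw cpj \<phi>)
    show "integrable lborel (\<lambda>z. \<bar>conv g \<eta> z - g z\<bar> * \<bar>\<phi> z\<bar> + M * (indicator (cball 0 R) z * \<bar>g1 z\<bar>)
         + L * (\<bar>conv w \<eta> z - w z\<bar> * \<bar>\<phi> z\<bar>))"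
      using iabs[OF lw(2) g(1) \<phi>] iabs[OF lw(1) w(1) \<phi>] loc_int_abs[OF gs(2)]
      by (auto simp: loc_int_def)
    fix z
    let ?p = "soft_pos' (conv w \<eta> z)"
    show "- (?p * conv g \<eta> z * \<phi> z) \<le> \<bar>conv g \<eta> z - g z\<bar> * \<bar>\<phi> z\<bar> + M * (indicator (cball 0 R) z * \<bar>g1 z\<bar>)
         + L * (\<bar>conv w \<eta> z - w z\<bar> * \<bar>\<phi> z\<bar>)"
    proof (cases "\<phi> z = 0")
      case False
      have z: "norm z \<le> R" "snd z \<le> a" using R(2)[of z] \<phi>a[of z] False by force+
      have 1: "?p * (g z - conv g \<eta> z) \<le> \<bar>conv g \<eta> z - g z\<bar>"
      proof -
        have "?p * (g z - conv g \<eta> z) \<le> ?p * \<bar>conv g \<eta> z - g z\<bar>" using soft_pos_bounds by (intro mult_left_mono) auto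
        also have "\<dots> \<le> \<bar>conv g \<eta> z - g z\<bar>" using soft_pos_bounds by (intro mult_left_le_one_le) auto
        finally show ?thesis .
      qed
      have 2: "- (?p * g z) \<le> \<bar>g1 z\<bar> + L * \<bar>conv w \<eta> z - w z\<bar>"
      proof (cases "g z \<ge> 0")
        case True
        then have "?p * g z \<ge> 0" using soft_pos_bounds by simp
        then show ?thesis using L by (smt (verit) mult_nonneg_nonneg abs_ge_zero)
      next
        case False
        then have "w z \<le> 0" using sign[of z] by linarith
        then have p: "?p \<le> \<bar>conv w \<eta> z - w z\<bar>" using soft_pos'_lipschitz[of "conv w \<eta> z" "w z"] soft_pos_bounds(1)[of "conv w \<eta> z"] by (simp add: soft_pos_le_0)
        have A: "- (?p * g z) \<le> ?p * \<bar>g1 z\<bar> + ?p * \<bar>g2 z\<bar>"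
        proof -
          have "- g z \<le> \<bar>g1 z\<bar> + \<bar>g2 z\<bar>" unfolding gs(1)[of z] by linarith
          from mult_left_mono[OF this soft_pos_bounds(1)[of "conv w \<eta> z"]] show ?thesis by (simp add: distrib_left)
        qed
        have B: "?p * \<bar>g1 z\<bar> \<le> \<bar>g1 z\<bar>" using soft_pos_bounds by (intro mult_left_le_one_le) auto
        have C: "?p * \<bar>g2 z\<bar> \<le> \<bar>conv w \<eta> z - w z\<bar> * L"
          using p L(2)[OF z] soft_pos_bounds by (intro mult_mono) auto
        from A B C show ?thesis unfolding mult.commute[of L] by linarith
      qed
      have "- (?p * conv g \<eta> z) \<le> \<bar>conv g \<eta> z - g z\<bar> + \<bar>g1 z\<bar> + L * \<bar>conv w \<eta> z - w z\<bar>"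
        using 1 2 by (simp add: right_diff_distrib)
      from mult_right_mono[OF this \<phi>0[of z]]
      have "- (?p * conv g \<eta> z * \<phi> z) \<le> \<bar>conv g \<eta> z - g z\<bar> * \<phi> z + \<bar>g1 z\<bar> * \<phi> z + L * (\<bar>conv w \<eta> z - w z\<bar> * \<phi> z)"
        by (simp add: distrib_right mult.assoc)
      moreover have "\<bar>g1 z\<bar> * \<phi> z \<le> M * (indicator (cball 0 R) z * \<bar>g1 z\<bar>)"
        using z M(2)[of z] mult_left_mono[of "\<phi> z" M "\<bar>g1 z\<bar>"] by (simp add: mult.commute)
      ultimately show ?thesis using \<phi>0[of z] by simp
    qed (use M L in \<open>simp add: mult_nonneg_nonneg\<close>)
  qed
  also have "\<dots> = (\<integral>z. \<bar>conv g \<eta> z - g z\<bar> * \<bar>\<phi> z\<bar> \<partial>lborel) + M * (\<integral>z. indicator (cball 0 R) z * \<bar>g1 z\<bar> \<partial>lborel)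
         + L * (\<integral>z. \<bar>conv w \<eta> z - w z\<bar> * \<bar>\<phi> z\<bar> \<partial>lborel)"
    using iabs[OF lw(2) g(1) \<phi>] iabs[OF lw(1) w(1) \<phi>] loc_int_abs[OF gs(2)]
    by (simp add: loc_int_def)
  finally have D: "- (\<integral>z. soft_pos' (conv w \<eta> z) * conv g \<eta> z * \<phi> z \<partial>lborel) \<le> \<dots>" .
  have "M * (\<integral>z. indicator (cball 0 R) z * \<bar>g1 z\<bar> \<partial>lborel) \<le> M * (\<kappa> / (8 * M))"
    using gs(6) M by (intro mult_left_mono) auto
  then have D1: "M * (\<integral>z. indicator (cball 0 R) z * \<bar>g1 z\<bar> \<partial>lborel) \<le> \<kappa> / 8" using M by simp
  have "L * (\<integral>z. \<bar>conv w \<eta> z - w z\<bar> * \<bar>\<phi> z\<bar> \<partial>lborel) \<le> L * (\<kappa> / (4 * L))"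
    using e3(2)[OF \<epsilon>(4) m] L by (intro mult_left_mono) auto
  then have D2: "L * (\<integral>z. \<bar>conv w \<eta> z - w z\<bar> * \<bar>\<phi> z\<bar> \<partial>lborel) \<le> \<kappa> / 4" using L by simp
  have "(\<integral>z. soft_pos (w z) * \<psi> z \<partial>lborel) \<le> 0 + \<kappa>"
    using A Bd D D1 D2 e2(2)[OF \<epsilon>(3) m] \<kappa> by linarith
  then show "(\<integral>z. soft_pos (w z) * (- \<phi>t z - (\<Sum>i\<in>UNIV. \<phi>xx i i z)) \<partial>lborel) \<le> 0 + \<kappa>"
    by (simp add: \<psi>_def)
qed

section \<open>Fundamental solutions extended by zero\<close>

definition cyl_ext :: "real \<Rightarrow> ((real^'n) \<times> real \<Rightarrow> real) \<Rightarrow> (real^'n) \<times> real \<Rightarrow> real" where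
  "cyl_ext T u z = (if z \<in> QT T then u z else 0)"

lemma open_QT: "open (QT T)"
  unfolding QT_def by (intro open_Times) auto

lemma mem_QT: "z \<in> QT T \<longleftrightarrow> 0 < snd z \<and> snd z < T"
  by (cases z) (auto simp: QT_def)

lemma continuous_on_ext: "continuous_on (QT T) u \<Longrightarrow> continuous_on (QT T) (cyl_ext T u)"
  by (subst continuous_on_cong[OF refl]) (auto simp: cyl_ext_def)

lemma ext_measurable:
  assumes "continuous_on (QT T) u" shows "cyl_ext T u \<in> borel_measurable borel"
proof -
  have "(\<lambda>z. indicator (QT T) z *\<^sub>R u z) \<in> borel_measurable borel"
    by (intro borel_measurable_continuous_on_indicator assms borel_open open_QT)
  moreover have "(\<lambda>z. indicator (QT T) z *\<^sub>R u z) = cyl_ext T u" by (auto simp: cyl_ext_def indicator_def)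
  ultimately show ?thesis by simp
qed

text \<open>Integrability down to time 0 comes from the closure in the hypothesis: a closed ball
  meets \<open>closure (QT T)\<close> in a compact set, but not \<open>QT T\<close> itself.\<close>

lemma loc_int_ext:
  assumes T: "T > 0" and c: "continuous_on (QT T) u" and l: "L1_loc (closure (QT T)) u"
  shows "loc_int (cyl_ext T u)"
  unfolding loc_int_def
proof (intro conjI allI ext_measurable c)
  fix R :: real
  let ?K = "cball 0 R \<inter> closure (QT T)"
  have "compact ?K" by (intro compact_Int_closed) auto
  then have "set_integrable lebesgue ?K u" using l by (auto simp: L1_loc_def)
  then have "set_integrable lebesgue (cball 0 R \<inter> QT T) u"
    by (rule set_integrable_subset) (use open_QT in \<open>auto simp: closure_def intro!: sets.Int sets_completionI_sets borel_open\<close>)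
  then have "integrable lebesgue (\<lambda>z. indicator (cball 0 R) z * cyl_ext T u z)"
    unfolding set_integrable_def
    by (rule Bochner_Integration.integrable_cong[THEN iffD1, OF refl, rotated]) (auto simp: cyl_ext_def indicator_def)
  then show "integrable lborel (\<lambda>z. indicator (cball 0 R) z * cyl_ext T u z)"
    by (subst (asm) integrable_completion)
       (intro borel_measurable_times borel_measurable_indicator ext_measurable c | simp)+
qed

lemma dir_deriv_time:
  assumes "dir_deriv (0,1) \<phi> \<phi>t"
  shows "((\<lambda>s. \<phi> (x, s)) has_vector_derivative \<phi>t (x, t)) (at t within I)"
proof -
  have "((\<lambda>s. \<phi> ((x, 0) + s *\<^sub>R (0, 1))) has_real_derivative \<phi>t ((x, 0) + t *\<^sub>R (0,1))) (at t)"
    by (rule dir_derivD[OF assms])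
  then show ?thesis
    by (simp add: has_real_derivative_iff_has_vector_derivative has_vector_derivative_at_within)
qed

text \<open>Needed for the endpoint 0: a one-sided derivative is unique there because 0 is an
  accumulation point of the interval.\<close>

lemma at_within_Ico_neq_bot:
  fixes t :: real assumes "t \<in> {0..<T}" shows "at t within {0..<T} \<noteq> bot"
proof -
  have "t islimpt {t..(t + T) / 2}" using assms by (simp add: islimpt_Icc)
  then have "t islimpt {0..<T}" by (rule islimpt_subset) (use assms in auto)
  then show ?thesis by (simp add: trivial_limit_within)
qed

lemma jet_dx: 
  assumes "jet \<phi> \<phi>t \<phi>x \<phi>xx"
  shows "dx i \<phi> = \<phi>x i" "dx j (\<phi>x i) = \<phi>xx i j" "dx_exists i I \<phi>" "dx_exists j I (\<phi>x i)"
proof -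
  have *: "((\<lambda>s. \<phi> (x + s *\<^sub>R axis i 1, t)) has_real_derivative \<phi>x i (x, t)) (at 0)"
    "((\<lambda>s. \<phi>x i (x + s *\<^sub>R axis j 1, t)) has_real_derivative \<phi>xx i j (x, t)) (at 0)" for i j x t
  proof -
    have "((\<lambda>s. \<phi> ((x, t) + s *\<^sub>R (axis i 1, 0))) has_real_derivative \<phi>x i (x, t)) (at 0)"
      "((\<lambda>s. \<phi>x i ((x, t) + s *\<^sub>R (axis j 1, 0))) has_real_derivative \<phi>xx i j (x, t)) (at 0)"
      using assms unfolding jet_def dir_deriv_def by blast+
    then show "((\<lambda>s. \<phi> (x + s *\<^sub>R axis i 1, t)) has_real_derivative \<phi>x i (x, t)) (at 0)"
      "((\<lambda>s. \<phi>x i (x + s *\<^sub>R axis j 1, t)) has_real_derivative \<phi>xx i j (x, t)) (at 0)" by simp_all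
  qed
  show "dx i \<phi> = \<phi>x i" "dx j (\<phi>x i) = \<phi>xx i j" using *[THEN DERIV_imp_deriv] by (auto simp: dx_def fun_eq_iff)
  show "dx_exists i I \<phi>" "dx_exists j I (\<phi>x i)" unfolding dx_exists_def field_differentiable_def using * by blast+
qed

lemma jet_dt:
  assumes "jet \<phi> \<phi>t \<phi>x \<phi>xx" "snd z \<in> {0..<T}"
  shows "dt {0..<T} \<phi> z = \<phi>t z"
proof -
  obtain x t where z: "z = (x, t)" by (cases z)
  have "vector_derivative (\<lambda>s. \<phi> (x, s)) (at t within {0..<T}) = \<phi>t (x, t)"
    by (rule vector_derivative_within[OF at_within_Ico_neq_bot dir_deriv_time])
       (use assms in \<open>auto simp: z jet_def\<close>)
  then show ?thesis by (simp add: z dt_def)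
qed

text \<open>Vanishing after \<open>a < T\<close> makes the support compact in the half-open strip.
  Nothing is asked at time 0, so the test function can see the initial datum.\<close>

lemma jet_C21_0:
  fixes \<phi> :: "(real^'n) \<times> real \<Rightarrow> real"
  assumes j: "jet \<phi> \<phi>t \<phi>x \<phi>xx" and a: "a < T" "\<And>z. snd z > a \<Longrightarrow> \<phi> z = 0"
  shows "\<phi> \<in> C21_0 {0..<T}"
proof -
  obtain R where R: "R > 0" "\<And>z. norm z > R \<Longrightarrow> \<phi> z = 0" using cc_supportE[of \<phi>] j by (auto simp: jet_def)
  have "continuous_on (UNIV \<times> {0..<T}) (dt {0..<T} \<phi>)"
    by (subst continuous_on_cong[OF refl jet_dt[OF j]])
       (use j in \<open>auto simp: jet_def intro: continuous_on_subset[OF cc_continuous]\<close>)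
  moreover have "(\<lambda>s. \<phi> (x, s)) differentiable (at t within {0..<T})" for x t
    using dir_deriv_time[of \<phi> \<phi>t x t "{0..<T}"] j by (auto simp: jet_def intro: differentiableI_vector)
  ultimately have "C21 {0..<T} \<phi>"
    using j unfolding C21_def jet_dx[OF j]
    by (auto simp: jet_def intro: continuous_on_subset[OF cc_continuous] jet_dx[OF j])
  moreover have "\<exists>K. compact K \<and> K \<subseteq> UNIV \<times> {0..<T} \<and> (\<forall>z\<in>UNIV \<times> {0..<T} - K. \<phi> z = 0)"
  proof (intro exI conjI ballI)
    show "compact (cball 0 R \<inter> {z::(real^'n) \<times> real. 0 \<le> snd z \<and> snd z \<le> a})"
      by (intro compact_Int_closed closed_Collect_conj closed_Collect_le continuous_intros) auto
    show "cball 0 R \<inter> {z::(real^'n) \<times> real. 0 \<le> snd z \<and> snd z \<le> a} \<subseteq> UNIV \<times> {0..<T}"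
      using a by auto
    fix z :: "(real^'n) \<times> real" assume z: "z \<in> UNIV \<times> {0..<T} - (cball 0 R \<inter> {z. 0 \<le> snd z \<and> snd z \<le> a})"
    then have "norm z > R \<or> snd z > a" by (auto simp: not_le)
    then show "\<phi> z = 0" using R(2) a(2) by blast
  qed
  ultimately show ?thesis unfolding C21_0_def by simp
qed

lemma weak_form_eq_jet:
  fixes u \<phi> :: "(real^'n) \<times> real \<Rightarrow> real"
  assumes T: "T > 0" and w: "loc_int (cyl_ext T u)" and g: "loc_int (cyl_ext T (\<lambda>z. h (snd z) * u z powr q))"
    and j: "jet \<phi> \<phi>t \<phi>x \<phi>xx"
  shows "weak_form h q T {0..<T} u \<phi> =
     (\<integral>y. cyl_ext T u y * (- \<phi>t y - (\<Sum>i\<in>UNIV. \<phi>xx i i y)) \<partial>lborel) + (\<integral>y. cyl_ext T (\<lambda>z. h (snd z) * u z powr q) y * \<phi> y \<partial>lborel)"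
proof -
  let ?F = "\<lambda>y. cyl_ext T u y * (- \<phi>t y - (\<Sum>i\<in>UNIV. \<phi>xx i i y)) + cyl_ext T (\<lambda>z. h (snd z) * u z powr q) y * \<phi> y"
  have i: "integrable lborel (\<lambda>y. cyl_ext T u y * (- \<phi>t y - (\<Sum>i\<in>UNIV. \<phi>xx i i y)))"
    "integrable lborel (\<lambda>y. cyl_ext T (\<lambda>z. h (snd z) * u z powr q) y * \<phi> y)"
    by (rule loc_int_mult_cc[OF w jet_heat_cc[OF j]])
       (rule loc_int_mult_cc[OF g], use j in \<open>simp add: jet_def\<close>)
  have "weak_form h q T {0..<T} u \<phi> = (\<integral>y. ?F y \<partial>lebesgue)"
    unfolding weak_form_def set_lebesgue_integral_def
  proof (rule Bochner_Integration.integral_cong[OF refl])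
    fix z
    have "laplacian \<phi> z = (\<Sum>i\<in>UNIV. \<phi>xx i i z)" by (simp add: laplacian_def jet_dx[OF j])
    moreover have "dt {0..<T} \<phi> z = \<phi>t z" if "z \<in> QT T" using that jet_dt[OF j] by (simp add: mem_QT)
    ultimately show "indicator (QT T) z *\<^sub>R (- u z * dt {0..<T} \<phi> z - u z * laplacian \<phi> z + h (snd z) * u z powr q * \<phi> z) = ?F z"
      by (auto simp: cyl_ext_def algebra_simps)
  qed
  also have "\<dots> = (\<integral>y. ?F y \<partial>lborel)"
    using i by (intro integral_completion) (auto dest!: borel_measurable_integrable)
  finally show ?thesis using i by simp
qed

lemma fundamental_solution_weak_eq:
  fixes u :: "(real^'n) \<times> real \<Rightarrow> real"
  assumes T: "T > 0" and f: "fundamental_solution h q T k u"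
    and w: "loc_int (cyl_ext T u)" and g: "loc_int (cyl_ext T (\<lambda>z. h (snd z) * u z powr q))"
  shows "weak_eq T (cyl_ext T u) (cyl_ext T (\<lambda>z. h (snd z) * u z powr q)) k"
  unfolding weak_eq_def
proof (intro allI impI)
  fix \<phi> \<phi>t :: "(real^'n) \<times> real \<Rightarrow> real" and \<phi>x \<phi>xx a assume j: "jet \<phi> \<phi>t \<phi>x \<phi>xx" and a: "a < T" "\<forall>z. snd z > a \<longrightarrow> \<phi> z = 0"
  have "\<phi> \<in> C21_0 {0..<T}" using jet_C21_0[OF j a(1)] a(2) by blast
  then have "weak_form h q T {0..<T} u \<phi> = k * \<phi> (0, 0)" using f by (auto simp: fundamental_solution_def)
  then show "(\<integral>y. cyl_ext T u y * (- \<phi>t y - (\<Sum>i\<in>UNIV. \<phi>xx i i y)) \<partial>lborel)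
    = - (\<integral>y. cyl_ext T (\<lambda>z. h (snd z) * u z powr q) y * \<phi> y \<partial>lborel) + k * \<phi> 0"
    unfolding weak_form_eq_jet[OF T w g j] by (simp add: zero_prod_def)
qed

lemma weak_eq_diff:
  fixes w w' g g' :: "(real^'n) \<times> real \<Rightarrow> real"
  assumes e: "weak_eq T w g c" "weak_eq T w' g' c'" and l: "loc_int w" "loc_int g" "loc_int w'" "loc_int g'"
  shows "weak_eq T (\<lambda>z. w z - w' z) (\<lambda>z. g z - g' z) (c - c')"
  unfolding weak_eq_def
proof (intro allI impI)
  fix \<phi> \<phi>t :: "(real^'n) \<times> real \<Rightarrow> real" and \<phi>x \<phi>xx a assume j: "jet \<phi> \<phi>t \<phi>x \<phi>xx" and a: "a < T" "\<forall>z. snd z > a \<longrightarrow> \<phi> z = 0"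
  have 1: "(\<integral>y. w y * (- \<phi>t y - (\<Sum>i\<in>UNIV. \<phi>xx i i y)) \<partial>lborel) = - (\<integral>y. g y * \<phi> y \<partial>lborel) + c * \<phi> 0"
    and 2: "(\<integral>y. w' y * (- \<phi>t y - (\<Sum>i\<in>UNIV. \<phi>xx i i y)) \<partial>lborel) = - (\<integral>y. g' y * \<phi> y \<partial>lborel) + c' * \<phi> 0"
    using e j a unfolding weak_eq_def by blast+
  have i: "integrable lborel (\<lambda>y. v y * (- \<phi>t y - (\<Sum>i\<in>UNIV. \<phi>xx i i y)))" "integrable lborel (\<lambda>y. v y * \<phi> y)"
    if "loc_int v" for v
    by (rule loc_int_mult_cc[OF that jet_heat_cc[OF j]])
       (rule loc_int_mult_cc[OF that], use j in \<open>simp add: jet_def\<close>)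
  show "(\<integral>y. (w y - w' y) * (- \<phi>t y - (\<Sum>i\<in>UNIV. \<phi>xx i i y)) \<partial>lborel)
    = - (\<integral>y. (g y - g' y) * \<phi> y \<partial>lborel) + (c - c') * \<phi> 0"
    unfolding left_diff_distrib
    using Bochner_Integration.integral_diff[OF i(1)[OF l(1)] i(1)[OF l(3)]]
      Bochner_Integration.integral_diff[OF i(2)[OF l(2)] i(2)[OF l(4)]] 1 2 by simp
qed

text \<open>Since \<open>W\<close> is 0 up to time 0, the mean value over a cylinder with top at a
  small time is an integral over a thin slab, and this tends to 0 by dominated convergence. All
  cylinders with axis over the bounded set \<open>A\<close> lie in one ball, hence the
  uniformity.\<close>

lemma initial_decay:
  fixes W :: "(real^'n) \<times> real \<Rightarrow> real" and A :: "(real^'n) set"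
  assumes W: "loc_int W" "\<And>z. W z \<ge> 0" "continuous_on (QT T) W" "\<And>z. snd z \<le> 0 \<Longrightarrow> W z = 0"
    and A: "bounded A" and r: "r > 0"
    and sub: "\<And>x0 t0. x0 \<in> A \<Longrightarrow> t0 < T \<Longrightarrow> subcal W (cball x0 (2 * r) \<times> {t0 - 2 * r\<^sup>2..t0})"
    and \<epsilon>: "\<epsilon> > 0"
  obtains \<tau> where "\<tau> > 0" "\<And>x t. x \<in> A \<Longrightarrow> 0 < t \<Longrightarrow> t < \<tau> \<Longrightarrow> t < T \<Longrightarrow> W (x, t) \<le> \<epsilon>"
proof -
  obtain C where C: "C \<ge> 0" and mv:
    "\<And>(W :: (real^'n) \<times> real \<Rightarrow> real) x0 t0.
      loc_int W \<Longrightarrow> \<forall>z. W z \<ge> 0 \<Longrightarrow> isCont W (x0, t0) \<Longrightarrow>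
      subcal W (cball x0 (2 * r) \<times> {t0 - 2 * r\<^sup>2..t0}) \<Longrightarrow>
      W (x0, t0) \<le> C * (\<integral>y. W y * indicator (cball x0 (2 * r) \<times> {t0 - 2 * r\<^sup>2..t0}) y \<partial>lborel)"
  proof (rule subcaloric_mean_value[OF r, where 'n='n])
    fix C assume C: "C \<ge> 0" and mv: "\<And>(W :: (real^'n) \<times> real \<Rightarrow> real) x0 t0.
      loc_int W \<Longrightarrow> \<forall>z. W z \<ge> 0 \<Longrightarrow> isCont W (x0, t0) \<Longrightarrow>
      subcal W (cball x0 (2 * r) \<times> {t0 - 2 * r\<^sup>2..t0}) \<Longrightarrow>
      W (x0, t0) \<le> C * (\<integral>y. W y * indicator (cball x0 (2 * r) \<times> {t0 - 2 * r\<^sup>2..t0}) y \<partial>lborel)"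
    show thesis by (rule that[OF C], rule mv)
  qed
  obtain D where D: "\<And>x. x \<in> A \<Longrightarrow> norm x \<le> D" using A by (auto simp: bounded_iff)
  \<comment> \<open>A radius that contains every cylinder of the mean value inequality with centre
    over \<open>A\<close> and top between 0 and \<open>T\<close>.\<close>
  define R where "R = D + 2 * r + 2 * r\<^sup>2 + \<bar>T\<bar>"
  define S where "S \<tau> = {z::(real^'n) \<times> real. norm z \<le> R \<and> snd z \<le> \<tau>}" for \<tau>
  have Sm: "S \<tau> \<in> sets borel" for \<tau>
    unfolding S_def by (intro borel_closed closed_Collect_conj closed_Collect_le continuous_intros)
  have iS: "integrable lborel (\<lambda>y. W y * indicator (S \<tau>) y)" for \<tau>
    by (rule loc_int_mult[OF W(1) borel_measurable_indicator[OF Sm], where M=1 and R=R])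
       (auto simp: indicator_def S_def)
  have "(\<lambda>n. \<integral>y. W y * indicator (S (1 / real (Suc n))) y \<partial>lborel) \<longlonglongrightarrow> (\<integral>y. 0 \<partial>(lborel :: ((real^'n) \<times> real) measure))"
  proof (rule integral_dominated_convergence[where w="\<lambda>y. W y * indicator (S 1) y"])
    show "(\<lambda>y. W y * indicator (S (1 / real (Suc n))) y) \<in> borel_measurable lborel" for n
      using iS by (rule borel_measurable_integrable)
    show "AE y in lborel. norm (W y * indicator (S (1 / real (Suc n))) y) \<le> W y * indicator (S 1) y" for n
    proof (intro AE_I2)
      fix y :: "(real^'n) \<times> real"
      have "snd y \<le> 1" if "snd y \<le> 1 / real (Suc n)"
      proof -
        note that
        also have "1 / real (Suc n) \<le> 1" by simp
        finally show ?thesis .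
      qed
      then have "y \<in> S (1 / real (Suc n)) \<Longrightarrow> y \<in> S 1" unfolding S_def mem_Collect_eq by blast
      then show "norm (W y * indicator (S (1 / real (Suc n))) y) \<le> W y * indicator (S 1) y"
        using W(2)[of y] by (cases "y \<in> S (1 / real (Suc n))") simp_all
    qed
    show "AE y in lborel. (\<lambda>n. W y * indicator (S (1 / real (Suc n))) y) \<longlonglongrightarrow> 0"
    proof (intro AE_I2)
      fix y show "(\<lambda>n. W y * indicator (S (1 / real (Suc n))) y) \<longlonglongrightarrow> 0"
      proof (cases "snd y > 0")
        case True
        have "eventually (\<lambda>n. 1 / real (Suc n) < snd y) sequentially"
          using order_tendstoD(2)[OF LIMSEQ_Suc[OF lim_1_over_n] True] by simp
        then have "eventually (\<lambda>n. W y * indicator (S (1 / real (Suc n))) y = 0) sequentially"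
          by eventually_elim (auto simp: S_def)
        then show ?thesis by (rule tendsto_eventually)
      qed (simp add: W(4))
    qed
  qed (use iS in auto)
  moreover have "\<epsilon> / (C + 1) > 0" using \<epsilon> C by simp
  ultimately have "eventually (\<lambda>n. (\<integral>y. W y * indicator (S (1 / real (Suc n))) y \<partial>lborel) < \<epsilon> / (C + 1)) sequentially"
    by (auto dest: order_tendstoD(2))
  then obtain n where n: "(\<integral>y. W y * indicator (S (1 / real (Suc n))) y \<partial>lborel) < \<epsilon> / (C + 1)"
    by (auto dest: eventually_happens)
  show ?thesis
  proof (rule that[of "1 / real (Suc n)"])
    fix x t assume x: "x \<in> A" and t: "0 < t" "t < 1 / real (Suc n)" "t < T"
    have "W (x, t) \<le> C * (\<integral>y. W y * indicator (cball x (2 * r) \<times> {t - 2 * r\<^sup>2..t}) y \<partial>lborel)"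
    proof (rule mv[OF W(1)])
      show "\<forall>z. W z \<ge> 0" using W(2) by blast
      show "isCont W (x, t)"
      proof -
        have "\<forall>z\<in>QT T. isCont W z" using W(3) by (simp add: continuous_on_eq_continuous_at open_QT)
        then show ?thesis using t by (simp add: mem_QT)
      qed
    qed (rule sub[OF x t(3)])
    also have "\<dots> \<le> C * (\<integral>y. W y * indicator (S (1 / real (Suc n))) y \<partial>lborel)"
    proof (rule mult_left_mono[OF integral_mono' C])
      fix y
      show "W y * indicator (cball x (2 * r) \<times> {t - 2 * r\<^sup>2..t}) y \<le> W y * indicator (S (1 / real (Suc n))) y"
      proof (cases "y \<in> cball x (2 * r) \<times> {t - 2 * r\<^sup>2..t}")
        case True
        have "norm y \<le> norm (fst y) + \<bar>snd y\<bar>" by (metis norm_Pair_le prod.collapse real_norm_def)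
        moreover have "norm (fst y) \<le> norm (fst y - x) + norm x" by (metis add.commute norm_triangle_sub)
        moreover have "norm (fst y - x) \<le> 2 * r" "t - 2 * r\<^sup>2 \<le> snd y" "snd y \<le> t"
          using True by (auto simp: dist_norm norm_minus_commute)
        ultimately have "y \<in> S (1 / real (Suc n))"
          using D[OF x] t zero_le_power2[of r] unfolding S_def R_def by simp
        then show ?thesis using True by simp
      qed (use W(2) in auto)
      show "0 \<le> W y * indicator (S (1 / real (Suc n))) y" using W(2) by simp
    qed (rule iS)
    also have "\<dots> \<le> C * (\<epsilon> / (C + 1))" using n C by (intro mult_left_mono) auto
    also have "\<dots> \<le> \<epsilon>" using \<epsilon> C by (simp add: field_simps)
    finally show "W (x, t) \<le> \<epsilon>" .
  qed simp
qed

section \<open>Comparison and the Keller--Osserman bound\<close>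

text \<open>Only the diagonal second derivatives enter the Laplacian; the mixed ones, which
  \<open>jet\<close> carries to match \<open>C21\<close>, are left out.\<close>

definition jet_on :: "((real^'n) \<times> real) set \<Rightarrow> ((real^'n) \<times> real \<Rightarrow> real) \<Rightarrow> ((real^'n) \<times> real \<Rightarrow> real) \<Rightarrow>
    ('n \<Rightarrow> (real^'n) \<times> real \<Rightarrow> real) \<Rightarrow> ('n \<Rightarrow> (real^'n) \<times> real \<Rightarrow> real) \<Rightarrow> bool" where
  "jet_on U \<psi> \<psi>t \<psi>x \<psi>xx \<longleftrightarrow> continuous_on U \<psi> \<and> continuous_on U \<psi>t \<and> (\<forall>i. continuous_on U (\<psi>xx i)) \<and>
     dir_deriv_on U (0, 1) \<psi> \<psi>t \<and> (\<forall>i. dir_deriv_on U (axis i 1, 0) \<psi> (\<psi>x i)) \<and>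
     (\<forall>i. dir_deriv_on U (axis i 1, 0) (\<psi>x i) (\<psi>xx i))"

text \<open>Viscosity subsolutions of \<open>\<partial>\<^sub>t w - \<Delta> w = f\<close> in the cylinder.\<close>

definition visc :: "real \<Rightarrow> ((real^'n) \<times> real \<Rightarrow> real) \<Rightarrow> ((real^'n) \<times> real \<Rightarrow> real) \<Rightarrow> bool" where
  "visc T w f \<longleftrightarrow> (\<forall>U z \<psi> \<psi>t \<psi>x \<psi>xx. open U \<longrightarrow> z \<in> U \<longrightarrow> U \<subseteq> QT T \<longrightarrow> jet_on U \<psi> \<psi>t \<psi>x \<psi>xx \<longrightarrow>
     (\<forall>y\<in>U. w y - \<psi> y \<le> w z - \<psi> z) \<longrightarrow> \<psi>t z - (\<Sum>i\<in>UNIV. \<psi>xx i z) \<le> f z)"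

lemma weak_eq_visc:
  assumes "weak_eq T w g c" "loc_int w" "loc_int g" "continuous_on (QT T) w" "continuous_on (QT T) g"
  shows "visc T w (\<lambda>z. - g z)"
  unfolding visc_def
proof (intro allI impI)
  fix U z \<psi> \<psi>t \<psi>x \<psi>xx
  assume U: "open U" "z \<in> U" "U \<subseteq> QT T" and j: "jet_on U \<psi> \<psi>t \<psi>x \<psi>xx" and m: "\<forall>y\<in>U. w y - \<psi> y \<le> w z - \<psi> z"
  show "\<psi>t z - (\<Sum>i\<in>UNIV. \<psi>xx i z) \<le> - g z"
    by (rule weak_eq_touch[OF assms(1-3) U, where \<psi>=\<psi> and \<psi>x=\<psi>x])
       (use j m in \<open>auto simp: jet_on_def intro: continuous_on_subset[OF assms(4) U(3)] continuous_on_subset[OF assms(5) U(3)]\<close>)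
qed

text \<open>A positive maximum of the difference would lie in \<open>U\<close>, and \<psi> shifted
  by a constant would touch \<open>w\<close> from above there. Hence the strict inequality for
  \<psi> is asked only where it lies below \<open>w\<close>; for the absorption term this is exactly
  where it can be verified.\<close>

lemma visc_comparison:
  assumes v: "visc T w f" and K: "compact K" "K \<subseteq> QT T" and U: "open U" "U \<subseteq> K"
    and c: "continuous_on K w" "continuous_on K \<psi>" and j: "jet_on U \<psi> \<psi>t \<psi>x \<psi>xx"
    and bd: "\<And>z. z \<in> K - U \<Longrightarrow> w z \<le> \<psi> z"
    and super: "\<And>z. z \<in> U \<Longrightarrow> w z > \<psi> z \<Longrightarrow> \<psi>t z - (\<Sum>i\<in>UNIV. \<psi>xx i z) > f z"
    and z: "z \<in> K"
  shows "w z \<le> \<psi> z"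
proof (rule ccontr)
  assume n: "\<not> w z \<le> \<psi> z"
  have "continuous_on K (\<lambda>z. w z - \<psi> z)" by (intro continuous_intros c)
  then obtain y where y: "y \<in> K" "\<And>x. x \<in> K \<Longrightarrow> w x - \<psi> x \<le> w y - \<psi> y"
    using continuous_attains_sup[OF K(1)] z by blast
  have "w y > \<psi> y" using y(2)[OF z] n by linarith
  moreover from this have yU: "y \<in> U" using bd[of y] y(1) by force
  ultimately have "\<psi>t y - (\<Sum>i\<in>UNIV. \<psi>xx i y) > f y" using super by blast
  moreover have "\<forall>x\<in>U. w x - \<psi> x \<le> w y - \<psi> y" using y U by blast
  then have "\<psi>t y - (\<Sum>i\<in>UNIV. \<psi>xx i y) \<le> f y"
    using v U K j yU unfolding visc_def by (meson order_trans)
  ultimately show False by linarith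
qed

lemma closed_prod_strip: "closed {z::(real^'n) \<times> real. (norm (fst z - x0))\<^sup>2 \<le> c \<and> a \<le> snd z \<and> snd z \<le> b}"
  by (intro closed_Collect_conj closed_Collect_le continuous_intros)

lemma compact_prod_strip: "compact {z::(real^'n) \<times> real. (norm (fst z - x0))\<^sup>2 \<le> c \<and> a \<le> snd z \<and> snd z \<le> b}"
proof (rule compact_eq_bounded_closed[THEN iffD2, OF conjI[OF _ closed_prod_strip]])
  have "{z::(real^'n) \<times> real. (norm (fst z - x0))\<^sup>2 \<le> c \<and> a \<le> snd z \<and> snd z \<le> b} \<subseteq> cball x0 (sqrt c) \<times> {a..b}"
    by (auto simp: dist_norm norm_minus_commute intro: real_le_rsqrt)
  then show "bounded {z::(real^'n) \<times> real. (norm (fst z - x0))\<^sup>2 \<le> c \<and> a \<le> snd z \<and> snd z \<le> b}"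
    by (rule bounded_subset[rotated]) (intro bounded_Times bounded_cball bounded_closed_interval)
qed

text \<open>The a priori bound comes from a barrier of Keller--Osserman type that is infinite on the whole
  boundary of the cylinder \<open>B\<^sub>1(x0) \<times> (t0/2, b)\<close>.\<close>

lemma keller_osserman:
  fixes q T T' :: real and h :: "real \<Rightarrow> real"
  assumes q: "q > 1" and T: "0 < T'" "T' < T" and h: "mono_on {0..} h" "\<And>t. t > 0 \<Longrightarrow> h t > 0"
  obtains C where "C > 0"
    "\<And>(u :: (real^'n) \<times> real \<Rightarrow> real) x0 t0. continuous_on (QT T) u \<Longrightarrow> visc T u (\<lambda>z. - (h (snd z) * u z powr q)) \<Longrightarrow>
       0 < t0 \<Longrightarrow> t0 \<le> T' \<Longrightarrow> u (x0, t0) \<le> (C / (t0 * h (t0 / 2))) powr (1 / (q - 1))"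
proof -
  \<comment> \<open>The exponent for which \<beta> q = \<beta> + 1: the power \<open>q\<close> of
    the barrier then has the same singularity at the boundary as the worst terms of its time
    derivative and Laplacian.\<close>
  define \<beta> where "\<beta> = 1 / (q - 1)"
  have \<beta>: "\<beta> > 0" "\<beta> * (q - 1) = 1" using q by (auto simp: \<beta>_def)
  have \<beta>q: "\<beta> * q = \<beta> + 1" using \<beta>(2) by (simp add: algebra_simps)
  define N where "N = real CARD('n)"
  have N: "N > 0" by (simp add: N_def)
  \<comment> \<open>The first summand bounds the time derivative of the barrier and the second its
    Laplacian, after the common singular factor has been taken out.\<close>
  define K0 where "K0 = \<beta> * T + T\<^sup>2 * (8 * \<beta> * (2 * \<beta> + 1) + 4 * N * \<beta>)"
  have K0: "K0 \<ge> 0" using \<beta> T N by (simp add: K0_def)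
  define C where "C = (K0 + 1) / ((T - T') / 4)"
  have C: "C > 0" using K0 T by (simp add: C_def)
  show ?thesis
  proof (rule that[OF C])
    fix u :: "(real^'n) \<times> real \<Rightarrow> real" and x0 t0
    assume uc: "continuous_on (QT T) u" and v: "visc T u (\<lambda>z. - (h (snd z) * u z powr q))" and t0: "0 < t0" "t0 \<le> T'"
    \<comment> \<open>Starting at t0/2 bounds \<open>h\<close> below by its value there. Ending a
      fixed time after \<open>t0\<close>, yet before \<open>T\<close>, keeps \<open>C\<close>
      independent of \<open>t0\<close>.\<close>
    define a b where "a = t0 / 2" and "b = t0 + (T - T') / 2"
    have ab: "0 < a" "a < t0" "t0 < b" "b < T" "b - a \<le> T" using t0 T by (auto simp: a_def b_def field_simps)
    define m where "m = h a"
    have m: "m > 0" using h ab by (simp add: m_def)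
    \<comment> \<open>Chosen so that m c^(q-1) = K0 + 1; the extra 1 makes the barrier a strict
      supersolution.\<close>
    define c where "c = ((K0 + 1) / m) powr \<beta>"
    have c: "c > 0" using K0 m by (simp add: c_def)
    have cq: "m * c powr (q - 1) = K0 + 1"
      using K0 m \<beta> by (simp add: c_def powr_powr)
    define \<theta> where "\<theta> s = (s - a) * (b - s)" for s
    define F where "F p s = c * (\<theta> s powr (- \<beta>) * (1 - p) powr (- 2 * \<beta>))" for p s
    define Fs where "Fs p s = c * ((- \<beta>) * \<theta> s powr (- \<beta> - 1) * ((b - s) - (s - a)) * (1 - p) powr (- 2 * \<beta>))" for p s
    define Fp where "Fp p s = c * (\<theta> s powr (- \<beta>) * (2 * \<beta> * (1 - p) powr (- 2 * \<beta> - 1)))" for p s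
    define Fpp where "Fpp p s = c * (\<theta> s powr (- \<beta>) * (2 * \<beta> * ((2 * \<beta> + 1) * (1 - p) powr (- 2 * \<beta> - 2))))" for p s
    let ?P = "\<lambda>z::(real^'n) \<times> real. (norm (fst z - x0))\<^sup>2"
    have \<theta>0: "\<theta> s > 0" if "a < s" "s < b" for s using that by (simp add: \<theta>_def)
    define Ks where "Ks = {z::(real^'n) \<times> real. ?P z \<le> 1 \<and> a \<le> snd z \<and> snd z \<le> b}"
    have "compact Ks" unfolding Ks_def by (rule compact_prod_strip)
    moreover have "continuous_on Ks u"
      by (rule continuous_on_subset[OF uc]) (use ab in \<open>auto simp: Ks_def mem_QT\<close>)
    ultimately have "bounded (u ` Ks)" by (intro compact_imp_bounded compact_continuous_image)
    then obtain L where L: "L > 0" "\<And>z. z \<in> Ks \<Longrightarrow> \<bar>u z\<bar> \<le> L" by (auto simp: bounded_pos)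
    define D where "D = T + T\<^sup>2 + 1"
    have D: "D > 0" "T \<le> D" "T\<^sup>2 \<le> D" using T by (auto simp: D_def add_nonneg_pos)
    \<comment> \<open>The barrier is infinite on the boundary of the full cylinder, so the
      comparison takes place on one shrunk by \<sigma>. The last bound makes the barrier at least
      \<open>L\<close>, hence at least \<open>u\<close>, on the new boundary; the others keep the
      point \<open>(x0, t0)\<close> inside.\<close>
    define \<sigma> where "\<sigma> = min (min (1 / 2) ((b - t0) / 2)) (min ((t0 - a) / 2) ((c / L) powr (q - 1) / D))"
    have \<sigma>: "\<sigma> > 0" "\<sigma> \<le> 1 / 2" "\<sigma> \<le> (b - t0) / 2" "\<sigma> \<le> (t0 - a) / 2" "\<sigma> * D \<le> (c / L) powr (q - 1)"
    proof -
      have p: "(c / L) powr (q - 1) > 0" using c L by simp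
      show "\<sigma> > 0" using p ab D by (auto simp: \<sigma>_def)
      show "\<sigma> \<le> 1 / 2" "\<sigma> \<le> (b - t0) / 2" "\<sigma> \<le> (t0 - a) / 2" unfolding \<sigma>_def by linarith+
      have "\<sigma> \<le> (c / L) powr (q - 1) / D" unfolding \<sigma>_def by linarith
      then show "\<sigma> * D \<le> (c / L) powr (q - 1)" using D by (simp add: pos_le_divide_eq)
    qed
    define K where "K = {z::(real^'n) \<times> real. ?P z \<le> 1 - \<sigma> \<and> a + \<sigma> \<le> snd z \<and> snd z \<le> b - \<sigma>}"
    define U where "U = {z::(real^'n) \<times> real. ?P z < 1 - \<sigma> \<and> a + \<sigma> < snd z \<and> snd z < b - \<sigma>}"
    have inK: "0 < 1 - ?P z" "a < snd z" "snd z < b" if "z \<in> K" for z using that \<sigma> by (auto simp: K_def)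
    have UK: "U \<subseteq> K" by (auto simp: U_def K_def)
    have "u (x0, t0) \<le> F (?P (x0, t0)) (snd (x0, t0))"
    proof (rule visc_comparison[OF v, where K=K and U=U and \<psi>="\<lambda>z. F (?P z) (snd z)" and \<psi>t="\<lambda>z. Fs (?P z) (snd z)"
          and \<psi>x="\<lambda>i z. 2 * (fst z - x0) $ i * Fp (?P z) (snd z)"
          and \<psi>xx="\<lambda>i z. 4 * (fst z - x0) $ i * (fst z - x0) $ i * Fpp (?P z) (snd z) + (if i = i then 2 * Fp (?P z) (snd z) else 0)"])
      show "compact K" unfolding K_def by (rule compact_prod_strip)
      show KQ: "K \<subseteq> QT T" using inK ab by (force simp: mem_QT)
      show "open U" unfolding U_def by (intro open_Collect_conj open_Collect_less continuous_intros)
      show "U \<subseteq> K" by (rule UK)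
      show "continuous_on K u" by (rule continuous_on_subset[OF uc KQ])
      have nz: "\<theta> (snd z) \<noteq> 0" "1 - ?P z \<noteq> 0" if "z \<in> K" for z using inK[OF that] \<theta>0[of "snd z"] by auto
      have c\<theta>: "continuous_on K (\<lambda>z. \<theta> (snd z))" unfolding \<theta>_def by (intro continuous_intros)
      have cP: "continuous_on K (\<lambda>z. (1 - ?P z) powr e)" "continuous_on K (\<lambda>z. \<theta> (snd z) powr e)" for e
        using nz by (auto intro!: continuous_on_powr c\<theta> continuous_intros)
      have cF: "continuous_on K (\<lambda>z. F (?P z) (snd z))" "continuous_on K (\<lambda>z. Fs (?P z) (snd z))"
        "continuous_on K (\<lambda>z. Fp (?P z) (snd z))" "continuous_on K (\<lambda>z. Fpp (?P z) (snd z))"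
        unfolding F_def Fs_def Fp_def Fpp_def by (intro continuous_intros cP)+
      show "continuous_on K (\<lambda>z. F (?P z) (snd z))" by (rule cF)
      have dP: "((\<lambda>p. (1 - p) powr e) has_real_derivative (- e) * (1 - p) powr (e - 1)) (at p)" if "1 - p > 0" for e p :: real
        using that by (auto intro!: derivative_eq_intros)
      have d\<theta>: "((\<lambda>s. \<theta> s powr e) has_real_derivative e * \<theta> s powr (e - 1) * ((b - s) - (s - a))) (at s)"
        if "\<theta> s > 0" for e s
      proof -
        have "(\<theta> has_real_derivative ((b - s) - (s - a))) (at s)"
          unfolding \<theta>_def[abs_def] by (auto intro!: derivative_eq_intros)
        from DERIV_fun_powr[OF this that, of e] show ?thesis by simp
      qed
      show "jet_on U (\<lambda>z. F (?P z) (snd z)) (\<lambda>z. Fs (?P z) (snd z)) (\<lambda>i z. 2 * (fst z - x0) $ i * Fp (?P z) (snd z))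
         (\<lambda>i z. 4 * (fst z - x0) $ i * (fst z - x0) $ i * Fpp (?P z) (snd z) + (if i = i then 2 * Fp (?P z) (snd z) else 0))"
        unfolding jet_on_def
      proof (intro conjI allI)
        show "continuous_on U (\<lambda>z. F (?P z) (snd z))" "continuous_on U (\<lambda>z. Fs (?P z) (snd z))"
          by (rule continuous_on_subset[OF cF(1) UK]) (rule continuous_on_subset[OF cF(2) UK])
        show "continuous_on U (\<lambda>z. 4 * (fst z - x0) $ i * (fst z - x0) $ i * Fpp (?P z) (snd z) + (if i = i then 2 * Fp (?P z) (snd z) else 0))" for i
          unfolding if_True simp_thms(6)
          by (intro continuous_intros continuous_on_subset[OF cF(3) UK] continuous_on_subset[OF cF(4) UK])
        show "dir_deriv_on U (0, 1) (\<lambda>z. F (?P z) (snd z)) (\<lambda>z. Fs (?P z) (snd z))"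
        proof (rule radial_dir_deriv_on_t)
          fix z assume "z \<in> U"
          then have "\<theta> (snd z) > 0" using UK inK \<theta>0 by blast
          then show "((\<lambda>s. F (?P z) s) has_real_derivative Fs (?P z) (snd z)) (at (snd z))"
            unfolding F_def Fs_def by (intro DERIV_cmult DERIV_cmult_right d\<theta>)
        qed
        show "dir_deriv_on U (axis i 1, 0) (\<lambda>z. F (?P z) (snd z)) (\<lambda>z. 2 * (fst z - x0) $ i * Fp (?P z) (snd z))" for i
        proof (rule radial_dir_deriv_on_x)
          fix z assume "z \<in> U"
          then have "1 - ?P z > 0" using UK inK by blast
          from dP[OF this, of "- 2 * \<beta>"]
          show "((\<lambda>p. F p (snd z)) has_real_derivative Fp (?P z) (snd z)) (at (?P z))"
            unfolding F_def Fp_def by (intro DERIV_cmult) simp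
        qed
        show "dir_deriv_on U (axis i 1, 0) (\<lambda>z. 2 * (fst z - x0) $ i * Fp (?P z) (snd z))
          (\<lambda>z. 4 * (fst z - x0) $ i * (fst z - x0) $ i * Fpp (?P z) (snd z) + (if i = i then 2 * Fp (?P z) (snd z) else 0))" for i
        proof (rule radial_dir_deriv_on_xx)
          fix z assume "z \<in> U"
          then have "1 - ?P z > 0" using UK inK by blast
          from dP[OF this, of "- 2 * \<beta> - 1"]
          show "((\<lambda>p. Fp p (snd z)) has_real_derivative Fpp (?P z) (snd z)) (at (?P z))"
            unfolding Fp_def Fpp_def by (intro DERIV_cmult) (erule DERIV_cong, simp add: algebra_simps)
        qed
      qed
      show "u z \<le> F (?P z) (snd z)" if z: "z \<in> K - U" for z
      proof -
        have zK: "z \<in> K" using z by simp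
        note i = inK[OF zK]
        define d where "d = \<theta> (snd z) * (1 - ?P z)\<^sup>2"
        have d0: "d > 0" using i \<theta>0 by (simp add: d_def)
        have P01: "0 \<le> 1 - ?P z" "1 - ?P z \<le> 1" using i by auto
        have P1: "(1 - ?P z)\<^sup>2 \<le> 1" using P01 by (intro power_le_one) auto
        have tT: "0 \<le> snd z - a" "snd z - a \<le> T" "0 \<le> b - snd z" "b - snd z \<le> T" using i ab by auto
        have dle: "d \<le> \<sigma> * D"
        proof -
          have "1 - ?P z = \<sigma> \<or> snd z - a = \<sigma> \<or> b - snd z = \<sigma>" using z by (auto simp: K_def U_def)
          then show ?thesis
          proof (elim disjE)
            assume e: "1 - ?P z = \<sigma>"
            have "d = ((snd z - a) * (b - snd z)) * (\<sigma> * \<sigma>)"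
              by (simp only: d_def \<theta>_def e) (simp only: power2_eq_square)
            also have "\<dots> \<le> (T * T) * (\<sigma> * 1)"
              using tT \<sigma> T by (intro mult_mono) auto
            also have "\<dots> \<le> \<sigma> * D" using D \<sigma> by (simp add: power2_eq_square mult.commute)
            finally show ?thesis .
          next
            assume e: "snd z - a = \<sigma>"
            have "d \<le> (\<sigma> * T) * 1" unfolding d_def \<theta>_def e using tT \<sigma> T P1 by (intro mult_mono) auto
            also have "\<dots> \<le> \<sigma> * D" using D \<sigma> by simp
            finally show ?thesis .
          next
            assume e: "b - snd z = \<sigma>"
            have "d \<le> (T * \<sigma>) * 1" unfolding d_def \<theta>_def e using tT \<sigma> T P1 by (intro mult_mono) auto
            also have "\<dots> \<le> \<sigma> * D" using D \<sigma> by (simp add: mult.commute)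
            finally show ?thesis .
          qed
        qed
        have "F (?P z) (snd z) = c * d powr (- \<beta>)"
        proof -
          have "(1 - ?P z)\<^sup>2 = (1 - ?P z) powr 2" using i by simp
          then have "((1 - ?P z)\<^sup>2) powr (- \<beta>) = (1 - ?P z) powr (- 2 * \<beta>)" by (simp only: powr_powr) simp
          then show ?thesis unfolding F_def d_def using i \<theta>0[of "snd z"] by (simp only: powr_mult)
        qed
        moreover have "L / c \<le> d powr (- \<beta>)"
        proof -
          have "L / c = ((c / L) powr (q - 1)) powr (- \<beta>)"
            using c L \<beta> by (simp add: powr_powr mult.commute powr_minus_divide)
          also have "\<dots> \<le> d powr (- \<beta>)"
            using d0 dle \<sigma>(5) \<beta> by (intro powr_mono2') auto
          finally show ?thesis .
        qed
        then have "L \<le> c * d powr (- \<beta>)" using c by (simp add: field_simps)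
        moreover have "u z \<le> L" using L(2)[of z] zK \<sigma> by (auto simp: K_def Ks_def)
        ultimately show ?thesis by linarith
      qed
      show "- (h (snd z) * u z powr q) < Fs (?P z) (snd z) -
          (\<Sum>i\<in>UNIV. 4 * (fst z - x0) $ i * (fst z - x0) $ i * Fpp (?P z) (snd z) + (if i = i then 2 * Fp (?P z) (snd z) else 0))"
        if z: "z \<in> U" and gt: "F (?P z) (snd z) < u z" for z
      proof -
        have zK: "z \<in> K" using z UK by blast
        note i = inK[OF zK]
        let ?p = "?P z" and ?s = "snd z"
        have \<theta>p: "\<theta> ?s > 0" using i \<theta>0 by blast
        define X where "X = \<theta> ?s powr (- \<beta> - 1) * (1 - ?p) powr (- 2 * \<beta> - 2)"
        have X: "X > 0" using \<theta>p i by (simp add: X_def)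
        have e1: "(1 - ?p) powr (- 2 * \<beta>) = (1 - ?p) powr (- 2 * \<beta> - 2) * (1 - ?p)\<^sup>2"
          using i powr_add[of "1 - ?p" "- 2 * \<beta> - 2" 2] by simp
        have e2: "(1 - ?p) powr (- 2 * \<beta> - 1) = (1 - ?p) powr (- 2 * \<beta> - 2) * (1 - ?p)"
        proof -
          have "- 2 * \<beta> - 1 = (- 2 * \<beta> - 2) + 1" by simp
          then show ?thesis using i by (simp only: powr_add powr_one)
        qed
        have e3: "\<theta> ?s powr (- \<beta>) = \<theta> ?s powr (- \<beta> - 1) * \<theta> ?s"
          using \<theta>p powr_add[of "\<theta> ?s" "- \<beta> - 1" 1] by simp
        have Fs: "Fs ?p ?s = - (c * X * (\<beta> * ((b - ?s) - (?s - a)) * (1 - ?p)\<^sup>2))"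
          unfolding Fs_def e1 X_def by (simp add: algebra_simps)
        have Lap: "4 * ?p * Fpp ?p ?s + 2 * N * Fp ?p ?s
          = c * X * (\<theta> ?s * (8 * ?p * \<beta> * (2 * \<beta> + 1) + 4 * N * \<beta> * (1 - ?p)))"
          unfolding Fpp_def Fp_def e2 e3 X_def by (simp add: algebra_simps)
        have b1: "\<beta> * ((b - ?s) - (?s - a)) * (1 - ?p)\<^sup>2 \<le> \<beta> * T * 1"
        proof -
          have "(b - ?s) - (?s - a) \<le> T" using i ab by linarith
          then have "\<beta> * ((b - ?s) - (?s - a)) * (1 - ?p)\<^sup>2 \<le> \<beta> * T * (1 - ?p)\<^sup>2"
            using \<beta> by (intro mult_right_mono mult_left_mono) auto
          also have "\<dots> \<le> \<beta> * T * 1" using \<beta> T i by (intro mult_left_mono power_le_one) auto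
          finally show ?thesis .
        qed
        have b2: "\<theta> ?s * (8 * ?p * \<beta> * (2 * \<beta> + 1) + 4 * N * \<beta> * (1 - ?p)) \<le> T\<^sup>2 * (8 * \<beta> * (2 * \<beta> + 1) + 4 * N * \<beta>)"
        proof (rule mult_mono)
          show "\<theta> ?s \<le> T\<^sup>2" unfolding \<theta>_def power2_eq_square using i ab T by (intro mult_mono) auto
          have "8 * ?p * \<beta> * (2 * \<beta> + 1) \<le> 8 * 1 * \<beta> * (2 * \<beta> + 1)" using i \<beta> by (intro mult_right_mono) auto
          moreover have "4 * N * \<beta> * (1 - ?p) \<le> 4 * N * \<beta> * 1" using i \<beta> N by (intro mult_left_mono) auto
          ultimately show "8 * ?p * \<beta> * (2 * \<beta> + 1) + 4 * N * \<beta> * (1 - ?p) \<le> 8 * \<beta> * (2 * \<beta> + 1) + 4 * N * \<beta>" by simp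
          show "0 \<le> 8 * ?p * \<beta> * (2 * \<beta> + 1) + 4 * N * \<beta> * (1 - ?p)" using i \<beta> N by (intro add_nonneg_nonneg mult_nonneg_nonneg) auto
        qed auto
        have "c * X * (\<beta> * ((b - ?s) - (?s - a)) * (1 - ?p)\<^sup>2 + \<theta> ?s * (8 * ?p * \<beta> * (2 * \<beta> + 1) + 4 * N * \<beta> * (1 - ?p))) \<le> c * X * K0"
          using b1 b2 c X unfolding K0_def by (intro mult_left_mono) auto
        then have "Fs ?p ?s - (4 * ?p * Fpp ?p ?s + 2 * N * Fp ?p ?s) \<ge> - (c * X * K0)"
          unfolding Fs Lap by (simp add: distrib_left)
        moreover have "c * X * K0 < c * X * (K0 + 1)" using c X by simp
        moreover have "c * X * (K0 + 1) \<le> h ?s * u z powr q"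
        proof -
          have "F ?p ?s powr q = c powr q * X"
          proof -
            have "- \<beta> * q = - \<beta> - 1" "- 2 * \<beta> * q = - 2 * \<beta> - 2" using \<beta>q by simp_all
            then show ?thesis unfolding F_def X_def using c \<theta>p i by (simp only: powr_mult powr_powr)
          qed
          moreover have "c powr q = c powr (q - 1) * c" using c powr_add[of c "q - 1" 1] by simp
          ultimately have "m * F ?p ?s powr q = (m * c powr (q - 1)) * (c * X)" by (simp add: mult_ac)
          then have "c * X * (K0 + 1) = m * F ?p ?s powr q" unfolding cq by (simp add: mult_ac)
          also have "\<dots> \<le> h ?s * u z powr q"
          proof (rule mult_mono)
            show "m \<le> h ?s" unfolding m_def using i ab by (intro mono_onD[OF h(1)]) auto
            have "F ?p ?s \<ge> 0" using c by (simp add: F_def)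
            then show "F ?p ?s powr q \<le> u z powr q" using gt q by (intro powr_mono2) auto
            show "0 \<le> h ?s" using h(2)[of ?s] i ab by simp
          qed simp
          finally show ?thesis .
        qed
        ultimately show ?thesis unfolding radial_laplacian N_def by linarith
      qed
      show "(x0, t0) \<in> K" using \<sigma> by (auto simp: K_def)
    qed
    also have "F (?P (x0, t0)) (snd (x0, t0)) = (C / (t0 * h (t0 / 2))) powr (1 / (q - 1))"
    proof -
      have th: "\<theta> t0 = t0 * ((T - T') / 4)" by (simp add: \<theta>_def a_def b_def)
      have "F 0 t0 = ((K0 + 1) / m) powr \<beta> * (t0 * ((T - T') / 4)) powr (- \<beta>)" by (simp add: F_def c_def th)
      also have "\<dots> = ((K0 + 1) / m / (t0 * ((T - T') / 4))) powr \<beta>"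
        using K0 m t0 T by (subst powr_divide) (auto simp: powr_minus_divide)
      also have "(K0 + 1) / m / (t0 * ((T - T') / 4)) = C / (t0 * h (t0 / 2))" by (simp add: C_def m_def a_def)
      finally show ?thesis by (simp add: \<beta>_def)
    qed
    finally show "u (x0, t0) \<le> (C / (t0 * h (t0 / 2))) powr (1 / (q - 1))" .
  qed
qed

section \<open>The moving front\<close>

lemma dir_deriv_on_sum:
  "finite I \<Longrightarrow> (\<And>j. j \<in> I \<Longrightarrow> dir_deriv_on U e (k j) (k' j)) \<Longrightarrow>
    dir_deriv_on U e (\<lambda>z. \<Sum>j\<in>I. k j z) (\<lambda>z. \<Sum>j\<in>I. k' j z)"
  unfolding dir_deriv_on_def by (auto intro!: DERIV_sum)

lemma dir_deriv_on_time:
  fixes U :: "((real^'n) \<times> real) set"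
  assumes "\<And>z. z \<in> U \<Longrightarrow> ((\<lambda>s. F (fst z) s) has_real_derivative F' (fst z) (snd z)) (at (snd z))"
  shows "dir_deriv_on U (0, 1) (\<lambda>z. F (fst z) (snd z)) (\<lambda>z. F' (fst z) (snd z))"
  unfolding dir_deriv_on_def
proof
  fix z assume z: "z \<in> U"
  have "((\<lambda>s. F (fst z) (snd z + s)) has_real_derivative F' (fst z) (snd z) * 1) (at 0)"
    by (rule DERIV_chain2[where f="\<lambda>s. F (fst z) s"])
       (use assms[OF z] in \<open>auto intro!: derivative_eq_intros\<close>)
  then show "((\<lambda>s. F (fst (z + s *\<^sub>R (0, 1))) (snd (z + s *\<^sub>R (0, 1)))) has_real_derivative F' (fst z) (snd z)) (at 0)"
    by simp
qed

lemma bounded_cube: "bounded {x::real^'n. \<forall>i. \<bar>(x - x0) $ i\<bar> \<le> R}"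
proof (rule boundedI)
  fix x assume "x \<in> {x::real^'n. \<forall>i. \<bar>(x - x0) $ i\<bar> \<le> R}"
  then have "(\<Sum>i\<in>UNIV. \<bar>(x - x0) $ i\<bar>) \<le> (\<Sum>i\<in>(UNIV::'n set). R)" by (intro sum_mono) auto
  then have "norm (x - x0) \<le> real CARD('n) * R" using norm_le_l1_cart[of "x - x0"] by simp
  then show "norm x \<le> real CARD('n) * R + norm x0" using norm_triangle_sub[of x x0] by simp
qed

text \<open>In each coordinate direction the barrier is \<open>exp (t B\<^sup>2 - B p)\<close>, where \<open>p\<close> is the distance to a
  face of the shrinking cube of half-width \<open>\<rho>\<close>. It equals \<open>exp (t B\<^sup>2)\<close> on that face, and the speed
  \<open>4 B\<close> of the face makes it a supersolution of the heat equation.\<close>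

lemma barrier_bound:
  fixes w f :: "(real^'n) \<times> real \<Rightarrow> real" and B B' \<rho> :: "real \<Rightarrow> real"
  assumes v: "visc T w f" and cw: "continuous_on (QT T) w" and f: "\<And>z. z \<in> QT T \<Longrightarrow> w z > 0 \<Longrightarrow> f z \<le> 0"
    and T: "T' \<le> T"
    and B: "\<And>t. 0 < t \<Longrightarrow> t < T' \<Longrightarrow> (B has_real_derivative B' t) (at t)"
      "\<And>t. 0 < t \<Longrightarrow> t < T' \<Longrightarrow> B' t \<le> 0" "\<And>t. 0 < t \<Longrightarrow> t < T' \<Longrightarrow> - (t * B' t) \<le> 2 * B t"
      "\<And>t. 0 < t \<Longrightarrow> t < T' \<Longrightarrow> 0 \<le> B t" "continuous_on {0<..<T'} B'"
    and \<rho>: "\<And>t. 0 < t \<Longrightarrow> t < T' \<Longrightarrow> (\<rho> has_real_derivative - 4 * B t) (at t)"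
      "\<And>t. 0 < t \<Longrightarrow> t < T' \<Longrightarrow> 0 < \<rho> t" "\<And>t. 0 < t \<Longrightarrow> t < T' \<Longrightarrow> \<rho> t \<le> R"
    and bd: "\<And>x t. 0 < t \<Longrightarrow> t < T' \<Longrightarrow> (\<And>i. \<bar>(x - x0) $ i\<bar> \<le> \<rho> t) \<Longrightarrow> w (x, t) \<le> exp (t * (B t)\<^sup>2)"
    and init: "\<And>\<epsilon>. \<epsilon> > 0 \<Longrightarrow> \<exists>\<tau>>0. \<forall>x t. 0 < t \<longrightarrow> t < \<tau> \<longrightarrow> t < T' \<longrightarrow> (\<forall>i. \<bar>(x - x0) $ i\<bar> \<le> R) \<longrightarrow> w (x, t) \<le> \<epsilon>"
    and t2: "0 < t2" "t2 < T'"
  shows "w (x0, t2) \<le> 2 * real CARD('n) * exp (t2 * (B t2)\<^sup>2 - B t2 * \<rho> t2)"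
proof -
  \<comment> \<open>Fixed before \<epsilon>, so that the error \<epsilon>/(t3 - t2) in the final
    estimate tends to 0 with \<epsilon>.\<close>
  define t3 where "t3 = (t2 + T') / 2"
  have t3: "t2 < t3" "t3 < T'" using t2 by (auto simp: t3_def)
  define y where "y j z = (fst z - x0) $ j" for j and z :: "(real^'n) \<times> real"
  define ex where "ex \<sigma> j z = exp (snd z * (B (snd z))\<^sup>2 - B (snd z) * (\<rho> (snd z) - \<sigma> * y j z))" for \<sigma> :: real and j z
  define ext' where "ext' \<sigma> j z = ex \<sigma> j z * ((B (snd z))\<^sup>2 + snd z * (2 * B (snd z) * B' (snd z))
      - (B' (snd z) * (\<rho> (snd z) - \<sigma> * y j z) + B (snd z) * (- 4 * B (snd z))))" for \<sigma> :: real and j z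
  define s where "s j z = ex 1 j z + ex (- 1) j z" for j z
  define st where "st j z = ext' 1 j z + ext' (- 1) j z" for j z
  let ?I = "{z::(real^'n) \<times> real. 0 < snd z \<and> snd z < T'}"
  have contB: "continuous_on {0<..<T'} B" "continuous_on {0<..<T'} \<rho>"
    by (rule continuous_at_imp_continuous_on, use DERIV_isCont[OF B(1)] in force)
       (rule continuous_at_imp_continuous_on, use DERIV_isCont[OF \<rho>(1)] in force)
  have cs: "continuous_on ?I (\<lambda>z. B (snd z))" "continuous_on ?I (\<lambda>z. B' (snd z))" "continuous_on ?I (\<lambda>z. \<rho> (snd z))"
    by (rule continuous_on_compose2[OF contB(1)] continuous_on_compose2[OF B(5)] continuous_on_compose2[OF contB(2)];
        auto intro!: continuous_intros)+
  have cy: "continuous_on A (y j)" for A j unfolding y_def[abs_def] by (intro continuous_intros)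
  have ce: "continuous_on ?I (ex \<sigma> j)" "continuous_on ?I (ext' \<sigma> j)" for \<sigma> j
    unfolding ext'_def[abs_def] ex_def[abs_def] by (intro continuous_intros cs cy)+
  have dt: "dir_deriv_on ?I (0, 1) (ex \<sigma> j) (ext' \<sigma> j)" for \<sigma> j
    unfolding ex_def[abs_def] ext'_def[abs_def] y_def
  proof (rule dir_deriv_on_time)
    fix z assume z: "z \<in> ?I"
    note d = B(1)[of "snd z"] \<rho>(1)[of "snd z"]
    have "((\<lambda>s. s * (B s)\<^sup>2 - B s * (\<rho> s - \<sigma> * (fst z - x0) $ j)) has_real_derivative
       (B (snd z))\<^sup>2 + snd z * (2 * B (snd z) * B' (snd z))
      - (B' (snd z) * (\<rho> (snd z) - \<sigma> * (fst z - x0) $ j) + B (snd z) * (- 4 * B (snd z)))) (at (snd z))"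
      using z d by (auto intro!: derivative_eq_intros)
    from DERIV_chain2[OF DERIV_exp this]
    show "((\<lambda>s. exp (s * (B s)\<^sup>2 - B s * (\<rho> s - \<sigma> * (fst z - x0) $ j))) has_real_derivative
       exp (snd z * (B (snd z))\<^sup>2 - B (snd z) * (\<rho> (snd z) - \<sigma> * (fst z - x0) $ j)) * ((B (snd z))\<^sup>2 + snd z * (2 * B (snd z) * B' (snd z))
      - (B' (snd z) * (\<rho> (snd z) - \<sigma> * (fst z - x0) $ j) + B (snd z) * (- 4 * B (snd z))))) (at (snd z))" .
  qed
  have dx: "dir_deriv_on U (axis i 1, 0) (ex \<sigma> j) (\<lambda>z. if i = j then \<sigma> * B (snd z) * ex \<sigma> j z else 0)" for \<sigma> i j U
    unfolding dir_deriv_on_def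
  proof
    fix z :: "(real^'n) \<times> real"
    have yy: "y j (z + r *\<^sub>R (axis i 1, 0)) = y j z + r * (if i = j then 1 else 0)" for r
      by (auto simp: y_def axis_def)
    have sn: "snd (z + r *\<^sub>R (axis i 1, 0)) = snd z" for r by simp
    have "((\<lambda>r. snd z * (B (snd z))\<^sup>2 - B (snd z) * (\<rho> (snd z) - \<sigma> * (y j z + r * (if i = j then 1 else 0)))) has_real_derivative
       \<sigma> * B (snd z) * (if i = j then 1 else 0)) (at 0)"
      by (auto intro!: derivative_eq_intros)
    from DERIV_chain2[OF DERIV_exp this]
    show "((\<lambda>r. ex \<sigma> j (z + r *\<^sub>R (axis i 1, 0))) has_real_derivative (if i = j then \<sigma> * B (snd z) * ex \<sigma> j z else 0)) (at 0)"
      unfolding ex_def yy sn by (rule DERIV_cong) simp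
  qed
  have dxB: "dir_deriv_on U (axis i 1, 0) (\<lambda>z. \<sigma> * B (snd z) * ex \<sigma> i z) (\<lambda>z. \<sigma> * B (snd z) * (\<sigma> * B (snd z) * ex \<sigma> i z))" for \<sigma> i U
    using dx[of U i \<sigma> i] unfolding dir_deriv_on_def by (auto intro!: DERIV_cmult)
  have main: "w (x0, t2) \<le> (\<Sum>j\<in>UNIV. s j (x0, t2)) + \<epsilon> + \<epsilon> / (t3 - t2)" if \<epsilon>: "\<epsilon> > 0" for \<epsilon>
  proof -
    obtain \<tau> where \<tau>: "\<tau> > 0" "\<And>x t. 0 < t \<Longrightarrow> t < \<tau> \<Longrightarrow> t < T' \<Longrightarrow> (\<And>i. \<bar>(x - x0) $ i\<bar> \<le> R) \<Longrightarrow> w (x, t) \<le> \<epsilon>"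
      using init[OF \<epsilon>] by blast
    define t1 where "t1 = min (\<tau> / 2) (t2 / 2)"
    have t1: "0 < t1" "t1 < \<tau>" "t1 < t2" using \<tau> t2 by (auto simp: t1_def)
    have bdd: "bounded {x. \<forall>i. \<bar>(x - x0) $ i\<bar> \<le> R}" by (rule bounded_cube)
    have cl: "closed {z::(real^'n) \<times> real. \<forall>i. \<bar>y i z\<bar> \<le> R}"
      by (intro closed_Collect_all closed_Collect_le continuous_intros cy)
    define Kb where "Kb = {z::(real^'n) \<times> real. (\<forall>i. \<bar>y i z\<bar> \<le> R) \<and> t1 \<le> snd z \<and> snd z \<le> t3}"
    have bKb: "bounded Kb"
      by (rule bounded_subset[OF bounded_Times[OF bdd bounded_closed_interval[of t1 t3]]]) (auto simp: Kb_def y_def)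
    have clKb: "closed Kb" unfolding Kb_def
      by (intro closed_Collect_conj cl closed_Collect_le continuous_intros)
    have "continuous_on Kb w" by (rule continuous_on_subset[OF cw]) (use t1 t3 T in \<open>auto simp: Kb_def mem_QT\<close>)
    then have "bounded (w ` Kb)"
      using compact_eq_bounded_closed[THEN iffD2, OF conjI[OF bKb clKb]]
      by (intro compact_imp_bounded compact_continuous_image)
    then obtain L where L: "L > 0" "\<And>z. z \<in> Kb \<Longrightarrow> \<bar>w z\<bar> \<le> L" by (auto simp: bounded_pos)
    \<comment> \<open>The lid of the comparison region: at \<open>t4\<close> the term \<epsilon>/(t3
      - t) has reached the bound \<open>L\<close> of \<open>w\<close>, so nothing needs to be known
      about \<open>w\<close> there.\<close>
    define t4 where "t4 = t3 - min ((t3 - t2) / 2) (\<epsilon> / L)"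
    have t4: "t2 < t4" "t4 < t3" "t3 - t4 \<le> \<epsilon> / L" using t3 \<epsilon> L by (auto simp: t4_def min_def field_simps)
    define K where "K = {z::(real^'n) \<times> real. (\<forall>i. \<bar>y i z\<bar> \<le> \<rho> (snd z)) \<and> t1 \<le> snd z \<and> snd z \<le> t4}"
    define U where "U = {z::(real^'n) \<times> real. (\<forall>i. \<bar>y i z\<bar> < \<rho> (snd z)) \<and> t1 < snd z \<and> snd z < t4}"
    have UK: "U \<subseteq> K" by (auto simp: U_def K_def less_imp_le)
    have KI: "K \<subseteq> ?I" using t1 t4 t3 by (auto simp: K_def)
    have KKb: "K \<subseteq> Kb"
    proof
      fix z assume z: "z \<in> K"
      then have "\<rho> (snd z) \<le> R" using KI by (intro \<rho>(3)) auto
      then show "z \<in> Kb" using z t4 by (auto simp: K_def Kb_def intro: order_trans)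
    qed
    define strip where "strip = {z::(real^'n) \<times> real. t1 \<le> snd z \<and> snd z \<le> t4}"
    have "closed strip" unfolding strip_def by (intro closed_Collect_conj closed_Collect_le continuous_intros)
    have sI: "strip \<subseteq> ?I" using t1 t4 t3 by (auto simp: strip_def)
    have "closed {z\<in>strip. \<bar>y i z\<bar> \<le> \<rho> (snd z)}" for i
      by (rule continuous_on_closed_Collect_le[OF _ continuous_on_subset[OF cs(3) sI] \<open>closed strip\<close>])
         (intro continuous_intros cy)
    then have "closed (\<Inter>i. {z\<in>strip. \<bar>y i z\<bar> \<le> \<rho> (snd z)})" by (intro closed_INT) auto
    also have "(\<Inter>i. {z\<in>strip. \<bar>y i z\<bar> \<le> \<rho> (snd z)}) = K" by (auto simp: K_def strip_def)
    finally have clK: "closed K" .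
    have coK: "compact K"
      by (rule compact_eq_bounded_closed[THEN iffD2, OF conjI[OF bounded_subset[OF bKb KKb] clK]])
    define ostrip where "ostrip = {z::(real^'n) \<times> real. t1 < snd z \<and> snd z < t4}"
    have oo: "open ostrip" unfolding ostrip_def by (intro open_Collect_conj open_Collect_less continuous_intros)
    have osI: "ostrip \<subseteq> ?I" using t1 t4 t3 by (auto simp: ostrip_def)
    have "open (ostrip \<inter> (\<lambda>z. \<rho> (snd z) - \<bar>y i z\<bar>) -` {0<..})" for i
      by (rule continuous_open_preimage[OF _ oo]) (intro continuous_intros cy continuous_on_subset[OF cs(3) osI], simp)
    then have "open (\<Inter>i. (ostrip \<inter> (\<lambda>z. \<rho> (snd z) - \<bar>y i z\<bar>) -` {0<..}))" by (intro open_INT) auto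
    also have "(\<Inter>i. (ostrip \<inter> (\<lambda>z. \<rho> (snd z) - \<bar>y i z\<bar>) -` {0<..})) = U" by (auto simp: U_def ostrip_def)
    finally have oU: "open U" .
    have KQ: "K \<subseteq> QT T" using KI T by (auto simp: mem_QT)
    have UI: "U \<subseteq> ?I" using UK KI by blast
    have t3z: "t3 - snd z > 0" if "z \<in> K" for z using that t4 by (auto simp: K_def)
    \<comment> \<open>Three parts: exponentials for the two faces in each direction dominate on the
      lateral boundary, \<epsilon> at the bottom, and \<epsilon>/(t3 - t) on the lid. The last one
      also makes the supersolution strict through its positive time derivative.\<close>
    define \<psi> where "\<psi> z = (\<Sum>j\<in>UNIV. s j z) + (\<epsilon> + \<epsilon> / (t3 - snd z))" for z
    define \<psi>t where "\<psi>t z = (\<Sum>j\<in>UNIV. st j z) + \<epsilon> / (t3 - snd z)\<^sup>2" for z :: "(real^'n) \<times> real"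
    define \<psi>x where "\<psi>x i z = 1 * B (snd z) * ex 1 i z + (- 1) * B (snd z) * ex (- 1) i z" for i z
    define \<psi>xx where "\<psi>xx i z = 1 * B (snd z) * (1 * B (snd z) * ex 1 i z) + (- 1) * B (snd z) * ((- 1) * B (snd z) * ex (- 1) i z)" for i z
    have s0: "s j z \<ge> 0" for j z by (simp add: s_def ex_def)
    have "w (x0, t2) \<le> \<psi> (x0, t2)"
    proof (rule visc_comparison[OF v coK KQ oU UK, where \<psi>=\<psi> and \<psi>t=\<psi>t and \<psi>x=\<psi>x and \<psi>xx=\<psi>xx])
      show "continuous_on K w" by (rule continuous_on_subset[OF cw KQ])
      have cK: "continuous_on K (ex \<sigma> j)" "continuous_on K (ext' \<sigma> j)" for \<sigma> j
        using ce continuous_on_subset[OF _ KI] by blast+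
      have cBK: "continuous_on K (\<lambda>z. B (snd z))" by (rule continuous_on_subset[OF cs(1) KI])
      have c3: "continuous_on K (\<lambda>z. \<epsilon> / (t3 - snd z))" "continuous_on K (\<lambda>z. \<epsilon> / (t3 - snd z)\<^sup>2)"
        using t3z by (force intro!: continuous_intros)+
      show c\<psi>: "continuous_on K \<psi>" unfolding \<psi>_def[abs_def] s_def by (intro continuous_intros cK c3)
      show "jet_on U \<psi> \<psi>t \<psi>x \<psi>xx"
        unfolding jet_on_def
      proof (intro conjI allI)
        show "continuous_on U \<psi>" by (rule continuous_on_subset[OF c\<psi> UK])
        have "continuous_on K \<psi>t" unfolding \<psi>t_def[abs_def] st_def by (intro continuous_intros cK c3)
        then show "continuous_on U \<psi>t" by (rule continuous_on_subset[OF _ UK])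
        have "continuous_on K (\<psi>xx i)" for i unfolding \<psi>xx_def[abs_def] by (intro continuous_intros cK cBK)
        then show "continuous_on U (\<psi>xx i)" for i by (rule continuous_on_subset[OF _ UK])
        have dtU: "dir_deriv_on U (0, 1) (ex \<sigma> j) (ext' \<sigma> j)" for \<sigma> j
          using dt[of \<sigma> j] UI by (auto simp: dir_deriv_on_def)
        have "dir_deriv_on U (0, 1) (\<lambda>z::(real^'n) \<times> real. \<epsilon> + \<epsilon> / (t3 - snd z)) (\<lambda>z. \<epsilon> / (t3 - snd z)\<^sup>2)"
        proof (rule dir_deriv_on_time[where F="\<lambda>_ s. \<epsilon> + \<epsilon> / (t3 - s)" and F'="\<lambda>_ s. \<epsilon> / (t3 - s)\<^sup>2"])
          fix z :: "(real^'n) \<times> real" assume "z \<in> U"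
          then have "t3 - snd z > 0" using t3z UK by blast
          then have "t3 - snd z \<noteq> 0" by simp
          then show "((\<lambda>s. \<epsilon> + \<epsilon> / (t3 - s)) has_real_derivative \<epsilon> / (t3 - snd z)\<^sup>2) (at (snd z))"
            by (auto intro!: derivative_eq_intros simp: power2_eq_square)
        qed
        then show "dir_deriv_on U (0, 1) \<psi> \<psi>t"
          unfolding \<psi>_def[abs_def] \<psi>t_def[abs_def] s_def st_def
          by (intro dir_deriv_on_add dir_deriv_on_sum dtU) auto
        have "dir_deriv_on U (axis i 1, 0) (\<lambda>z. (\<Sum>j\<in>UNIV. s j z) + (\<epsilon> + \<epsilon> / (t3 - snd z)))
          (\<lambda>z. (\<Sum>j\<in>UNIV. (if i = j then 1 * B (snd z) * ex 1 j z else 0) + (if i = j then (- 1) * B (snd z) * ex (- 1) j z else 0)) + 0)" for i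
          unfolding s_def
          by (intro dir_deriv_on_add dir_deriv_on_sum dx) (auto simp: dir_deriv_on_def)
        moreover have "(\<Sum>j\<in>UNIV. (if i = j then 1 * B (snd z) * ex 1 j z else 0) + (if i = j then (- 1) * B (snd z) * ex (- 1) j z else 0)) + 0 = \<psi>x i z" for i z
          by (simp add: sum.distrib \<psi>x_def)
        ultimately show "dir_deriv_on U (axis i 1, 0) \<psi> (\<psi>x i)" for i
          unfolding \<psi>_def[abs_def] by simp
        show "dir_deriv_on U (axis i 1, 0) (\<psi>x i) (\<psi>xx i)" for i
          unfolding \<psi>x_def[abs_def] \<psi>xx_def[abs_def] by (intro dir_deriv_on_add dxB)
      qed
      show "w z \<le> \<psi> z" if z: "z \<in> K - U" for z
      proof -
        have zK: "z \<in> K" using z by simp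
        then have zI: "0 < snd z" "snd z < T'" using KI by auto
        have yR: "\<bar>(fst z - x0) $ i\<bar> \<le> \<rho> (snd z)" for i using zK by (auto simp: K_def y_def)
        have wexp: "w z \<le> exp (snd z * (B (snd z))\<^sup>2)" using bd[OF zI yR] by simp
        have sum0: "(\<Sum>j\<in>UNIV. s j z) \<ge> 0" by (intro sum_nonneg s0)
        have e3: "\<epsilon> / (t3 - snd z) \<ge> 0" using t3z[OF zK] \<epsilon> by simp
        consider "snd z = t1" | "snd z = t4" | i where "\<bar>y i z\<bar> = \<rho> (snd z)"
        proof -
          have "\<And>i. \<bar>y i z\<bar> \<le> \<rho> (snd z)" "t1 \<le> snd z" "snd z \<le> t4" using zK by (simp_all add: K_def)
          moreover have "\<not> ((\<forall>i. \<bar>y i z\<bar> < \<rho> (snd z)) \<and> t1 < snd z \<and> snd z < t4)" using z by (simp add: U_def)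
          ultimately show thesis using that by (metis less_le)
        qed
        then show ?thesis
        proof cases
          case 1
          have "w (fst z, snd z) \<le> \<epsilon>"
          proof (rule \<tau>(2))
            show "\<bar>(fst z - x0) $ i\<bar> \<le> R" for i using yR[of i] \<rho>(3)[OF zI] by linarith
          qed (use zI 1 t1 in auto)
          then show ?thesis using sum0 e3 by (simp add: \<psi>_def)
        next
          case 2
          have "L * (t3 - t4) \<le> \<epsilon>" using t4(3) L by (simp add: field_simps)
          then have "L \<le> \<epsilon> / (t3 - snd z)" using 2 t4 by (simp add: pos_le_divide_eq)
          moreover have "w z \<le> L" using L(2)[of z] zK KKb by force
          ultimately show ?thesis using sum0 \<epsilon> by (simp add: \<psi>_def)
        next
          case (3 i)
          have "exp (snd z * (B (snd z))\<^sup>2) \<le> s i z"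
          proof (cases "y i z \<ge> 0")
            case True
            then have "ex 1 i z = exp (snd z * (B (snd z))\<^sup>2)" using 3 by (simp add: ex_def)
            moreover have "ex \<sigma> i z \<ge> 0" for \<sigma> by (simp add: ex_def)
            ultimately show ?thesis by (simp add: s_def)
          next
            case False
            then have "ex (- 1) i z = exp (snd z * (B (snd z))\<^sup>2)" using 3 by (simp add: ex_def)
            moreover have "ex \<sigma> i z \<ge> 0" for \<sigma> by (simp add: ex_def)
            ultimately show ?thesis by (simp add: s_def)
          qed
          also have "\<dots> \<le> (\<Sum>j\<in>UNIV. s j z)" by (rule member_le_sum) (auto intro: s0)
          finally show ?thesis using wexp e3 \<epsilon> by (simp add: \<psi>_def)
        qed
      qed
      show "f z < \<psi>t z - (\<Sum>i\<in>UNIV. \<psi>xx i z)" if z: "z \<in> U" and gt: "\<psi> z < w z" for z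
      proof -
        have zI: "0 < snd z" "snd z < T'" using z UI by auto
        have zK: "z \<in> K" using z UK by blast
        have "(\<Sum>j\<in>UNIV. s j z) \<ge> 0" by (intro sum_nonneg s0)
        moreover have "\<epsilon> / (t3 - snd z) > 0" "\<epsilon> / (t3 - snd z)\<^sup>2 > 0" using t3z[OF zK] \<epsilon> by simp_all
        ultimately have "w z > 0" and e2: "\<epsilon> / (t3 - snd z)\<^sup>2 > 0" using gt \<epsilon> by (auto simp: \<psi>_def)
        then have "f z \<le> 0" using f zK KQ by blast
        moreover have "st i z - \<psi>xx i z \<ge> 0" for i
        proof -
          \<comment> \<open>With \<open>p\<close> the distance to the face, the heat operator of the
            exponential is the exponential times 4 B^2 + 2 t B B' - B' p. The speed
            \<open>4 B\<close> supplies 4 B^2, which absorbs the second term because - t B' \<le> 2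
            B; the third is nonnegative because B' \<le> 0.\<close>
          have e: "ext' \<sigma> i z - B (snd z) * (B (snd z) * ex \<sigma> i z) \<ge> 0" if \<sigma>: "\<bar>\<sigma>\<bar> = 1" for \<sigma>
          proof -
            have "\<bar>y i z\<bar> \<le> \<rho> (snd z)" using z by (auto simp: U_def less_imp_le)
            then have "\<rho> (snd z) - \<sigma> * y i z \<ge> 0" using \<sigma> by (auto simp: abs_if split: if_splits)
            then have 1: "- (B' (snd z) * (\<rho> (snd z) - \<sigma> * y i z)) \<ge> 0" using B(2)[OF zI] by (simp add: mult_nonpos_nonneg)
            have 2: "snd z * (2 * B (snd z) * B' (snd z)) \<ge> - 4 * (B (snd z))\<^sup>2"
              using mult_left_mono[OF B(3)[OF zI], of "2 * B (snd z)"] B(4)[OF zI] by (simp add: power2_eq_square algebra_simps)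
            have eq: "ext' \<sigma> i z - B (snd z) * (B (snd z) * ex \<sigma> i z) = ex \<sigma> i z * (snd z * (2 * B (snd z) * B' (snd z))
              + 4 * (B (snd z))\<^sup>2 + - (B' (snd z) * (\<rho> (snd z) - \<sigma> * y i z)))"
            proof -
              have "e * (b\<^sup>2 + x - (r + b * (- 4 * b))) - b * (b * e) = e * (x + 4 * b\<^sup>2 + - r)" for e b x r :: real
                by (simp add: power2_eq_square algebra_simps)
              then show ?thesis unfolding ext'_def .
            qed
            show ?thesis unfolding eq
            proof (rule mult_nonneg_nonneg)
              show "0 \<le> snd z * (2 * B (snd z) * B' (snd z)) + 4 * (B (snd z))\<^sup>2 + - (B' (snd z) * (\<rho> (snd z) - \<sigma> * y i z))"
                using 1 2 by linarith
            qed (simp add: ex_def)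
          qed
          show ?thesis using e[of 1] e[of "- 1"] by (simp add: st_def \<psi>xx_def)
        qed
        then have "(\<Sum>i\<in>UNIV. st i z - \<psi>xx i z) \<ge> 0" by (intro sum_nonneg) auto
        ultimately show ?thesis using e2 by (simp add: \<psi>t_def sum_subtractf)
      qed
      have "\<rho> t2 > 0" using \<rho>(2) t2 by blast
      then show "(x0, t2) \<in> K" using t1 t4 by (auto simp: K_def y_def)
    qed
    then show ?thesis by (simp add: \<psi>_def)
  qed
  have "w (x0, t2) \<le> (\<Sum>j\<in>UNIV. s j (x0, t2)) + \<epsilon>" if \<epsilon>: "\<epsilon> > 0" for \<epsilon>
  proof -
    \<comment> \<open>Rescaled so that both error terms together amount to \<epsilon>.\<close>
    define e where "e = \<epsilon> / (1 + 1 / (t3 - t2))"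
    have p: "1 + 1 / (t3 - t2) > 0" using t3 by (simp add: add_pos_pos)
    have "e > 0" using \<epsilon> p by (simp add: e_def)
    from main[OF this] have "w (x0, t2) \<le> (\<Sum>j\<in>UNIV. s j (x0, t2)) + e * (1 + 1 / (t3 - t2))" by (simp add: distrib_left)
    also have "e * (1 + 1 / (t3 - t2)) = \<epsilon>" using p by (simp add: e_def)
    finally show ?thesis .
  qed
  then have "w (x0, t2) \<le> (\<Sum>j\<in>UNIV. s j (x0, t2))" by (rule field_le_epsilon)
  also have "\<dots> = 2 * real CARD('n) * exp (t2 * (B t2)\<^sup>2 - B t2 * \<rho> t2)" by (simp add: s_def ex_def y_def)
  finally show ?thesis .
qed

text \<open>\<open>J\<close> is a primitive of \<open>b\<close>: faces moving with speed
  \<open>4 b\<close> are displaced by \<open>4 J\<close>. The limits at 0 say that the front starts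
  with no displacement, that t b^2 is negligible against b times any fixed distance, and that the
  barrier decays at any positive distance from the front.\<close>

definition front_profile :: "real \<Rightarrow> (real \<Rightarrow> real) \<Rightarrow> (real \<Rightarrow> real) \<Rightarrow> (real \<Rightarrow> real) \<Rightarrow> bool" where
  "front_profile T b b' J \<longleftrightarrow>
     (\<forall>t. 0 < t \<longrightarrow> t < T \<longrightarrow> (b has_real_derivative b' t) (at t) \<and> b' t \<le> 0 \<and> - (t * b' t) \<le> 2 * b t \<and> 0 < b t \<and>
        (J has_real_derivative b t) (at t) \<and> 0 \<le> J t) \<and>
     continuous_on {0<..<T} b' \<and> (J \<longlongrightarrow> 0) (at_right 0) \<and> ((\<lambda>t. t * b t) \<longlongrightarrow> 0) (at_right 0) \<and>
     filterlim b at_top (at_right 0)"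

text \<open>With \<open>\<sigma> = k (\<surd>\<omega> + s\<^sup>1\<^sup>/\<^sup>4)\<close> the profile is \<open>B t = \<integral> \<sigma> / s\<^sup>2\<close> over \<open>{t..S}\<close>. It is \<open>C\<^sup>1\<close> although \<open>\<omega>\<close> need
  not be, dominates \<open>\<sigma> / t\<close>, and integration by parts turns the Dini condition into \<open>t B \<longlongrightarrow> 0\<close> and
  integrability of \<open>B\<close>, that is, into a finite total displacement of the front.\<close>

lemma dini_front:
  fixes h \<omega> :: "real \<Rightarrow> real" and \<beta> C T :: real
  assumes \<omega>: "continuous_on {0..} \<omega>" "mono_on {0..} \<omega>" "\<And>t. t \<ge> 0 \<Longrightarrow> \<omega> t \<ge> 0"
    and h: "\<And>t. t > 0 \<Longrightarrow> h t = exp (- \<omega> t / t)"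
    and dini: "(\<integral>\<^sup>+s\<in>{0<..<1}. ennreal (sqrt (\<omega> s) / s) \<partial>lborel) < \<infinity>"
    and pos: "\<beta> > 0" "C > 0" "T > 0"
  obtains B B' I :: "real \<Rightarrow> real" where "front_profile T B B' I"
    "\<forall>t. 0 < t \<longrightarrow> t < T \<longrightarrow> (C / (t * h (t / 2))) powr \<beta> \<le> exp (t * (B t)\<^sup>2)"
proof -
  \<comment> \<open>Chosen so that k^2 (\<omega> + sqrt t) / (4 t) dominates \<beta> (2 sqrt (C/t) +
    2 \<omega>/t), the bound for the logarithm of the absorption estimate.\<close>
  define k where "k = sqrt (8 * \<beta> * (1 + sqrt C))"
  have k: "k > 0" using pos by (simp add: k_def add_pos_pos)
  have k2: "k\<^sup>2 = 8 * \<beta> * (1 + sqrt C)" using pos by (simp add: k_def)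
  \<comment> \<open>\<open>S > 2 T\<close> gives 1/t - 1/S \<ge> 1/(2t) for t < T, which is used in
    \<open>Blow\<close>; \<open>S > 1\<close> places the interval of the Dini integral inside the
    range of integration.\<close>
  define S where "S = 2 * T + 1"
  have S: "S > 1" "S > 2 * T" using pos by (auto simp: S_def)
  \<comment> \<open>The fourth root absorbs the factor C/t of the absorption estimate and makes
    \<open>B\<close> unbounded even if \<omega> vanishes, while \<sigma>/s stays integrable at
    0.\<close>
  define \<sigma> where "\<sigma> s = k * (sqrt (\<omega> s) + sqrt (sqrt s))" for s
  have \<sigma>c: "continuous_on A \<sigma>" if "A \<subseteq> {0..}" for A
    unfolding \<sigma>_def[abs_def] by (intro continuous_intros continuous_on_subset[OF \<omega>(1) that])
  have \<sigma>mono: "\<sigma> s \<le> \<sigma> t" if "0 \<le> s" "s \<le> t" for s t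
    unfolding \<sigma>_def using k that mono_onD[OF \<omega>(2), of s t]
    by (intro mult_left_mono add_mono real_sqrt_le_mono) auto
  have \<sigma>low: "\<sigma> s \<ge> k * sqrt (sqrt s)" if "s \<ge> 0" for s
    unfolding \<sigma>_def using k \<omega>(3)[OF that] by (intro mult_left_mono) auto
  have \<sigma>pos: "\<sigma> s > 0" if "s > 0" for s
  proof -
    have "k * sqrt (sqrt s) > 0" using k that by simp
    then show ?thesis using \<sigma>low[of s] that by linarith
  qed
  have \<sigma>nn: "\<sigma> s \<ge> 0" if "s \<ge> 0" for s
    unfolding \<sigma>_def using k \<omega>(3)[OF that] that by simp
  have c1: "continuous_on {a..b} (\<lambda>s. \<sigma> s / s)" and c2: "continuous_on {a..b} (\<lambda>s. \<sigma> s / s\<^sup>2)" if "a > 0" for a b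
    using that by (auto intro!: continuous_intros \<sigma>c)
  define B where "B t = integral {t..S} (\<lambda>s. \<sigma> s / s\<^sup>2)" for t
  define J where "J t = integral {t..S} (\<lambda>s. \<sigma> s / s)" for t
  define B' where "B' t = - (\<sigma> t / t\<^sup>2)" for t
  have deriv: "((\<lambda>t. integral {t..S} f) has_real_derivative - f t) (at t)"
    if f: "\<And>a b. a > 0 \<Longrightarrow> continuous_on {a..b} f" and t: "0 < t" "t < S" for f :: "real \<Rightarrow> real" and t
  proof -
    have "((\<lambda>t. integral {t..S} f) has_real_derivative - f t) (at t within {t / 2..S})"
      by (rule integral_has_real_derivative'[OF f]) (use t in auto)
    moreover have "at t within {t / 2..S} = at t" using t by (intro at_within_interior) auto
    ultimately show ?thesis by simp
  qed
  have dB: "(B has_real_derivative B' t) (at t)" if "0 < t" "t < S" for t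
    unfolding B_def[abs_def] B'_def by (rule deriv) (use c2 that in auto)
  have dJ: "(J has_real_derivative - (\<sigma> t / t)) (at t)" if "0 < t" "t < S" for t
    unfolding J_def[abs_def] by (rule deriv) (use c1 that in auto)
  \<comment> \<open>Since \<sigma> is nondecreasing, it may be replaced by its value at the lower
    endpoint, and the rest integrates to 1/t - 1/S.\<close>
  have Blow: "B t \<ge> \<sigma> t / (2 * t)" if t: "0 < t" "t < T" for t
  proof -
    have "((\<lambda>s. \<sigma> t / s\<^sup>2) has_integral (- \<sigma> t / S - - \<sigma> t / t)) {t..S}"
    proof (rule fundamental_theorem_of_calculus)
      fix s assume "s \<in> {t..S}"
      then have "s \<noteq> 0" using t by auto
      then have "((\<lambda>s. - \<sigma> t / s) has_real_derivative \<sigma> t / s\<^sup>2) (at s within {t..S})"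
        by (auto intro!: derivative_eq_intros simp: power2_eq_square)
      then show "((\<lambda>s. - \<sigma> t / s) has_vector_derivative \<sigma> t / s\<^sup>2) (at s within {t..S})"
        by (simp only: has_real_derivative_iff_has_vector_derivative)
    qed (use t S in auto)
    moreover have "(\<lambda>s. \<sigma> s / s\<^sup>2) integrable_on {t..S}" by (rule integrable_continuous_interval[OF c2[OF t(1)]])
    moreover have "\<sigma> t / s\<^sup>2 \<le> \<sigma> s / s\<^sup>2" if "s \<in> {t..S}" for s
      using that t \<sigma>mono[of t s] by (intro divide_right_mono) auto
    ultimately have "- \<sigma> t / S - - \<sigma> t / t \<le> B t"
      unfolding B_def by (rule has_integral_le[OF _ integrable_integral])
    moreover have "\<sigma> t / S \<le> \<sigma> t / (2 * t)"
      using t S \<sigma>nn[of t] by (intro divide_left_mono) auto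
    moreover have "\<sigma> t / (2 * t) = (\<sigma> t / t) / 2" by (simp only: divide_divide_eq_left mult.commute)
    moreover have "- \<sigma> t / S - - \<sigma> t / t = \<sigma> t / t - \<sigma> t / S" by (simp only: minus_divide_left[symmetric])
    ultimately show ?thesis by linarith
  qed
  have Bpos: "B t > 0" if "0 < t" "t < T" for t
  proof -
    have "\<sigma> t / (2 * t) > 0" using that \<sigma>pos[of t] by simp
    then show ?thesis using Blow[OF that] by linarith
  qed
  have Jmono: "J t \<le> J s" if "0 < s" "s \<le> t" "t \<le> S" for s t
    unfolding J_def
  proof (rule integral_subset_le)
    have i: "(\<lambda>s. \<sigma> s / s) integrable_on {a..S}" if "a > 0" for a
      by (rule integrable_continuous_interval[OF c1[OF that]])
    show "(\<lambda>s. \<sigma> s / s) integrable_on {t..S}" using that by (intro i) linarith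
    show "(\<lambda>s. \<sigma> s / s) integrable_on {s..S}" by (rule i[OF that(1)])
    show "\<forall>x\<in>{s..S}. 0 \<le> \<sigma> x / x"
    proof
      fix x assume "x \<in> {s..S}"
      then show "0 \<le> \<sigma> x / x" using \<open>0 < s\<close> \<sigma>nn[of x] by (intro divide_nonneg_nonneg) auto
    qed
  qed (use that in auto)
  \<comment> \<open>Here the Dini condition enters: below 1, \<sigma>/s integrates to at most
    \<open>k\<close> times the Dini integral plus 4, the integral of s^(-3/4) over (0,1).\<close>
  obtain L where L: "\<And>t. 0 < t \<Longrightarrow> t < S \<Longrightarrow> J t \<le> L"
  proof -
    define A where "A = enn2real (\<integral>\<^sup>+s\<in>{0<..<1}. ennreal (sqrt (\<omega> s) / s) \<partial>lborel)"
    define M where "M = J 1"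
    have b: "J t \<le> k * (A + 4) + M" if t: "0 < t" "t < 1" for t
    proof -
      have cw: "continuous_on {t..1} (\<lambda>s. sqrt (\<omega> s) / s)"
        using t by (auto intro!: continuous_intros continuous_on_subset[OF \<omega>(1)])
      have cs: "continuous_on {t..1} (\<lambda>s. sqrt (sqrt s) / s)" using t by (auto intro!: continuous_intros)
      have "J t = integral {t..1} (\<lambda>s. \<sigma> s / s) + J 1"
        unfolding J_def using t S
        by (intro Henstock_Kurzweil_Integration.integral_combine[symmetric] integrable_continuous_interval c1) auto
      also have "integral {t..1} (\<lambda>s. \<sigma> s / s) = k * (integral {t..1} (\<lambda>s. sqrt (\<omega> s) / s) + integral {t..1} (\<lambda>s. sqrt (sqrt s) / s))"
        unfolding \<sigma>_def
        by (subst Henstock_Kurzweil_Integration.integral_add[symmetric])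
           (auto intro!: integrable_continuous_interval cw cs simp: add_divide_distrib distrib_left
             simp flip: integral_mult_right intro!: integral_cong)
      finally have J: "J t = k * (integral {t..1} (\<lambda>s. sqrt (\<omega> s) / s) + integral {t..1} (\<lambda>s. sqrt (sqrt s) / s)) + M"
        by (simp add: M_def)
      have "((\<lambda>s. sqrt (sqrt s) / s) has_integral (4 * sqrt (sqrt 1) - 4 * sqrt (sqrt t))) {t..1}"
      proof (rule fundamental_theorem_of_calculus)
        fix s assume s: "s \<in> {t..1}"
        then have s0: "s > 0" using t by auto
        have "((\<lambda>s. 4 * sqrt (sqrt s)) has_real_derivative 4 * (inverse (sqrt (sqrt s)) / 2 * (inverse (sqrt s) / 2))) (at s)"
          using s0 by (intro DERIV_cmult DERIV_chain2[OF DERIV_real_sqrt] DERIV_real_sqrt) auto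
        moreover have "4 * (inverse (sqrt (sqrt s)) / 2 * (inverse (sqrt s) / 2)) = sqrt (sqrt s) / s"
        proof -
          define r where "r = sqrt (sqrt s)"
          have r: "r > 0" "sqrt s = r * r" using s0 by (auto simp: r_def)
          moreover have "s = (r * r) * (r * r)" using s0 by (simp flip: r(2))
          ultimately show ?thesis unfolding r_def[symmetric] by (simp add: field_simps)
        qed
        ultimately show "((\<lambda>s. 4 * sqrt (sqrt s)) has_vector_derivative sqrt (sqrt s) / s) (at s within {t..1})"
          by (simp add: has_real_derivative_iff_has_vector_derivative has_vector_derivative_at_within)
      qed (use t in auto)
      then have i4: "integral {t..1} (\<lambda>s. sqrt (sqrt s) / s) \<le> 4" using t by (simp add: integral_unique)
      have si: "set_integrable lborel {t..1} (\<lambda>s. sqrt (\<omega> s) / s)"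
        unfolding set_integrable_def by (rule borel_integrable_compact[OF compact_Icc cw])
      have "ennreal (integral {t..1} (\<lambda>s. sqrt (\<omega> s) / s)) = ennreal (LINT s:{t..1}|lborel. sqrt (\<omega> s) / s)"
        using set_borel_integral_eq_integral(2)[OF si] by simp
      also have "\<dots> = (\<integral>\<^sup>+ s. ennreal (indicator {t..1} s *\<^sub>R (sqrt (\<omega> s) / s)) \<partial>lborel)"
        unfolding set_lebesgue_integral_def using si[unfolded set_integrable_def] t \<omega>(3)
        by (intro nn_integral_eq_integral[symmetric]) (auto simp: indicator_def)
      also have "\<dots> \<le> (\<integral>\<^sup>+s\<in>{0<..<1}. ennreal (sqrt (\<omega> s) / s) \<partial>lborel)"
      proof (rule nn_integral_mono_AE)
        show "AE s in lborel. ennreal (indicator {t..1} s *\<^sub>R (sqrt (\<omega> s) / s)) \<le> ennreal (sqrt (\<omega> s) / s) * indicator {0<..<1} s"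
          using AE_lborel_singleton[of "1::real"] by eventually_elim (use t in \<open>auto simp: indicator_def\<close>)
      qed
      also have "\<dots> = ennreal A" using dini by (simp add: A_def)
      finally have "integral {t..1} (\<lambda>s. sqrt (\<omega> s) / s) \<le> A" by (simp add: A_def ennreal_le_iff)
      then have "k * (integral {t..1} (\<lambda>s. sqrt (\<omega> s) / s) + integral {t..1} (\<lambda>s. sqrt (sqrt s) / s)) \<le> k * (A + 4)"
        using i4 k by (intro mult_left_mono) auto
      then show ?thesis unfolding J by simp
    qed
    show ?thesis
    proof (rule that[of "k * (A + 4) + M"])
      fix t assume t: "0 < t" "t < S"
      have "J t \<le> J (min t (1 / 2))" using t by (intro Jmono) auto
      also have "\<dots> \<le> k * (A + 4) + M" using t by (intro b) auto
      finally show "J t \<le> k * (A + 4) + M" .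
    qed
  qed
  \<comment> \<open>As \<open>J\<close> grows towards time 0, the supremum is its limit there, and
    \<open>Jl - J t\<close> plays the role of the integral of \<sigma>/s over (0,t).\<close>
  define Jl where "Jl = (SUP t\<in>{0<..<S}. J t)"
  have bddJ: "bdd_above (J ` {0<..<S})" by (rule bdd_aboveI[of _ L]) (use L in auto)
  have JJl: "J t \<le> Jl" if "0 < t" "t < S" for t
    unfolding Jl_def by (rule cSUP_upper[OF _ bddJ]) (use that in auto)
  have Japp: "\<exists>\<delta>. 0 < \<delta> \<and> \<delta> < S \<and> Jl - e < J \<delta>" if "e > 0" for e
  proof -
    have "Jl - e < Jl" using that by simp
    then obtain \<delta> where "\<delta> \<in> {0<..<S}" "Jl - e < J \<delta>"
      unfolding Jl_def using less_cSUP_iff[OF _ bddJ] S by auto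
    then show ?thesis by auto
  qed
  have Jlim: "((\<lambda>t. Jl - J t) \<longlongrightarrow> 0) (at_right 0)"
  proof (rule tendstoI)
    fix e :: real assume "e > 0"
    then obtain \<delta> where \<delta>: "0 < \<delta>" "\<delta> < S" "Jl - e < J \<delta>" using Japp by blast
    have "dist (Jl - J t) 0 < e" if "0 < t" "t < \<delta>" for t
      using Jmono[of t \<delta>] JJl[of t] that \<delta> by (simp add: dist_real_def)
    then show "eventually (\<lambda>t. dist (Jl - J t) 0 < e) (at_right 0)"
      using \<delta> unfolding eventually_at_right_field by blast
  qed
  \<comment> \<open>Up to \<delta> the factor t/s is at most 1, so t \<sigma>/s^2 \<le> \<sigma>/s
    there; the part of \<open>B\<close> beyond \<delta> is a constant and is killed by the factor
    \<open>t\<close>.\<close>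
  have tB: "t * B t \<le> (J t - J \<delta>) + t * B \<delta>" if t: "0 < t" "t < \<delta>" "\<delta> < S" for t \<delta>
  proof -
    have "B t = integral {t..\<delta>} (\<lambda>s. \<sigma> s / s\<^sup>2) + B \<delta>"
      unfolding B_def using t
      by (intro Henstock_Kurzweil_Integration.integral_combine[symmetric] integrable_continuous_interval c2) auto
    moreover have "J t = integral {t..\<delta>} (\<lambda>s. \<sigma> s / s) + J \<delta>"
      unfolding J_def using t
      by (intro Henstock_Kurzweil_Integration.integral_combine[symmetric] integrable_continuous_interval c1) auto
    moreover have "t * integral {t..\<delta>} (\<lambda>s. \<sigma> s / s\<^sup>2) \<le> integral {t..\<delta>} (\<lambda>s. \<sigma> s / s)"
      unfolding integral_mult_right[symmetric]
    proof (rule integral_le)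
      show "(\<lambda>s. t * (\<sigma> s / s\<^sup>2)) integrable_on {t..\<delta>}"
        using t by (intro integrable_continuous_interval continuous_intros c2)
      show "(\<lambda>s. \<sigma> s / s) integrable_on {t..\<delta>}"
        using t by (intro integrable_continuous_interval c1)
      fix s assume "s \<in> {t..\<delta>}"
      then have s: "t \<le> s" "s > 0" using t by auto
      have "t * (\<sigma> s / s\<^sup>2) = (t / s) * (\<sigma> s / s)" by (simp add: power2_eq_square)
      also have "\<dots> \<le> 1 * (\<sigma> s / s)" using s \<sigma>nn[of s] by (intro mult_right_mono) auto
      finally show "t * (\<sigma> s / s\<^sup>2) \<le> \<sigma> s / s" by simp
    qed
    ultimately show ?thesis by (simp add: distrib_left)
  qed
  have tBlim: "((\<lambda>t. t * B t) \<longlongrightarrow> 0) (at_right 0)"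
  proof (rule tendstoI)
    fix e :: real assume e: "e > 0"
    then obtain \<delta> where \<delta>: "0 < \<delta>" "\<delta> < S" "Jl - e / 2 < J \<delta>" using Japp[of "e / 2"] by auto
    define b where "b = min (min \<delta> T) (e / (2 * (\<bar>B \<delta>\<bar> + 1)))"
    have b: "b > 0" using \<delta> e pos by (auto simp: b_def)
    have "dist (t * B t) 0 < e" if t: "0 < t" "t < b" for t
    proof -
      have tt: "t < \<delta>" "t < T" "t < e / (2 * (\<bar>B \<delta>\<bar> + 1))" using t by (auto simp: b_def)
      have "t * (\<bar>B \<delta>\<bar> + 1) < e / 2" using tt(3) by (simp add: field_simps)
      moreover have "t * B \<delta> \<le> t * (\<bar>B \<delta>\<bar> + 1)" using t by (intro mult_left_mono) auto
      moreover have "J t - J \<delta> < e / 2" using JJl[of t] t tt \<delta> by linarith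
      moreover have "t * B t \<ge> 0" using Bpos[of t] t tt by simp
      ultimately show ?thesis using tB[OF t(1) tt(1) \<delta>(2)] by (simp add: dist_real_def)
    qed
    then show "eventually (\<lambda>t. dist (t * B t) 0 < e) (at_right 0)"
      using b unfolding eventually_at_right_field by blast
  qed
  have Btop: "filterlim B at_top (at_right 0)"
    unfolding filterlim_at_top
  proof
    fix M :: real
    define b where "b = min (min 1 T) ((k / (2 * (\<bar>M\<bar> + 1)))\<^sup>2)"
    have b: "b > 0" using k pos by (auto simp: b_def)
    have "M \<le> B t" if t: "0 < t" "t < b" for t
    proof -
      have tt: "t < 1" "t < T" "t < (k / (2 * (\<bar>M\<bar> + 1)))\<^sup>2" using t by (auto simp: b_def)
      have "sqrt t < k / (2 * (\<bar>M\<bar> + 1))" using tt(3) k by (intro real_less_lsqrt) auto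
      then have 1: "\<bar>M\<bar> + 1 < k / (2 * sqrt t)" using t by (simp add: field_simps)
      have "sqrt t \<le> sqrt (sqrt t)"
      proof -
        have "t \<le> sqrt t" using t tt by (intro real_le_rsqrt) (simp add: power2_eq_square mult_left_le)
        then show ?thesis by simp
      qed
      then have "k * sqrt t \<le> \<sigma> t" using \<sigma>low[of t] k t by (meson less_imp_le mult_left_mono order_trans)
      then have "k * sqrt t / (2 * t) \<le> \<sigma> t / (2 * t)" using t by (intro divide_right_mono) auto
      moreover have "k * sqrt t / (2 * t) = k / (2 * sqrt t)"
        using t by (simp add: field_simps)
      ultimately show ?thesis using 1 Blow[of t] t tt by linarith
    qed
    then show "eventually (\<lambda>t. M \<le> B t) (at_right 0)"
      using b unfolding eventually_at_right_field by blast
  qed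
  \<comment> \<open>The integral of \<open>B\<close> over (0,t), integrated by parts: the derivative
    of t B produces - \<sigma>/t, which the second term cancels.\<close>
  define I where "I t = t * B t + (Jl - J t)" for t
  have bound: "(C / (t * h (t / 2))) powr \<beta> \<le> exp (t * (B t)\<^sup>2)" if t: "0 < t" "t < T" for t
  proof -
    have w0: "\<omega> t \<ge> 0" "\<omega> (t / 2) \<le> \<omega> t" using \<omega>(3)[of t] mono_onD[OF \<omega>(2), of "t / 2" t] t by auto
    have hp: "h (t / 2) > 0" using h[of "t / 2"] t by simp
    have "ln (C / (t * h (t / 2))) = ln (C / t) - ln (h (t / 2))"
      using pos t hp by (simp add: ln_div ln_mult)
    also have "ln (h (t / 2)) = - (2 * \<omega> (t / 2) / t)" using h[of "t / 2"] t by simp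
    also have "ln (C / t) - - (2 * \<omega> (t / 2) / t) \<le> 2 * sqrt (C / t) + 2 * \<omega> t / t"
    proof -
      have "ln (C / t) = 2 * ln (sqrt (C / t))" using pos t by (simp add: ln_sqrt)
      also have "\<dots> \<le> 2 * sqrt (C / t)" using ln_bound[of "sqrt (C / t)"] pos t by simp
      finally have "ln (C / t) \<le> 2 * sqrt (C / t)" .
      moreover have "2 * \<omega> (t / 2) / t \<le> 2 * \<omega> t / t" using w0 t by (intro divide_right_mono) auto
      ultimately show ?thesis by linarith
    qed
    finally have l: "\<beta> * ln (C / (t * h (t / 2))) \<le> \<beta> * (2 * sqrt (C / t) + 2 * \<omega> t / t)"
      using pos by (intro mult_left_mono) auto
    have "t * (\<sigma> t / (2 * t))\<^sup>2 \<le> t * (B t)\<^sup>2"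
      using Blow[OF t] \<sigma>nn[of t] t by (intro mult_left_mono power_mono) auto
    moreover have "t * (\<sigma> t / (2 * t))\<^sup>2 = (\<sigma> t)\<^sup>2 / (4 * t)" using t by (simp add: power2_eq_square)
    moreover have "k\<^sup>2 * (\<omega> t + sqrt t) / (4 * t) \<le> (\<sigma> t)\<^sup>2 / (4 * t)"
    proof (rule divide_right_mono)
      have "\<omega> t + sqrt t \<le> (sqrt (\<omega> t) + sqrt (sqrt t))\<^sup>2" using w0 t by (simp add: power2_sum)
      then show "k\<^sup>2 * (\<omega> t + sqrt t) \<le> (\<sigma> t)\<^sup>2" unfolding \<sigma>_def power_mult_distrib by (intro mult_left_mono) auto
    qed (use t in auto)
    moreover have "\<beta> * (2 * sqrt (C / t) + 2 * \<omega> t / t) \<le> k\<^sup>2 * (\<omega> t + sqrt t) / (4 * t)"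
    proof -
      have st: "sqrt t * sqrt t = t" using t by simp
      have "sqrt (C / t) = sqrt C * sqrt t / t" using t st by (simp add: real_sqrt_divide field_simps)
      then have "\<beta> * (2 * sqrt (C / t) + 2 * \<omega> t / t) = \<beta> * (2 * (sqrt C * sqrt t / t) + 2 * \<omega> t / t)" by (simp only:)
      also have "\<dots> = 2 * \<beta> * (sqrt C * sqrt t + \<omega> t) / t" using t(1) by (simp add: field_simps)
      also have "\<dots> \<le> 2 * \<beta> * ((1 + sqrt C) * (\<omega> t + sqrt t)) / t"
        using t pos w0 by (intro divide_right_mono mult_left_mono) (auto simp: algebra_simps)
      also have "\<dots> = k\<^sup>2 * (\<omega> t + sqrt t) / (4 * t)" unfolding k2 by simp
      finally show ?thesis .
    qed
    ultimately have "\<beta> * ln (C / (t * h (t / 2))) \<le> t * (B t)\<^sup>2" using l by linarith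
    then show ?thesis using pos t hp by (simp add: powr_def)
  qed
  show ?thesis
  proof (rule that[of B B' I])
    show "front_profile T B B' I"
      unfolding front_profile_def
    proof (intro conjI allI impI)
      fix t assume t: "0 < t" "t < T"
      then have tS: "t < S" using S by simp
      show "(B has_real_derivative B' t) (at t)" by (rule dB[OF t(1) tS])
      show "B' t \<le> 0" using \<sigma>nn[of t] t by (simp add: B'_def)
      show "- (t * B' t) \<le> 2 * B t" using Blow[OF t] t by (simp add: B'_def power2_eq_square field_simps)
      show "0 < B t" by (rule Bpos[OF t])
      show "(I has_real_derivative B t) (at t)"
      proof -
        have "((\<lambda>t. t * B t + (Jl - J t)) has_real_derivative 1 * B t + B' t * t + (0 - - (\<sigma> t / t))) (at t)"
          by (intro DERIV_add DERIV_mult DERIV_diff DERIV_const DERIV_ident dB dJ t tS)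
        moreover have "1 * B t + B' t * t + (0 - - (\<sigma> t / t)) = B t" using t by (simp add: B'_def power2_eq_square)
        ultimately show ?thesis unfolding I_def[abs_def] by (rule DERIV_cong)
      qed
      show "0 \<le> I t" using Bpos[OF t] t JJl[OF t(1) tS] by (simp add: I_def)
    next
      show "continuous_on {0<..<T} B'" unfolding B'_def[abs_def] by (intro continuous_intros \<sigma>c) auto
      show "(I \<longlongrightarrow> 0) (at_right 0)" using tendsto_add[OF tBlim Jlim] by (simp add: I_def[abs_def])
    qed (rule tBlim, rule Btop)
  qed (use bound in blast)
qed

section \<open>Test functions vanishing near the initial time\<close>

text \<open>A test function for the open interval is unconstrained at times t \<le> 0; resetting it
  to 0 there makes it a test function for the half-open one.\<close>

definition ext0 :: "((real^'n) \<times> real \<Rightarrow> real) \<Rightarrow> (real^'n) \<times> real \<Rightarrow> real" where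
  "ext0 f z = (if snd z > 0 then f z else 0)"

lemma dx_ext0:
  fixes f :: "(real^'n) \<times> real \<Rightarrow> real"
  shows "dx i (ext0 f) = ext0 (dx i f)"
proof
  fix z :: "(real^'n) \<times> real"
  show "dx i (ext0 f) z = ext0 (dx i f) z"
    by (cases z, cases "snd z > 0") (auto simp: dx_def ext0_def)
qed

lemma dx_eq_0:
  fixes f :: "(real^'n) \<times> real \<Rightarrow> real"
  assumes "\<And>x. f (x, t) = 0" shows "dx i f (x, t) = 0"
  using assms by (simp add: dx_def)

lemma dx_exists_ext0:
  assumes "dx_exists i {0<..<T} f" shows "dx_exists i {0..<T} (ext0 f)"
  unfolding dx_exists_def
proof (intro allI ballI)
  fix x :: "real^'a" and t assume t: "t \<in> {0..<T}"
  show "(\<lambda>s. ext0 f (x + s *\<^sub>R axis i 1, t)) field_differentiable at 0"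
  proof (cases "t > 0")
    case True
    then have "ext0 f (x + s *\<^sub>R axis i 1, t) = f (x + s *\<^sub>R axis i 1, t)" for s by (simp add: ext0_def)
    then show ?thesis using assms t True by (simp add: dx_exists_def)
  qed (simp add: ext0_def)
qed

lemma continuous_on_ext0:
  fixes f :: "(real^'n) \<times> real \<Rightarrow> real"
  assumes c: "continuous_on (UNIV \<times> {0<..<T}) f" and b: "b > 0"
    and 0: "\<And>x t. 0 < t \<Longrightarrow> t < b \<Longrightarrow> t < T \<Longrightarrow> f (x, t) = 0"
  shows "continuous_on (UNIV \<times> {0..<T}) (ext0 f)"
proof -
  have "continuous_on ((UNIV \<times> {0<..<T}) \<union> (UNIV \<times> {..<min b T})) (ext0 f)"
  proof (rule continuous_on_open_Un)
    show "open ((UNIV :: (real^'n) set) \<times> {0<..<T})" "open ((UNIV :: (real^'n) set) \<times> {..<min b T})"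
      by (intro open_Times; simp)+
    show "continuous_on (UNIV \<times> {0<..<T}) (ext0 f)"
      by (rule continuous_on_eq[OF c]) (auto simp: ext0_def)
    show "continuous_on (UNIV \<times> {..<min b T}) (ext0 f)"
      by (rule continuous_on_eq[where f="\<lambda>_. 0"]) (auto simp: ext0_def 0)
  qed
  then show ?thesis by (rule continuous_on_subset) (use b in \<open>auto simp: not_less\<close>)
qed

text \<open>The complement of the compact support is open in the cylinder, so the derivatives vanish
  on it too. This confines the integrand of the weak form to a compact set, as dominated convergence
  requires.\<close>

lemma C21_0_interior_bounds:
  fixes \<phi> :: "(real^'n) \<times> real \<Rightarrow> real"
  assumes "\<phi> \<in> C21_0 {0<..<T}"
  obtains K where "compact K" "K \<subseteq> QT T"
    "\<And>z. z \<in> QT T \<Longrightarrow> z \<notin> K \<Longrightarrow> \<phi> z = 0 \<and> dt {0<..<T} \<phi> z = 0 \<and> laplacian \<phi> z = 0"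
proof -
  obtain K where K: "compact K" "K \<subseteq> UNIV \<times> {0<..<T}" "\<And>z. z \<in> UNIV \<times> {0<..<T} - K \<Longrightarrow> \<phi> z = 0"
    using assms by (auto simp: C21_0_def)
  define S where "S = QT T - K"
  have S: "open S" unfolding S_def using open_QT K(1) by (intro open_Diff compact_imp_closed)
  have \<phi>0: "\<phi> z = 0" if "z \<in> S" for z using K(3)[of z] that by (auto simp: S_def QT_def)
  have line: "((\<lambda>s. f (z + s *\<^sub>R e)) has_real_derivative 0) (at 0)"
    if z: "z \<in> S" and f: "\<And>y. y \<in> S \<Longrightarrow> f y = 0" for f :: "(real^'n) \<times> real \<Rightarrow> real" and z e
  proof -
    obtain d where d: "d > 0" "\<And>s. \<bar>s\<bar> < d \<Longrightarrow> z + s *\<^sub>R e \<in> S" using line_in_open[OF S z] by blast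
    have "eventually (\<lambda>s. (0::real) = f (z + s *\<^sub>R e)) (nhds 0)"
      using d f by (intro eventually_nhds_in_open[of "{-d<..<d}" 0, THEN eventually_mono]) (auto simp: abs_less_iff)
    from DERIV_cong_ev[THEN iffD1, OF refl this refl DERIV_const] show ?thesis .
  qed
  have dx0: "dx i f z = 0" if "z \<in> S" "\<And>y. y \<in> S \<Longrightarrow> f y = 0" for f :: "(real^'n) \<times> real \<Rightarrow> real" and z i
  proof -
    have "((\<lambda>s. f (z + s *\<^sub>R (axis i 1, 0))) has_real_derivative 0) (at 0)"
      by (rule line) (use that in auto)
    then show ?thesis by (cases z) (simp add: dx_def DERIV_imp_deriv)
  qed
  have dt0: "dt {0<..<T} \<phi> z = 0" if z: "z \<in> S" for z
  proof -
    obtain x t where xt: "z = (x, t)" by (cases z)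
    have "((\<lambda>s. \<phi> ((x, t) + s *\<^sub>R (0, 1))) has_real_derivative 0) (at 0)"
      by (rule line[OF z[unfolded xt] \<phi>0])
    then have "((\<lambda>s. \<phi> (x, s)) has_real_derivative 0) (at t)"
      using DERIV_shift[of "\<lambda>s. \<phi> (x, s)" 0 0 t] by (simp add: add.commute)
    then have "((\<lambda>s. \<phi> (x, s)) has_vector_derivative 0) (at t)"
      by (simp add: has_real_derivative_iff_has_vector_derivative)
    moreover have "at t within {0<..<T} = at t" using z by (intro at_within_open) (auto simp: S_def xt mem_QT)
    ultimately show ?thesis by (simp add: dt_def xt vector_derivative_at)
  qed
  show ?thesis
  proof (rule that[OF K(1)])
    show "K \<subseteq> QT T" using K(2) by (simp add: QT_def)
    fix z assume "z \<in> QT T" "z \<notin> K"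
    then have z: "z \<in> S" by (simp add: S_def)
    have "dx i (dx i \<phi>) z = 0" for i by (intro dx0 z \<phi>0)
    then show "\<phi> z = 0 \<and> dt {0<..<T} \<phi> z = 0 \<and> laplacian \<phi> z = 0"
      using \<phi>0[OF z] dt0[OF z] by (simp add: laplacian_def)
  qed
qed

lemma ext0_test_function:
  fixes \<phi> :: "(real^'n) \<times> real \<Rightarrow> real"
  assumes \<phi>: "\<phi> \<in> C21_0 {0<..<T}" and T: "T > 0"
  shows "ext0 \<phi> \<in> C21_0 {0..<T}"
    and "\<And>z. z \<in> QT T \<Longrightarrow> dt {0..<T} (ext0 \<phi>) z = dt {0<..<T} \<phi> z"
    and "\<And>z. z \<in> QT T \<Longrightarrow> laplacian (ext0 \<phi>) z = laplacian \<phi> z"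
proof -
  obtain K where K: "compact K" "K \<subseteq> UNIV \<times> {0<..<T}" "\<And>z. z \<in> UNIV \<times> {0<..<T} - K \<Longrightarrow> \<phi> z = 0"
    using \<phi> by (auto simp: C21_0_def)
  have C: "C21 {0<..<T} \<phi>" using \<phi> by (simp add: C21_0_def)
  \<comment> \<open>A compact set in the open strip keeps a positive distance \<open>b\<close> from
    time 0, so the extended function is 0 on a whole slab around time 0 and no regularity is lost
    there.\<close>
  obtain b where b: "b > 0" "\<And>z. z \<in> K \<Longrightarrow> b \<le> snd z"
  proof (cases "K = {}")
    case False
    have "continuous_on K snd" by (intro continuous_intros)
    then obtain y where "y \<in> K" "\<And>z. z \<in> K \<Longrightarrow> snd y \<le> snd z"
      using continuous_attains_inf[OF K(1) False] by blast
    then show ?thesis using K(2) by (intro that[of "snd y"]) auto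
  qed (use that[of 1] in auto)
  have \<phi>0: "\<phi> (x, t) = 0" if "0 < t" "t < b" "t < T" for x t
    using K(3)[of "(x, t)"] b(2)[of "(x, t)"] that by force
  have dx0: "dx i \<phi> (x, t) = 0" "dx j (dx i \<phi>) (x, t) = 0" if "0 < t" "t < b" "t < T" for x t i j
    by (intro dx_eq_0 \<phi>0 that)+
  have dtd: "((\<lambda>s. \<phi> (x, s)) has_vector_derivative dt {0<..<T} \<phi> (x, t)) (at t)" if t: "0 < t" "t < T" for x t
  proof -
    have "(\<lambda>s. \<phi> (x, s)) differentiable (at t within {0<..<T})" using C t by (auto simp: C21_def)
    then have "((\<lambda>s. \<phi> (x, s)) has_vector_derivative dt {0<..<T} \<phi> (x, t)) (at t within {0<..<T})"
      by (simp add: dt_def vector_derivative_works)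
    moreover have "at t within {0<..<T} = at t" using t by (intro at_within_open) auto
    ultimately show ?thesis by simp
  qed
  have dt1: "((\<lambda>s. ext0 \<phi> (x, s)) has_vector_derivative dt {0<..<T} \<phi> (x, t)) (at t)" if t: "0 < t" "t < T" for x t
    by (rule has_vector_derivative_transform_within_open[OF dtd[OF t], of "{0<..}"]) (use t in \<open>auto simp: ext0_def\<close>)
  have dt2: "((\<lambda>s. ext0 \<phi> (x, s)) has_vector_derivative 0) (at t)" if t: "t < b" "t < T" for x t
    by (rule has_vector_derivative_transform_within_open[of "\<lambda>_. 0" 0 t "{..<min b T}"])
       (use t in \<open>auto simp: ext0_def \<phi>0\<close>)
  have dt3: "((\<lambda>s. ext0 \<phi> (x, s)) has_vector_derivative ext0 (dt {0<..<T} \<phi>) (x, t)) (at t within {0..<T})"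
    if t: "0 \<le> t" "t < T" for x t
  proof (cases "t > 0")
    case True
    then show ?thesis using dt1[OF True t(2)] by (simp add: ext0_def has_vector_derivative_at_within)
  next
    case False
    then show ?thesis using dt2[of t] t b by (simp add: ext0_def has_vector_derivative_at_within)
  qed
  have dt4: "dt {0..<T} (ext0 \<phi>) z = ext0 (dt {0<..<T} \<phi>) z" if "snd z \<in> {0..<T}" for z
  proof -
    obtain x t where xt: "z = (x, t)" by (cases z)
    then show ?thesis
      using vector_derivative_within[OF at_within_Ico_neq_bot dt3[of t x]] that by (simp add: dt_def)
  qed
  have dt0: "dt {0<..<T} \<phi> (x, t) = 0" if t: "0 < t" "t < b" "t < T" for x t
    using vector_derivative_at[OF dt1[OF t(1,3)]] vector_derivative_at[OF dt2[OF t(2,3)]] by simp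
  show "dt {0..<T} (ext0 \<phi>) z = dt {0<..<T} \<phi> z" if "z \<in> QT T" for z
    using dt4[of z] that by (simp add: mem_QT ext0_def)
  show "laplacian (ext0 \<phi>) z = laplacian \<phi> z" if "z \<in> QT T" for z
    using that by (simp add: laplacian_def dx_ext0 ext0_def mem_QT)
  have "C21 {0..<T} (ext0 \<phi>)"
    unfolding C21_def dx_ext0
  proof (intro conjI allI ballI)
    show "continuous_on (UNIV \<times> {0..<T}) (ext0 \<phi>)"
      by (rule continuous_on_ext0[where f=\<phi>, OF _ b(1) \<phi>0]) (use C in \<open>auto simp: C21_def\<close>)
    show "(\<lambda>s. ext0 \<phi> (x, s)) differentiable at t within {0..<T}" if "t \<in> {0..<T}" for x t
      using dt3[of t x] that by (auto intro: differentiableI_vector)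
    have "continuous_on (UNIV \<times> {0..<T}) (ext0 (dt {0<..<T} \<phi>))"
      by (rule continuous_on_ext0[where f="dt {0<..<T} \<phi>", OF _ b(1) dt0]) (use C in \<open>auto simp: C21_def\<close>)
    then show "continuous_on (UNIV \<times> {0..<T}) (dt {0..<T} (ext0 \<phi>))"
      by (rule continuous_on_eq) (auto simp: dt4)
    show "dx_exists i {0..<T} (ext0 \<phi>)" "dx_exists j {0..<T} (ext0 (dx i \<phi>))" for i j
      using C by (auto simp: C21_def intro: dx_exists_ext0)
    show "continuous_on (UNIV \<times> {0..<T}) (ext0 (dx i \<phi>))" for i
      by (rule continuous_on_ext0[where f="dx i \<phi>", OF _ b(1) dx0(1)]) (use C in \<open>auto simp: C21_def\<close>)
    show "continuous_on (UNIV \<times> {0..<T}) (ext0 (dx j (dx i \<phi>)))" for i j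
      by (rule continuous_on_ext0[where f="dx j (dx i \<phi>)", OF _ b(1) dx0(2)]) (use C in \<open>auto simp: C21_def\<close>)
  qed
  moreover have "K \<subseteq> UNIV \<times> {0..<T}" using K(2) by auto
  moreover have "ext0 \<phi> z = 0" if "z \<in> UNIV \<times> {0..<T} - K" for z
    using K(3)[of z] that by (auto simp: ext0_def)
  ultimately show "ext0 \<phi> \<in> C21_0 {0..<T}" unfolding C21_0_def using K(1) by blast
qed

text \<open>The extended test function vanishes at the origin, so the Dirac mass drops out.\<close>

lemma fundamental_solution_interior:
  assumes f: "fundamental_solution h q T k u" and T: "T > 0" and \<phi>: "\<phi> \<in> C21_0 {0<..<T}"
  shows "weak_form h q T {0<..<T} u \<phi> = 0"
proof -
  have "weak_form h q T {0<..<T} u \<phi> = weak_form h q T {0..<T} u (ext0 \<phi>)"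
    unfolding weak_form_def set_lebesgue_integral_def
  proof (rule Bochner_Integration.integral_cong[OF refl])
    fix z
    show "indicator (QT T) z *\<^sub>R (- u z * dt {0<..<T} \<phi> z - u z * laplacian \<phi> z + h (snd z) * u z powr q * \<phi> z) =
       indicator (QT T) z *\<^sub>R (- u z * dt {0..<T} (ext0 \<phi>) z - u z * laplacian (ext0 \<phi>) z + h (snd z) * u z powr q * ext0 \<phi> z)"
    proof (cases "z \<in> QT T")
      case True
      then show ?thesis using ext0_test_function(2,3)[OF \<phi> T True] by (simp add: ext0_def mem_QT)
    qed simp
  qed
  also have "\<dots> = k * ext0 \<phi> (0, 0)"
    using f ext0_test_function(1)[OF \<phi> T] by (auto simp: fundamental_solution_def)
  finally show ?thesis by (simp add: ext0_def)
qed

section \<open>The increasing family of fundamental solutions\<close>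

locale absorption =
  fixes q T :: real and h \<omega> :: "real \<Rightarrow> real" and u :: "real \<Rightarrow> (real^'n) \<times> real \<Rightarrow> real"
  assumes q: "q > 1" and T: "T > 0"
    and h_cont: "continuous_on {0..} h" and h_mono: "mono_on {0..} h"
    and h_nonneg: "\<And>t. t \<ge> 0 \<Longrightarrow> h t \<ge> 0" and h_pos: "\<And>t. t > 0 \<Longrightarrow> h t > 0"
    and \<omega>: "continuous_on {0..} \<omega>" "mono_on {0..} \<omega>" "\<And>t. t \<ge> 0 \<Longrightarrow> \<omega> t \<ge> 0"
    and h_eq: "\<And>t. t > 0 \<Longrightarrow> h t = exp (- \<omega> t / t)"
    and dini: "(\<integral>\<^sup>+s\<in>{0<..<1}. ennreal (sqrt (\<omega> s) / s) \<partial>lborel) < \<infinity>"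
    and sol: "\<And>k. k > 0 \<Longrightarrow> fundamental_solution h q T k (u k)"
begin

definition w where "w k = cyl_ext T (u k)"
definition g where "g k = cyl_ext T (\<lambda>z. h (snd z) * u k z powr q)"

lemma w_simp: "z \<in> QT T \<Longrightarrow> w k z = u k z"
  by (simp add: w_def cyl_ext_def)

lemma w_nonneg: "k > 0 \<Longrightarrow> w k z \<ge> 0"
  using sol[of k] by (auto simp: w_def cyl_ext_def fundamental_solution_def)

lemma g_eq: "g k z = h (snd z) * w k z powr q"
  using q by (auto simp: g_def w_def cyl_ext_def)

lemma g_nonneg: "g k z \<ge> 0"
  using h_nonneg by (auto simp: g_def cyl_ext_def mem_QT)

lemma w_outside: "z \<notin> QT T \<Longrightarrow> w k z = 0" "z \<notin> QT T \<Longrightarrow> g k z = 0"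
  by (auto simp: w_def g_def cyl_ext_def)

lemma g_mono:
  assumes "k > 0" "w k z \<le> w l z" shows "g k z \<le> g l z"
proof (cases "z \<in> QT T")
  case True
  then have "h (snd z) \<ge> 0" using h_nonneg[of "snd z"] by (simp add: mem_QT)
  moreover have "w k z powr q \<le> w l z powr q" using assms w_nonneg[of k z] q by (intro powr_mono2) auto
  ultimately show ?thesis unfolding g_eq by (rule mult_left_mono[rotated])
qed (simp add: w_outside)

lemma u_cont: "k > 0 \<Longrightarrow> continuous_on (QT T) (u k)"
  using sol[of k] by (simp add: fundamental_solution_def)

lemma h_snd_cont: "continuous_on (QT T) (\<lambda>z::(real^'n) \<times> real. h (snd z))"
  by (rule continuous_on_compose2[OF h_cont]) (auto intro!: continuous_intros simp: mem_QT)

lemma powr_cont: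
  fixes f :: "(real^'n) \<times> real \<Rightarrow> real"
  assumes "continuous_on A f" "\<And>z. z \<in> A \<Longrightarrow> f z \<ge> 0"
  shows "continuous_on A (\<lambda>z. f z powr q)"
  using q assms by (intro continuous_on_powr') auto

lemma hu_cont: "k > 0 \<Longrightarrow> continuous_on (QT T) (\<lambda>z. h (snd z) * u k z powr q)"
  using sol[of k] by (intro continuous_on_mult h_snd_cont powr_cont u_cont) (auto simp: fundamental_solution_def)

lemma w_cont: "k > 0 \<Longrightarrow> continuous_on (QT T) (w k)"
  unfolding w_def by (intro continuous_on_ext u_cont)

lemma g_cont: "k > 0 \<Longrightarrow> continuous_on (QT T) (g k)"
  unfolding g_def by (intro continuous_on_ext hu_cont)

lemma w_loc: "k > 0 \<Longrightarrow> loc_int (w k)"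
  unfolding w_def using sol[of k] by (intro loc_int_ext T u_cont) (auto simp: fundamental_solution_def)

lemma g_loc: "k > 0 \<Longrightarrow> loc_int (g k)"
  unfolding g_def using sol[of k] by (intro loc_int_ext T hu_cont) (auto simp: fundamental_solution_def)

lemma w_weak: "k > 0 \<Longrightarrow> weak_eq T (w k) (g k) k"
  unfolding w_def g_def
  by (rule fundamental_solution_weak_eq[OF T sol]) (use w_loc g_loc in \<open>auto simp: w_def g_def\<close>)

lemma w_initial: "snd z \<le> 0 \<Longrightarrow> w k z = 0"
  by (rule w_outside) (simp add: mem_QT)

lemma w_visc: "k > 0 \<Longrightarrow> visc T (w k) (\<lambda>z. - g k z)"
  by (rule weak_eq_visc[OF w_weak w_loc g_loc w_cont g_cont])

lemma w_bound:
  assumes "0 < T'" "T' < T"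
  obtains C where "C > 0"
    "\<And>k x t. k > 0 \<Longrightarrow> 0 < t \<Longrightarrow> t \<le> T' \<Longrightarrow> w k (x, t) \<le> (C / (t * h (t / 2))) powr (1 / (q - 1))"
proof (rule keller_osserman[OF q assms h_mono h_pos, where 'n='n])
  fix C :: real assume C: "C > 0" and bd:
    "\<And>(v :: (real^'n) \<times> real \<Rightarrow> real) x0 t0. continuous_on (QT T) v \<Longrightarrow> visc T v (\<lambda>z. - (h (snd z) * v z powr q)) \<Longrightarrow>
       0 < t0 \<Longrightarrow> t0 \<le> T' \<Longrightarrow> v (x0, t0) \<le> (C / (t0 * h (t0 / 2))) powr (1 / (q - 1))"
  show thesis
  proof (rule that[OF C])
    fix k :: real and x t assume "k > 0" "0 < t" "t \<le> T'"
    then show "w k (x, t) \<le> (C / (t * h (t / 2))) powr (1 / (q - 1))"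
      using w_visc[of k] by (intro bd w_cont) (simp_all add: g_eq)
  qed
qed

text \<open>Absorption is monotone, so the larger solution loses more and the difference is
  subcaloric. The source of strength \<open>l - k\<close> would have the wrong sign;
  \<open>0 \<notin> Q\<close> excludes it.\<close>

lemma diff_subcal_interior:
  assumes k: "0 < k" "0 < l" and le: "\<And>z. w k z \<le> w l z" and Q: "0 \<notin> Q" "\<And>z. z \<in> Q \<Longrightarrow> snd z \<le> a" "a < T"
  shows "subcal (\<lambda>z. w l z - w k z) Q"
  unfolding subcal_def
proof (intro allI impI)
  fix \<phi> \<phi>t \<phi>x \<phi>xx assume j: "jet \<phi> \<phi>t \<phi>x \<phi>xx" and 0: "\<forall>z. 0 \<le> \<phi> z" "\<forall>z. z \<notin> Q \<longrightarrow> \<phi> z = 0"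
  have "weak_eq T (\<lambda>z. w l z - w k z) (\<lambda>z. g l z - g k z) (l - k)"
    using k by (intro weak_eq_diff w_weak w_loc g_loc)
  moreover have "\<forall>z. snd z > a \<longrightarrow> \<phi> z = 0" using 0(2) Q(2) by (meson not_le)
  ultimately have "(\<integral>y. (w l y - w k y) * (- \<phi>t y - (\<Sum>i\<in>UNIV. \<phi>xx i i y)) \<partial>lborel)
      = - (\<integral>y. (g l y - g k y) * \<phi> y \<partial>lborel) + (l - k) * \<phi> 0"
    using j Q(3) unfolding weak_eq_def by blast
  moreover have "\<phi> 0 = 0" using 0(2) Q(1) by blast
  moreover have "(\<integral>y. (g l y - g k y) * \<phi> y \<partial>lborel) \<ge> 0"
    using 0(1) g_mono[OF k(1) le] by (intro integral_nonneg_AE AE_I2) auto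
  ultimately show "(\<integral>y. (w l y - w k y) * (- \<phi>t y - (\<Sum>i\<in>UNIV. \<phi>xx i i y)) \<partial>lborel) \<le> 0" by simp
qed

text \<open>The absorption term is nonnegative by itself, so only the Dirac source has to be kept
  out of \<open>Q\<close>.\<close>

lemma w_subcal:
  assumes k: "0 < k" and Q: "0 \<notin> Q" "\<And>z. z \<in> Q \<Longrightarrow> snd z \<le> a" "a < T"
  shows "subcal (w k) Q"
  unfolding subcal_def
proof (intro allI impI)
  fix \<phi> \<phi>t \<phi>x \<phi>xx assume j: "jet \<phi> \<phi>t \<phi>x \<phi>xx" and 0: "\<forall>z. 0 \<le> \<phi> z" "\<forall>z. z \<notin> Q \<longrightarrow> \<phi> z = 0"
  have "\<forall>z. snd z > a \<longrightarrow> \<phi> z = 0" using 0(2) Q(2) by (meson not_le)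
  then have "(\<integral>y. w k y * (- \<phi>t y - (\<Sum>i\<in>UNIV. \<phi>xx i i y)) \<partial>lborel) = - (\<integral>y. g k y * \<phi> y \<partial>lborel) + k * \<phi> 0"
    using w_weak[OF k] j Q(3) unfolding weak_eq_def by blast
  moreover have "\<phi> 0 = 0" using 0(2) Q(1) by blast
  moreover have "(\<integral>y. g k y * \<phi> y \<partial>lborel) \<ge> 0"
    using 0(1) g_nonneg by (intro integral_nonneg_AE AE_I2) auto
  ultimately show "(\<integral>y. w k y * (- \<phi>t y - (\<Sum>i\<in>UNIV. \<phi>xx i i y)) \<partial>lborel) \<le> 0" by simp
qed

text \<open>The absorption bound does not involve \<open>k\<close>, so one profile serves the whole
  family; the uniformity in \<open>k\<close> of the initial decay rests on this.\<close>

lemma front: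
  assumes "0 < T'" "T' < T"
  obtains B B' I :: "real \<Rightarrow> real" where "front_profile T B B' I"
    "\<forall>k x t. k > 0 \<longrightarrow> 0 < t \<longrightarrow> t \<le> T' \<longrightarrow> w k (x, t) \<le> exp (t * (B t)\<^sup>2)"
proof (rule w_bound[OF assms])
  fix C :: real assume C: "C > 0" and bd: "\<And>k x t. k > 0 \<Longrightarrow> 0 < t \<Longrightarrow> t \<le> T' \<Longrightarrow>
    w k (x, t) \<le> (C / (t * h (t / 2))) powr (1 / (q - 1))"
  have "1 / (q - 1) > 0" using q by simp
  from dini_front[OF \<omega> h_eq dini this C T]
  obtain B B' I where f: "front_profile T B B' I"
    and e: "\<forall>t. 0 < t \<longrightarrow> t < T \<longrightarrow> (C / (t * h (t / 2))) powr (1 / (q - 1)) \<le> exp (t * (B t)\<^sup>2)"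
    by blast
  show thesis
  proof (rule that[OF f], intro allI impI)
    fix k x t assume "(0::real) < k" "0 < t" "t \<le> T'"
    then show "w k (x, t) \<le> exp (t * (B t)\<^sup>2)"
      using bd[of k t x] e assms by (meson le_less_trans order_trans)
  qed
qed

text \<open>Kato's inequality across the initial time makes the positive part of \<open>w k - w l\<close> vanish at time
  \<open>0\<close> locally uniformly; a front started at distance \<open>R\<close> then bounds it, and \<open>R\<close> is arbitrary.\<close>

lemma w_mono:
  assumes k: "0 < k" "k \<le> l" shows "w k z \<le> w l z"
proof (cases "z \<in> QT T")
  case True
  have l: "l > 0" using k by simp
  obtain x0 t2 where z: "z = (x0, t2)" by (cases z)
  have t2: "0 < t2" "t2 < T" using True z by (auto simp: mem_QT)
  define T' where "T' = (t2 + T) / 2"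
  have T': "t2 < T'" "T' < T" "0 < T'" using t2 by (auto simp: T'_def)
  define v where "v z = w k z - w l z" for z
  define gv where "gv z = g k z - g l z" for z
  have eq: "weak_eq T v gv (k - l)"
    unfolding v_def[abs_def] gv_def[abs_def] using k l by (intro weak_eq_diff w_weak w_loc g_loc)
  have vl: "loc_int v" "loc_int gv"
    unfolding v_def[abs_def] gv_def[abs_def] using k l by (simp_all add: loc_int_diff w_loc g_loc)
  have vc: "continuous_on (QT T) v" "continuous_on (QT T) gv"
    unfolding v_def[abs_def] gv_def[abs_def] using k l by (auto intro!: continuous_intros w_cont g_cont)
  have vo: "z \<notin> QT T \<Longrightarrow> v z = 0" "z \<notin> QT T \<Longrightarrow> gv z = 0" for z by (auto simp: v_def gv_def w_outside)
  have sign: "gv z \<ge> 0" if "v z > 0" for z using g_mono[of l z k] l that by (simp add: v_def gv_def)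
  have vis: "visc T v (\<lambda>z. - gv z)" by (rule weak_eq_visc[OF eq vl vc])
  define W where "W z = soft_pos (v z)" for z
  have pjc: "continuous_on UNIV soft_pos" by (simp add: continuous_at_imp_continuous_on isCont_pj)
  have W: "loc_int W" "W z \<ge> 0" "continuous_on (QT T) W" "snd z \<le> 0 \<Longrightarrow> W z = 0" for z
  proof -
    have "soft_pos \<in> borel_measurable borel" by (rule borel_measurable_continuous_onI[OF pjc])
    then show "loc_int W" unfolding W_def[abs_def]
      by (intro loc_int_bound[OF vl(1)] measurable_compose[OF loc_int_measurable[OF vl(1)]] soft_pos_le_abs)
    show "W z \<ge> 0" by (simp add: W_def soft_pos_nonneg)
    show "continuous_on (QT T) W" unfolding W_def[abs_def] by (rule continuous_on_compose2[OF pjc vc(1)]) auto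
    show "W z = 0" if "snd z \<le> 0" using that by (simp add: W_def vo mem_QT soft_pos_def)
  qed
  \<comment> \<open>Unlike in the interior lemmas the cylinder may contain the origin: the source
    has strength k - l \<le> 0, the sign that Kato's inequality allows. The radius 1 is
    arbitrary.\<close>
  have sub: "subcal W (cball y (2 * 1) \<times> {s - 2 * 1\<^sup>2..s})" if "s < T" for y s
    unfolding subcal_def
  proof (intro allI impI)
    fix \<phi> \<phi>t \<phi>x \<phi>xx assume j: "jet \<phi> \<phi>t \<phi>x \<phi>xx" and 0: "\<forall>z. 0 \<le> \<phi> z"
      "\<forall>z. z \<notin> cball y (2 * 1) \<times> {s - 2 * 1\<^sup>2..s} \<longrightarrow> \<phi> z = 0"
    show "(\<integral>y. W y * (- \<phi>t y - (\<Sum>i\<in>UNIV. \<phi>xx i i y)) \<partial>lborel) \<le> 0"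
      unfolding W_def
    proof (rule kato[OF eq _ vl(1) vc(1) vo(1) vl(2) vc(2) vo(2) sign j _ _ that])
      show "\<phi> z = 0" if "snd z > s" for z using 0(2) that by (cases z) auto
    qed (use 0 k in auto)
  qed
  obtain B B' I where fp: "front_profile T B B' I"
    and bd': "\<forall>k x t. k > 0 \<longrightarrow> 0 < t \<longrightarrow> t \<le> T' \<longrightarrow> w k (x, t) \<le> exp (t * (B t)\<^sup>2)"
    using front[OF T'(3,2)] by blast
  have B: "\<And>t. 0 < t \<Longrightarrow> t < T \<Longrightarrow> (B has_real_derivative B' t) (at t)"
    "\<And>t. 0 < t \<Longrightarrow> t < T \<Longrightarrow> B' t \<le> 0" "\<And>t. 0 < t \<Longrightarrow> t < T \<Longrightarrow> - (t * B' t) \<le> 2 * B t"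
    "\<And>t. 0 < t \<Longrightarrow> t < T \<Longrightarrow> 0 < B t" "continuous_on {0<..<T} B'"
    and I: "\<And>t. 0 < t \<Longrightarrow> t < T \<Longrightarrow> (I has_real_derivative B t) (at t)" "\<And>t. 0 < t \<Longrightarrow> t < T \<Longrightarrow> 0 \<le> I t"
    using fp unfolding front_profile_def by blast+
  have bd: "\<And>k x t. k > 0 \<Longrightarrow> 0 < t \<Longrightarrow> t \<le> T' \<Longrightarrow> w k (x, t) \<le> exp (t * (B t)\<^sup>2)" using bd' by blast
  have Imono: "I t \<le> I T'" if "0 < t" "t < T'" for t
  proof (rule DERIV_nonneg_imp_nondecreasing[of t T' I])
    fix s assume "t \<le> s" "s \<le> T'"
    then have s: "0 < s" "s < T" using that T' by auto
    show "\<exists>y. (I has_real_derivative y) (at s) \<and> 0 \<le> y"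
      using I(1)[OF s] B(4)[OF s] by (intro exI[of _ "B s"]) simp
  qed (use that in simp)
  \<comment> \<open>Up to \<open>T'\<close> the faces move by at most 4 I(T'), so every larger
    \<open>R\<close> leaves a cube of positive width around \<open>x0\<close>.\<close>
  have vR: "v (x0, t2) \<le> 2 * real CARD('n) * exp (t2 * (B t2)\<^sup>2 - B t2 * (R - 4 * I t2))" if R: "R > 4 * I T'" for R
  proof (rule barrier_bound[OF vis vc(1), where T'=T' and \<rho>="\<lambda>t. R - 4 * I t" and R=R and B'=B'])
    show "- gv z \<le> 0" if "v z > 0" for z using sign[OF that] by simp
    show "continuous_on {0<..<T'} B'" by (rule continuous_on_subset[OF B(5)]) (use T' in auto)
    show "((\<lambda>t. R - 4 * I t) has_real_derivative - 4 * B t) (at t)" if "0 < t" "t < T'" for t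
      using I(1)[of t] that T' by (auto intro!: derivative_eq_intros)
    show "0 < R - 4 * I t" if "0 < t" "t < T'" for t using Imono[OF that] R by simp
    show "R - 4 * I t \<le> R" if "0 < t" "t < T'" for t using I(2)[of t] that T' by simp
    show "v (x, t) \<le> exp (t * (B t)\<^sup>2)" if "0 < t" "t < T'" for x t
      using bd[of k t x] w_nonneg[OF l, of "(x, t)"] k that by (simp add: v_def)
    show "\<exists>\<tau>>0. \<forall>x t. 0 < t \<longrightarrow> t < \<tau> \<longrightarrow> t < T' \<longrightarrow> (\<forall>i. \<bar>(x - x0) $ i\<bar> \<le> R) \<longrightarrow> v (x, t) \<le> \<epsilon>" if \<epsilon>: "\<epsilon> > 0" for \<epsilon>
    proof -
      \<comment> \<open>Decay is available for \<open>soft_pos\<close> of \<open>v\<close> only. By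
        monotonicity v > \<epsilon> would make it at least \<open>soft_pos \<epsilon>\<close>, so
        half of that value is a sufficient threshold.\<close>
      have p: "soft_pos \<epsilon> / 2 > 0" using soft_pos_pos[OF \<epsilon>] by simp
      show ?thesis
      proof (rule initial_decay[OF W(1,2,3,4) bounded_cube[of x0 R] zero_less_one sub p])
        fix \<tau> :: real
        assume \<tau>: "0 < \<tau>" "\<And>x t. x \<in> {x. \<forall>i. \<bar>(x - x0) $ i\<bar> \<le> R} \<Longrightarrow> 0 < t \<Longrightarrow> t < \<tau> \<Longrightarrow> t < T \<Longrightarrow> W (x, t) \<le> soft_pos \<epsilon> / 2"
        have "v (x, t) \<le> \<epsilon>" if "0 < t" "t < \<tau>" "t < T'" "\<forall>i. \<bar>(x - x0) $ i\<bar> \<le> R" for x t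
        proof (rule ccontr)
          assume "\<not> v (x, t) \<le> \<epsilon>"
          then have "soft_pos \<epsilon> \<le> W (x, t)" unfolding W_def by (intro soft_pos_mono) simp
          moreover have "W (x, t) \<le> soft_pos \<epsilon> / 2" using that T' by (intro \<tau>(2)) auto
          ultimately show False using p by linarith
        qed
        then show ?thesis using \<tau>(1) by blast
      qed auto
    qed
  qed (use T' t2 B in \<open>auto intro: less_imp_le\<close>)
  have "v (x0, t2) \<le> 0"
  proof (rule ccontr)
    assume "\<not> v (x0, t2) \<le> 0"
    then have v0: "v (x0, t2) > 0" by simp
    define D where "D = 2 * real CARD('n) * exp (t2 * (B t2)\<^sup>2 + 4 * B t2 * I t2)"
    have D: "D > 0" by (simp add: D_def)
    have b: "B t2 > 0" using B(4) t2 by blast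
    \<comment> \<open>The estimate says that v exp (B R) is at most \<open>D\<close>, which does not
      depend on \<open>R\<close>. This \<open>R\<close> makes v B R at least \<open>D\<close>,
      against exp y > y.\<close>
    define R where "R = max (4 * I T' + 1) (D / (B t2 * v (x0, t2)))"
    have R4: "R > 4 * I T'" by (auto simp: R_def)
    have eq4: "t2 * (B t2)\<^sup>2 - B t2 * (R - 4 * I t2) = (t2 * (B t2)\<^sup>2 + 4 * B t2 * I t2) + - (B t2 * R)"
      by (simp add: algebra_simps)
    have "v (x0, t2) \<le> D * exp (- (B t2 * R))" using vR[OF R4] unfolding eq4 exp_add D_def by (simp only: mult.assoc)
    then have "v (x0, t2) * exp (B t2 * R) \<le> D" by (simp add: exp_minus field_simps)
    moreover have "D / (B t2 * v (x0, t2)) \<le> R" by (simp add: R_def)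
    then have "D \<le> v (x0, t2) * (B t2 * R)" using b v0 by (simp add: pos_divide_le_eq mult_ac)
    moreover have "v (x0, t2) * (B t2 * R) < v (x0, t2) * exp (B t2 * R)"
      using v0 exp_ge_add_one_self[of "B t2 * R"] by (intro mult_strict_left_mono) linarith+
    ultimately show False by linarith
  qed
  then show ?thesis by (simp add: z v_def)
qed (simp add: w_outside)


section \<open>The limit function: continuity, initial trace, singularity and equation\<close>

definition uinf where "uinf z = (if z \<in> QT T then SUP k\<in>{0<..}. w k z else 0)"

text \<open>Since t h(t/2) increases with t, the absorption bound is worst at the earliest time in
  \<open>K\<close>, which is positive by compactness.\<close>

lemma w_loc_bound:
  assumes K: "compact K" "K \<subseteq> QT T"
  obtains M where "M > 0" "\<And>k z. k > 0 \<Longrightarrow> z \<in> K \<Longrightarrow> w k z \<le> M"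
proof (cases "K = {}")
  case False
  have c: "continuous_on K snd" by (intro continuous_intros)
  obtain y where y: "y \<in> K" "\<And>z. z \<in> K \<Longrightarrow> snd y \<le> snd z" using continuous_attains_inf[OF K(1) False c] by blast
  obtain y' where y': "y' \<in> K" "\<And>z. z \<in> K \<Longrightarrow> snd z \<le> snd y'" using continuous_attains_sup[OF K(1) False c] by blast
  have ty: "0 < snd y" "snd y \<le> snd y'" "snd y' < T" using y y' K(2) by (auto simp: mem_QT)
  obtain C where C: "C > 0" "\<And>k x t. k > 0 \<Longrightarrow> 0 < t \<Longrightarrow> t \<le> snd y' \<Longrightarrow> w k (x, t) \<le> (C / (t * h (t / 2))) powr (1 / (q - 1))"
    using w_bound[of "snd y'"] ty by (metis less_le_trans)
  have hy: "h (snd y / 2) > 0" using h_pos ty by simp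
  show ?thesis
  proof (rule that[of "(C / (snd y * h (snd y / 2))) powr (1 / (q - 1))"])
    show "(C / (snd y * h (snd y / 2))) powr (1 / (q - 1)) > 0" using C ty hy by simp
    fix k z assume k: "k > (0::real)" and z: "z \<in> K"
    obtain x t where xt: "z = (x, t)" by (cases z)
    have t: "snd y \<le> t" "t \<le> snd y'" "0 < t" using y(2)[OF z] y'(2)[OF z] ty xt by auto
    have "snd y * h (snd y / 2) \<le> t * h (t / 2)"
      using t ty hy mono_onD[OF h_mono, of "snd y / 2" "t / 2"] by (intro mult_mono) auto
    then have "C / (t * h (t / 2)) \<le> C / (snd y * h (snd y / 2))"
      using C ty hy by (intro divide_left_mono mult_pos_pos) (auto simp: t h_pos)
    then have "(C / (t * h (t / 2))) powr (1 / (q - 1)) \<le> (C / (snd y * h (snd y / 2))) powr (1 / (q - 1))"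
      using q C t h_pos[of "t / 2"] by (intro powr_mono2) auto
    then show "w k z \<le> (C / (snd y * h (snd y / 2))) powr (1 / (q - 1))"
      using C(2)[OF k t(3,2), of x] by (simp add: xt)
  qed
qed (use that[of 1] in auto)

lemma w_bdd:
  assumes "z \<in> QT T" shows "bdd_above ((\<lambda>k. w k z) ` {0<..})"
proof (rule w_loc_bound[of "{z}"])
  fix M assume M: "\<And>k y. k > 0 \<Longrightarrow> y \<in> {z} \<Longrightarrow> w k y \<le> M"
  have "w k z \<le> M" if "k > 0" for k using M[OF that, of z] by simp
  then show ?thesis by (intro bdd_aboveI[of _ M]) auto
qed (use assms in auto)

lemma w_le_uinf: "k > 0 \<Longrightarrow> w k z \<le> uinf z"
  by (cases "z \<in> QT T") (auto simp: uinf_def w_outside intro: cSUP_upper w_bdd)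

lemma uinf_le:
  assumes "\<And>k. k > 0 \<Longrightarrow> w k z \<le> M" "M \<ge> 0" shows "uinf z \<le> M"
  using assms by (auto simp: uinf_def intro!: cSUP_least)

lemma uinf_nonneg: "uinf z \<ge> 0"
  using w_le_uinf[of 1 z] w_nonneg[of 1 z] by linarith

lemma w_tendsto: "((\<lambda>k. w k z) \<longlongrightarrow> uinf z) at_top"
proof (cases "z \<in> QT T")
  case True
  show ?thesis
  proof (rule tendstoI)
    fix e :: real assume "e > 0"
    then have "uinf z - e < (SUP k\<in>{0<..}. w k z)" using True by (simp add: uinf_def)
    then have "\<exists>k\<in>{0<..}. uinf z - e < w k z"
      by (subst (asm) less_cSUP_iff[OF _ w_bdd[OF True]]) auto
    then obtain k where k: "k > 0" "uinf z - e < w k z" by auto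
    have "dist (w l z) (uinf z) < e" if "l \<ge> k" for l
      using w_mono[of k l z] w_le_uinf[of l z] k that by (simp add: dist_real_def)
    then show "eventually (\<lambda>l. dist (w l z) (uinf z) < e) at_top" unfolding eventually_at_top_linorder by blast
  qed
qed (simp add: w_outside uinf_def)

text \<open>Differences of the approximating solutions are nonnegative and subcaloric away from the origin, so
  by the mean value inequality \<open>L1\<close> convergence is locally uniform.\<close>

lemma uinf_cont: "continuous_on (QT T) uinf"
proof (rule continuous_at_imp_continuous_on, rule ballI)
  fix z0 :: "(real^'n) \<times> real" assume "z0 \<in> QT T"
  then obtain x0 t0 where z0: "z0 = (x0, t0)" and t0: "0 < t0" "t0 < T" by (cases z0) (auto simp: mem_QT)
  define \<eta> where "\<eta> = min 1 (min (t0 / 4) ((T - t0) / 4))"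
  have \<eta>: "\<eta> > 0" "\<eta> \<le> t0 / 4" "\<eta> \<le> (T - t0) / 4" "\<eta> \<le> 1"
  proof -
    show "\<eta> > 0" using t0 by (simp add: \<eta>_def)
    show "\<eta> \<le> t0 / 4" "\<eta> \<le> (T - t0) / 4" "\<eta> \<le> 1" unfolding \<eta>_def by linarith+
  qed
  \<comment> \<open>With 2r^2 = t0/4 a mean value cylinder whose top is within \<eta> \<le> t0/4 of
    \<open>t0\<close> starts no earlier than t0/2, hence stays in \<open>Kc\<close>.\<close>
  define r where "r = sqrt (t0 / 8)"
  have r: "r > 0" "2 * r\<^sup>2 = t0 / 4" using t0 by (auto simp: r_def)
  define Kc where "Kc = cball x0 (1 + 2 * r) \<times> {t0 / 2..t0 + \<eta>}"
  have Kc: "compact Kc" "Kc \<subseteq> QT T"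
    unfolding Kc_def using t0 \<eta> by (auto intro!: compact_Times simp: mem_QT)
  obtain M where M: "M > 0" "\<And>k z. k > 0 \<Longrightarrow> z \<in> Kc \<Longrightarrow> w k z \<le> M" using w_loc_bound[OF Kc] by blast
  have Kcm: "Kc \<in> sets borel" using Kc(1) by (intro borel_closed compact_imp_closed)
  obtain R where R: "\<And>z. z \<in> Kc \<Longrightarrow> norm z \<le> R" using compact_imp_bounded[OF Kc(1)] by (auto simp: bounded_iff)
  have iK: "integrable lborel (\<lambda>y. f y * indicator Kc y)" if "loc_int f" for f
    by (rule loc_int_mult[OF that borel_measurable_indicator[OF Kcm], where M=1 and R=R])
       (use R in \<open>force simp: indicator_def\<close>)+
  \<comment> \<open>The masses on \<open>Kc\<close> increase with \<open>k\<close> and are bounded,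
    so they converge; this is all the L1 convergence that is needed.\<close>
  define a where "a k = (\<integral>y. w k y * indicator Kc y \<partial>lborel)" for k
  have amono: "a k \<le> a l" if "0 < k" "k \<le> l" for k l
    unfolding a_def using that
    by (intro integral_mono iK w_loc mult_right_mono w_mono) auto
  have "a k \<le> M * measure lborel Kc" if "k > 0" for k
  proof -
    have fin: "emeasure lborel Kc < \<infinity>" by (rule emeasure_compact_finite[OF Kc(1)])
    have "a k \<le> (\<integral>y. M * indicator Kc y \<partial>lborel)"
      unfolding a_def
    proof (rule integral_mono[OF iK[OF w_loc[OF that]]])
      show "integrable lborel (\<lambda>y. M * indicat_real Kc y)"
        using fin Kcm by (intro integrable_mult_right integrable_real_indicator) auto
      show "w k y * indicator Kc y \<le> M * indicator Kc y" for y using M(2)[OF that, of y] by (auto simp: indicator_def)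
    qed
    also have "\<dots> = M * measure lborel Kc" using fin Kcm by simp
    finally show ?thesis .
  qed
  then have bdda: "bdd_above (a ` {0<..})" by (intro bdd_aboveI[of _ "M * measure lborel Kc"]) auto
  define aS where "aS = (SUP k\<in>{0<..}. a k)"
  have aS: "a k \<le> aS" if "k > 0" for k unfolding aS_def by (rule cSUP_upper[OF _ bdda]) (use that in simp)
  obtain C where C: "C \<ge> 0" "\<And>(W :: (real^'n) \<times> real \<Rightarrow> real) x0 t0.
      loc_int W \<Longrightarrow> \<forall>z. W z \<ge> 0 \<Longrightarrow> isCont W (x0, t0) \<Longrightarrow>
      subcal W (cball x0 (2 * r) \<times> {t0 - 2 * r\<^sup>2..t0}) \<Longrightarrow>
      W (x0, t0) \<le> C * (\<integral>y. W y * indicator (cball x0 (2 * r) \<times> {t0 - 2 * r\<^sup>2..t0}) y \<partial>lborel)"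
  proof (rule subcaloric_mean_value[OF r(1), where 'n='n])
    fix C assume C: "C \<ge> 0" and mv: "\<And>(W :: (real^'n) \<times> real \<Rightarrow> real) x0 t0.
      loc_int W \<Longrightarrow> \<forall>z. W z \<ge> 0 \<Longrightarrow> isCont W (x0, t0) \<Longrightarrow>
      subcal W (cball x0 (2 * r) \<times> {t0 - 2 * r\<^sup>2..t0}) \<Longrightarrow>
      W (x0, t0) \<le> C * (\<integral>y. W y * indicator (cball x0 (2 * r) \<times> {t0 - 2 * r\<^sup>2..t0}) y \<partial>lborel)"
    show thesis by (rule that[OF C], rule mv)
  qed
  \<comment> \<open>For l > k the mean value inequality bounds the difference of the two solutions
    by \<open>C\<close> times the difference of their masses. The bound does not depend on
    \<open>l\<close> or \<open>z\<close>, so it survives the supremum and is uniform on the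
    ball.\<close>
  have near: "uinf z \<le> w k z + C * (aS - a k)" if k: "k > 0" and z: "z \<in> ball z0 \<eta>" for k z
  proof (rule uinf_le)
    obtain x t where xt: "z = (x, t)" by (cases z)
    have d: "dist x x0 < \<eta>" "\<bar>t - t0\<bar> < \<eta>"
      using z dist_fst_le[of z z0] dist_snd_le[of z z0] by (auto simp: xt z0 dist_commute dist_real_def)
    have tt: "0 < t" "t < T" using d(2) \<eta> t0 by auto
    have z0K: "aS - a k \<ge> 0" using aS[OF k] by simp
    show "0 \<le> w k z + C * (aS - a k)" using w_nonneg[OF k, of z] C(1) z0K by simp
    fix l :: real assume l: "l > 0"
    show "w l z \<le> w k z + C * (aS - a k)"
    proof (cases "l \<le> k")
      case True
      have "C * (aS - a k) \<ge> 0" using C(1) z0K by simp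
      then show ?thesis using w_mono[OF l True, of z] by linarith
    next
      case False
      then have kl: "k \<le> l" by simp
      define Q where "Q = cball x (2 * r) \<times> {t - 2 * r\<^sup>2..t}"
      define W where "W z = w l z - w k z" for z
      have QK: "Q \<subseteq> Kc"
      proof
        fix y assume y: "y \<in> Q"
        have "dist x0 (fst y) \<le> dist x0 x + dist x (fst y)" by (rule dist_triangle)
        then show "y \<in> Kc" using y d r \<eta> unfolding Q_def Kc_def by (auto simp: mem_Times_iff dist_commute)
      qed
      have Wl: "loc_int W" unfolding W_def[abs_def] by (intro loc_int_diff w_loc l k)
      have W0: "W y \<ge> 0" for y using w_mono[OF k kl, of y] by (simp add: W_def)
      have "continuous_on (QT T) W" unfolding W_def[abs_def] by (intro continuous_intros w_cont l k)
      then have cW: "isCont W (x, t)" using tt by (simp add: continuous_on_eq_continuous_at open_QT mem_QT)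
      have "subcal W Q" unfolding W_def[abs_def]
      proof (rule diff_subcal_interior[OF k l w_mono[OF k kl]])
        show "0 \<notin> Q" using QK Kc(2) by (force simp: mem_QT)
        show "snd z \<le> t" if "z \<in> Q" for z using that by (auto simp: Q_def)
      qed (rule tt)
      then have "W (x, t) \<le> C * (\<integral>y. W y * indicator Q y \<partial>lborel)"
        unfolding Q_def using Wl W0 cW by (intro C(2)) auto
      also have "\<dots> \<le> C * (\<integral>y. W y * indicator Kc y \<partial>lborel)"
      proof (rule mult_left_mono[OF integral_mono' C(1)])
        show "W y * indicator Q y \<le> W y * indicator Kc y" for y
          using QK W0[of y] by (auto simp: indicator_def)
        show "0 \<le> W y * indicator Kc y" for y using W0[of y] by simp
      qed (rule iK[OF Wl])
      also have "(\<integral>y. W y * indicator Kc y \<partial>lborel) = a l - a k"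
        unfolding W_def a_def left_diff_distrib
        by (rule Bochner_Integration.integral_diff) (intro iK w_loc l k)+
      also have "C * (a l - a k) \<le> C * (aS - a k)" using aS[OF l] C(1) by (intro mult_left_mono) auto
      finally show ?thesis by (simp add: W_def xt)
    qed
  qed
  have "uniform_limit (ball z0 \<eta>) (\<lambda>k. w k) uinf at_top"
    unfolding uniform_limit_iff
  proof (intro allI impI)
    fix e :: real assume e: "e > 0"
    have "aS - e / (C + 1) < aS" using e C(1) by simp
    then have "\<exists>k\<in>{0<..}. aS - e / (C + 1) < a k"
      by (subst (asm) (2) aS_def) (subst (asm) less_cSUP_iff[OF _ bdda], auto)
    then obtain k where k: "k > 0" "aS - e / (C + 1) < a k" by auto
    have "dist (w l z) (uinf z) < e" if l: "l \<ge> k" and z: "z \<in> ball z0 \<eta>" for l z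
    proof -
      have l0: "l > 0" using k l by simp
      have "aS - a l < e / (C + 1)" using amono[OF k(1) l] k(2) by linarith
      then have "C * (aS - a l) \<le> C * (e / (C + 1))" using C(1) by (intro mult_left_mono) auto
      also have "\<dots> < e" using e C(1) by (simp add: field_simps)
      finally show ?thesis using near[OF l0 z] w_le_uinf[OF l0, of z] by (simp add: dist_real_def)
    qed
    then show "eventually (\<lambda>l. \<forall>z\<in>ball z0 \<eta>. dist (w l z) (uinf z) < e) at_top"
      unfolding eventually_at_top_linorder by blast
  qed
  moreover have "eventually (\<lambda>k. continuous_on (ball z0 \<eta>) (w k)) at_top"
    using eventually_gt_at_top[of 0]
  proof eventually_elim
    case (elim k)
    have "ball z0 \<eta> \<subseteq> QT T"
    proof
      fix z assume "z \<in> ball z0 \<eta>"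
      then have "\<bar>snd z - t0\<bar> < \<eta>" using dist_snd_le[of z z0] by (auto simp: z0 dist_commute dist_real_def)
      then show "z \<in> QT T" using \<eta> t0 by (auto simp: mem_QT)
    qed
    then show ?case by (rule continuous_on_subset[OF w_cont[OF elim]])
  qed
  ultimately have "continuous_on (ball z0 \<eta>) uinf"
    by (intro uniform_limit_theorem[where F=at_top and f="\<lambda>k. w k"]) auto
  then show "isCont uinf z0" using \<eta>(1) by (simp add: continuous_on_eq_continuous_at)
qed

text \<open>Around x the initial values vanish on a cube that avoids the origin. The front entering
  this cube from outside covers only a small part of its half-width in a short time, so the barrier
  bounds all \<open>w k\<close> at x by the same quantity, which tends to 0.\<close>

lemma uinf_initial:
  fixes x :: "real^'n"
  assumes x: "x \<noteq> 0" shows "((\<lambda>t. uinf (x, t)) \<longlongrightarrow> 0) (at_right 0)"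
proof -
  obtain i0 where i0: "x $ i0 \<noteq> 0" using x by (auto simp: vec_eq_iff)
  \<comment> \<open>Half the size of a nonzero coordinate: every point of the cube of half-width
    \<open>R\<close> has norm at least \<open>R\<close>, so cylinders of radius R/2 around it miss
    the origin.\<close>
  define R where "R = \<bar>x $ i0\<bar> / 2"
  have R: "R > 0" using i0 by (simp add: R_def)
  define T1 where "T1 = T / 2"
  have T1: "0 < T1" "T1 < T" using T by (auto simp: T1_def)
  obtain B B' I where fp: "front_profile T B B' I"
    and bd': "\<forall>k x t. k > 0 \<longrightarrow> 0 < t \<longrightarrow> t \<le> T1 \<longrightarrow> w k (x, t) \<le> exp (t * (B t)\<^sup>2)"
    using front[OF T1] by blast
  have B: "\<And>t. 0 < t \<Longrightarrow> t < T \<Longrightarrow> (B has_real_derivative B' t) (at t)"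
    "\<And>t. 0 < t \<Longrightarrow> t < T \<Longrightarrow> B' t \<le> 0" "\<And>t. 0 < t \<Longrightarrow> t < T \<Longrightarrow> - (t * B' t) \<le> 2 * B t"
    "\<And>t. 0 < t \<Longrightarrow> t < T \<Longrightarrow> 0 < B t" "continuous_on {0<..<T} B'"
    and I: "\<And>t. 0 < t \<Longrightarrow> t < T \<Longrightarrow> (I has_real_derivative B t) (at t)" "\<And>t. 0 < t \<Longrightarrow> t < T \<Longrightarrow> 0 \<le> I t"
    and lim: "(I \<longlongrightarrow> 0) (at_right 0)" "((\<lambda>t. t * B t) \<longlongrightarrow> 0) (at_right 0)" "filterlim B at_top (at_right 0)"
    using fp unfolding front_profile_def by blast+
  have "eventually (\<lambda>t. I t < R / 8) (at_right 0)" using R by (intro order_tendstoD(2)[OF lim(1)]) simp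
  then obtain b where b: "b > 0" "\<And>t. 0 < t \<Longrightarrow> t < b \<Longrightarrow> I t < R / 8" unfolding eventually_at_right_field by auto
  \<comment> \<open>Up to this time the front has moved by 4 I < R/2, and the bound that is uniform
    in \<open>k\<close> is available.\<close>
  define T' where "T' = min b T1"
  have T': "0 < T'" "T' \<le> b" "T' \<le> T1" "T' \<le> T" using b T1 by (auto simp: T'_def)
  have sub: "subcal (w k) (cball y (2 * (R / 4)) \<times> {s - 2 * (R / 4)\<^sup>2..s})"
    if k: "k > 0" and y: "y \<in> {y. \<forall>i. \<bar>(y - x) $ i\<bar> \<le> R}" and s: "s < T" for k y s
  proof (rule w_subcal[OF k _ _ s])
    have "\<bar>x $ i0\<bar> \<le> \<bar>y $ i0\<bar> + \<bar>(y - x) $ i0\<bar>" by simp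
    moreover have "\<bar>(y - x) $ i0\<bar> \<le> R" using y by blast
    ultimately have "R \<le> \<bar>y $ i0\<bar>" by (simp add: R_def)
    also have "\<dots> \<le> norm y" by (rule component_le_norm_cart)
    finally have "R \<le> norm y" .
    then show "0 \<notin> cball y (2 * (R / 4)) \<times> {s - 2 * (R / 4)\<^sup>2..s}"
      using R by (simp add: zero_prod_def)
    show "snd z \<le> s" if "z \<in> cball y (2 * (R / 4)) \<times> {s - 2 * (R / 4)\<^sup>2..s}" for z using that by auto
  qed
  have wb: "w k (x, t2) \<le> 2 * real CARD('n) * exp (t2 * (B t2)\<^sup>2 - B t2 * (R - 4 * I t2))"
    if k: "k > 0" and t2: "0 < t2" "t2 < T'" for k t2
  proof (rule barrier_bound[OF w_visc[OF k] w_cont[OF k], where T'=T' and \<rho>="\<lambda>t. R - 4 * I t" and R=R and B'=B'])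
    show "- g k z \<le> 0" for z using g_nonneg[of k z] by simp
    show "continuous_on {0<..<T'} B'" by (rule continuous_on_subset[OF B(5)]) (use T' in auto)
    show "((\<lambda>t. R - 4 * I t) has_real_derivative - 4 * B t) (at t)" if "0 < t" "t < T'" for t
      using I(1)[of t] that T' by (auto intro!: derivative_eq_intros)
    show "0 < R - 4 * I t" if "0 < t" "t < T'" for t using b(2)[of t] that T' R by simp
    show "R - 4 * I t \<le> R" if "0 < t" "t < T'" for t using I(2)[of t] that T' by simp
    show "w k (y, t) \<le> exp (t * (B t)\<^sup>2)" if "0 < t" "t < T'" for y t
      using bd' k that T' by simp
    show "\<exists>\<tau>>0. \<forall>y t. 0 < t \<longrightarrow> t < \<tau> \<longrightarrow> t < T' \<longrightarrow> (\<forall>i. \<bar>(y - x) $ i\<bar> \<le> R) \<longrightarrow> w k (y, t) \<le> \<epsilon>" if \<epsilon>: "\<epsilon> > 0" for \<epsilon>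
    proof -
      have R4: "R / 4 > 0" using R by simp
      show ?thesis
      proof (rule initial_decay[OF w_loc[OF k] w_nonneg[OF k] w_cont[OF k] w_initial bounded_cube[of x R] R4 sub[OF k] \<epsilon>])
        fix \<tau> :: real
        assume \<tau>: "0 < \<tau>" "\<And>y t. y \<in> {y. \<forall>i. \<bar>(y - x) $ i\<bar> \<le> R} \<Longrightarrow> 0 < t \<Longrightarrow> t < \<tau> \<Longrightarrow> t < T \<Longrightarrow> w k (y, t) \<le> \<epsilon>"
        have "w k (y, t) \<le> \<epsilon>" if "0 < t" "t < \<tau>" "t < T'" "\<forall>i. \<bar>(y - x) $ i\<bar> \<le> R" for y t
          using that T' by (intro \<tau>(2)) auto
        then show ?thesis using \<tau>(1) by blast
      qed auto
    qed
  qed (use T' t2 B in \<open>auto intro: less_imp_le\<close>)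
  have "eventually (\<lambda>t. t * B t < R / 4) (at_right 0)" using R by (intro order_tendstoD(2)[OF lim(2)]) simp
  moreover have "eventually (\<lambda>t. 0 < t \<and> t < T') (at_right 0)"
    using T'(1) unfolding eventually_at_right_field by blast
  ultimately have ub: "eventually (\<lambda>t. uinf (x, t) \<le> 2 * real CARD('n) * exp (- (R / 4 * B t))) (at_right 0)"
  proof eventually_elim
    case (elim t)
    then have t: "0 < t" "t < T'" "t < T" using T' by auto
    have Bt: "B t > 0" by (rule B(4)[OF t(1,3)])
    \<comment> \<open>The bracket is below -R/4, because t B < R/4 and 4 I < R/2.\<close>
    have "t * (B t)\<^sup>2 - B t * (R - 4 * I t) = B t * (t * B t - (R - 4 * I t))"
      by (simp add: power2_eq_square algebra_simps)
    also have "\<dots> \<le> B t * (- (R / 4))"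
      using Bt elim b(2)[of t] T' t by (intro mult_left_mono) auto
    finally have e: "t * (B t)\<^sup>2 - B t * (R - 4 * I t) \<le> - (R / 4 * B t)" by (simp add: mult.commute)
    show ?case
    proof (rule uinf_le)
      fix k :: real assume "k > 0"
      from wb[OF this t(1,2)] have "w k (x, t) \<le> 2 * real CARD('n) * exp (t * (B t)\<^sup>2 - B t * (R - 4 * I t))" .
      also have "\<dots> \<le> 2 * real CARD('n) * exp (- (R / 4 * B t))" using e by (intro mult_left_mono) auto
      finally show "w k (x, t) \<le> 2 * real CARD('n) * exp (- (R / 4 * B t))" .
    qed simp
  qed
  have "filterlim (\<lambda>t. R / 4 * B t) at_top (at_right 0)"
    using R by (intro filterlim_tendsto_pos_mult_at_top[OF tendsto_const _ lim(3)]) simp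
  then have "filterlim (\<lambda>t. - (R / 4 * B t)) at_bot (at_right 0)"
    by (simp add: filterlim_uminus_at_top)
  from filterlim_compose[OF exp_at_bot this] have "((\<lambda>t. exp (- (R / 4 * B t))) \<longlongrightarrow> 0) (at_right 0)" .
  from tendsto_mult_left[OF this, of "2 * real CARD('n)"]
  have up: "((\<lambda>t. 2 * real CARD('n) * exp (- (R / 4 * B t))) \<longlongrightarrow> 0) (at_right 0)" by simp
  show ?thesis
    by (rule tendsto_sandwich[OF _ ub tendsto_const up]) (simp add: uinf_nonneg)
qed

text \<open>If the limit were bounded near the origin, then all \<open>w k\<close> and their
  absorption terms would share a bound there. Testing the equation with one fixed function
  concentrated near the origin would bound k \<phi>(0) independently of \<open>k\<close>.\<close>

lemma uinf_singular: "singular_at_origin T uinf"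
  unfolding singular_at_origin_def
proof (intro allI impI notI)
  fix r :: real assume r: "r > 0" and "bounded (uinf ` (QT T \<inter> ball (0, 0) r))"
  then obtain L where L: "L > 0" "\<And>z. z \<in> QT T \<inter> ball (0, 0) r \<Longrightarrow> \<bar>uinf z\<bar> \<le> L"
    by (auto simp: bounded_pos)
  define e where "e = min r T / 4"
  have e: "e > 0" "2 * e < r" "2 * e < T" using r T by (auto simp: e_def)
  obtain \<eta> \<eta>t \<eta>x \<eta>xx where j: "jet (\<eta> :: (real^'n) \<times> real \<Rightarrow> real) \<eta>t \<eta>x \<eta>xx" and \<eta>: "\<And>z. \<eta> z \<ge> 0"
    "\<And>z. norm z \<ge> e \<Longrightarrow> \<eta> z = 0" "(\<integral>z. \<eta> z \<partial>lborel) = 1"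
    using exists_mollifier[OF e(1)] by metis
  have cc: "cc \<eta>" using j by (simp add: jet_def)
  have "\<exists>z. \<eta> z \<noteq> 0"
  proof (rule ccontr)
    assume "\<not> ?thesis"
    then have "\<eta> = (\<lambda>_. 0)" by auto
    then show False using \<eta>(3) by simp
  qed
  \<comment> \<open>The mollifier is only known to be nonzero somewhere, so it is reflected about
    such a point; the test function then takes the value \<eta>(z1) > 0 at the origin, at the price
    of a support of radius 2e instead of e.\<close>
  then obtain z1 where z1: "\<eta> z1 \<noteq> 0" by blast
  have n1: "norm z1 < e" using \<eta>(2)[of z1] z1 by (meson not_less)
  define \<phi> where "\<phi> y = \<eta> (z1 - y)" for y
  define \<phi>t where "\<phi>t y = - \<eta>t (z1 - y)" for y
  define \<phi>x where "\<phi>x i y = - \<eta>x i (z1 - y)" for i y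
  define \<phi>xx where "\<phi>xx i k y = \<eta>xx i k (z1 - y)" for i k y
  have j': "jet \<phi> \<phi>t \<phi>x \<phi>xx"
    unfolding \<phi>_def[abs_def] \<phi>t_def[abs_def] \<phi>x_def[abs_def] \<phi>xx_def[abs_def] by (rule jet_reflect[OF j])
  define \<psi> where "\<psi> y = - \<phi>t y - (\<Sum>i\<in>UNIV. \<phi>xx i i y)" for y
  have c\<phi>: "cc \<phi>" using j' by (simp add: jet_def)
  have c\<psi>: "cc \<psi>" unfolding \<psi>_def[abs_def] by (rule jet_heat_cc[OF j'])
  have far: "\<phi> y = 0" if "norm y > 2 * e" for y
  proof -
    have "norm y \<le> norm (z1 - y) + norm z1" by (metis add.commute norm_minus_commute norm_triangle_sub)
    then show ?thesis unfolding \<phi>_def using n1 that by (intro \<eta>(2)) linarith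
  qed
  have opn: "open {y::(real^'n) \<times> real. norm y > 2 * e}" by (intro open_Collect_less continuous_intros)
  have far': "\<psi> y = 0" if "norm y > 2 * e" for y
    unfolding \<psi>_def using jet_eq_0[OF j' opn, of y] that far by simp
  have supp: "norm y \<le> 2 * e" if "\<phi> y \<noteq> 0 \<or> \<psi> y \<noteq> 0" for y using far far' that by (meson not_less)
  have hT: "h T \<ge> 0" using h_nonneg T by simp
  have bw: "w k y \<le> L" "g k y \<le> h T * L powr q" if k: "k > 0" and y: "norm y \<le> 2 * e" for k y
  proof -
    show wl: "w k y \<le> L"
    proof (cases "y \<in> QT T")
      case True
      then have "y \<in> QT T \<inter> ball (0, 0) r" using y e by (simp add: dist_norm zero_prod_def[symmetric])
      then show ?thesis using w_le_uinf[OF k, of y] L(2)[of y] by linarith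
    qed (use L in \<open>simp add: w_outside\<close>)
    show "g k y \<le> h T * L powr q"
    proof (cases "y \<in> QT T")
      case True
      then have "0 \<le> snd y" "snd y \<le> T" by (auto simp: mem_QT)
      then have "h (snd y) \<le> h T" using T by (intro mono_onD[OF h_mono]) auto
      moreover have "w k y powr q \<le> L powr q" using q wl w_nonneg[OF k, of y] by (intro powr_mono2) auto
      ultimately show ?thesis unfolding g_eq using hT by (intro mult_mono) auto
    qed (use hT in \<open>simp add: w_outside\<close>)
  qed
  have iabs: "integrable lborel (\<lambda>y. \<bar>f y\<bar>)" if "cc f" for f :: "(real^'n) \<times> real \<Rightarrow> real"
    by (intro integrable_abs cc_integrable that)
  have main: "k * \<phi> 0 \<le> L * (\<integral>y. \<bar>\<psi> y\<bar> \<partial>lborel) + h T * L powr q * (\<integral>y. \<bar>\<phi> y\<bar> \<partial>lborel)" if k: "k > 0" for k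
  proof -
    have "\<forall>z. snd z > 2 * e \<longrightarrow> \<phi> z = 0"
    proof (intro allI impI far)
      fix z :: "(real^'n) \<times> real" assume "snd z > 2 * e"
      also have "snd z \<le> norm (snd z)" by simp
      also have "\<dots> \<le> norm z" by (metis norm_snd_le prod.collapse)
      finally show "2 * e < norm z" .
    qed
    then have "(\<integral>y. w k y * \<psi> y \<partial>lborel) = - (\<integral>y. g k y * \<phi> y \<partial>lborel) + k * \<phi> 0"
      using w_weak[OF k] j' e(3) unfolding weak_eq_def \<psi>_def by blast
    moreover have "(\<integral>y. w k y * \<psi> y \<partial>lborel) \<le> (\<integral>y. L * \<bar>\<psi> y\<bar> \<partial>lborel)"
    proof (rule integral_mono[OF loc_int_mult_cc[OF w_loc[OF k] c\<psi>] integrable_mult_right[OF iabs[OF c\<psi>]]])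
      fix y
      have "w k y * \<psi> y \<le> w k y * \<bar>\<psi> y\<bar>" using w_nonneg[OF k, of y] by (intro mult_left_mono) auto
      also have "\<dots> \<le> L * \<bar>\<psi> y\<bar>"
        using bw(1)[OF k, of y] supp[of y] by (cases "\<psi> y = 0") (auto intro: mult_right_mono)
      finally show "w k y * \<psi> y \<le> L * \<bar>\<psi> y\<bar>" .
    qed
    moreover have "(\<integral>y. g k y * \<phi> y \<partial>lborel) \<le> (\<integral>y. h T * L powr q * \<bar>\<phi> y\<bar> \<partial>lborel)"
    proof (rule integral_mono[OF loc_int_mult_cc[OF g_loc[OF k] c\<phi>] integrable_mult_right[OF iabs[OF c\<phi>]]])
      fix y
      have "g k y * \<phi> y \<le> g k y * \<bar>\<phi> y\<bar>" using g_nonneg[of k y] by (intro mult_left_mono) auto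
      also have "\<dots> \<le> h T * L powr q * \<bar>\<phi> y\<bar>"
        using bw(2)[OF k, of y] supp[of y] by (cases "\<phi> y = 0") (auto intro: mult_right_mono)
      finally show "g k y * \<phi> y \<le> h T * L powr q * \<bar>\<phi> y\<bar>" .
    qed
    ultimately show ?thesis by simp
  qed
  have p0: "\<phi> 0 > 0" using z1 \<eta>(1)[of z1] by (simp add: \<phi>_def less_le)
  define M where "M = L * (\<integral>y. \<bar>\<psi> y\<bar> \<partial>lborel) + h T * L powr q * (\<integral>y. \<bar>\<phi> y\<bar> \<partial>lborel)"
  define k where "k = (\<bar>M\<bar> + 1) / \<phi> 0"
  have "k > 0" using p0 by (simp add: k_def)
  from main[OF this] have "k * \<phi> 0 \<le> M" by (simp add: M_def)
  moreover have "k * \<phi> 0 = \<bar>M\<bar> + 1" using p0 by (simp add: k_def)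
  ultimately show False by linarith
qed

lemma uinf_powr_cont: "continuous_on (QT T) (\<lambda>z. h (snd z) * uinf z powr q)"
  by (intro continuous_on_mult h_snd_cont powr_cont uinf_cont uinf_nonneg)

lemma L1_loc_continuous:
  fixes f :: "(real^'n) \<times> real \<Rightarrow> real"
  assumes f: "continuous_on (QT T) f" shows "L1_loc (QT T) f"
  unfolding L1_loc_def
proof (intro allI impI)
  fix K :: "((real^'n) \<times> real) set" assume K: "compact K \<and> K \<subseteq> QT T"
  have i: "integrable lborel (\<lambda>z. indicator K z *\<^sub>R f z)"
    by (rule borel_integrable_compact) (use K continuous_on_subset[OF f] in auto)
  then have "integrable lebesgue (\<lambda>z. indicator K z *\<^sub>R f z)"
    by (subst integrable_completion) (auto dest: borel_measurable_integrable)
  then show "f absolutely_integrable_on K" by (simp add: set_integrable_def)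
qed

text \<open>On the compact support of \<phi> and its derivatives all \<open>w k\<close> share one
  bound, so the interior identity passes to the limit by dominated convergence. The sequence runs
  over \<open>Suc n\<close> because \<open>k\<close> has to be positive.\<close>

lemma uinf_weak:
  assumes \<phi>: "\<phi> \<in> C21_0 {0<..<T}" shows "weak_form h q T {0<..<T} uinf \<phi> = 0"
proof -
  obtain K where K: "compact K" "K \<subseteq> QT T"
    "\<And>z. z \<in> QT T \<Longrightarrow> z \<notin> K \<Longrightarrow> \<phi> z = 0 \<and> dt {0<..<T} \<phi> z = 0 \<and> laplacian \<phi> z = 0"
    using C21_0_interior_bounds[OF \<phi>] by metis
  have QI: "QT T = UNIV \<times> {0<..<T}" by (simp add: QT_def)
  have C: "C21 {0<..<T} \<phi>" using \<phi> by (simp add: C21_0_def)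
  have c\<phi>: "continuous_on (QT T) \<phi>" "continuous_on (QT T) (dt {0<..<T} \<phi>)"
    using C by (auto simp: C21_def QI)
  have cl: "continuous_on (QT T) (laplacian \<phi>)"
    unfolding laplacian_def[abs_def] using C by (intro continuous_on_sum) (auto simp: C21_def QI)
  define F where "F v z = - v z * dt {0<..<T} \<phi> z - v z * laplacian \<phi> z + h (snd z) * v z powr q * \<phi> z" for v z
  have cF: "continuous_on (QT T) (F v)" if "continuous_on (QT T) v" "\<And>z. v z \<ge> 0" for v
    unfolding F_def[abs_def] using that by (intro continuous_intros c\<phi> cl h_snd_cont powr_cont) auto
  obtain M where M: "M > 0" "\<And>k z. k > 0 \<Longrightarrow> z \<in> K \<Longrightarrow> w k z \<le> M"
    using w_loc_bound[OF K(1,2)] by metis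
  define D where "D z = M * \<bar>dt {0<..<T} \<phi> z\<bar> + M * \<bar>laplacian \<phi> z\<bar> + \<bar>h (snd z)\<bar> * M powr q * \<bar>\<phi> z\<bar>" for z
  have "continuous_on K D" unfolding D_def[abs_def]
    by (intro continuous_intros continuous_on_subset[OF c\<phi>(1) K(2)] continuous_on_subset[OF c\<phi>(2) K(2)]
        continuous_on_subset[OF cl K(2)] continuous_on_subset[OF h_snd_cont K(2)])
  then have iD: "integrable lborel (\<lambda>z. indicator K z *\<^sub>R D z)"
    by (rule borel_integrable_compact[OF K(1)])
  have wk: "weak_form h q T {0<..<T} v \<phi> = (\<integral>z. indicator (QT T) z *\<^sub>R F v z \<partial>lborel)"
    if "continuous_on (QT T) v" "\<And>z. v z \<ge> 0" for v
  proof -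
    have "(\<lambda>z. indicator (QT T) z *\<^sub>R F v z) \<in> borel_measurable borel"
      by (intro borel_measurable_continuous_on_indicator cF that borel_open open_QT)
    then show ?thesis
      unfolding weak_form_def set_lebesgue_integral_def F_def by (intro integral_completion) simp
  qed
  have "(\<lambda>n. \<integral>z. indicator (QT T) z *\<^sub>R F (w (real (Suc n))) z \<partial>lborel) \<longlonglongrightarrow> (\<integral>z. indicator (QT T) z *\<^sub>R F uinf z \<partial>lborel)"
  proof (rule integral_dominated_convergence[OF _ _ iD])
    show "(\<lambda>z. indicator (QT T) z *\<^sub>R F uinf z) \<in> borel_measurable lborel"
      "(\<lambda>z. indicator (QT T) z *\<^sub>R F (w (real (Suc n))) z) \<in> borel_measurable lborel" for n
      unfolding measurable_lborel2
      by (intro borel_measurable_continuous_on_indicator cF uinf_cont uinf_nonneg w_cont w_nonneg borel_open open_QT; simp)+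
    show "AE z in lborel. (\<lambda>n. indicator (QT T) z *\<^sub>R F (w (real (Suc n))) z) \<longlonglongrightarrow> indicator (QT T) z *\<^sub>R F uinf z"
    proof (intro AE_I2 tendsto_scaleR tendsto_const)
      fix z
      have "filterlim (\<lambda>n. real (Suc n)) at_top sequentially"
        by (rule filterlim_compose[OF filterlim_real_sequentially filterlim_Suc])
      from filterlim_compose[OF w_tendsto this]
      have l: "(\<lambda>n. w (real (Suc n)) z) \<longlonglongrightarrow> uinf z" .
      have "eventually (\<lambda>n. 0 \<le> w (real (Suc n)) z) sequentially" by (intro always_eventually allI w_nonneg) simp
      then have p: "(\<lambda>n. w (real (Suc n)) z powr q) \<longlonglongrightarrow> uinf z powr q"
        using q by (intro tendsto_powr'[OF l tendsto_const]) auto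
      show "(\<lambda>n. F (w (real (Suc n))) z) \<longlonglongrightarrow> F uinf z"
        unfolding F_def by (intro tendsto_add tendsto_diff tendsto_mult tendsto_minus tendsto_const l p)
    qed
    show "AE z in lborel. norm (indicator (QT T) z *\<^sub>R F (w (real (Suc n))) z) \<le> indicator K z *\<^sub>R D z" for n
    proof (intro AE_I2)
      fix z
      let ?k = "real (Suc n)"
      have k: "?k > 0" by simp
      show "norm (indicator (QT T) z *\<^sub>R F (w ?k) z) \<le> indicator K z *\<^sub>R D z"
      proof (cases "z \<in> K")
        case True
        have w0: "0 \<le> w ?k z" "w ?k z \<le> M" using w_nonneg[OF k] M(2)[OF k True] by auto
        then have p: "w ?k z powr q \<le> M powr q" using q by (intro powr_mono2) auto
        have "\<bar>F (w ?k) z\<bar> \<le> \<bar>w ?k z * dt {0<..<T} \<phi> z\<bar> + \<bar>w ?k z * laplacian \<phi> z\<bar> + \<bar>h (snd z) * w ?k z powr q * \<phi> z\<bar>"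
          unfolding F_def by linarith
        also have "\<dots> \<le> D z"
          unfolding D_def abs_mult using w0 p by (intro add_mono mult_right_mono mult_left_mono) auto
        finally show ?thesis using True K(2) by auto
      next
        case False
        then show ?thesis using K(3)[of z] by (cases "z \<in> QT T") (simp_all add: F_def)
      qed
    qed
  qed
  moreover have "(\<integral>z. indicator (QT T) z *\<^sub>R F (w (real (Suc n))) z \<partial>lborel) = 0" for n
  proof -
    let ?k = "real (Suc n)"
    have k: "?k > 0" by simp
    have "(\<integral>z. indicator (QT T) z *\<^sub>R F (w ?k) z \<partial>lborel) = weak_form h q T {0<..<T} (w ?k) \<phi>"
      by (rule wk[symmetric]) (intro w_cont w_nonneg k)+
    also have "\<dots> = weak_form h q T {0<..<T} (u ?k) \<phi>"
      unfolding weak_form_def set_lebesgue_integral_def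
    proof (rule Bochner_Integration.integral_cong[OF refl])
      fix z
      show "indicator (QT T) z *\<^sub>R (- w ?k z * dt {0<..<T} \<phi> z - w ?k z * laplacian \<phi> z + h (snd z) * w ?k z powr q * \<phi> z)
        = indicator (QT T) z *\<^sub>R (- u ?k z * dt {0<..<T} \<phi> z - u ?k z * laplacian \<phi> z + h (snd z) * u ?k z powr q * \<phi> z)"
        by (cases "z \<in> QT T") (simp_all add: w_simp)
    qed
    also have "\<dots> = 0" by (rule fundamental_solution_interior[OF sol[OF k] T \<phi>])
    finally show ?thesis .
  qed
  ultimately have "(\<integral>z. indicator (QT T) z *\<^sub>R F uinf z \<partial>lborel) = 0"
    by (simp add: LIMSEQ_const_iff)
  then show ?thesis using wk[OF uinf_cont uinf_nonneg] by simp
qed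

lemma uinf_blow_up: "single_point_initial_blow_up h q T uinf"
  unfolding single_point_initial_blow_up_def solution_in_QT_def
  by (intro conjI uinf_cont ballI allI impI uinf_nonneg L1_loc_continuous uinf_powr_cont uinf_weak uinf_singular uinf_initial)

end

theorem theorem1p2:
  fixes q T :: real
    and h \<omega> :: "real \<Rightarrow> real"
    and u :: "real \<Rightarrow> (real^'n) \<times> real \<Rightarrow> real"
  assumes "q > 1" and "T > 0"
    and "continuous_on {0..} h" and "mono_on {0..} h"
    and "\<And>t. t \<ge> 0 \<Longrightarrow> h t \<ge> 0" and "\<And>t. t > 0 \<Longrightarrow> h t > 0"
    and "continuous_on {0..} \<omega>" and "mono_on {0..} \<omega>"
    and "\<And>t. t \<ge> 0 \<Longrightarrow> \<omega> t \<ge> 0"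
    and "\<And>t. t > 0 \<Longrightarrow> h t = exp (- \<omega> t / t)"
    and "(\<integral>\<^sup>+s\<in>{0<..<1}. ennreal (sqrt (\<omega> s) / s) \<partial>lborel) < \<infinity>"
    and "\<And>(k::real) (R::ereal). k > 0 \<Longrightarrow> R > 0 \<Longrightarrow>
           (\<integral>\<^sup>+t\<in>{0<..<T}.
              (\<integral>\<^sup>+x\<in>B R. ennreal (h t * (k * heat_kernel (x :: real^'n) t) powr q) \<partial>lborel)
            \<partial>lborel) < \<infinity>"
    and "\<And>k. k > 0 \<Longrightarrow> fundamental_solution h q T k (u k)"
  shows "\<exists>u_inf. (\<forall>z\<in>QT T. ((\<lambda>k. u k z) \<longlongrightarrow> u_inf z) at_top) \<and>
           single_point_initial_blow_up h q T u_inf"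
proof -
  interpret absorption q T h \<omega> u
    by unfold_locales (fact assms)+
  have "((\<lambda>k. u k z) \<longlongrightarrow> uinf z) at_top" if "z \<in> QT T" for z
    using w_tendsto[of z] w_simp[OF that] by simp
  then show ?thesis using uinf_blow_up by blast
qed

end
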